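(* Let $\mathbf k$ be a field and let $\mathbf D^b(\mathbf{mod}\,\mathbf k)$ be the bounded derived category of finite dimensional $\mathbf k$-vector spaces. Then $\mathsf{Stab}\,\mathbf D^b(\mathbf{mod}\,\mathbf k)$ is isomorphic to $\mathbb C$ (as a complex manifold).
   Context: For a triangulated category $\mathbf D$ with $\mathrm{rank}\,K_0(\mathbf D)<\infty$, $\mathsf{Stab}\,\mathbf D$ is the space of locally finite Bridgeland stability conditions $\sigma=(Z,\mathcal P)$ on $\mathbf D$, with Bridgeland's topology and complex manifold structure (each connected component is locally modelled, via $(Z,\mathcal P)\mapsto Z$, on a linear subspace of $\mathrm{Hom}(K_0(\mathbf D),\mathbb C)$). *)

theory Defs
  imports
    "HOL-Algebra.Module"
    "HOL-Algebra.AbelCoset"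
    "HOL-Algebra.Generated_Groups"
    "HOL-Algebra.Free_Abelian_Groups"
    "HOL-Analysis.Analysis"
begin

section \<open>Triangulated categories: data and elementary notions\<close>

text \<open>
  The structure carried by a triangulated category: objects, morphism sets, identities,
  composition (\<open>tcmp T g f\<close> is \<open>g\<close> after \<open>f\<close>), the shift functor on objects and on morphisms,
  and the distinguished triangles \<open>X \<rightarrow> Y \<rightarrow> Z \<rightarrow> X[1]\<close>, coded as \<open>(X, Y, Z, u, v, w)\<close>.
  The addition of morphisms is not recorded: in an additive category it is determined by the
  underlying category.
\<close>

record ('o, 'm) tricat =
  tob :: "'o set"
  thom :: "'o \<Rightarrow> 'o \<Rightarrow> 'm set"
  tid :: "'o \<Rightarrow> 'm"
  tcmp :: "'m \<Rightarrow> 'm \<Rightarrow> 'm"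
  tsh :: "'o \<Rightarrow> 'o"
  tshm :: "'m \<Rightarrow> 'm"
  tdt :: "('o \<times> 'o \<times> 'o \<times> 'm \<times> 'm \<times> 'm) set"

definition iso_mor :: "('o, 'm) tricat \<Rightarrow> 'o \<Rightarrow> 'o \<Rightarrow> 'm \<Rightarrow> bool" where
  "iso_mor T X Y f \<longleftrightarrow> f \<in> thom T X Y \<and>
     (\<exists>g\<in>thom T Y X. tcmp T g f = tid T X \<and> tcmp T f g = tid T Y)"

definition iso_obj :: "('o, 'm) tricat \<Rightarrow> 'o \<Rightarrow> 'o \<Rightarrow> bool" where
  "iso_obj T X Y \<longleftrightarrow> X \<in> tob T \<and> Y \<in> tob T \<and> (\<exists>f. iso_mor T X Y f)"

definition zero_obj :: "('o, 'm) tricat \<Rightarrow> 'o \<Rightarrow> bool" where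
  "zero_obj T Z \<longleftrightarrow> Z \<in> tob T \<and>
     (\<forall>X\<in>tob T. (\<exists>!f. f \<in> thom T X Z) \<and> (\<exists>!f. f \<in> thom T Z X))"

definition zero_mor :: "('o, 'm) tricat \<Rightarrow> 'o \<Rightarrow> 'o \<Rightarrow> 'm \<Rightarrow> bool" where
  "zero_mor T X Y f \<longleftrightarrow>
     (\<exists>Z g h. zero_obj T Z \<and> g \<in> thom T X Z \<and> h \<in> thom T Z Y \<and> f = tcmp T h g)"

definition direct_sum :: "('o, 'm) tricat \<Rightarrow> 'o \<Rightarrow> 'o \<Rightarrow> 'o \<Rightarrow> bool" where
  "direct_sum T A B S \<longleftrightarrow> S \<in> tob T \<and>
     (\<exists>i\<in>thom T A S. \<exists>j\<in>thom T B S. \<exists>p\<in>thom T S A. \<exists>q\<in>thom T S B.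
        tcmp T p i = tid T A \<and> tcmp T q j = tid T B \<and>
        zero_mor T A B (tcmp T q i) \<and> zero_mor T B A (tcmp T p j) \<and>
        (\<forall>W\<in>tob T. \<forall>f\<in>thom T A W. \<forall>g\<in>thom T B W.
           \<exists>!h. h \<in> thom T S W \<and> tcmp T h i = f \<and> tcmp T h j = g) \<and>
        (\<forall>W\<in>tob T. \<forall>f\<in>thom T W A. \<forall>g\<in>thom T W B.
           \<exists>!h. h \<in> thom T W S \<and> tcmp T p h = f \<and> tcmp T q h = g))"

text \<open>Full subcategories are given by their sets of objects and are taken to be closed under
  isomorphism.\<close>

definition additive_subcat :: "('o, 'm) tricat \<Rightarrow> 'o set \<Rightarrow> bool" where
  "additive_subcat T S \<longleftrightarrow> S \<subseteq> tob T \<and>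
     (\<forall>A\<in>S. \<forall>B. iso_obj T A B \<longrightarrow> B \<in> S) \<and>
     (\<exists>Z\<in>S. zero_obj T Z) \<and>
     (\<forall>A\<in>S. \<forall>B\<in>S. \<forall>D. direct_sum T A B D \<longrightarrow> D \<in> S)"

abbreviation full_sub :: "('o, 'm) tricat \<Rightarrow> 'o set \<Rightarrow> ('o, 'm) tricat" where
  "full_sub T S \<equiv> T\<lparr>tob := S\<rparr>"

inductive_set ext_closure :: "('o, 'm) tricat \<Rightarrow> 'o set \<Rightarrow> 'o set"
  for T :: "('o, 'm) tricat" and S :: "'o set" where
  base: "A \<in> S \<Longrightarrow> A \<in> ext_closure T S"
| ext: "A \<in> ext_closure T S \<Longrightarrow> B \<in> ext_closure T S \<Longrightarrow> (A, E, B, u, v, w) \<in> tdt T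
        \<Longrightarrow> E \<in> ext_closure T S"


section \<open>Strict subobjects and finite length\<close>

definition is_kernel :: "('o, 'm) tricat \<Rightarrow> 'o \<Rightarrow> 'o \<Rightarrow> 'm \<Rightarrow> 'o \<Rightarrow> 'm \<Rightarrow> bool" where
  "is_kernel C X Y f K k \<longleftrightarrow> K \<in> tob C \<and> k \<in> thom C K X \<and> zero_mor C K Y (tcmp C f k) \<and>
     (\<forall>W\<in>tob C. \<forall>g\<in>thom C W X. zero_mor C W Y (tcmp C f g) \<longrightarrow>
        (\<exists>!u. u \<in> thom C W K \<and> tcmp C k u = g))"

definition is_cokernel :: "('o, 'm) tricat \<Rightarrow> 'o \<Rightarrow> 'o \<Rightarrow> 'm \<Rightarrow> 'o \<Rightarrow> 'm \<Rightarrow> bool" where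
  "is_cokernel C X Y f Q q \<longleftrightarrow> Q \<in> tob C \<and> q \<in> thom C Y Q \<and> zero_mor C X Q (tcmp C q f) \<and>
     (\<forall>W\<in>tob C. \<forall>g\<in>thom C Y W. zero_mor C X W (tcmp C g f) \<longrightarrow>
        (\<exists>!u. u \<in> thom C Q W \<and> tcmp C u q = g))"

text \<open>A morphism is strict if the canonical map from its coimage (the cokernel of its kernel)
  to its image (the kernel of its cokernel) is an isomorphism.\<close>

definition strict_mor :: "('o, 'm) tricat \<Rightarrow> 'o \<Rightarrow> 'o \<Rightarrow> 'm \<Rightarrow> bool" where
  "strict_mor C X Y f \<longleftrightarrow> f \<in> thom C X Y \<and>
     (\<exists>K k Q q I i J j u.
        is_kernel C X Y f K k \<and> is_cokernel C X Y f Q q \<and>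
        is_kernel C Y Q q I i \<and> is_cokernel C K X k J j \<and>
        iso_mor C J I u \<and> f = tcmp C i (tcmp C u j))"

definition mono_mor :: "('o, 'm) tricat \<Rightarrow> 'o \<Rightarrow> 'o \<Rightarrow> 'm \<Rightarrow> bool" where
  "mono_mor C X Y f \<longleftrightarrow> f \<in> thom C X Y \<and>
     (\<forall>W\<in>tob C. \<forall>g\<in>thom C W X. \<forall>h\<in>thom C W X. tcmp C f g = tcmp C f h \<longrightarrow> g = h)"

definition strict_sub :: "('o, 'm) tricat \<Rightarrow> 'o \<Rightarrow> 'o \<Rightarrow> 'm \<Rightarrow> bool" where
  "strict_sub C E A i \<longleftrightarrow> A \<in> tob C \<and> mono_mor C A E i \<and> strict_mor C A E i"

definition strict_artinian :: "('o, 'm) tricat \<Rightarrow> bool" where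
  "strict_artinian C \<longleftrightarrow> (\<forall>E\<in>tob C. \<forall>A i u.
     (\<forall>n::nat. strict_sub C E (A n) (i n) \<and> u n \<in> thom C (A (Suc n)) (A n) \<and>
        tcmp C (i n) (u n) = i (Suc n)) \<longrightarrow>
     (\<exists>N. \<forall>n\<ge>N. iso_mor C (A (Suc n)) (A n) (u n)))"

definition strict_noetherian :: "('o, 'm) tricat \<Rightarrow> bool" where
  "strict_noetherian C \<longleftrightarrow> (\<forall>E\<in>tob C. \<forall>A i u.
     (\<forall>n::nat. strict_sub C E (A n) (i n) \<and> u n \<in> thom C (A n) (A (Suc n)) \<and>
        tcmp C (i (Suc n)) (u n) = i n) \<longrightarrow>
     (\<exists>N. \<forall>n\<ge>N. iso_mor C (A n) (A (Suc n)) (u n)))"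

definition finite_length :: "('o, 'm) tricat \<Rightarrow> bool" where
  "finite_length C \<longleftrightarrow> strict_artinian C \<and> strict_noetherian C"


section \<open>The Grothendieck group\<close>

definition K0_rel :: "('o, 'm) tricat \<Rightarrow> ('o \<Rightarrow>\<^sub>0 int) set" where
  "K0_rel T = generate (free_Abelian_group (tob T))
     {frag_of Y - frag_of X - frag_of Z | X Y Z u v w. (X, Y, Z, u, v, w) \<in> tdt T}"

definition K0 :: "('o, 'm) tricat \<Rightarrow> ('o \<Rightarrow>\<^sub>0 int) set monoid" where
  "K0 T = free_Abelian_group (tob T) Mod K0_rel T"

definition K0_class :: "('o, 'm) tricat \<Rightarrow> 'o \<Rightarrow> ('o \<Rightarrow>\<^sub>0 int) set" where
  "K0_class T E = K0_rel T #>\<^bsub>free_Abelian_group (tob T)\<^esub> frag_of E"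

definition complex_add :: "complex monoid" where
  "complex_add = \<lparr>carrier = UNIV, monoid.mult = (+), one = 0\<rparr>"

text \<open>\<open>Hom(K\<^sub>0(D), \<complex>)\<close>; extensionality makes equality of functions equality of homomorphisms.\<close>

definition K0_dual :: "('o, 'm) tricat \<Rightarrow> (('o \<Rightarrow>\<^sub>0 int) set \<Rightarrow> complex) set" where
  "K0_dual T = hom (K0 T) complex_add \<inter> extensional (carrier (K0 T))"


section \<open>Stability conditions\<close>

text \<open>\<open>hn_filtration T P E \<phi>s\<close>: there are triangles \<open>E\<^sub>j \<rightarrow> E\<^sub>j\<^sub>+\<^sub>1 \<rightarrow> A\<^sub>j \<rightarrow> E\<^sub>j[1]\<close> with \<open>E\<^sub>0 = 0\<close>, last
  term \<open>E\<close>, and nonzero factors \<open>A\<^sub>j\<close> of strictly decreasing phases \<open>\<phi>s\<close>.\<close>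

definition hn_filtration :: "('o, 'm) tricat \<Rightarrow> (real \<Rightarrow> 'o set) \<Rightarrow> 'o \<Rightarrow> real list \<Rightarrow> bool" where
  "hn_filtration T P E \<phi>s \<longleftrightarrow> sorted_wrt (>) \<phi>s \<and>
     (\<exists>F A. zero_obj T (F 0) \<and> F (length \<phi>s) = E \<and>
        (\<forall>j<length \<phi>s. A j \<in> P (\<phi>s ! j) \<and> \<not> zero_obj T (A j) \<and>
           (\<exists>u v w. (F j, F (Suc j), A j, u, v, w) \<in> tdt T)))"

definition slicing :: "('o, 'm) tricat \<Rightarrow> (real \<Rightarrow> 'o set) \<Rightarrow> bool" where
  "slicing T P \<longleftrightarrow>
     (\<forall>\<phi>. additive_subcat T (P \<phi>)) \<and>
     (\<forall>\<phi>. P (\<phi> + 1) = {E \<in> tob T. \<exists>A\<in>P \<phi>. iso_obj T E (tsh T A)}) \<and>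
     (\<forall>\<phi> \<psi>. \<phi> > \<psi> \<longrightarrow> (\<forall>A\<in>P \<phi>. \<forall>B\<in>P \<psi>. \<forall>f\<in>thom T A B. zero_mor T A B f)) \<and>
     (\<forall>E\<in>tob T. \<not> zero_obj T E \<longrightarrow> (\<exists>\<phi>s. hn_filtration T P E \<phi>s))"

definition phi_plus :: "('o, 'm) tricat \<Rightarrow> (real \<Rightarrow> 'o set) \<Rightarrow> 'o \<Rightarrow> real" where
  "phi_plus T P E = (THE \<phi>. \<exists>\<phi>s. hn_filtration T P E \<phi>s \<and> \<phi> = hd \<phi>s)"

definition phi_minus :: "('o, 'm) tricat \<Rightarrow> (real \<Rightarrow> 'o set) \<Rightarrow> 'o \<Rightarrow> real" where
  "phi_minus T P E = (THE \<phi>. \<exists>\<phi>s. hn_filtration T P E \<phi>s \<and> \<phi> = last \<phi>s)"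

definition locally_finite :: "('o, 'm) tricat \<Rightarrow> (real \<Rightarrow> 'o set) \<Rightarrow> bool" where
  "locally_finite T P \<longleftrightarrow> (\<exists>\<eta>>0. \<forall>t.
     finite_length (full_sub T (ext_closure T (\<Union>\<phi>\<in>{t - \<eta><..<t + \<eta>}. P \<phi>))))"

type_synonym 'o stab = "(('o \<Rightarrow>\<^sub>0 int) set \<Rightarrow> complex) \<times> (real \<Rightarrow> 'o set)"

definition stability_condition :: "('o, 'm) tricat \<Rightarrow> 'o stab \<Rightarrow> bool" where
  "stability_condition T \<sigma> \<longleftrightarrow> fst \<sigma> \<in> K0_dual T \<and> slicing T (snd \<sigma>) \<and>
     (\<forall>\<phi>. \<forall>E\<in>snd \<sigma> \<phi>. \<not> zero_obj T E \<longrightarrow>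
        (\<exists>m::real. m > 0 \<and> fst \<sigma> (K0_class T E) = of_real m * exp (\<i> * of_real (pi * \<phi>))))"

definition Stab :: "('o, 'm) tricat \<Rightarrow> 'o stab set" where
  "Stab T = {\<sigma>. stability_condition T \<sigma> \<and> locally_finite T (snd \<sigma>)}"


section \<open>Bridgeland's topology\<close>

definition stab_norm :: "('o, 'm) tricat \<Rightarrow> 'o stab \<Rightarrow> (('o \<Rightarrow>\<^sub>0 int) set \<Rightarrow> complex) \<Rightarrow> ennreal" where
  "stab_norm T \<sigma> U = (SUP E\<in>{E. (\<exists>\<phi>. E \<in> snd \<sigma> \<phi>) \<and> \<not> zero_obj T E}.
     ennreal (cmod (U (K0_class T E)) / cmod (fst \<sigma> (K0_class T E))))"

definition slicing_dist ::
    "('o, 'm) tricat \<Rightarrow> (real \<Rightarrow> 'o set) \<Rightarrow> (real \<Rightarrow> 'o set) \<Rightarrow> ennreal" where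
  "slicing_dist T P Q = (SUP E\<in>{E\<in>tob T. \<not> zero_obj T E}.
     ennreal (max \<bar>phi_minus T P E - phi_minus T Q E\<bar> \<bar>phi_plus T P E - phi_plus T Q E\<bar>))"

definition stab_ball :: "('o, 'm) tricat \<Rightarrow> 'o stab \<Rightarrow> real \<Rightarrow> 'o stab set" where
  "stab_ball T \<sigma> \<epsilon> = {\<tau>\<in>Stab T.
     stab_norm T \<sigma> (\<lambda>x. fst \<tau> x - fst \<sigma> x) < ennreal (sin (pi * \<epsilon>)) \<and>
     slicing_dist T (snd \<sigma>) (snd \<tau>) < ennreal \<epsilon>}"

definition stab_topology :: "('o, 'm) tricat \<Rightarrow> 'o stab topology" where
  "stab_topology T =
     topology_generated_by {stab_ball T \<sigma> \<epsilon> | \<sigma> \<epsilon>. \<sigma> \<in> Stab T \<and> 0 < \<epsilon> \<and> \<epsilon> < 1 / 4}"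


section \<open>Complex manifolds\<close>

text \<open>\<open>\<complex>\<^sup>n\<close> as the space of sequences supported in \<open>{..<n}\<close>, so that \<open>n\<close> may depend on the chart;
  the product topology on sequences induces the Euclidean topology on it.\<close>

definition cvec :: "nat \<Rightarrow> (nat \<Rightarrow> complex) set" where
  "cvec n = {x. \<forall>i\<ge>n. x i = 0}"

definition holo_fun :: "nat \<Rightarrow> (nat \<Rightarrow> complex) set \<Rightarrow> ((nat \<Rightarrow> complex) \<Rightarrow> complex) \<Rightarrow> bool" where
  "holo_fun n W f \<longleftrightarrow> (\<forall>x\<in>W. \<exists>a. \<forall>e>0. \<exists>\<delta>>0. \<forall>y\<in>W. (\<forall>i<n. cmod (y i - x i) < \<delta>) \<longrightarrow>
     cmod (f y - f x - (\<Sum>i<n. a i * (y i - x i))) \<le> e * (\<Sum>i<n. cmod (y i - x i)))"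

definition holo_map ::
    "nat \<Rightarrow> nat \<Rightarrow> (nat \<Rightarrow> complex) set \<Rightarrow> ((nat \<Rightarrow> complex) \<Rightarrow> (nat \<Rightarrow> complex)) \<Rightarrow> bool" where
  "holo_map n m W f \<longleftrightarrow> (\<forall>j<m. holo_fun n W (\<lambda>x. f x j))"

text \<open>A chart \<open>(n, U, \<phi>)\<close> consists of a domain \<open>U\<close> and a coordinate map \<open>\<phi>\<close> from \<open>U\<close> to \<open>\<complex>\<^sup>n\<close>.\<close>

type_synonym 'x chart = "nat \<times> 'x set \<times> ('x \<Rightarrow> nat \<Rightarrow> complex)"

definition chart_on :: "'x topology \<Rightarrow> 'x chart \<Rightarrow> bool" where
  "chart_on X c \<longleftrightarrow> (case c of (n, U, \<phi>) \<Rightarrow>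
     openin X U \<and> openin (top_of_set (cvec n)) (\<phi> ` U) \<and>
     homeomorphic_map (subtopology X U) (top_of_set (\<phi> ` U)) \<phi>)"

definition complex_manifold :: "'x topology \<Rightarrow> 'x chart set \<Rightarrow> bool" where
  "complex_manifold X A \<longleftrightarrow>
     Hausdorff_space X \<and> second_countable X \<and>
     (\<forall>c\<in>A. chart_on X c) \<and> (\<Union>(n, U, \<phi>)\<in>A. U) = topspace X \<and>
     (\<forall>(n, U, \<phi>)\<in>A. \<forall>(m, V, \<psi>)\<in>A. holo_map n m (\<phi> ` (U \<inter> V)) (\<psi> \<circ> inv_into U \<phi>))"

definition holomorphic_between ::
    "'x topology \<Rightarrow> 'x chart set \<Rightarrow> 'y topology \<Rightarrow> 'y chart set \<Rightarrow> ('x \<Rightarrow> 'y) \<Rightarrow> bool" where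
  "holomorphic_between X A Y B F \<longleftrightarrow> continuous_map X Y F \<and>
     (\<forall>(n, U, \<phi>)\<in>A. \<forall>(m, V, \<psi>)\<in>B.
        holo_map n m (\<phi> ` (U \<inter> F -` V)) (\<psi> \<circ> F \<circ> inv_into U \<phi>))"

definition isomorphic_complex_manifolds ::
    "'x topology \<Rightarrow> 'x chart set \<Rightarrow> 'y topology \<Rightarrow> 'y chart set \<Rightarrow> bool" where
  "isomorphic_complex_manifolds X A Y B \<longleftrightarrow>
     complex_manifold X A \<and> complex_manifold Y B \<and>
     (\<exists>F G. holomorphic_between X A Y B F \<and> holomorphic_between Y B X A G \<and>
        (\<forall>x\<in>topspace X. G (F x) = x) \<and> (\<forall>y\<in>topspace Y. F (G y) = y))"

definition complex_plane_atlas :: "complex chart set" where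
  "complex_plane_atlas = {(1, UNIV, \<lambda>z i. if i = 0 then z else 0)}"

text \<open>The subspace of \<open>Hom(K\<^sub>0(D), \<complex>)\<close> on which the component of \<open>\<sigma>\<close> is modelled.\<close>

definition stab_tangent :: "('o, 'm) tricat \<Rightarrow> 'o stab \<Rightarrow> (('o \<Rightarrow>\<^sub>0 int) set \<Rightarrow> complex) set" where
  "stab_tangent T \<sigma> = {U \<in> K0_dual T. stab_norm T \<sigma> U < \<infinity>}"

definition linear_coordinates ::
    "('o, 'm) tricat \<Rightarrow> (('o \<Rightarrow>\<^sub>0 int) set \<Rightarrow> complex) set \<Rightarrow> nat \<Rightarrow>
     ((('o \<Rightarrow>\<^sub>0 int) set \<Rightarrow> complex) \<Rightarrow> nat \<Rightarrow> complex) \<Rightarrow> bool" where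
  "linear_coordinates T V n L \<longleftrightarrow> bij_betw L V (cvec n) \<and>
     (\<forall>u\<in>V. \<forall>v\<in>V. L (\<lambda>x\<in>carrier (K0 T). u x + v x) = (\<lambda>i. L u i + L v i)) \<and>
     (\<forall>c. \<forall>u\<in>V. L (\<lambda>x\<in>carrier (K0 T). c * u x) = (\<lambda>i. c * L u i))"

text \<open>The charts are the restrictions of \<open>(Z, P) \<mapsto> Z\<close>, read in linear coordinates of the model
  space, to those open sets on which they are homeomorphisms onto open sets.\<close>

definition stab_atlas :: "('o, 'm) tricat \<Rightarrow> 'o stab chart set" where
  "stab_atlas T = {(n, U, \<phi>) | n U \<phi>. chart_on (stab_topology T) (n, U, \<phi>) \<and>
     (\<exists>V L. (\<forall>\<sigma>\<in>U. stab_tangent T \<sigma> = V \<and> fst \<sigma> \<in> V) \<and> linear_coordinates T V n L \<and>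
        \<phi> = (\<lambda>\<sigma>. L (fst \<sigma>)))}"


section \<open>Finite dimensional vector spaces\<close>

definition fin_dim_space :: "('a, 'r) ring_scheme \<Rightarrow> ('a, 'v, 's) module_scheme \<Rightarrow> bool" where
  "fin_dim_space K V \<longleftrightarrow> Module.module K V \<and>
     (\<exists>B. finite B \<and> B \<subseteq> carrier V \<and>
        (\<forall>x\<in>carrier V. \<exists>c\<in>B \<rightarrow> carrier K. x = (\<Oplus>\<^bsub>V\<^esub>b\<in>B. c b \<odot>\<^bsub>V\<^esub> b)))"

definition lin_maps ::
    "('a, 'r) ring_scheme \<Rightarrow> ('a, 'v, 's) module_scheme \<Rightarrow> ('a, 'w, 't) module_scheme \<Rightarrow>
     ('v \<Rightarrow> 'w) set" where
  "lin_maps K V W = {f \<in> carrier V \<rightarrow>\<^sub>E carrier W.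
     (\<forall>x\<in>carrier V. \<forall>y\<in>carrier V. f (x \<oplus>\<^bsub>V\<^esub> y) = f x \<oplus>\<^bsub>W\<^esub> f y) \<and>
     (\<forall>c\<in>carrier K. \<forall>x\<in>carrier V. f (c \<odot>\<^bsub>V\<^esub> x) = c \<odot>\<^bsub>W\<^esub> f x)}"


text \<open>Lists of scalars suffice as a universe for the underlying sets:\<close>

lemma fin_dim_space_iso_lists:
  fixes K :: "('a, 'r) ring_scheme" and M :: "('a, 'w, 's) module_scheme"
  assumes fd: "fin_dim_space K M"
  shows "\<exists>(N :: ('a, 'a list) module) f.
    fin_dim_space K N \<and> f \<in> lin_maps K M N \<and> bij_betw f (carrier M) (carrier N)"
proof -
  from fd interpret M: Module.module K M
    by (simp add: fin_dim_space_def)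
  from fd obtain B where B: "finite B" "B \<subseteq> carrier M"
    and span: "\<forall>x\<in>carrier M. \<exists>c\<in>B \<rightarrow> carrier K. x = (\<Oplus>\<^bsub>M\<^esub>b\<in>B. c b \<odot>\<^bsub>M\<^esub> b)"
    unfolding fin_dim_space_def by blast
  obtain bs where bs: "set bs = B"
    using finite_list[OF B(1)] by blast
  obtain c where c: "\<And>x. x \<in> carrier M \<Longrightarrow> c x \<in> B \<rightarrow> carrier K \<and> x = (\<Oplus>\<^bsub>M\<^esub>b\<in>B. c x b \<odot>\<^bsub>M\<^esub> b)"
    using span by metis
  define e where "e = (\<lambda>x\<in>carrier M. map (c x) bs)"
  have inj: "inj_on e (carrier M)"
  proof (rule inj_onI)
    fix x y assume xy: "x \<in> carrier M" "y \<in> carrier M" "e x = e y"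
    then have eq: "\<And>b. b \<in> B \<Longrightarrow> c x b = c y b"
      by (simp add: e_def bs)
    have "(\<Oplus>\<^bsub>M\<^esub>b\<in>B. c x b \<odot>\<^bsub>M\<^esub> b) = (\<Oplus>\<^bsub>M\<^esub>b\<in>B. c y b \<odot>\<^bsub>M\<^esub> b)"
      using c[OF xy(2)] B(2) by (intro M.finsum_cong') (auto simp: eq Pi_iff)
    then show "x = y" using c xy by metis
  qed
  define g where "g = inv_into (carrier M) e"
  have ge[simp]: "g (e x) = x" if "x \<in> carrier M" for x
    using that inj by (simp add: g_def)
  define N :: "('a, 'a list) module" where
    "N = \<lparr>carrier = e ` carrier M, monoid.mult = undefined, monoid.one = undefined,
       ring.zero = e \<zero>\<^bsub>M\<^esub>, ring.add = (\<lambda>x y. e (g x \<oplus>\<^bsub>M\<^esub> g y)), module.smult = (\<lambda>a x. e (a \<odot>\<^bsub>M\<^esub> g x))\<rparr>"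
  have N[simp]: "carrier N = e ` carrier M" "\<zero>\<^bsub>N\<^esub> = e \<zero>\<^bsub>M\<^esub>"
    "\<And>x y. x \<oplus>\<^bsub>N\<^esub> y = e (g x \<oplus>\<^bsub>M\<^esub> g y)" "\<And>a x. a \<odot>\<^bsub>N\<^esub> x = e (a \<odot>\<^bsub>M\<^esub> g x)"
    by (auto simp: N_def)
  have ab: "abelian_group N"
  proof (rule abelian_groupI)
    fix x assume "x \<in> carrier N"
    then obtain y where y: "y \<in> carrier M" "x = e y" by auto
    then show "\<exists>y\<in>carrier N. y \<oplus>\<^bsub>N\<^esub> x = \<zero>\<^bsub>N\<^esub>"
      by (intro bexI[of _ "e (\<ominus>\<^bsub>M\<^esub> y)"]) (auto simp: M.l_neg)
  qed (auto simp: M.a_ac)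
  have modN: "Module.module K N"
    by (rule moduleI[OF M.is_cring ab])
      (auto simp: M.smult_l_distr M.smult_r_distr M.smult_assoc1)
  interpret N: Module.module K N by (rule modN)
  have lin: "e \<in> lin_maps K M N"
    by (auto simp: lin_maps_def e_def[symmetric]) (simp add: e_def)
  have sum: "e (\<Oplus>\<^bsub>M\<^esub>b\<in>A. h b) = (\<Oplus>\<^bsub>N\<^esub>b\<in>A. e (h b))"
    if "finite A" "h \<in> A \<rightarrow> carrier M" for A :: "'w set" and h
    using that
  proof (induction A)
    case (insert a A)
    then have "h \<in> A \<rightarrow> carrier M" "h a \<in> carrier M" by auto
    then show ?case using insert
      by (simp add: M.finsum_insert N.finsum_insert Pi_iff flip: insert.IH)
  qed (simp_all del: N(2) add: N(2)[symmetric] M.finsum_empty N.finsum_empty)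
  have "\<exists>d\<in>e ` B \<rightarrow> carrier K. x = (\<Oplus>\<^bsub>N\<^esub>b\<in>e ` B. d b \<odot>\<^bsub>N\<^esub> b)" if x: "x \<in> carrier N" for x
  proof -
    from x obtain y where y: "y \<in> carrier M" "x = e y" by auto
    note cy = c[OF y(1)]
    have "x = (\<Oplus>\<^bsub>N\<^esub>b\<in>B. e (c y b \<odot>\<^bsub>M\<^esub> b))"
      using cy B sum[OF B(1), of "\<lambda>b. c y b \<odot>\<^bsub>M\<^esub> b"] y(2) by (auto simp: Pi_iff)
    also have "\<dots> = (\<Oplus>\<^bsub>N\<^esub>b\<in>B. c y (g (e b)) \<odot>\<^bsub>N\<^esub> e b)"
      using cy B(2) by (intro N.finsum_cong') (auto simp: Pi_iff subset_iff)
    also have "\<dots> = (\<Oplus>\<^bsub>N\<^esub>b\<in>e ` B. c y (g b) \<odot>\<^bsub>N\<^esub> b)"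
      using cy B(2) by (intro N.finsum_reindex[symmetric] inj_on_subset[OF inj])
        (auto simp: Pi_iff subset_iff)
    finally show ?thesis
      using cy B(2) by (intro bexI[of _ "\<lambda>b. c y (g b)"]) (auto simp: Pi_iff subset_iff)
  qed
  then have "fin_dim_space K N"
    unfolding fin_dim_space_def using modN B
    by (intro conjI exI[of _ "e ` B"]) auto
  then show ?thesis
    using lin inj by (intro exI[of _ N] exI[of _ e]) (auto simp: bij_betw_def)
qed


section \<open>Bounded complexes\<close>

text \<open>Complexes are cohomologically graded. The underlying sets of the vector spaces are subsets
  of the type \<open>'v\<close>.\<close>

record ('a, 'v) cplx =
  csp :: "int \<Rightarrow> ('a, 'v) module"
  cdf :: "int \<Rightarrow> 'v \<Rightarrow> 'v"

definition bounded_complexes :: "('a, 'r) ring_scheme \<Rightarrow> ('a, 'v) cplx set" where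
  "bounded_complexes K = {X.
     (\<forall>n. fin_dim_space K (csp X n)) \<and>
     (\<forall>n. cdf X n \<in> lin_maps K (csp X n) (csp X (n + 1))) \<and>
     (\<forall>n. \<forall>x\<in>carrier (csp X n). cdf X (n + 1) (cdf X n x) = \<zero>\<^bsub>csp X (n + 2)\<^esub>) \<and>
     (\<exists>N. \<forall>n. \<bar>n\<bar> > N \<longrightarrow> carrier (csp X n) = {\<zero>\<^bsub>csp X n\<^esub>})}"

type_synonym 'v cmap = "int \<Rightarrow> 'v \<Rightarrow> 'v"

definition chain_maps ::
    "('a, 'r) ring_scheme \<Rightarrow> ('a, 'v) cplx \<Rightarrow> ('a, 'v) cplx \<Rightarrow> 'v cmap set" where
  "chain_maps K X Y = {f.
     (\<forall>n. f n \<in> lin_maps K (csp X n) (csp Y n)) \<and>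
     (\<forall>n. \<forall>x\<in>carrier (csp X n). f (n + 1) (cdf X n x) = cdf Y n (f n x))}"

definition cm_id :: "('a, 'v) cplx \<Rightarrow> 'v cmap" where
  "cm_id X = (\<lambda>n. \<lambda>x\<in>carrier (csp X n). x)"

definition cm_comp :: "('a, 'v) cplx \<Rightarrow> 'v cmap \<Rightarrow> 'v cmap \<Rightarrow> 'v cmap" where
  "cm_comp X g f = (\<lambda>n. compose (carrier (csp X n)) (g n) (f n))"

definition homotopic ::
    "('a, 'r) ring_scheme \<Rightarrow> ('a, 'v) cplx \<Rightarrow> ('a, 'v) cplx \<Rightarrow> 'v cmap \<Rightarrow> 'v cmap \<Rightarrow> bool" where
  "homotopic K X Y f g \<longleftrightarrow> (\<exists>h.
     (\<forall>n. h n \<in> lin_maps K (csp X n) (csp Y (n - 1))) \<and>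
     (\<forall>n. \<forall>x\<in>carrier (csp X n).
        f n x \<ominus>\<^bsub>csp Y n\<^esub> g n x = cdf Y (n - 1) (h n x) \<oplus>\<^bsub>csp Y n\<^esub> h (n + 1) (cdf X n x)))"

definition cx_shift :: "('a, 'v) cplx \<Rightarrow> ('a, 'v) cplx" where
  "cx_shift X = \<lparr>csp = (\<lambda>n. csp X (n + 1)),
     cdf = (\<lambda>n. \<lambda>x\<in>carrier (csp X (n + 1)). \<ominus>\<^bsub>csp X (n + 2)\<^esub> cdf X (n + 1) x)\<rparr>"

definition cm_shift :: "'v cmap \<Rightarrow> 'v cmap" where
  "cm_shift f = (\<lambda>n. f (n + 1))"

definition cocycles :: "('a, 'v) cplx \<Rightarrow> int \<Rightarrow> 'v set" where
  "cocycles X n = {x \<in> carrier (csp X n). cdf X n x = \<zero>\<^bsub>csp X (n + 1)\<^esub>}"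

definition coboundaries :: "('a, 'v) cplx \<Rightarrow> int \<Rightarrow> 'v set" where
  "coboundaries X n = cdf X (n - 1) ` carrier (csp X (n - 1))"

definition cohomology :: "('a, 'v) cplx \<Rightarrow> int \<Rightarrow> 'v set set" where
  "cohomology X n = {coboundaries X n +>\<^bsub>csp X n\<^esub> x | x. x \<in> cocycles X n}"

definition cohomology_map :: "('a, 'v) cplx \<Rightarrow> 'v cmap \<Rightarrow> int \<Rightarrow> 'v set \<Rightarrow> 'v set" where
  "cohomology_map Y f n C = (\<Union>x\<in>C. coboundaries Y n +>\<^bsub>csp Y n\<^esub> f n x)"

definition quasi_isos ::
    "('a, 'r) ring_scheme \<Rightarrow> ('a, 'v) cplx \<Rightarrow> ('a, 'v) cplx \<Rightarrow> 'v cmap set" where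
  "quasi_isos K X Y = {f \<in> chain_maps K X Y.
     \<forall>n. bij_betw (cohomology_map Y f n) (cohomology X n) (cohomology Y n)}"


section \<open>The bounded derived category\<close>

text \<open>
  The localisation of the homotopy category of bounded complexes at the quasi-isomorphisms.
  \<open>Roof X W Y s f\<close> stands for the fraction \<open>X \<leftarrow> W \<rightarrow> Y\<close> with left leg the quasi-isomorphism \<open>s\<close>
  and right leg \<open>f\<close>. A morphism is an equivalence class of roofs; the operations on classes are
  defined as the union, over all admissible choices of representatives (and of Ore squares), of
  the resulting classes.
\<close>

datatype ('a, 'v) roof =
  Roof "('a, 'v) cplx" "('a, 'v) cplx" "('a, 'v) cplx" "'v cmap" "'v cmap"

fun is_roof :: "('a, 'r) ring_scheme \<Rightarrow> ('a, 'v) roof \<Rightarrow> bool" where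
  "is_roof K (Roof X W Y s f) \<longleftrightarrow>
     X \<in> bounded_complexes K \<and> W \<in> bounded_complexes K \<and> Y \<in> bounded_complexes K \<and>
     s \<in> quasi_isos K W X \<and> f \<in> chain_maps K W Y"

fun roof_equiv :: "('a, 'r) ring_scheme \<Rightarrow> ('a, 'v) roof \<Rightarrow> ('a, 'v) roof \<Rightarrow> bool" where
  "roof_equiv K (Roof X W Y s f) (Roof X' W' Y' s' f') \<longleftrightarrow>
     is_roof K (Roof X W Y s f) \<and> is_roof K (Roof X' W' Y' s' f') \<and> X = X' \<and> Y = Y' \<and>
     (\<exists>V\<in>bounded_complexes K. \<exists>u\<in>chain_maps K V W. \<exists>u'\<in>chain_maps K V W'.
        cm_comp V s u \<in> quasi_isos K V X \<and>
        homotopic K V X (cm_comp V s u) (cm_comp V s' u') \<and>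
        homotopic K V Y (cm_comp V f u) (cm_comp V f' u'))"

definition roof_class :: "('a, 'r) ring_scheme \<Rightarrow> ('a, 'v) roof \<Rightarrow> ('a, 'v) roof set" where
  "roof_class K r = {r'. roof_equiv K r r'}"

definition der_hom ::
    "('a, 'r) ring_scheme \<Rightarrow> ('a, 'v) cplx \<Rightarrow> ('a, 'v) cplx \<Rightarrow> ('a, 'v) roof set set" where
  "der_hom K X Y = {roof_class K (Roof X W Y s f) | W s f. is_roof K (Roof X W Y s f)}"

definition der_map ::
    "('a, 'r) ring_scheme \<Rightarrow> ('a, 'v) cplx \<Rightarrow> ('a, 'v) cplx \<Rightarrow> 'v cmap \<Rightarrow> ('a, 'v) roof set" where
  "der_map K X Y f = roof_class K (Roof X X Y (cm_id X) f)"

definition der_comp ::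
    "('a, 'r) ring_scheme \<Rightarrow> ('a, 'v) roof set \<Rightarrow> ('a, 'v) roof set \<Rightarrow> ('a, 'v) roof set" where
  "der_comp K b a = \<Union>{roof_class K (Roof X V Z (cm_comp V s p) (cm_comp V g q)) |
     X W Y s f W' Z t g V p q.
     Roof X W Y s f \<in> a \<and> Roof Y W' Z t g \<in> b \<and> V \<in> bounded_complexes K \<and>
     p \<in> quasi_isos K V W \<and> q \<in> chain_maps K V W' \<and>
     homotopic K V Y (cm_comp V f p) (cm_comp V t q)}"

definition der_shift ::
    "('a, 'r) ring_scheme \<Rightarrow> ('a, 'v) roof set \<Rightarrow> ('a, 'v) roof set" where
  "der_shift K a = \<Union>{roof_class K
       (Roof (cx_shift X) (cx_shift W) (cx_shift Y) (cm_shift s) (cm_shift f)) |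
     X W Y s f. Roof X W Y s f \<in> a}"

text \<open>
  The triangle \<open>A \<rightarrow> B \<rightarrow> C \<rightarrow> A[1]\<close> of a termwise split short exact sequence of complexes with
  splittings \<open>\<pi>\<^sup>n : B\<^sup>n \<rightarrow> A\<^sup>n\<close> and \<open>\<sigma>\<^sup>n : C\<^sup>n \<rightarrow> B\<^sup>n\<close>; its last map is \<open>\<pi>\<^sup>n\<^sup>+\<^sup>1 d\<^sub>B\<^sup>n \<sigma>\<^sup>n\<close>. These are, up to
  isomorphism, the mapping cone triangles.
\<close>

definition termwise_split ::
    "('a, 'r) ring_scheme \<Rightarrow> ('a, 'v) cplx \<Rightarrow> ('a, 'v) cplx \<Rightarrow> ('a, 'v) cplx \<Rightarrow>
     'v cmap \<Rightarrow> 'v cmap \<Rightarrow> 'v cmap \<Rightarrow> 'v cmap \<Rightarrow> bool" where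
  "termwise_split K A B C \<alpha> \<beta> \<pi> \<sigma> \<longleftrightarrow>
     A \<in> bounded_complexes K \<and> B \<in> bounded_complexes K \<and> C \<in> bounded_complexes K \<and>
     \<alpha> \<in> chain_maps K A B \<and> \<beta> \<in> chain_maps K B C \<and>
     (\<forall>n. \<pi> n \<in> lin_maps K (csp B n) (csp A n) \<and> \<sigma> n \<in> lin_maps K (csp C n) (csp B n)) \<and>
     (\<forall>n. (\<forall>x\<in>carrier (csp A n). \<pi> n (\<alpha> n x) = x \<and> \<beta> n (\<alpha> n x) = \<zero>\<^bsub>csp C n\<^esub>) \<and>
        (\<forall>x\<in>carrier (csp C n). \<beta> n (\<sigma> n x) = x) \<and>
        (\<forall>x\<in>carrier (csp B n). \<alpha> n (\<pi> n x) \<oplus>\<^bsub>csp B n\<^esub> \<sigma> n (\<beta> n x) = x))"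

definition split_connecting ::
    "('a, 'v) cplx \<Rightarrow> ('a, 'v) cplx \<Rightarrow> 'v cmap \<Rightarrow> 'v cmap \<Rightarrow> 'v cmap" where
  "split_connecting B C \<pi> \<sigma> = (\<lambda>n. \<lambda>x\<in>carrier (csp C n). \<pi> (n + 1) (cdf B n (\<sigma> n x)))"

text \<open>The underlying category and shift; the triangles are supplied in \<open>Db_mod\<close> below.\<close>

definition der_cat ::
    "('a, 'r) ring_scheme \<Rightarrow> (('a, 'v) cplx, ('a, 'v) roof set) tricat" where
  "der_cat K = \<lparr>tob = bounded_complexes K, thom = der_hom K,
     tid = (\<lambda>X. der_map K X X (cm_id X)), tcmp = der_comp K,
     tsh = cx_shift, tshm = der_shift K, tdt = {}\<rparr>"

definition der_triangles ::
    "('a, 'r) ring_scheme \<Rightarrow>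
     (('a, 'v) cplx \<times> ('a, 'v) cplx \<times> ('a, 'v) cplx \<times>
      ('a, 'v) roof set \<times> ('a, 'v) roof set \<times> ('a, 'v) roof set) set" where
  "der_triangles K = {(X, Y, Z, u, v, w) | X Y Z u v w.
     X \<in> bounded_complexes K \<and> Y \<in> bounded_complexes K \<and> Z \<in> bounded_complexes K \<and>
     u \<in> der_hom K X Y \<and> v \<in> der_hom K Y Z \<and> w \<in> der_hom K Z (cx_shift X) \<and>
     (\<exists>A B C \<alpha> \<beta> \<pi> \<sigma> a b c. termwise_split K A B C \<alpha> \<beta> \<pi> \<sigma> \<and>
        iso_mor (der_cat K) X A a \<and> iso_mor (der_cat K) Y B b \<and> iso_mor (der_cat K) Z C c \<and>
        der_comp K b u = der_comp K (der_map K A B \<alpha>) a \<and>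
        der_comp K c v = der_comp K (der_map K B C \<beta>) b \<and>
        der_comp K (der_shift K a) w =
          der_comp K (der_map K C (cx_shift A) (split_connecting B C \<pi> \<sigma>)) c)}"

text \<open>
  The bounded derived category of the finite dimensional \<open>K\<close>-vector spaces whose underlying sets
  are sets of lists of elements of the type of scalars. By \<open>fin_dim_space_iso_lists\<close> above, this
  universe contains every finite dimensional vector space up to isomorphism.
\<close>

definition Db_mod ::
    "'a ring \<Rightarrow> (('a, 'a list) cplx, ('a, 'a list) roof set) tricat" where
  "Db_mod K = der_cat K\<lparr>tdt := der_triangles K\<rparr>"

end

theory Submission
  imports "Jordan_Normal_Form.Missing_VectorSpace" "HOL-Complex_Analysis.Complex_Analysis" Defs
begin

text \<open>
  Over a field every bounded complex splits: it is the direct sum of its cohomology and a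
  contractible complex. Hence an object of \<open>D\<^sup>b(mod k)\<close> is determined up to isomorphism by the
  dimensions of its cohomology, morphisms are graded linear maps, and \<open>K\<^sub>0 = \<int>\<close> through the Euler
  characteristic. A semistable object lives in a single degree, since otherwise a shift of it by a
  positive amount would map nontrivially to it. So a stability condition is given by the
  central charge \<open>exp w\<close> of the simple object \<open>k\<close> together with its phase \<open>Im w / \<pi>\<close>, i.e. by one
  complex number \<open>w\<close>; in this parameter the charge, which gives the charts, is \<open>exp w\<close>, and the
  basic neighbourhoods of \<open>w\<close> are the sets of \<open>w'\<close> with \<open>exp (w' - w)\<close> near \<open>1\<close> and \<open>Im (w' - w)\<close>
  small.
\<close>

section \<open>Linear algebra\<close>

text \<open>The obstacle is the form of a morphism: a class of roofs, composed by a union over all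
  Ore squares. A contraction of each complex singles out harmonic elements, exactly one in each
  cohomology class, so that cohomology consists of elements rather than cosets. Two facts then
  control all roofs: a chain map is a quasi-isomorphism iff it is bijective on harmonic elements,
  and two chain maps are homotopic iff they induce the same map there. So a roof class is named by
  the one graded map that each of its members represents. What the study of stability needs after
  that is numerical: dimensions and, for triangles, the rank of the connecting map. The locale
  \<open>graded_tricat\<close> records just such properties. Generation of K0 by one class rests on
  a triangle with acyclic middle term, which makes the classes of neighbouring degrees opposite. The
  charge alone determines w only up to multiples of 2 pi i; the slicing removes this ambiguity,
  which is why the universal cover of the punctured plane appears.\<close>

context abelian_group
begin

lemma minus_cancel: "a \<in> carrier G \<Longrightarrow> b \<in> carrier G \<Longrightarrow> (a \<ominus> b) \<oplus> b = a"
  by (simp add: a_minus_def a_assoc l_neg)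

lemma minus_eq_iff: "a \<in> carrier G \<Longrightarrow> b \<in> carrier G \<Longrightarrow> c \<in> carrier G \<Longrightarrow> a \<ominus> b = c \<longleftrightarrow> a = c \<oplus> b"
  by (metis minus_cancel minus_closed add.right_cancel)

lemma eq_minus_iff: "a \<in> carrier G \<Longrightarrow> b \<in> carrier G \<Longrightarrow> c \<in> carrier G \<Longrightarrow> c = a \<ominus> b \<longleftrightarrow> c \<oplus> b = a"
  using minus_eq_iff[of a b c] by auto

lemma add_minus_assoc: "a \<in> carrier G \<Longrightarrow> b \<in> carrier G \<Longrightarrow> c \<in> carrier G \<Longrightarrow> a \<oplus> (b \<ominus> c) = (a \<oplus> b) \<ominus> c"
  by (simp add: a_minus_def a_assoc)

lemma minus_add_comm: "a \<in> carrier G \<Longrightarrow> b \<in> carrier G \<Longrightarrow> c \<in> carrier G \<Longrightarrow> (a \<ominus> b) \<oplus> c = (a \<oplus> c) \<ominus> b"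
  by (simp add: a_minus_def a_ac)

lemma minus_minus_assoc: "a \<in> carrier G \<Longrightarrow> b \<in> carrier G \<Longrightarrow> c \<in> carrier G \<Longrightarrow> (a \<ominus> b) \<ominus> c = a \<ominus> (b \<oplus> c)"
  by (simp add: a_minus_def a_ac minus_add)

lemma minus_minus_comm: "a \<in> carrier G \<Longrightarrow> b \<in> carrier G \<Longrightarrow> c \<in> carrier G \<Longrightarrow> a \<ominus> (b \<ominus> c) = (a \<oplus> c) \<ominus> b"
  by (simp add: a_minus_def a_ac minus_add)

lemma add_uminus: "a \<in> carrier G \<Longrightarrow> b \<in> carrier G \<Longrightarrow> a \<oplus> \<ominus> b = a \<ominus> b"
  by (simp add: a_minus_def)

lemma uminus_add: "a \<in> carrier G \<Longrightarrow> b \<in> carrier G \<Longrightarrow> \<ominus> a \<oplus> b = b \<ominus> a"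
  by (simp add: a_minus_def a_ac)

lemma minus_uminus: "a \<in> carrier G \<Longrightarrow> b \<in> carrier G \<Longrightarrow> a \<ominus> (\<ominus> b) = a \<oplus> b"
  by (simp add: a_minus_def a_ac)

lemma uminus_minus: "a \<in> carrier G \<Longrightarrow> b \<in> carrier G \<Longrightarrow> \<ominus> (a \<ominus> b) = b \<ominus> a"
  by (simp add: a_minus_def a_ac minus_add)

text \<open>Rewriting with these moves every subtracted term to the other side of an equation, so
  that an identity between sums and differences becomes one between sums, settled by
  \<open>a_ac\<close>.\<close>

lemmas diff_simps = minus_eq_iff eq_minus_iff add_minus_assoc minus_add_comm minus_minus_assoc
  minus_minus_comm add_uminus uminus_add minus_uminus uminus_minus a_ac

end

section \<open>Linear maps as extensional functions\<close>

lemma lin_closed: "f \<in> lin_maps K V W \<Longrightarrow> x \<in> carrier V \<Longrightarrow> f x \<in> carrier W"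
  by (auto simp: lin_maps_def)

lemma lin_add: "f \<in> lin_maps K V W \<Longrightarrow> x \<in> carrier V \<Longrightarrow> y \<in> carrier V \<Longrightarrow>
    f (x \<oplus>\<^bsub>V\<^esub> y) = f x \<oplus>\<^bsub>W\<^esub> f y"
  by (auto simp: lin_maps_def)

lemma lin_smult: "f \<in> lin_maps K V W \<Longrightarrow> c \<in> carrier K \<Longrightarrow> x \<in> carrier V \<Longrightarrow>
    f (c \<odot>\<^bsub>V\<^esub> x) = c \<odot>\<^bsub>W\<^esub> f x"
  by (auto simp: lin_maps_def)

lemma lin_eqI: "f \<in> lin_maps K V W \<Longrightarrow> g \<in> lin_maps K V W \<Longrightarrow>
    (\<And>x. x \<in> carrier V \<Longrightarrow> f x = g x) \<Longrightarrow> f = g"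
  by (auto simp: lin_maps_def intro: PiE_ext)

lemma lin_restrictI:
  assumes "\<And>x. x \<in> carrier V \<Longrightarrow> f x \<in> carrier W"
    and "\<And>x y. x \<in> carrier V \<Longrightarrow> y \<in> carrier V \<Longrightarrow> f (x \<oplus>\<^bsub>V\<^esub> y) = f x \<oplus>\<^bsub>W\<^esub> f y"
    and "\<And>c x. c \<in> carrier K \<Longrightarrow> x \<in> carrier V \<Longrightarrow> f (c \<odot>\<^bsub>V\<^esub> x) = c \<odot>\<^bsub>W\<^esub> f x"
    and "Module.module K V"
  shows "(\<lambda>x\<in>carrier V. f x) \<in> lin_maps K V W"
proof -
  interpret V: Module.module K V by fact
  show ?thesis
    unfolding lin_maps_def
    by (intro CollectI conjI ballI) (simp_all add: assms(1-3))
qed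

text \<open>Bridge to the vector space library, from which kernels, images and rank-nullity are
  taken.\<close>

lemma lin_module_hom: "f \<in> lin_maps K V W \<Longrightarrow> f \<in> LinearCombinations.module_hom K V W"
  by (auto simp: LinearCombinations.module_hom_def lin_maps_def)

lemma lin_mod_hom:
  assumes "f \<in> lin_maps K V W" "Module.module K V" "Module.module K W"
  shows "mod_hom K V W f"
  by (intro mod_hom.intro mod_hom_axioms.intro lin_module_hom assms)

lemma lin_linear_map:
  assumes "f \<in> lin_maps K V W" "vectorspace K V" "vectorspace K W"
  shows "linear_map K V W f"
  by (intro linear_map.intro lin_mod_hom assms vectorspace.axioms)

lemma lin_zero:
  assumes "f \<in> lin_maps K V W" "Module.module K V" "Module.module K W"
  shows "f \<zero>\<^bsub>V\<^esub> = \<zero>\<^bsub>W\<^esub>"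
  using mod_hom.f0_is_0[OF lin_mod_hom[OF assms]] .

lemma lin_minus:
  assumes "f \<in> lin_maps K V W" "Module.module K V" "Module.module K W"
    and "x \<in> carrier V" "y \<in> carrier V"
  shows "f (x \<ominus>\<^bsub>V\<^esub> y) = f x \<ominus>\<^bsub>W\<^esub> f y"
  using mod_hom.f_minus[OF lin_mod_hom[OF assms(1-3)]] assms by blast

lemma lin_comp:
  assumes "g \<in> lin_maps K W U" "f \<in> lin_maps K V W" "Module.module K V"
  shows "compose (carrier V) g f \<in> lin_maps K V U"
  unfolding compose_def
  by (rule lin_restrictI) (simp_all add: assms lin_closed[OF assms(1)] lin_closed[OF assms(2)]
      lin_add[OF assms(1)] lin_add[OF assms(2)] lin_smult[OF assms(1)] lin_smult[OF assms(2)])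

lemma lin_id: "Module.module K V \<Longrightarrow> (\<lambda>x\<in>carrier V. x) \<in> lin_maps K V V"
  by (rule lin_restrictI) simp_all

lemma lin_zero_map:
  assumes "Module.module K V" "Module.module K W"
  shows "(\<lambda>x\<in>carrier V. \<zero>\<^bsub>W\<^esub>) \<in> lin_maps K V W"
proof -
  interpret W: Module.module K W by fact
  show ?thesis by (rule lin_restrictI) (simp_all add: assms)
qed

lemma lin_plus_map:
  assumes f: "f \<in> lin_maps K V W" and g: "g \<in> lin_maps K V W"
    and V: "Module.module K V" and W: "Module.module K W"
  shows "(\<lambda>x\<in>carrier V. f x \<oplus>\<^bsub>W\<^esub> g x) \<in> lin_maps K V W"
proof -
  interpret W: Module.module K W by fact
  note [simp] = lin_closed[OF f] lin_closed[OF g]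
  show ?thesis
    by (rule lin_restrictI)
      (simp_all add: V lin_add[OF f] lin_add[OF g] lin_smult[OF f] lin_smult[OF g]
        W.smult_r_distr W.a_ac)
qed

lemma lin_minus_map:
  assumes f: "f \<in> lin_maps K V W" and g: "g \<in> lin_maps K V W"
    and V: "Module.module K V" and W: "Module.module K W"
  shows "(\<lambda>x\<in>carrier V. f x \<ominus>\<^bsub>W\<^esub> g x) \<in> lin_maps K V W"
proof -
  interpret V: Module.module K V by fact
  interpret W: Module.module K W by fact
  note [simp] = lin_closed[OF f] lin_closed[OF g]
  show ?thesis
    by (rule lin_restrictI)
      (simp_all add: V lin_add[OF f] lin_add[OF g] lin_smult[OF f] lin_smult[OF g]
        W.smult_r_distr W.smult_r_minus a_minus_def W.minus_add W.a_ac)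
qed

lemma lin_inv_into:
  assumes f: "f \<in> lin_maps K V W" and bij: "bij_betw f (carrier V) (carrier W)"
    and V: "Module.module K V" and W: "Module.module K W"
  shows "(\<lambda>y\<in>carrier W. inv_into (carrier V) f y) \<in> lin_maps K W V"
proof -
  interpret V: Module.module K V by fact
  interpret W: Module.module K W by fact
  let ?g = "inv_into (carrier V) f"
  have inj: "inj_on f (carrier V)" and g: "\<And>y. y \<in> carrier W \<Longrightarrow> ?g y \<in> carrier V"
    and fg: "\<And>y. y \<in> carrier W \<Longrightarrow> f (?g y) = y"
    using bij by (auto simp: bij_betw_def inv_into_into f_inv_into_f)
  show ?thesis
  proof (rule lin_restrictI)
    fix x y assume *: "x \<in> carrier W" "y \<in> carrier W"
    have "f (?g (x \<oplus>\<^bsub>W\<^esub> y)) = f (?g x \<oplus>\<^bsub>V\<^esub> ?g y)"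
      using * by (simp add: fg g lin_add[OF f])
    then show "?g (x \<oplus>\<^bsub>W\<^esub> y) = ?g x \<oplus>\<^bsub>V\<^esub> ?g y"
      using inj * g by (auto dest!: inj_onD)
  next
    fix c x assume *: "c \<in> carrier K" "x \<in> carrier W"
    have "f (?g (c \<odot>\<^bsub>W\<^esub> x)) = f (c \<odot>\<^bsub>V\<^esub> ?g x)"
      using * by (simp add: fg g lin_smult[OF f])
    then show "?g (c \<odot>\<^bsub>W\<^esub> x) = c \<odot>\<^bsub>V\<^esub> ?g x"
      using inj * g by (auto dest!: inj_onD)
  qed (use g W in auto)
qed

lemma lin_inj_onI:
  assumes f: "f \<in> lin_maps K V W" and V: "Module.module K V" and W: "Module.module K W"
    and ker: "\<And>x. x \<in> carrier V \<Longrightarrow> f x = \<zero>\<^bsub>W\<^esub> \<Longrightarrow> x = \<zero>\<^bsub>V\<^esub>"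
  shows "inj_on f (carrier V)"
proof (rule inj_onI)
  interpret V: Module.module K V by fact
  interpret W: Module.module K W by fact
  fix x y assume *: "x \<in> carrier V" "y \<in> carrier V" "f x = f y"
  then have "f (x \<ominus>\<^bsub>V\<^esub> y) = \<zero>\<^bsub>W\<^esub>"
    using lin_minus[OF f V W] lin_closed[OF f] by (simp add: W.M.minus_other_side)
  then have "x \<ominus>\<^bsub>V\<^esub> y = \<zero>\<^bsub>V\<^esub>" using ker * by simp
  then show "x = y" using * by (simp add: V.M.minus_other_side)
qed

lemma lin_carrier_update:
  assumes "f \<in> lin_maps K V W" "\<And>x. x \<in> carrier V \<Longrightarrow> f x \<in> S"
  shows "f \<in> lin_maps K V (W\<lparr>carrier := S\<rparr>)"
  using assms by (auto simp: lin_maps_def)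

lemma lin_of_subspace:
  assumes "f \<in> lin_maps K V (W\<lparr>carrier := S\<rparr>)" "S \<subseteq> carrier W"
  shows "f \<in> lin_maps K V W"
  using assms by (auto simp: lin_maps_def)

section \<open>Finite dimensional spaces\<close>

lemma fdsp_module: "fin_dim_space K V \<Longrightarrow> Module.module K V"
  by (simp add: fin_dim_space_def)

lemma fdsp_vectorspace: "field K \<Longrightarrow> fin_dim_space K V \<Longrightarrow> vectorspace K V"
  by (simp add: fin_dim_space_def vectorspace_def)

text \<open>The explicit finite sums in \<open>fin_dim_space\<close> are the linear combinations of
  the library, so its dimension theory becomes available.\<close>

lemma fin_dim_space_iff:
  assumes "field K"
  shows "fin_dim_space K V \<longleftrightarrow> vectorspace K V \<and> vectorspace.fin_dim K V"
proof (cases "vectorspace K V")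
  case True
  then interpret V: vectorspace K V .
  have *: "V.gen_set B \<longleftrightarrow> (\<forall>x\<in>carrier V. \<exists>c\<in>B \<rightarrow> carrier K. x = (\<Oplus>\<^bsub>V\<^esub>b\<in>B. c b \<odot>\<^bsub>V\<^esub> b))"
    if "finite B" "B \<subseteq> carrier V" for B
  proof -
    have "V.span B \<subseteq> carrier V"
      using that by (metis V.span_is_subset2)
    then show ?thesis
      unfolding V.finite_span[OF that] V.lincomb_def by blast
  qed
  have "V.fin_dim \<longleftrightarrow> (\<exists>B. finite B \<and> B \<subseteq> carrier V \<and>
      (\<forall>x\<in>carrier V. \<exists>c\<in>B \<rightarrow> carrier K. x = (\<Oplus>\<^bsub>V\<^esub>b\<in>B. c b \<odot>\<^bsub>V\<^esub> b)))"
    unfolding V.fin_dim_def by (intro ex_cong1) (simp add: * cong: conj_cong)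
  then show ?thesis
    using True V.module_axioms by (simp add: fin_dim_space_def)
qed (use assms fdsp_vectorspace in blast)

lemma fdsp_surj:
  assumes K: "field K"
    and f: "f \<in> lin_maps K V W" and V: "fin_dim_space K V" and W: "Module.module K W"
    and surj: "f ` carrier V = carrier W"
  shows "fin_dim_space K W"
proof -
  have "vectorspace K W" using W K by (simp add: vectorspace_def)
  then have "linear_map K V W f" using lin_linear_map f V fdsp_vectorspace[OF K] by blast
  from linear_map.surj_fin_dim[OF this _ surj] show ?thesis
    using V \<open>vectorspace K W\<close>
    by (simp add: fin_dim_space_iff[OF K])
qed

section \<open>Subspaces, complements and generalized inverses\<close>

lemma submodule_ker:
  assumes f: "f \<in> lin_maps K V W" and V: "Module.module K V" and W: "Module.module K W"
  shows "submodule K {x \<in> carrier V. f x = \<zero>\<^bsub>W\<^esub>} V"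
  using mod_hom.ker_is_submodule[OF lin_mod_hom[OF assms]]
  by (simp add: mod_hom.ker_def[OF lin_mod_hom[OF assms]])

lemma submodule_im:
  assumes f: "f \<in> lin_maps K V W" and V: "Module.module K V" and W: "Module.module K W"
  shows "submodule K (f ` carrier V) W"
  using mod_hom.im_is_submodule[OF lin_mod_hom[OF assms]]
  by (simp add: mod_hom.im_def[OF lin_mod_hom[OF assms]])

lemma submodule_finsum:
  assumes "submodule K S V" "finite A" "\<And>x. x \<in> A \<Longrightarrow> f x \<in> S"
  shows "(\<Oplus>\<^bsub>V\<^esub>x\<in>A. f x) \<in> S"
proof -
  interpret S: submodule K S V by fact
  interpret V: Module.module K V by (rule S.module)
  show ?thesis using assms(2,3)
  proof (induction A)
    case (insert a A)
    then have "f \<in> A \<rightarrow> carrier V" "f a \<in> carrier V" using S.subset by auto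
    then show ?case using insert by (auto simp: V.M.finsum_insert)
  qed auto
qed

lemma submodule_uminus:
  assumes "submodule K S V" "x \<in> S"
  shows "\<ominus>\<^bsub>V\<^esub> x \<in> S"
proof -
  interpret S: submodule K S V by fact
  interpret V: Module.module K V by (rule S.module)
  have "(\<ominus>\<^bsub>K\<^esub> \<one>\<^bsub>K\<^esub>) \<odot>\<^bsub>V\<^esub> x \<in> S" using assms by simp
  then show ?thesis using V.smult_minus_1[of x] assms S.subset by (metis subsetD)
qed

lemma submodule_minus:
  assumes "submodule K S V" "x \<in> S" "y \<in> S"
  shows "x \<ominus>\<^bsub>V\<^esub> y \<in> S"
  using assms submodule_uminus[OF assms(1,3)] submodule.m_closed[OF assms(1)]
  by (simp add: a_minus_def)

text \<open>If \<open>c + r b\<close> with nonzero r lay in U, division by r would exhibit b as an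
  element of \<open>U + C\<close>, against the choice of b.\<close>

lemma complement_step:
  assumes "field K"
    and U: "submodule K U V" and C: "submodule K C V" and int: "U \<inter> C = {\<zero>\<^bsub>V\<^esub>}"
    and b: "b \<in> carrier V" and nb: "\<And>u c. u \<in> U \<Longrightarrow> c \<in> C \<Longrightarrow> b \<noteq> u \<oplus>\<^bsub>V\<^esub> c"
  defines "C' \<equiv> {c \<oplus>\<^bsub>V\<^esub> r \<odot>\<^bsub>V\<^esub> b | c r. c \<in> C \<and> r \<in> carrier K}"
  shows "submodule K C' V" "U \<inter> C' = {\<zero>\<^bsub>V\<^esub>}" "C \<subseteq> C'" "b \<in> C'"
proof -
  interpret U: submodule K U V by fact
  interpret C: submodule K C V by fact
  interpret V: Module.module K V by (rule C.module)
  interpret K: field K by fact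
  have [simp]: "c \<in> C \<Longrightarrow> c \<in> carrier V" "u \<in> U \<Longrightarrow> u \<in> carrier V" for c u
    using C.subset U.subset by auto
  show "C \<subseteq> C'"
  proof
    fix c assume "c \<in> C"
    then have "c = c \<oplus>\<^bsub>V\<^esub> \<zero>\<^bsub>K\<^esub> \<odot>\<^bsub>V\<^esub> b" using b by simp
    then show "c \<in> C'" using \<open>c \<in> C\<close> by (auto simp: C'_def)
  qed
  have "b = \<zero>\<^bsub>V\<^esub> \<oplus>\<^bsub>V\<^esub> \<one>\<^bsub>K\<^esub> \<odot>\<^bsub>V\<^esub> b" using b by simp
  then show "b \<in> C'" unfolding C'_def using C.zero_closed V.R.one_closed by blast
  show sub: "submodule K C' V"
  proof
    show "C' \<subseteq> carrier V" using b by (auto simp: C'_def)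
    show "\<zero>\<^bsub>V\<^esub> \<in> C'" using \<open>C \<subseteq> C'\<close> C.zero_closed by blast
  next
    fix v w assume "v \<in> C'" "w \<in> C'"
    then obtain c r d s where *: "c \<in> C" "r \<in> carrier K" "d \<in> C" "s \<in> carrier K"
      "v = c \<oplus>\<^bsub>V\<^esub> r \<odot>\<^bsub>V\<^esub> b" "w = d \<oplus>\<^bsub>V\<^esub> s \<odot>\<^bsub>V\<^esub> b"
      by (auto simp: C'_def)
    then have "v \<oplus>\<^bsub>V\<^esub> w = (c \<oplus>\<^bsub>V\<^esub> d) \<oplus>\<^bsub>V\<^esub> (r \<oplus>\<^bsub>K\<^esub> s) \<odot>\<^bsub>V\<^esub> b"
      using b by (simp add: V.smult_l_distr V.M.a_ac)
    then show "v \<oplus>\<^bsub>V\<^esub> w \<in> C'" using * by (auto simp: C'_def)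
  next
    fix a v assume "a \<in> carrier K" "v \<in> C'"
    then obtain c r where *: "c \<in> C" "r \<in> carrier K" "v = c \<oplus>\<^bsub>V\<^esub> r \<odot>\<^bsub>V\<^esub> b"
      by (auto simp: C'_def)
    then have "a \<odot>\<^bsub>V\<^esub> v = (a \<odot>\<^bsub>V\<^esub> c) \<oplus>\<^bsub>V\<^esub> (a \<otimes>\<^bsub>K\<^esub> r) \<odot>\<^bsub>V\<^esub> b"
      using b \<open>a \<in> carrier K\<close> by (simp add: V.smult_r_distr V.smult_assoc1)
    then show "a \<odot>\<^bsub>V\<^esub> v \<in> C'" using * \<open>a \<in> carrier K\<close> by (auto simp: C'_def)
  qed
  show "U \<inter> C' = {\<zero>\<^bsub>V\<^esub>}"
  proof (rule equalityI, rule subsetI)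
    fix x assume "x \<in> U \<inter> C'"
    then obtain c r where *: "x \<in> U" "c \<in> C" "r \<in> carrier K" "x = c \<oplus>\<^bsub>V\<^esub> r \<odot>\<^bsub>V\<^esub> b"
      by (auto simp: C'_def)
    show "x \<in> {\<zero>\<^bsub>V\<^esub>}"
    proof (cases "r = \<zero>\<^bsub>K\<^esub>")
      case True
      then have "x = c" using * b by simp
      then show ?thesis using * int by auto
    next
      case False
      then have r: "inv\<^bsub>K\<^esub> r \<in> carrier K" "inv\<^bsub>K\<^esub> r \<otimes>\<^bsub>K\<^esub> r = \<one>\<^bsub>K\<^esub>"
        using * K.field_Units by auto
      have "inv\<^bsub>K\<^esub> r \<odot>\<^bsub>V\<^esub> x = inv\<^bsub>K\<^esub> r \<odot>\<^bsub>V\<^esub> c \<oplus>\<^bsub>V\<^esub> b"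
        using * b r by (simp add: V.smult_r_distr flip: V.smult_assoc1)
      then have "b = inv\<^bsub>K\<^esub> r \<odot>\<^bsub>V\<^esub> x \<oplus>\<^bsub>V\<^esub> (\<ominus>\<^bsub>V\<^esub> (inv\<^bsub>K\<^esub> r \<odot>\<^bsub>V\<^esub> c))"
        using * b r by (simp add: V.M.diff_simps)
      moreover have "\<ominus>\<^bsub>V\<^esub> (inv\<^bsub>K\<^esub> r \<odot>\<^bsub>V\<^esub> c) \<in> C"
        by (rule submodule_uminus[OF C]) (use * r in simp)
      ultimately show ?thesis using nb * r by blast
    qed
  qed (use U.zero_closed submodule.zero_closed[OF sub] in simp)
qed

text \<open>A finite spanning set is run through, and C is enlarged by each vector that is not yet
  in \<open>U + C\<close>. The resulting sum is a subspace containing a spanning set.\<close>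

lemma complement_exists:
  assumes K: "field K" and V: "fin_dim_space K V" and U: "submodule K U V"
  obtains C where "submodule K C V" "U \<inter> C = {\<zero>\<^bsub>V\<^esub>}"
    "\<And>x. x \<in> carrier V \<Longrightarrow> \<exists>u\<in>U. \<exists>c\<in>C. x = u \<oplus>\<^bsub>V\<^esub> c"
proof -
  interpret V: Module.module K V using V by (rule fdsp_module)
  interpret U: submodule K U V by fact
  have ex: "\<exists>C. submodule K C V \<and> U \<inter> C = {\<zero>\<^bsub>V\<^esub>} \<and> (\<forall>b\<in>B. \<exists>u\<in>U. \<exists>c\<in>C. b = u \<oplus>\<^bsub>V\<^esub> c)"
    if "finite B" "B \<subseteq> carrier V" for B
    using that
  proof (induction B)
    case empty
    have "submodule K {\<zero>\<^bsub>V\<^esub>} V"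
      by unfold_locales auto
    moreover have "U \<inter> {\<zero>\<^bsub>V\<^esub>} = {\<zero>\<^bsub>V\<^esub>}" using U.zero_closed by auto
    ultimately show ?case by (intro exI[of _ "{\<zero>\<^bsub>V\<^esub>}"]) simp
  next
    case (insert b B)
    then obtain C where C: "submodule K C V" "U \<inter> C = {\<zero>\<^bsub>V\<^esub>}"
      "\<forall>b\<in>B. \<exists>u\<in>U. \<exists>c\<in>C. b = u \<oplus>\<^bsub>V\<^esub> c" by auto
    show ?case
    proof (cases "\<exists>u\<in>U. \<exists>c\<in>C. b = u \<oplus>\<^bsub>V\<^esub> c")
      case False
      then have nb: "\<And>u c. u \<in> U \<Longrightarrow> c \<in> C \<Longrightarrow> b \<noteq> u \<oplus>\<^bsub>V\<^esub> c" by blast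
      have b: "b \<in> carrier V" using insert by auto
      note step = complement_step[OF K U C(1,2) b nb]
      have "b = \<zero>\<^bsub>V\<^esub> \<oplus>\<^bsub>V\<^esub> b" using b by simp
      with step C(3) U.zero_closed show ?thesis
        by (intro exI[of _ "{c \<oplus>\<^bsub>V\<^esub> r \<odot>\<^bsub>V\<^esub> b | c r. c \<in> C \<and> r \<in> carrier K}"] conjI ballI) blast+
    qed (use C in blast)
  qed
  obtain B where B: "finite B" "B \<subseteq> carrier V"
    "\<forall>x\<in>carrier V. \<exists>c\<in>B \<rightarrow> carrier K. x = (\<Oplus>\<^bsub>V\<^esub>b\<in>B. c b \<odot>\<^bsub>V\<^esub> b)"
    using V by (auto simp: fin_dim_space_def)
  obtain C where C: "submodule K C V" "U \<inter> C = {\<zero>\<^bsub>V\<^esub>}"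
      "\<forall>b\<in>B. \<exists>u\<in>U. \<exists>c\<in>C. b = u \<oplus>\<^bsub>V\<^esub> c" using ex[OF B(1,2)] by auto
  interpret C: submodule K C V by fact
  have "submodule K (V.submodule_sum U C) V"
    by (rule V.sum_is_submodule[OF U C(1)])
  then have "x \<in> V.submodule_sum U C" if x: "x \<in> carrier V" for x
  proof -
    obtain c where c: "c \<in> B \<rightarrow> carrier K" "x = (\<Oplus>\<^bsub>V\<^esub>b\<in>B. c b \<odot>\<^bsub>V\<^esub> b)"
      using B(3) x by blast
    have "b \<in> V.submodule_sum U C" if "b \<in> B" for b
      using C(3) that unfolding V.submodule_sum_def by force
    then show ?thesis unfolding c(2)
      using c(1) submodule.smult_closed[OF \<open>submodule K (V.submodule_sum U C) V\<close>]
      by (intro submodule_finsum[OF \<open>submodule K (V.submodule_sum U C) V\<close> B(1)]) (simp add: Pi_iff)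
  qed
  then show ?thesis using that[OF C(1,2)] unfolding V.submodule_sum_def by force
qed

text \<open>The element \<open>u - u' = c' - c\<close> lies in both subspaces and hence
  vanishes.\<close>

lemma complement_unique:
  assumes U: "submodule K U V" and C: "submodule K C V" and int: "U \<inter> C = {\<zero>\<^bsub>V\<^esub>}"
    and "u \<in> U" "u' \<in> U" "c \<in> C" "c' \<in> C" "u \<oplus>\<^bsub>V\<^esub> c = u' \<oplus>\<^bsub>V\<^esub> c'"
  shows "u = u'" "c = c'"
proof -
  interpret U: submodule K U V by fact
  interpret C: submodule K C V by fact
  interpret V: Module.module K V by (rule C.module)
  have [simp]: "c \<in> C \<Longrightarrow> c \<in> carrier V" "u \<in> U \<Longrightarrow> u \<in> carrier V" for c u
    using C.subset U.subset by auto
  have "u \<ominus>\<^bsub>V\<^esub> u' = c' \<ominus>\<^bsub>V\<^esub> c"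
  proof -
    have "u \<ominus>\<^bsub>V\<^esub> u' = (u \<oplus>\<^bsub>V\<^esub> c) \<ominus>\<^bsub>V\<^esub> u' \<ominus>\<^bsub>V\<^esub> c"
      using assms(4-7) by (simp add: V.M.diff_simps)
    also have "\<dots> = (u' \<oplus>\<^bsub>V\<^esub> c') \<ominus>\<^bsub>V\<^esub> u' \<ominus>\<^bsub>V\<^esub> c" using assms by simp
    also have "\<dots> = c' \<ominus>\<^bsub>V\<^esub> c"
      using assms(4-7) by (simp add: V.M.diff_simps)
    finally show ?thesis .
  qed
  moreover have "u \<ominus>\<^bsub>V\<^esub> u' \<in> U" "c' \<ominus>\<^bsub>V\<^esub> c \<in> C"
    by (rule submodule_minus[OF U assms(4,5)], rule submodule_minus[OF C assms(7,6)])
  ultimately have "u \<ominus>\<^bsub>V\<^esub> u' = \<zero>\<^bsub>V\<^esub>" "c' \<ominus>\<^bsub>V\<^esub> c = \<zero>\<^bsub>V\<^esub>" using int by (metis IntI singletonD)+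
  then show "u = u'" "c = c'" using assms(4-7) by simp_all
qed

text \<open>The source of all splittings below. With a complement C of the kernel and a complement D
  of the image, f restricts to a bijection from C onto its image; g inverts this bijection and kills
  D.\<close>

lemma lin_generalized_inverse:
  assumes K: "field K" and f: "f \<in> lin_maps K V W" and V: "fin_dim_space K V" and W: "fin_dim_space K W"
  obtains g where "g \<in> lin_maps K W V" "\<And>x. x \<in> carrier V \<Longrightarrow> f (g (f x)) = f x"
proof -
  interpret V: Module.module K V using V by (rule fdsp_module)
  interpret W: Module.module K W using W by (rule fdsp_module)
  define N where "N = {x \<in> carrier V. f x = \<zero>\<^bsub>W\<^esub>}"
  have N: "submodule K N V" unfolding N_def
    by (rule submodule_ker[OF f V.module_axioms W.module_axioms])
  have I: "submodule K (f ` carrier V) W"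
    by (rule submodule_im[OF f V.module_axioms W.module_axioms])
  obtain C where C: "submodule K C V" "N \<inter> C = {\<zero>\<^bsub>V\<^esub>}"
    "\<And>x. x \<in> carrier V \<Longrightarrow> \<exists>u\<in>N. \<exists>c\<in>C. x = u \<oplus>\<^bsub>V\<^esub> c"
    using complement_exists[OF K V N] by blast
  obtain D where D: "submodule K D W" "f ` carrier V \<inter> D = {\<zero>\<^bsub>W\<^esub>}"
    "\<And>x. x \<in> carrier W \<Longrightarrow> \<exists>u\<in>f ` carrier V. \<exists>c\<in>D. x = u \<oplus>\<^bsub>W\<^esub> c"
    using complement_exists[OF K W I] by blast
  interpret C: submodule K C V by fact
  interpret D: submodule K D W by fact
  have Cc: "c \<in> C \<Longrightarrow> c \<in> carrier V" and Dc: "d \<in> D \<Longrightarrow> d \<in> carrier W" for c d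
    using C.subset D.subset by auto
  note [simp] = lin_closed[OF f]
  have fC: "\<exists>c\<in>C. f c = f x" if x: "x \<in> carrier V" for x
  proof -
    obtain u c where "u \<in> N" "c \<in> C" "x = u \<oplus>\<^bsub>V\<^esub> c" using C(3)[OF x] by blast
    then show ?thesis by (intro bexI[of _ c]) (auto simp: N_def lin_add[OF f] Cc)
  qed
  have fC_inj: "c = c'" if "c \<in> C" "c' \<in> C" "f c = f c'" for c c'
  proof -
    have "f (c \<ominus>\<^bsub>V\<^esub> c') = \<zero>\<^bsub>W\<^esub>"
      using that by (simp add: lin_minus[OF f V.module_axioms W.module_axioms] Cc W.M.minus_other_side)
    then have "c \<ominus>\<^bsub>V\<^esub> c' \<in> N \<inter> C" using that submodule_minus[OF C(1)] by (simp add: N_def Cc)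
    then show ?thesis using C(2) that by (simp add: Cc V.M.minus_other_side)
  qed
  have ex1: "\<exists>!v. v \<in> C \<and> (\<exists>d\<in>D. w = f v \<oplus>\<^bsub>W\<^esub> d)" if "w \<in> carrier W" for w
  proof -
    obtain x d where x: "x \<in> carrier V" "d \<in> D" "w = f x \<oplus>\<^bsub>W\<^esub> d"
      using D(3)[OF \<open>w \<in> carrier W\<close>] by blast
    obtain c where c: "c \<in> C" "f c = f x" using fC x by blast
    show ?thesis
    proof (rule ex1I[of _ c])
      fix v assume "v \<in> C \<and> (\<exists>d\<in>D. w = f v \<oplus>\<^bsub>W\<^esub> d)"
      then obtain d' where v: "v \<in> C" "d' \<in> D" "w = f v \<oplus>\<^bsub>W\<^esub> d'" by blast
      then have "f v = f c"
        using complement_unique(1)[OF I D(1,2), of "f v" "f c" d' d] x c Cc by auto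
      then show "v = c" using fC_inj v c by blast
    qed (use c x in auto)
  qed
  define g where "g = (\<lambda>w. THE v. v \<in> C \<and> (\<exists>d\<in>D. w = f v \<oplus>\<^bsub>W\<^esub> d))"
  have g: "g w \<in> C" "\<exists>d\<in>D. w = f (g w) \<oplus>\<^bsub>W\<^esub> d" if "w \<in> carrier W" for w
    using theI'[OF ex1[OF that]] unfolding g_def by auto
  \<comment> \<open>Uniqueness of the decomposition turns this into a test for the values of g. Both
    laws of linearity then follow by exhibiting a decomposition of the sum or multiple.\<close>
  have g_eq: "g w = v" if "w \<in> carrier W" "v \<in> C" "d \<in> D" "w = f v \<oplus>\<^bsub>W\<^esub> d" for w v d
    using ex1[OF that(1)] g[OF that(1)] that by blast
  have "(\<lambda>w\<in>carrier W. g w) \<in> lin_maps K W V"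
  proof (rule lin_restrictI)
    fix x y assume xy: "x \<in> carrier W" "y \<in> carrier W"
    obtain d where d: "d \<in> D" "x = f (g x) \<oplus>\<^bsub>W\<^esub> d" using g(2)[OF xy(1)] by blast
    obtain e where e: "e \<in> D" "y = f (g y) \<oplus>\<^bsub>W\<^esub> e" using g(2)[OF xy(2)] by blast
    note gxy = g(1)[OF xy(1)] g(1)[OF xy(2)]
    have "(f (g x) \<oplus>\<^bsub>W\<^esub> d) \<oplus>\<^bsub>W\<^esub> (f (g y) \<oplus>\<^bsub>W\<^esub> e) = f (g x \<oplus>\<^bsub>V\<^esub> g y) \<oplus>\<^bsub>W\<^esub> (d \<oplus>\<^bsub>W\<^esub> e)"
      using gxy d(1) e(1) by (simp add: lin_add[OF f] Cc Dc W.M.a_ac)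
    then have "x \<oplus>\<^bsub>W\<^esub> y = f (g x \<oplus>\<^bsub>V\<^esub> g y) \<oplus>\<^bsub>W\<^esub> (d \<oplus>\<^bsub>W\<^esub> e)"
      by (simp flip: d(2) e(2))
    then show "g (x \<oplus>\<^bsub>W\<^esub> y) = g x \<oplus>\<^bsub>V\<^esub> g y"
      by (intro g_eq[of _ _ "d \<oplus>\<^bsub>W\<^esub> e"] W.M.a_closed xy C.m_closed D.m_closed gxy d(1) e(1))
  next
    fix c x assume cx: "c \<in> carrier K" "x \<in> carrier W"
    obtain d where d: "d \<in> D" "x = f (g x) \<oplus>\<^bsub>W\<^esub> d" using g(2)[OF cx(2)] by blast
    have "c \<odot>\<^bsub>W\<^esub> (f (g x) \<oplus>\<^bsub>W\<^esub> d) = f (c \<odot>\<^bsub>V\<^esub> g x) \<oplus>\<^bsub>W\<^esub> c \<odot>\<^bsub>W\<^esub> d"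
      using g(1)[OF cx(2)] d(1) cx(1) by (simp add: lin_smult[OF f] Cc Dc W.smult_r_distr)
    then have "c \<odot>\<^bsub>W\<^esub> x = f (c \<odot>\<^bsub>V\<^esub> g x) \<oplus>\<^bsub>W\<^esub> c \<odot>\<^bsub>W\<^esub> d"
      by (simp flip: d(2))
    then show "g (c \<odot>\<^bsub>W\<^esub> x) = c \<odot>\<^bsub>V\<^esub> g x"
      by (intro g_eq[of _ _ "c \<odot>\<^bsub>W\<^esub> d"] W.smult_closed cx C.smult_closed D.smult_closed g(1) d(1))
  qed (simp_all add: g(1) Cc W.module_axioms)
  moreover have "f (g (f x)) = f x" if x: "x \<in> carrier V" for x
  proof -
    obtain c where c: "c \<in> C" "f c = f x" using fC x by blast
    have "g (f x) = c"
      by (rule g_eq[of _ _ "\<zero>\<^bsub>W\<^esub>"]) (use c x in auto)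
    then show ?thesis using c by simp
  qed
  ultimately show ?thesis using that[of "\<lambda>w\<in>carrier W. g w"] by simp
qed

lemma lin_rank_nullity:
  assumes K: "field K" and f: "f \<in> lin_maps K V W" and V: "fin_dim_space K V"
    and W: "Module.module K W"
  shows "vectorspace.dim K (W\<lparr>carrier := f ` carrier V\<rparr>) +
    vectorspace.dim K (V\<lparr>carrier := {x \<in> carrier V. f x = \<zero>\<^bsub>W\<^esub>}\<rparr>) = vectorspace.dim K V"
proof -
  have vW: "vectorspace K W" using K W by (simp add: vectorspace_def)
  interpret linear_map K V W f
    by (rule lin_linear_map[OF f fdsp_vectorspace[OF K V] vW])
  show ?thesis
    using rank_nullity V by (simp add: im_def ker_def fin_dim_space_iff[OF K])
qed

lemma dim_eq_0_iff:
  assumes K: "field K" and V: "fin_dim_space K V"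
  shows "vectorspace.dim K V = 0 \<longleftrightarrow> carrier V = {\<zero>\<^bsub>V\<^esub>}"
proof -
  interpret V: vectorspace K V by (rule fdsp_vectorspace[OF K V])
  have fd: "V.fin_dim" using V K by (simp add: fin_dim_space_iff)
  show ?thesis
  proof
    assume 0: "V.dim = 0"
    obtain B where B: "finite B" "V.basis B" using V.finite_basis_exists[OF fd] by blast
    then have "B = {}" using 0 V.dim_basis[OF B] by simp
    then have "V.span {} = carrier V" using B by (simp add: V.basis_def)
    then show "carrier V = {\<zero>\<^bsub>V\<^esub>}" by (simp add: V.span_empty)
  next
    assume "carrier V = {\<zero>\<^bsub>V\<^esub>}"
    then have "V.dim \<le> card {}"
      using V.gen_ge_dim[of "{}"] by (simp add: V.span_empty)
    then show "V.dim = 0" by simp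
  qed
qed

lemma lin_bij_dim:
  assumes K: "field K" and f: "f \<in> lin_maps K V W" and V: "fin_dim_space K V"
    and W: "Module.module K W" and bij: "bij_betw f (carrier V) (carrier W)"
  shows "vectorspace.dim K V = vectorspace.dim K W"
proof -
  have vW: "vectorspace K W" using K W by (simp add: vectorspace_def)
  interpret linear_map K V W f
    by (rule lin_linear_map[OF f fdsp_vectorspace[OF K V] vW])
  show ?thesis
    using dim_eq bij V by (simp add: fin_dim_space_iff[OF K] bij_betw_def)
qed

lemma fdsp_im:
  assumes K: "field K" and f: "f \<in> lin_maps K V W" and V: "fin_dim_space K V"
    and W: "Module.module K W"
  shows "fin_dim_space K (W\<lparr>carrier := f ` carrier V\<rparr>)"
proof -
  interpret W: Module.module K W by fact
  have m: "Module.module K (W\<lparr>carrier := f ` carrier V\<rparr>)"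
    by (rule W.submodule_is_module[OF submodule_im[OF f fdsp_module[OF V] W]])
  show ?thesis
    by (rule fdsp_surj[OF K _ V m, of f]) (auto intro: lin_carrier_update[OF f])
qed

text \<open>For a generalized inverse g the map \<open>1 - g f\<close> has the kernel of f as its
  image, so the kernel inherits a finite spanning set.\<close>

lemma fdsp_ker:
  assumes K: "field K" and f: "f \<in> lin_maps K V W" and V: "fin_dim_space K V"
    and W: "fin_dim_space K W"
  shows "fin_dim_space K (V\<lparr>carrier := {x \<in> carrier V. f x = \<zero>\<^bsub>W\<^esub>}\<rparr>)"
proof -
  interpret V: Module.module K V by (rule fdsp_module[OF V])
  interpret W: Module.module K W by (rule fdsp_module[OF W])
  note mV = V.module_axioms and mW = W.module_axioms
  obtain g where g: "g \<in> lin_maps K W V" "\<And>x. x \<in> carrier V \<Longrightarrow> f (g (f x)) = f x"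
    using lin_generalized_inverse[OF K f V W] by blast
  define p where "p = (\<lambda>x\<in>carrier V. (\<lambda>x\<in>carrier V. x) x \<ominus>\<^bsub>V\<^esub> compose (carrier V) g f x)"
  have p: "p \<in> lin_maps K V V"
    unfolding p_def by (rule lin_minus_map[OF lin_id lin_comp[OF g(1) f]]) (rule mV)+
  have "f ` carrier V \<subseteq> carrier W" using lin_closed[OF f] by blast
  have "p ` carrier V = {x \<in> carrier V. f x = \<zero>\<^bsub>W\<^esub>}"
  proof (intro equalityI subsetI)
    fix y assume "y \<in> p ` carrier V"
    then obtain x where x: "x \<in> carrier V" "y = x \<ominus>\<^bsub>V\<^esub> g (f x)"
      by (auto simp: p_def compose_eq)
    then show "y \<in> {x \<in> carrier V. f x = \<zero>\<^bsub>W\<^esub>}"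
      using lin_closed[OF f x(1)] lin_closed[OF g(1), of "f x"] g(2)[OF x(1)]
      by (simp add: lin_minus[OF f mV mW])
  next
    fix x assume "x \<in> {x \<in> carrier V. f x = \<zero>\<^bsub>W\<^esub>}"
    then have x: "x \<in> carrier V" "f x = \<zero>\<^bsub>W\<^esub>" by auto
    then have "x = p x" using lin_zero[OF g(1) mW mV] by (simp add: p_def compose_eq a_minus_def)
    then show "x \<in> p ` carrier V" using x by blast
  qed
  then show ?thesis using fdsp_im[OF K p V mV] by simp
qed

text \<open>In \<open>f g f = f\<close> an injective f can be cancelled on the left.\<close>

lemma lin_inj_left_inverse:
  assumes K: "field K" and f: "f \<in> lin_maps K V W" and V: "fin_dim_space K V"
    and W: "fin_dim_space K W" and inj: "inj_on f (carrier V)"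
  obtains g where "g \<in> lin_maps K W V" "\<And>x. x \<in> carrier V \<Longrightarrow> g (f x) = x"
proof -
  obtain g where g: "g \<in> lin_maps K W V" "\<And>x. x \<in> carrier V \<Longrightarrow> f (g (f x)) = f x"
    using lin_generalized_inverse[OF K f V W] by blast
  have "g (f x) = x" if "x \<in> carrier V" for x
    using inj_onD[OF inj g(2)[OF that]] lin_closed[OF g(1) lin_closed[OF f that]] that by simp
  with g(1) show ?thesis using that by blast
qed

lemma lin_surj_dim:
  assumes K: "field K" and g: "g \<in> lin_maps K W V" and V: "Module.module K V"
    and W: "fin_dim_space K W" and surj: "g ` carrier W = carrier V"
  shows "vectorspace.dim K V + vectorspace.dim K (W\<lparr>carrier := {x \<in> carrier W. g x = \<zero>\<^bsub>V\<^esub>}\<rparr>) =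
    vectorspace.dim K W"
  using lin_rank_nullity[OF K g W V] surj by simp

text \<open>A left inverse g is surjective, so the dimension of W exceeds that of V by the dimension
  of the kernel of g. If the dimensions agree, g is injective as well, hence a two-sided
  inverse.\<close>

lemma lin_inj_dim:
  assumes K: "field K" and f: "f \<in> lin_maps K V W" and V: "fin_dim_space K V"
    and W: "fin_dim_space K W" and inj: "inj_on f (carrier V)"
  shows "vectorspace.dim K V \<le> vectorspace.dim K W"
    and "vectorspace.dim K V = vectorspace.dim K W \<Longrightarrow> bij_betw f (carrier V) (carrier W)"
proof -
  interpret V: Module.module K V by (rule fdsp_module[OF V])
  interpret W: Module.module K W by (rule fdsp_module[OF W])
  obtain g where g: "g \<in> lin_maps K W V" "\<And>x. x \<in> carrier V \<Longrightarrow> g (f x) = x"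
    using lin_inj_left_inverse[OF K f V W inj] by blast
  have surj: "g ` carrier W = carrier V"
  proof (intro equalityI subsetI)
    fix x assume "x \<in> carrier V"
    then show "x \<in> g ` carrier W" using g(2) lin_closed[OF f] by (metis imageI)
  qed (use lin_closed[OF g(1)] in blast)
  note dims = lin_surj_dim[OF K g(1) V.module_axioms W surj]
  then show "vectorspace.dim K V \<le> vectorspace.dim K W" by linarith
  assume "vectorspace.dim K V = vectorspace.dim K W"
  with dims have "vectorspace.dim K (W\<lparr>carrier := {x \<in> carrier W. g x = \<zero>\<^bsub>V\<^esub>}\<rparr>) = 0"
    by linarith
  then have ker: "{x \<in> carrier W. g x = \<zero>\<^bsub>V\<^esub>} = {\<zero>\<^bsub>W\<^esub>}"
    using dim_eq_0_iff[OF K fdsp_ker[OF K g(1) W V]] by simp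
  have "inj_on g (carrier W)"
    by (rule lin_inj_onI[OF g(1) W.module_axioms V.module_axioms]) (use ker in blast)
  then have "f (g w) = w" if "w \<in> carrier W" for w
    using that g lin_closed[OF g(1)] lin_closed[OF f] by (metis inj_onD)
  then have "f ` carrier V = carrier W"
    using lin_closed[OF f] lin_closed[OF g(1)] by (metis (no_types, lifting) image_iff subsetI equalityI image_subsetI)
  then show "bij_betw f (carrier V) (carrier W)" using inj by (simp add: bij_betw_def)
qed

section \<open>Coordinate spaces and classification by dimension\<close>

definition std_space :: "('a, 'r) ring_scheme \<Rightarrow> nat \<Rightarrow> ('a, 'a list) module" where
  "std_space K n = \<lparr>carrier = {xs. length xs = n \<and> set xs \<subseteq> carrier K},
     monoid.mult = undefined, monoid.one = undefined,
     ring.zero = replicate n \<zero>\<^bsub>K\<^esub>, ring.add = map2 (\<oplus>\<^bsub>K\<^esub>), module.smult = (\<lambda>c. map ((\<otimes>\<^bsub>K\<^esub>) c))\<rparr>"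

lemma std_space_sel [simp]:
  "carrier (std_space K n) = {xs. length xs = n \<and> set xs \<subseteq> carrier K}"
  "\<zero>\<^bsub>std_space K n\<^esub> = replicate n \<zero>\<^bsub>K\<^esub>"
  "xs \<oplus>\<^bsub>std_space K n\<^esub> ys = map2 (\<oplus>\<^bsub>K\<^esub>) xs ys"
  "c \<odot>\<^bsub>std_space K n\<^esub> xs = map ((\<otimes>\<^bsub>K\<^esub>) c) xs"
  by (simp_all add: std_space_def)

lemma std_space_module:
  assumes "cring K"
  shows "Module.module K (std_space K n)"
proof -
  interpret cring K by fact
  have mem: "xs ! i \<in> carrier K" if "set xs \<subseteq> carrier K" "i < length xs" for xs i
    using that nth_mem by blast
  have "abelian_group (std_space K n)"
  proof (rule abelian_groupI)
    fix x assume x: "x \<in> carrier (std_space K n)"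
    then show "\<exists>y\<in>carrier (std_space K n). y \<oplus>\<^bsub>std_space K n\<^esub> x = \<zero>\<^bsub>std_space K n\<^esub>"
      by (intro bexI[of _ "map (a_inv K) x"]) (auto simp: list_eq_iff_nth_eq mem l_neg)
  qed (auto simp: list_eq_iff_nth_eq mem a_ac set_zip)
  then show ?thesis
    by (intro moduleI[OF is_cring])
      (auto simp: list_eq_iff_nth_eq mem l_distr r_distr m_assoc set_zip)
qed

lemma fdsp_submoduleD:
  assumes "finite B" "B \<subseteq> carrier V"
    "\<forall>x\<in>carrier V. \<exists>c\<in>B \<rightarrow> carrier K. x = (\<Oplus>\<^bsub>V\<^esub>b\<in>B. c b \<odot>\<^bsub>V\<^esub> b)"
    and S: "submodule K S V" "B \<subseteq> S" and x: "x \<in> carrier V"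
  shows "x \<in> S"
proof -
  obtain c where c: "c \<in> B \<rightarrow> carrier K" "x = (\<Oplus>\<^bsub>V\<^esub>b\<in>B. c b \<odot>\<^bsub>V\<^esub> b)"
    using assms(3) x by blast
  show ?thesis unfolding c(2)
    using c(1) submodule.smult_closed[OF S(1)] S(2)
    by (intro submodule_finsum[OF S(1) assms(1)]) (simp add: Pi_iff subset_iff)
qed

text \<open>The span of B is a submodule containing B. Testing against all such submodules avoids
  writing down coefficients.\<close>

lemma fdspI:
  assumes V: "Module.module K V" and B: "finite B" "B \<subseteq> carrier V"
    and S: "\<And>S. submodule K S V \<Longrightarrow> B \<subseteq> S \<Longrightarrow> carrier V \<subseteq> S"
  shows "fin_dim_space K V"
proof -
  interpret V: Module.module K V by fact
  have "carrier V \<subseteq> V.span B"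
    by (rule S[OF V.span_is_submodule[OF B(2)] V.in_own_span[OF B(2)]])
  then have "\<forall>x\<in>carrier V. \<exists>c\<in>B \<rightarrow> carrier K. x = (\<Oplus>\<^bsub>V\<^esub>b\<in>B. c b \<odot>\<^bsub>V\<^esub> b)"
    unfolding V.finite_span[OF B] V.lincomb_def by blast
  then show ?thesis using V B by (auto simp: fin_dim_space_def)
qed

lemma std_space_fd:
  assumes "cring K"
  shows "fin_dim_space K (std_space K n)"
proof -
  interpret cring K by fact
  note m = std_space_module[OF assms]
  show ?thesis
  proof (induction n)
    case 0
    show ?case
    proof (rule fdspI[OF m, of "{}"])
      fix S assume "submodule K S (std_space K 0)"
      from submodule.zero_closed[OF this] show "carrier (std_space K 0) \<subseteq> S" by auto
    qed auto
  next
    case (Suc n)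
    then obtain B where B: "finite B" "B \<subseteq> carrier (std_space K n)"
      "\<forall>x\<in>carrier (std_space K n). \<exists>c\<in>B \<rightarrow> carrier K.
        x = (\<Oplus>\<^bsub>std_space K n\<^esub>b\<in>B. c b \<odot>\<^bsub>std_space K n\<^esub> b)"
      by (auto simp: fin_dim_space_def)
    let ?e = "\<one>\<^bsub>K\<^esub> # replicate n \<zero>\<^bsub>K\<^esub>"
    show ?case
    \<comment> \<open>The first unit vector, together with a spanning set of K^n placed behind a
      leading zero.\<close>
    proof (rule fdspI[OF m, of "insert ?e ((#) \<zero>\<^bsub>K\<^esub> ` B)"])
      fix S assume S: "submodule K S (std_space K (Suc n))" "insert ?e ((#) \<zero>\<^bsub>K\<^esub> ` B) \<subseteq> S"
      interpret S: submodule K S "std_space K (Suc n)" by (rule S(1))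
      \<comment> \<open>The preimage of S under prepending a zero. It is a subspace of K^n that
        contains B, hence all of K^n, and the unit vector supplies the first coordinate.\<close>
      define U where "U = {xs \<in> carrier (std_space K n). \<zero>\<^bsub>K\<^esub> # xs \<in> S}"
      interpret N: Module.module K "std_space K n" by (rule m)
      have U: "submodule K U (std_space K n)"
      proof (rule submodule.intro[OF m])
        show "\<zero>\<^bsub>std_space K n\<^esub> \<in> U" using S.zero_closed by (auto simp: U_def)
        show "v \<oplus>\<^bsub>std_space K n\<^esub> w \<in> U" if "v \<in> U" "w \<in> U" for v w
          using that S.m_closed[of "\<zero>\<^bsub>K\<^esub> # v" "\<zero>\<^bsub>K\<^esub> # w"] N.M.a_closed[of v w]
          by (auto simp: U_def)
        show "c \<odot>\<^bsub>std_space K n\<^esub> v \<in> U" if "c \<in> carrier K" "v \<in> U" for c v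
          using that S.smult_closed[of c "\<zero>\<^bsub>K\<^esub> # v"] N.smult_closed[of c v]
          by (auto simp: U_def)
      qed (auto simp: U_def)
      show "carrier (std_space K (Suc n)) \<subseteq> S"
      proof
        fix x assume "x \<in> carrier (std_space K (Suc n))"
        then obtain a xs where x: "x = a # xs" "a \<in> carrier K" "xs \<in> carrier (std_space K n)"
          by (auto simp: length_Suc_conv)
        have "xs \<in> U"
          using fdsp_submoduleD[OF B U _ x(3)] B(2) S(2) by (auto simp: U_def)
        then have "a \<odot>\<^bsub>std_space K (Suc n)\<^esub> ?e \<oplus>\<^bsub>std_space K (Suc n)\<^esub> (\<zero>\<^bsub>K\<^esub> # xs) \<in> S"
          using S(2) x(2) by (intro S.m_closed S.smult_closed) (auto simp: U_def)
        moreover have "map2 (\<oplus>\<^bsub>K\<^esub>) (map ((\<otimes>\<^bsub>K\<^esub>) a) (replicate n \<zero>\<^bsub>K\<^esub>)) xs = xs"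
        proof (rule nth_equalityI)
          fix i assume "i < length (map2 (\<oplus>\<^bsub>K\<^esub>) (map ((\<otimes>\<^bsub>K\<^esub>) a) (replicate n \<zero>\<^bsub>K\<^esub>)) xs)"
          then have "i < n" "xs ! i \<in> carrier K" using x(3) nth_mem[of i xs] by auto
          then show "map2 (\<oplus>\<^bsub>K\<^esub>) (map ((\<otimes>\<^bsub>K\<^esub>) a) (replicate n \<zero>\<^bsub>K\<^esub>)) xs ! i = xs ! i"
            using x by simp
        qed (use x in simp)
        ultimately show "x \<in> S" using x by simp
      qed
    qed (use B(1,2) in \<open>auto simp: subset_iff\<close>)
  qed
qed

text \<open>Induction by rank-nullity for \<open>tl\<close>: it is onto, and its kernel is a copy of
  the one-dimensional coordinate space through the first entry.\<close>

lemma dim_std_space: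
  assumes K: "field K"
  shows "vectorspace.dim K (std_space K n) = n"
proof -
  interpret K: field K by fact
  note m = std_space_module[OF K.is_cring] and fd = std_space_fd[OF K.is_cring]
  have zip0: "map2 (\<oplus>\<^bsub>K\<^esub>) (replicate n \<zero>\<^bsub>K\<^esub>) (replicate n \<zero>\<^bsub>K\<^esub>) = replicate n \<zero>\<^bsub>K\<^esub>" for n
    by (auto simp: list_eq_iff_nth_eq)
  have one: "vectorspace.dim K (std_space K 1) = 1"
  proof -
    interpret V: vectorspace K "std_space K 1" by (rule fdsp_vectorspace[OF K fd])
    have e: "[\<one>\<^bsub>K\<^esub>] \<in> carrier (std_space K 1)" "{[\<one>\<^bsub>K\<^esub>]} \<subseteq> carrier (std_space K 1)" by auto
    have "x \<in> V.span {[\<one>\<^bsub>K\<^esub>]}" if x: "x \<in> carrier (std_space K 1)" for x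
    proof -
      obtain a where a: "x = [a]" "a \<in> carrier K"
        using x by (cases x) auto
      have "a \<odot>\<^bsub>std_space K 1\<^esub> [\<one>\<^bsub>K\<^esub>] \<in> V.span {[\<one>\<^bsub>K\<^esub>]}"
        by (rule submodule.smult_closed[OF V.span_is_submodule[OF e(2)]])
          (use a V.in_own_span[OF e(2)] in auto)
      then show ?thesis using a by simp
    qed
    then have "V.gen_set {[\<one>\<^bsub>K\<^esub>]}"
      using V.span_is_subset2[OF e(2)] by blast
    then show ?thesis
      by (rule V.dim1I) (use e in auto)
  qed
  show ?thesis
  proof (induction n)
    case 0
    show ?case using dim_eq_0_iff[OF K fd, of 0] by auto
  next
    case (Suc n)
    let ?t = "\<lambda>x\<in>carrier (std_space K (Suc n)). tl x"
    have t: "?t \<in> lin_maps K (std_space K (Suc n)) (std_space K n)"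
    proof (rule lin_restrictI)
      show "Module.module K (std_space K (Suc n))" by (rule m)
    qed (auto simp: length_Suc_conv)
    have surj: "?t ` carrier (std_space K (Suc n)) = carrier (std_space K n)"
    proof (intro equalityI subsetI)
      fix xs assume "xs \<in> carrier (std_space K n)"
      then show "xs \<in> ?t ` carrier (std_space K (Suc n))"
        by (intro image_eqI[of _ _ "\<zero>\<^bsub>K\<^esub> # xs"]) auto
    qed (auto simp: length_Suc_conv)
    let ?N = "{x \<in> carrier (std_space K (Suc n)). ?t x = \<zero>\<^bsub>std_space K n\<^esub>}"
    let ?h = "\<lambda>x\<in>carrier (std_space K 1). hd x # replicate n \<zero>\<^bsub>K\<^esub>"
    have h: "?h \<in> lin_maps K (std_space K 1) (std_space K (Suc n) \<lparr>carrier := ?N\<rparr>)"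
    proof (rule lin_restrictI)
      show "Module.module K (std_space K 1)" by (rule m)
    qed (auto simp: length_Suc_conv zip0)
    have "bij_betw ?h (carrier (std_space K 1)) (carrier (std_space K (Suc n) \<lparr>carrier := ?N\<rparr>))"
      unfolding bij_betw_def
    proof
      show "inj_on ?h (carrier (std_space K 1))"
        by (auto simp: inj_on_def length_Suc_conv)
      show "?h ` carrier (std_space K 1) = carrier (std_space K (Suc n) \<lparr>carrier := ?N\<rparr>)"
      proof (intro equalityI subsetI)
        fix x assume "x \<in> carrier (std_space K (Suc n) \<lparr>carrier := ?N\<rparr>)"
        then show "x \<in> ?h ` carrier (std_space K 1)"
          by (intro image_eqI[of _ _ "[hd x]"]) (auto simp: length_Suc_conv)
      qed (auto simp: length_Suc_conv)
    qed
    from lin_bij_dim[OF K h fd fdsp_module[OF fdsp_ker[OF K t fd fd]] this]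
    have "vectorspace.dim K (std_space K (Suc n) \<lparr>carrier := ?N\<rparr>) = 1" unfolding one by (rule sym)
    then show ?case using lin_surj_dim[OF K t m fd surj] Suc by simp
  qed
qed

text \<open>A nonzero vector v spans a line, and a left inverse g of its inclusion splits V into
  this line and the kernel of g. The kernel has one dimension less, so induction provides its
  coordinates.\<close>

lemma std_space_iso:
  assumes K: "field K" and V: "fin_dim_space K V" and dim: "vectorspace.dim K V = n"
  shows "\<exists>\<phi>\<in>lin_maps K (std_space K n) V. bij_betw \<phi> (carrier (std_space K n)) (carrier V)"
  using V dim
proof (induction n arbitrary: V)
  case 0
  interpret K: field K by fact
  interpret V: Module.module K V by (rule fdsp_module[OF 0(1)])
  have "carrier V = {\<zero>\<^bsub>V\<^esub>}" using dim_eq_0_iff[OF K 0(1)] 0(2) by simp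
  then have "bij_betw (\<lambda>x\<in>carrier (std_space K 0). \<zero>\<^bsub>V\<^esub>) (carrier (std_space K 0)) (carrier V)"
    by (auto simp: bij_betw_def inj_on_def)
  then show ?case
    using lin_zero_map[OF std_space_module[OF K.is_cring] V.module_axioms] by blast
next
  case (Suc n)
  interpret K: field K by fact
  interpret V: Module.module K V by (rule fdsp_module[OF Suc.prems(1)])
  note m = std_space_module[OF K.is_cring] and fd = std_space_fd[OF K.is_cring]
  note mV = V.module_axioms and V = Suc.prems(1)
  have "carrier V \<noteq> {\<zero>\<^bsub>V\<^esub>}" using dim_eq_0_iff[OF K V] Suc.prems(2) by simp
  then obtain v where v: "v \<in> carrier V" "v \<noteq> \<zero>\<^bsub>V\<^esub>" by blast
  let ?l = "\<lambda>x\<in>carrier (std_space K 1). hd x \<odot>\<^bsub>V\<^esub> v"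
  have l: "?l \<in> lin_maps K (std_space K 1) V"
  proof (rule lin_restrictI)
    show "Module.module K (std_space K 1)" by (rule m)
  qed (use v in \<open>auto simp: length_Suc_conv V.smult_l_distr V.smult_assoc1\<close>)
  have v0: "a = \<zero>\<^bsub>K\<^esub>" if "a \<in> carrier K" "a \<odot>\<^bsub>V\<^esub> v = \<zero>\<^bsub>V\<^esub>" for a
  proof (rule ccontr)
    assume "a \<noteq> \<zero>\<^bsub>K\<^esub>"
    then have *: "inv\<^bsub>K\<^esub> a \<in> carrier K" "inv\<^bsub>K\<^esub> a \<otimes>\<^bsub>K\<^esub> a = \<one>\<^bsub>K\<^esub>"
      using that K.field_Units by auto
    then have "v = (inv\<^bsub>K\<^esub> a \<otimes>\<^bsub>K\<^esub> a) \<odot>\<^bsub>V\<^esub> v" using v by simp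
    also have "\<dots> = inv\<^bsub>K\<^esub> a \<odot>\<^bsub>V\<^esub> (a \<odot>\<^bsub>V\<^esub> v)"
      by (rule V.smult_assoc1[OF *(1) that(1) v(1)])
    also have "\<dots> = \<zero>\<^bsub>V\<^esub>" using *(1) that(2) by simp
    finally show False using v by simp
  qed
  have inj: "inj_on ?l (carrier (std_space K 1))"
    by (rule lin_inj_onI[OF l m mV]) (auto simp: length_Suc_conv dest: v0)
  obtain g where g: "g \<in> lin_maps K V (std_space K 1)"
    "\<And>x. x \<in> carrier (std_space K 1) \<Longrightarrow> g (?l x) = x"
    using lin_inj_left_inverse[OF K l fd V inj] by blast
  have gv: "g (a \<odot>\<^bsub>V\<^esub> v) = [a]" if "a \<in> carrier K" for a
    using g(2)[of "[a]"] that by simp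
  have surj: "g ` carrier V = carrier (std_space K 1)"
  proof (intro equalityI subsetI)
    fix x assume x: "x \<in> carrier (std_space K 1)"
    show "x \<in> g ` carrier V"
      by (rule image_eqI[of _ _ "?l x"]) (use g(2)[OF x] lin_closed[OF l x] in simp_all)
  qed (use lin_closed[OF g(1)] in blast)
  define C where "C = {x \<in> carrier V. g x = \<zero>\<^bsub>std_space K 1\<^esub>}"
  have fC: "fin_dim_space K (V\<lparr>carrier := C\<rparr>)"
    unfolding C_def by (rule fdsp_ker[OF K g(1) V fd])
  have "vectorspace.dim K (V\<lparr>carrier := C\<rparr>) = n"
    using lin_surj_dim[OF K g(1) m V surj] Suc.prems(2) dim_std_space[OF K, of 1]
    by (simp add: C_def)
  then obtain \<phi> where \<phi>: "\<phi> \<in> lin_maps K (std_space K n) (V\<lparr>carrier := C\<rparr>)"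
    "bij_betw \<phi> (carrier (std_space K n)) C"
    using Suc.IH[OF fC] by auto
  have \<phi>C: "\<phi> xs \<in> C" if "xs \<in> carrier (std_space K n)" for xs
    using lin_closed[OF \<phi>(1) that] by simp
  have \<phi>V: "\<phi> xs \<in> carrier V" "g (\<phi> xs) = [\<zero>\<^bsub>K\<^esub>]" if "xs \<in> carrier (std_space K n)" for xs
    using \<phi>C[OF that] by (auto simp: C_def)
  let ?p = "\<lambda>x\<in>carrier (std_space K (Suc n)). hd x \<odot>\<^bsub>V\<^esub> v \<oplus>\<^bsub>V\<^esub> \<phi> (tl x)"
  have hdtl: "hd x \<in> carrier K" "tl x \<in> carrier (std_space K n)"
    if "x \<in> carrier (std_space K (Suc n))" for x
    using that by (auto simp: length_Suc_conv)
  have p: "?p \<in> lin_maps K (std_space K (Suc n)) V"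
  proof (rule lin_restrictI)
    fix x y assume xy: "x \<in> carrier (std_space K (Suc n))" "y \<in> carrier (std_space K (Suc n))"
    have "hd (x \<oplus>\<^bsub>std_space K (Suc n)\<^esub> y) = hd x \<oplus>\<^bsub>K\<^esub> hd y"
      "tl (x \<oplus>\<^bsub>std_space K (Suc n)\<^esub> y) = tl x \<oplus>\<^bsub>std_space K n\<^esub> tl y"
      using xy by (auto simp: length_Suc_conv)
    then show "hd (x \<oplus>\<^bsub>std_space K (Suc n)\<^esub> y) \<odot>\<^bsub>V\<^esub> v \<oplus>\<^bsub>V\<^esub> \<phi> (tl (x \<oplus>\<^bsub>std_space K (Suc n)\<^esub> y)) =
      hd x \<odot>\<^bsub>V\<^esub> v \<oplus>\<^bsub>V\<^esub> \<phi> (tl x) \<oplus>\<^bsub>V\<^esub> (hd y \<odot>\<^bsub>V\<^esub> v \<oplus>\<^bsub>V\<^esub> \<phi> (tl y))"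
      using hdtl[OF xy(1)] hdtl[OF xy(2)] v lin_add[OF \<phi>(1)] \<phi>V
      by (simp add: V.smult_l_distr V.M.a_ac del: std_space_sel)
  next
    fix c x assume cx: "c \<in> carrier K" "x \<in> carrier (std_space K (Suc n))"
    have "hd (c \<odot>\<^bsub>std_space K (Suc n)\<^esub> x) = c \<otimes>\<^bsub>K\<^esub> hd x"
      "tl (c \<odot>\<^bsub>std_space K (Suc n)\<^esub> x) = c \<odot>\<^bsub>std_space K n\<^esub> tl x"
      using cx by (auto simp: length_Suc_conv)
    then show "hd (c \<odot>\<^bsub>std_space K (Suc n)\<^esub> x) \<odot>\<^bsub>V\<^esub> v \<oplus>\<^bsub>V\<^esub> \<phi> (tl (c \<odot>\<^bsub>std_space K (Suc n)\<^esub> x)) =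
      c \<odot>\<^bsub>V\<^esub> (hd x \<odot>\<^bsub>V\<^esub> v \<oplus>\<^bsub>V\<^esub> \<phi> (tl x))"
      using hdtl[OF cx(2)] cx(1) v lin_smult[OF \<phi>(1)] \<phi>V
      by (simp add: V.smult_assoc1 V.smult_r_distr del: std_space_sel)
  next
    fix x assume "x \<in> carrier (std_space K (Suc n))"
    from hdtl[OF this] show "hd x \<odot>\<^bsub>V\<^esub> v \<oplus>\<^bsub>V\<^esub> \<phi> (tl x) \<in> carrier V"
      using v \<phi>V by simp
  qed (rule m)
  have "inj_on ?p (carrier (std_space K (Suc n)))"
  proof (rule lin_inj_onI[OF p m mV])
    fix x assume x: "x \<in> carrier (std_space K (Suc n))" "?p x = \<zero>\<^bsub>V\<^esub>"
    note h = hdtl[OF x(1)]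
    have "g (?p x) = [hd x]"
      using x(1) h v \<phi>V[OF h(2)] gv[OF h(1)] lin_add[OF g(1), of "hd x \<odot>\<^bsub>V\<^esub> v" "\<phi> (tl x)"] by simp
    then have 1: "hd x = \<zero>\<^bsub>K\<^esub>" using x(2) lin_zero[OF g(1) mV m] by simp
    then have "\<phi> (tl x) = \<zero>\<^bsub>V\<^esub>" using x h v \<phi>V[OF h(2)] by simp
    moreover have "\<phi> \<zero>\<^bsub>std_space K n\<^esub> = \<zero>\<^bsub>V\<^esub>"
      using lin_zero[OF \<phi>(1) m fdsp_module[OF fC]] by simp
    ultimately have "tl x = \<zero>\<^bsub>std_space K n\<^esub>"
      using \<phi>(2) h by (intro inj_onD[of \<phi> "carrier (std_space K n)"]) (auto simp: bij_betw_def)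
    then show "x = \<zero>\<^bsub>std_space K (Suc n)\<^esub>" using 1 x(1) by (auto simp: length_Suc_conv)
  qed
  moreover have "?p ` carrier (std_space K (Suc n)) = carrier V"
  proof (intro equalityI subsetI)
    fix w assume w: "w \<in> carrier V"
    obtain a where a: "g w = [a]" "a \<in> carrier K"
      using lin_closed[OF g(1) w] by (auto simp: length_Suc_conv)
    interpret N: Module.module K "std_space K 1" by (rule m)
    have av: "a \<odot>\<^bsub>V\<^esub> v \<in> carrier V" using a v by simp
    have "g (w \<ominus>\<^bsub>V\<^esub> a \<odot>\<^bsub>V\<^esub> v) = g w \<ominus>\<^bsub>std_space K 1\<^esub> g w"
      using lin_minus[OF g(1) mV m w av] gv[OF a(2)] a(1) by (simp del: std_space_sel)
    also have "\<dots> = \<zero>\<^bsub>std_space K 1\<^esub>"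
      by (rule N.M.minus_other_side[THEN iffD2, OF _ _ refl]; rule lin_closed[OF g(1) w])
    finally have "w \<ominus>\<^bsub>V\<^esub> a \<odot>\<^bsub>V\<^esub> v \<in> C"
      using w av unfolding C_def by simp
    then obtain xs where xs: "xs \<in> carrier (std_space K n)" "\<phi> xs = w \<ominus>\<^bsub>V\<^esub> a \<odot>\<^bsub>V\<^esub> v"
      using \<phi>(2) by (auto simp: bij_betw_def image_iff)
    have "a # xs \<in> carrier (std_space K (Suc n))" using a xs by auto
    moreover have "w = ?p (a # xs)"
      using xs a w v by (simp add: V.M.diff_simps)
    ultimately show "w \<in> ?p ` carrier (std_space K (Suc n))" by blast
  qed (use lin_closed[OF p] in blast)
  ultimately show ?case using p unfolding bij_betw_def by blast
qed

lemma lin_iso_of_dim_eq: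
  assumes K: "field K" and V: "fin_dim_space K V" and W: "fin_dim_space K W"
    and dim: "vectorspace.dim K V = vectorspace.dim K W"
  obtains f where "f \<in> lin_maps K V W" "bij_betw f (carrier V) (carrier W)"
proof -
  interpret K: field K by fact
  note m = std_space_module[OF K.is_cring]
  define n where "n = vectorspace.dim K V"
  obtain \<phi> where \<phi>: "\<phi> \<in> lin_maps K (std_space K n) V"
    "bij_betw \<phi> (carrier (std_space K n)) (carrier V)"
    using std_space_iso[OF K V] n_def by blast
  obtain \<psi> where \<psi>: "\<psi> \<in> lin_maps K (std_space K n) W"
    "bij_betw \<psi> (carrier (std_space K n)) (carrier W)"
    using std_space_iso[OF K W] n_def dim by metis
  let ?i = "\<lambda>y\<in>carrier V. inv_into (carrier (std_space K n)) \<phi> y"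
  have i: "?i \<in> lin_maps K V (std_space K n)"
    by (rule lin_inv_into[OF \<phi> m fdsp_module[OF V]])
  have "bij_betw ?i (carrier V) (carrier (std_space K n))"
    using bij_betw_inv_into[OF \<phi>(2)] by (subst bij_betw_cong[where g = "inv_into (carrier (std_space K n)) \<phi>"]) auto
  then have "bij_betw (compose (carrier V) \<psi> ?i) (carrier V) (carrier W)"
    by (rule bij_betw_compose) (rule \<psi>(2))
  then show ?thesis
    using that lin_comp[OF \<psi>(1) i fdsp_module[OF V]] by blast
qed

section \<open>Splitting a bounded complex\<close>

lemma (in abelian_group) minus_zero_right [simp]: "a \<in> carrier G \<Longrightarrow> a \<ominus> \<zero> = a"
  by (simp add: a_minus_def)

lemma (in abelian_group) minus_self [simp]: "a \<in> carrier G \<Longrightarrow> a \<ominus> a = \<zero>"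
  by (simp add: a_minus_def r_neg)

lemma carrier_update_id:
  fixes V :: "('a, 'v) module"
  assumes "S = carrier V"
  shows "V\<lparr>carrier := S\<rparr> = V"
  using assms by (cases V) simp

text \<open>The relations d h d = d, h d h = h and h h = 0 are those of a special deformation
  retraction: with them \<open>1 - d h - h d\<close> projects onto a complement of the coboundaries
  in the cocycles.\<close>

definition is_contraction ::
    "('a, 'r) ring_scheme \<Rightarrow> ('a, 'v) cplx \<Rightarrow> (int \<Rightarrow> 'v \<Rightarrow> 'v) \<Rightarrow> bool" where
  "is_contraction K X h \<longleftrightarrow>
     (\<forall>n. h n \<in> lin_maps K (csp X n) (csp X (n - 1))) \<and>
     (\<forall>n. \<forall>x\<in>carrier (csp X n). cdf X n (h (n + 1) (cdf X n x)) = cdf X n x \<and>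
        h n (cdf X (n - 1) (h n x)) = h n x \<and> h (n - 1) (h n x) = \<zero>\<^bsub>csp X (n - 2)\<^esub>)"

definition contraction :: "('a, 'r) ring_scheme \<Rightarrow> ('a, 'v) cplx \<Rightarrow> int \<Rightarrow> 'v \<Rightarrow> 'v" where
  "contraction K X = (SOME h. is_contraction K X h)"

definition harm_proj :: "('a, 'r) ring_scheme \<Rightarrow> ('a, 'v) cplx \<Rightarrow> int \<Rightarrow> 'v \<Rightarrow> 'v" where
  "harm_proj K X n = (\<lambda>x\<in>carrier (csp X n). x \<ominus>\<^bsub>csp X n\<^esub> cdf X (n - 1) (contraction K X n x)
     \<ominus>\<^bsub>csp X n\<^esub> contraction K X (n + 1) (cdf X n x))"

text \<open>Cohomology realized by elements of the complex instead of cosets, so that induced maps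
  are functions between subspaces of the given terms. The subspace depends on the chosen
  contraction.\<close>

definition harmonic :: "('a, 'r) ring_scheme \<Rightarrow> ('a, 'v) cplx \<Rightarrow> int \<Rightarrow> ('a, 'v) module" where
  "harmonic K X n = csp X n\<lparr>carrier := harm_proj K X n ` carrier (csp X n)\<rparr>"

lemma harmonic_sel [simp]:
  "\<zero>\<^bsub>harmonic K X n\<^esub> = \<zero>\<^bsub>csp X n\<^esub>" "x \<oplus>\<^bsub>harmonic K X n\<^esub> y = x \<oplus>\<^bsub>csp X n\<^esub> y"
  "c \<odot>\<^bsub>harmonic K X n\<^esub> x = c \<odot>\<^bsub>csp X n\<^esub> x"
  by (simp_all add: harmonic_def)

locale bounded_complex =
  fixes K :: "('a, 'r) ring_scheme" and X :: "('a, 'v) cplx"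
  assumes K: "field K" and X: "X \<in> bounded_complexes K"
begin

lemma fd: "fin_dim_space K (csp X n)"
  using X by (simp add: bounded_complexes_def)

lemma mod: "Module.module K (csp X n)"
  by (rule fdsp_module[OF fd])

lemma ab: "abelian_group (csp X n)"
  using mod by (rule module.axioms)

lemma d_lin: "cdf X n \<in> lin_maps K (csp X n) (csp X (n + 1))"
  using X by (simp add: bounded_complexes_def)

lemma d_closed [simp]:
  "x \<in> carrier (csp X n) \<Longrightarrow> m = n + 1 \<Longrightarrow> cdf X n x \<in> carrier (csp X m)"
  using lin_closed[OF d_lin] by simp

lemma d_zero [simp]: "cdf X n \<zero>\<^bsub>csp X n\<^esub> = \<zero>\<^bsub>csp X (n + 1)\<^esub>"
  by (rule lin_zero[OF d_lin mod mod])

lemma d_d [simp]: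
  "x \<in> carrier (csp X n) \<Longrightarrow> m = n + 1 \<Longrightarrow> cdf X m (cdf X n x) = \<zero>\<^bsub>csp X (n + 2)\<^esub>"
  using X by (simp add: bounded_complexes_def)

lemmas d_minus = lin_minus[OF d_lin mod mod]

text \<open>Start from degreewise generalized inverses g with d g d = d. Then k = g d g satisfies k
  d k = k in addition, and h = k - d k k has square zero because k h = k k - k d k k = 0. The
  correction is killed by d, so d h = d k and the first two relations survive.\<close>

lemma contraction_exists: "\<exists>h. is_contraction K X h"
proof -
  interpret M: Module.module K "csp X i" for i by (rule mod)
  have "\<exists>g\<in>lin_maps K (csp X n) (csp X (n - 1)). \<forall>x\<in>carrier (csp X (n - 1)).
      cdf X (n - 1) (g (cdf X (n - 1) x)) = cdf X (n - 1) x" for n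
    using lin_generalized_inverse[OF K d_lin[of "n - 1"] fd fd] by (metis diff_add_cancel)
  then obtain g where g: "\<And>n. g n \<in> lin_maps K (csp X n) (csp X (n - 1))"
    "\<And>n x. x \<in> carrier (csp X (n - 1)) \<Longrightarrow>
      cdf X (n - 1) (g n (cdf X (n - 1) x)) = cdf X (n - 1) x" by metis
  have d': "cdf X (n - 1) \<in> lin_maps K (csp X (n - 1)) (csp X n)" for n
    using d_lin[of "n - 1"] by simp
  define k where "k n = compose (carrier (csp X n)) (g n) (compose (carrier (csp X n)) (cdf X (n - 1)) (g n))" for n
  have k: "k n \<in> lin_maps K (csp X n) (csp X (n - 1))" for n
    unfolding k_def by (intro lin_comp[OF g(1)] lin_comp[OF d' g(1)] mod)
  have k_closed: "k n x \<in> carrier (csp X m)" if "x \<in> carrier (csp X n)" "m = n - 1" for n m x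
    using lin_closed[OF k] that by simp
  have g_closed: "g n x \<in> carrier (csp X m)" if "x \<in> carrier (csp X n)" "m = n - 1" for n m x
    using lin_closed[OF g(1)] that by simp
  have k_eq: "k n x = g n (cdf X (n - 1) (g n x))" if "x \<in> carrier (csp X n)" for n x
    using that by (simp add: k_def compose_eq)
  have dkd: "cdf X m (k n (cdf X m x)) = cdf X m x" if "x \<in> carrier (csp X m)" "m = n - 1" for n m x
    using that g(2)[of x n] g(2)[of "g n (cdf X (n - 1) x)" n] by (simp add: k_eq g_closed)
  have kdk: "k n (cdf X m (k n x)) = k n x" if "x \<in> carrier (csp X n)" "m = n - 1" for n m x
  proof -
    have "cdf X m (k n x) = cdf X m (g n x)"
      using that g(2)[of "g n x" n] by (simp add: k_eq g_closed)
    then show ?thesis using that g(2)[of "g n x" n] by (simp add: k_eq g_closed)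
  qed
  note k_minus = lin_minus[OF k mod mod] and k_zero = lin_zero[OF k mod mod]
  define e where "e n = compose (carrier (csp X n)) (cdf X (n - 2))
    (compose (carrier (csp X n)) (k (n - 1)) (k n))" for n
  have d'': "cdf X (n - 2) \<in> lin_maps K (csp X (n - 2)) (csp X (n - 1))" for n
    using d_lin[of "n - 2"] by simp
  have k': "k (n - 1) \<in> lin_maps K (csp X (n - 1)) (csp X (n - 2))" for n
    using k[of "n - 1"] by simp
  define h where "h n = (\<lambda>x\<in>carrier (csp X n). k n x \<ominus>\<^bsub>csp X (n - 1)\<^esub> e n x)" for n
  have h: "h n \<in> lin_maps K (csp X n) (csp X (n - 1))" for n
    unfolding h_def e_def
    by (intro lin_minus_map k mod lin_comp[OF d''] lin_comp[OF k' k])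
  have h_eq: "h n x = k n x \<ominus>\<^bsub>csp X (n - 1)\<^esub> cdf X (n - 2) (k (n - 1) (k n x))"
    if "x \<in> carrier (csp X n)" for n x
    using that by (simp add: h_def e_def compose_eq)
  have dh: "cdf X m (h n x) = cdf X m (k n x)" if "x \<in> carrier (csp X n)" "m = n - 1" for n m x
    using that by (simp add: h_eq d_minus k_closed)
  have "is_contraction K X h"
    unfolding is_contraction_def
  proof (intro conjI allI ballI)
    fix n x assume x: "x \<in> carrier (csp X n)"
    show "cdf X n (h (n + 1) (cdf X n x)) = cdf X n x"
      using x by (simp add: dh dkd)
    show "h n (cdf X (n - 1) (h n x)) = h n x"
      using x by (simp add: dh k_closed h_eq[of "cdf X (n - 1) (k n x)"] kdk) (simp add: h_eq)
    have "k (n - 1) (h n x) = \<zero>\<^bsub>csp X (n - 2)\<^esub>"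
      using x by (simp add: h_eq k_minus k_closed kdk)
    then show "h (n - 1) (h n x) = \<zero>\<^bsub>csp X (n - 2)\<^esub>"
      using x lin_closed[OF h x] k_zero[of "n - 2"] d_zero[of "n - 3"]
      by (simp add: h_eq[of "h n x"])
  qed (rule h)
  then show ?thesis by blast
qed

abbreviation "h \<equiv> contraction K X"
abbreviation "p \<equiv> harm_proj K X"
abbreviation "H \<equiv> harmonic K X"

lemma is_contr: "is_contraction K X h"
  unfolding contraction_def by (rule someI_ex[OF contraction_exists])

lemma h_lin: "h n \<in> lin_maps K (csp X n) (csp X (n - 1))"
  using is_contr by (simp add: is_contraction_def)

lemma h_closed [simp]:
  "x \<in> carrier (csp X n) \<Longrightarrow> m = n - 1 \<Longrightarrow> h n x \<in> carrier (csp X m)"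
  using lin_closed[OF h_lin] by simp

lemma h_zero [simp]: "h n \<zero>\<^bsub>csp X n\<^esub> = \<zero>\<^bsub>csp X (n - 1)\<^esub>"
  by (rule lin_zero[OF h_lin mod mod])

lemma d_h_d [simp]:
  "x \<in> carrier (csp X n) \<Longrightarrow> m = n + 1 \<Longrightarrow> cdf X n (h m (cdf X n x)) = cdf X n x"
  using is_contr by (simp add: is_contraction_def)

lemma h_d_h [simp]:
  "x \<in> carrier (csp X n) \<Longrightarrow> m = n - 1 \<Longrightarrow> h n (cdf X m (h n x)) = h n x"
  using is_contr by (simp add: is_contraction_def)

lemma h_h [simp]:
  "x \<in> carrier (csp X n) \<Longrightarrow> m = n - 1 \<Longrightarrow> h m (h n x) = \<zero>\<^bsub>csp X (n - 2)\<^esub>"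
  using is_contr by (simp add: is_contraction_def)

lemmas h_minus = lin_minus[OF h_lin mod mod]

lemma p_eq: "x \<in> carrier (csp X n) \<Longrightarrow>
    p n x = x \<ominus>\<^bsub>csp X n\<^esub> cdf X (n - 1) (h n x) \<ominus>\<^bsub>csp X n\<^esub> h (n + 1) (cdf X n x)"
  by (simp add: harm_proj_def)

lemma p_lin: "p n \<in> lin_maps K (csp X n) (csp X n)"
proof -
  have d': "cdf X (n - 1) \<in> lin_maps K (csp X (n - 1)) (csp X n)"
    using d_lin[of "n - 1"] by simp
  have h': "h (n + 1) \<in> lin_maps K (csp X (n + 1)) (csp X n)"
    using h_lin[of "n + 1"] by simp
  have "p n = (\<lambda>x\<in>carrier (csp X n). (\<lambda>x\<in>carrier (csp X n). (\<lambda>x\<in>carrier (csp X n). x) x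
      \<ominus>\<^bsub>csp X n\<^esub> compose (carrier (csp X n)) (cdf X (n - 1)) (h n) x) x
      \<ominus>\<^bsub>csp X n\<^esub> compose (carrier (csp X n)) (h (n + 1)) (cdf X n) x)"
    by (auto simp: harm_proj_def compose_def)
  also have "\<dots> \<in> lin_maps K (csp X n) (csp X n)"
    by (intro lin_minus_map lin_id mod lin_comp[OF d' h_lin] lin_comp[OF h' d_lin])
  finally show ?thesis .
qed

lemma p_closed [simp]: "x \<in> carrier (csp X n) \<Longrightarrow> p n x \<in> carrier (csp X n)"
  by (rule lin_closed[OF p_lin])

text \<open>From d h d = d and d d = 0 one gets d p = d - d d h - d h d = 0. The other products of p
  with d and h vanish likewise by the relations of a contraction.\<close>

lemma d_p [simp]: "x \<in> carrier (csp X n) \<Longrightarrow> cdf X n (p n x) = \<zero>\<^bsub>csp X (n + 1)\<^esub>"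
proof -
  interpret M: abelian_group "csp X i" for i by (rule ab)
  show "x \<in> carrier (csp X n) \<Longrightarrow> cdf X n (p n x) = \<zero>\<^bsub>csp X (n + 1)\<^esub>"
    by (simp add: p_eq d_minus add.commute[of 1])
qed

lemma h_p [simp]: "x \<in> carrier (csp X n) \<Longrightarrow> h n (p n x) = \<zero>\<^bsub>csp X (n - 1)\<^esub>"
proof -
  interpret M: abelian_group "csp X i" for i by (rule ab)
  show "x \<in> carrier (csp X n) \<Longrightarrow> h n (p n x) = \<zero>\<^bsub>csp X (n - 1)\<^esub>"
    by (simp add: p_eq h_minus add.commute[of 1])
qed

lemma p_d [simp]:
  "x \<in> carrier (csp X n) \<Longrightarrow> m = n + 1 \<Longrightarrow> p m (cdf X n x) = \<zero>\<^bsub>csp X (n + 1)\<^esub>"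
proof -
  interpret M: abelian_group "csp X i" for i by (rule ab)
  assume x: "x \<in> carrier (csp X n)" and m: "m = n + 1"
  have "h (n + 1 + 1) (cdf X (n + 1) (cdf X n x)) = h (n + 2) \<zero>\<^bsub>csp X (n + 2)\<^esub>"
    using d_d[OF x refl] by (simp add: add.commute)
  also have "\<dots> = \<zero>\<^bsub>csp X (n + 1)\<^esub>"
    using h_zero[of "n + 2"] by (simp add: add.commute)
  finally have "p (n + 1) (cdf X n x) = \<zero>\<^bsub>csp X (n + 1)\<^esub>"
    unfolding p_eq[OF d_closed[OF x refl]] using x by simp
  then show "p m (cdf X n x) = \<zero>\<^bsub>csp X (n + 1)\<^esub>" using m by simp
qed

lemma p_p [simp]: "x \<in> carrier (csp X n) \<Longrightarrow> p n (p n x) = p n x"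
proof -
  interpret M: abelian_group "csp X i" for i by (rule ab)
  assume x: "x \<in> carrier (csp X n)"
  have [simp]: "cdf X (n - 1) \<zero>\<^bsub>csp X (n - 1)\<^esub> = \<zero>\<^bsub>csp X n\<^esub>" "h (n + 1) \<zero>\<^bsub>csp X (n + 1)\<^esub> = \<zero>\<^bsub>csp X n\<^esub>"
    using d_zero[of "n - 1"] h_zero[of "n + 1"] by simp_all
  show "p n (p n x) = p n x"
    by (rule trans[OF p_eq[OF p_closed[OF x]]]) (use x in simp)
qed

lemma p_zero [simp]: "p n \<zero>\<^bsub>csp X n\<^esub> = \<zero>\<^bsub>csp X n\<^esub>"
  by (rule lin_zero[OF p_lin mod mod])

lemmas p_minus = lin_minus[OF p_lin mod mod]

text \<open>The projection is idempotent, so its image is the set of its fixed points; membership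
  becomes an equation.\<close>

lemma carrier_H: "carrier (H n) = {x \<in> carrier (csp X n). p n x = x}"
  unfolding harmonic_def by (auto simp: image_iff) (metis)

lemma H_closed: "x \<in> carrier (H n) \<Longrightarrow> x \<in> carrier (csp X n)"
  by (simp add: carrier_H)

lemma p_H: "x \<in> carrier (H n) \<Longrightarrow> p n x = x"
  by (simp add: carrier_H)

lemma p_in_H [simp]: "x \<in> carrier (csp X n) \<Longrightarrow> p n x \<in> carrier (H n)"
  by (simp add: carrier_H)

lemma d_H [simp]: "x \<in> carrier (H n) \<Longrightarrow> cdf X n x = \<zero>\<^bsub>csp X (n + 1)\<^esub>"
  using d_p[of x n] by (simp add: carrier_H)

lemma fd_H: "fin_dim_space K (H n)"
  unfolding harmonic_def by (rule fdsp_im[OF K p_lin fd mod])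

lemma mod_H: "Module.module K (H n)"
  by (rule fdsp_module[OF fd_H])

lemma p_lin_H: "p n \<in> lin_maps K (csp X n) (H n)"
  unfolding harmonic_def by (rule lin_carrier_update[OF p_lin]) simp

lemma incl_lin: "(\<lambda>x\<in>carrier (H n). x) \<in> lin_maps K (H n) (csp X n)"
  by (rule lin_restrictI[OF _ _ _ mod_H]) (simp_all add: H_closed)

text \<open>On a cocycle the term h d vanishes, so the projection changes it by a coboundary only:
  the harmonic representative lies in the same class.\<close>

lemma p_cocycle:
  "x \<in> carrier (csp X n) \<Longrightarrow> cdf X n x = \<zero>\<^bsub>csp X (n + 1)\<^esub> \<Longrightarrow>
    p n x = x \<ominus>\<^bsub>csp X n\<^esub> cdf X (n - 1) (h n x)"
proof -
  interpret M: abelian_group "csp X i" for i by (rule ab)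
  have [simp]: "h (n + 1) \<zero>\<^bsub>csp X (n + 1)\<^esub> = \<zero>\<^bsub>csp X n\<^esub>"
    using h_zero[of "n + 1"] by simp
  show "x \<in> carrier (csp X n) \<Longrightarrow> cdf X n x = \<zero>\<^bsub>csp X (n + 1)\<^esub> \<Longrightarrow>
    p n x = x \<ominus>\<^bsub>csp X n\<^esub> cdf X (n - 1) (h n x)"
    by (simp add: p_eq)
qed

text \<open>If d = 0, then h = h d h = 0 and the projection is the identity. The conclusion is an
  equality of modules, not merely an isomorphism, which makes the standard complexes
  computable.\<close>

lemma zero_diff:
  assumes "\<And>n x. x \<in> carrier (csp X n) \<Longrightarrow> cdf X n x = \<zero>\<^bsub>csp X (n + 1)\<^esub>"
  shows "H n = csp X n"
proof -
  interpret M: abelian_group "csp X i" for i by (rule ab)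
  have h0: "h n x = \<zero>\<^bsub>csp X (n - 1)\<^esub>" if "x \<in> carrier (csp X n)" for n x
    using h_d_h[OF that refl] that assms[of "h n x" "n - 1"] h_zero[of n] by simp
  have [simp]: "cdf X (n - 1) \<zero>\<^bsub>csp X (n - 1)\<^esub> = \<zero>\<^bsub>csp X n\<^esub>" "h (n + 1) \<zero>\<^bsub>csp X (n + 1)\<^esub> = \<zero>\<^bsub>csp X n\<^esub>"
    using d_zero[of "n - 1"] h_zero[of "n + 1"] by simp_all
  have "p n x = x" if "x \<in> carrier (csp X n)" for x
    using that by (simp add: p_eq h0 assms)
  then have "p n ` carrier (csp X n) = carrier (csp X n)" by simp
  then show ?thesis unfolding harmonic_def by (rule carrier_update_id)
qed

end

section \<open>Maps induced on harmonic parts\<close>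

definition hmap ::
    "('a, 'r) ring_scheme \<Rightarrow> ('a, 'v) cplx \<Rightarrow> ('a, 'v) cplx \<Rightarrow> 'v cmap \<Rightarrow> int \<Rightarrow> 'v \<Rightarrow> 'v" where
  "hmap K X Y f n = (\<lambda>x\<in>carrier (harmonic K X n). harm_proj K Y n (f n x))"

definition graded_maps ::
    "('a, 'r) ring_scheme \<Rightarrow> ('a, 'v) cplx \<Rightarrow> ('a, 'v) cplx \<Rightarrow> 'v cmap set" where
  "graded_maps K X Y = {\<alpha>. \<forall>n. \<alpha> n \<in> lin_maps K (harmonic K X n) (harmonic K Y n)}"

text \<open>Lifts a graded map to the complexes. Since harmonic elements are cocycles and the
  projection kills coboundaries, both sides of the chain map equation are zero.\<close>

definition cm_of :: "('a, 'r) ring_scheme \<Rightarrow> ('a, 'v) cplx \<Rightarrow> 'v cmap \<Rightarrow> 'v cmap" where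
  "cm_of K X \<alpha> = (\<lambda>n. \<lambda>x\<in>carrier (csp X n). \<alpha> n (harm_proj K X n x))"

context bounded_complex
begin

lemma submodule_coboundaries: "submodule K (coboundaries X n) (csp X n)"
  using submodule_im[OF d_lin[of "n - 1"] mod mod] by (simp add: coboundaries_def)

lemma p_coboundary [simp]: "b \<in> coboundaries X n \<Longrightarrow> p n b = \<zero>\<^bsub>csp X n\<^esub>"
proof -
  assume "b \<in> coboundaries X n"
  then obtain y where y: "y \<in> carrier (csp X (n - 1))" "b = cdf X (n - 1) y"
    by (auto simp: coboundaries_def)
  then show "p n b = \<zero>\<^bsub>csp X n\<^esub>" using p_d[OF y(1), of n] by simp
qed

lemma coset_eq:
  assumes "x \<in> carrier (csp X n)" "b \<in> coboundaries X n"
  shows "coboundaries X n +>\<^bsub>csp X n\<^esub> (b \<oplus>\<^bsub>csp X n\<^esub> x) = coboundaries X n +>\<^bsub>csp X n\<^esub> x"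
proof -
  interpret M: abelian_group "csp X i" for i by (rule ab)
  interpret B: submodule K "coboundaries X n" "csp X n" by (rule submodule_coboundaries)
  have c: "c \<in> carrier (csp X n)" if "c \<in> coboundaries X n" for c using that B.subset by blast
  show ?thesis
  proof (intro equalityI subsetI)
    fix z assume "z \<in> coboundaries X n +>\<^bsub>csp X n\<^esub> (b \<oplus>\<^bsub>csp X n\<^esub> x)"
    then obtain b' where b': "b' \<in> coboundaries X n" "z = b' \<oplus>\<^bsub>csp X n\<^esub> (b \<oplus>\<^bsub>csp X n\<^esub> x)"
      by (auto simp: a_r_coset_def')
    then have "z = (b' \<oplus>\<^bsub>csp X n\<^esub> b) \<oplus>\<^bsub>csp X n\<^esub> x" using assms c by (simp add: M.a_assoc)
    then show "z \<in> coboundaries X n +>\<^bsub>csp X n\<^esub> x"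
      using b' assms by (auto simp: a_r_coset_def')
  next
    fix z assume "z \<in> coboundaries X n +>\<^bsub>csp X n\<^esub> x"
    then obtain b' where b': "b' \<in> coboundaries X n" "z = b' \<oplus>\<^bsub>csp X n\<^esub> x"
      by (auto simp: a_r_coset_def')
    then have "z = (b' \<ominus>\<^bsub>csp X n\<^esub> b) \<oplus>\<^bsub>csp X n\<^esub> (b \<oplus>\<^bsub>csp X n\<^esub> x)"
      using assms c by (simp add: M.diff_simps)
    moreover have "b' \<ominus>\<^bsub>csp X n\<^esub> b \<in> coboundaries X n"
      by (rule submodule_minus[OF submodule_coboundaries b'(1) assms(2)])
    ultimately show "z \<in> coboundaries X n +>\<^bsub>csp X n\<^esub> (b \<oplus>\<^bsub>csp X n\<^esub> x)"
      by (auto simp: a_r_coset_def')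
  qed
qed

lemma cocycle_decomp:
  assumes "x \<in> carrier (csp X n)" "cdf X n x = \<zero>\<^bsub>csp X (n + 1)\<^esub>"
  shows "\<exists>b\<in>coboundaries X n. x = b \<oplus>\<^bsub>csp X n\<^esub> p n x"
proof -
  interpret M: abelian_group "csp X i" for i by (rule ab)
  have "x = cdf X (n - 1) (h n x) \<oplus>\<^bsub>csp X n\<^esub> p n x"
    using assms by (simp add: p_cocycle M.diff_simps)
  then show ?thesis using assms by (auto simp: coboundaries_def intro!: bexI[of _ "h n x"])
qed

lemma coset_p:
  assumes "x \<in> carrier (csp X n)" "cdf X n x = \<zero>\<^bsub>csp X (n + 1)\<^esub>"
  shows "coboundaries X n +>\<^bsub>csp X n\<^esub> x = coboundaries X n +>\<^bsub>csp X n\<^esub> p n x"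
proof -
  obtain b where b: "b \<in> coboundaries X n" "x = b \<oplus>\<^bsub>csp X n\<^esub> p n x"
    using cocycle_decomp[OF assms] by blast
  have "coboundaries X n +>\<^bsub>csp X n\<^esub> (b \<oplus>\<^bsub>csp X n\<^esub> p n x) = coboundaries X n +>\<^bsub>csp X n\<^esub> p n x"
    by (rule coset_eq) (use assms b(1) in simp_all)
  then show ?thesis using b(2) by simp
qed

text \<open>The projection is constant on cosets of the coboundaries and moves a cocycle within its
  coset, so each class contains exactly one harmonic element.\<close>

lemma harm_cohomology:
  "bij_betw (\<lambda>x. coboundaries X n +>\<^bsub>csp X n\<^esub> x) (carrier (H n)) (cohomology X n)"
  unfolding bij_betw_def
proof
  interpret M: abelian_group "csp X i" for i by (rule ab)
  interpret B: submodule K "coboundaries X n" "csp X n" by (rule submodule_coboundaries)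
  show "inj_on (\<lambda>x. coboundaries X n +>\<^bsub>csp X n\<^esub> x) (carrier (H n))"
  proof (rule inj_onI)
    fix x y assume xy: "x \<in> carrier (H n)" "y \<in> carrier (H n)"
      "coboundaries X n +>\<^bsub>csp X n\<^esub> x = coboundaries X n +>\<^bsub>csp X n\<^esub> y"
    have "\<zero>\<^bsub>csp X n\<^esub> \<oplus>\<^bsub>csp X n\<^esub> x \<in> coboundaries X n +>\<^bsub>csp X n\<^esub> x"
      using B.zero_closed by (auto simp: a_r_coset_def')
    moreover have "\<zero>\<^bsub>csp X n\<^esub> \<oplus>\<^bsub>csp X n\<^esub> x = x" using xy(1) H_closed by simp
    ultimately have "x \<in> coboundaries X n +>\<^bsub>csp X n\<^esub> y" using xy(3) by simp
    then obtain b where b: "b \<in> coboundaries X n" "x = b \<oplus>\<^bsub>csp X n\<^esub> y"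
      by (auto simp: a_r_coset_def')
    then have "p n x = p n y"
      using lin_add[OF p_lin, of b n y] xy H_closed B.subset by auto
    then show "x = y" using xy p_H by simp
  qed
  show "(\<lambda>x. coboundaries X n +>\<^bsub>csp X n\<^esub> x) ` carrier (H n) = cohomology X n"
  proof (intro equalityI subsetI)
    fix c assume "c \<in> cohomology X n"
    then obtain x where x: "x \<in> carrier (csp X n)" "cdf X n x = \<zero>\<^bsub>csp X (n + 1)\<^esub>"
      and c: "c = coboundaries X n +>\<^bsub>csp X n\<^esub> x"
      unfolding cohomology_def cocycles_def by blast
    show "c \<in> (\<lambda>x. coboundaries X n +>\<^bsub>csp X n\<^esub> x) ` carrier (H n)"
      unfolding c coset_p[OF x] using x(1) by (intro imageI) simp
  next
    fix c assume "c \<in> (\<lambda>x. coboundaries X n +>\<^bsub>csp X n\<^esub> x) ` carrier (H n)"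
    then obtain x where x: "x \<in> carrier (H n)" and c: "c = coboundaries X n +>\<^bsub>csp X n\<^esub> x"
      by blast
    have "x \<in> cocycles X n" using x H_closed d_H by (simp add: cocycles_def)
    then show "c \<in> cohomology X n" unfolding cohomology_def c by blast
  qed
qed

lemma graded_id: "(\<lambda>n. \<lambda>x\<in>carrier (H n). x) \<in> graded_maps K X X"
  using lin_id[OF mod_H] by (simp add: graded_maps_def)

lemma hmap_id: "hmap K X X (cm_id X) = (\<lambda>n. \<lambda>x\<in>carrier (H n). x)"
  by (auto simp: hmap_def cm_id_def fun_eq_iff H_closed p_H)

lemma cm_id_chain: "cm_id X \<in> chain_maps K X X"
  by (auto simp: chain_maps_def cm_id_def lin_id[OF mod])

end

locale bounded_complex_pair = X: bounded_complex K X + Y: bounded_complex K Y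
  for K :: "('a, 'r) ring_scheme" and X Y :: "('a, 'v) cplx"
begin

lemma f_lin: "f \<in> chain_maps K X Y \<Longrightarrow> f n \<in> lin_maps K (csp X n) (csp Y n)"
  by (simp add: chain_maps_def)

lemma f_closed: "f \<in> chain_maps K X Y \<Longrightarrow> x \<in> carrier (csp X n) \<Longrightarrow> f n x \<in> carrier (csp Y n)"
  using lin_closed[OF f_lin] .

lemma f_d: "f \<in> chain_maps K X Y \<Longrightarrow> x \<in> carrier (csp X n) \<Longrightarrow> m = n + 1 \<Longrightarrow>
    f m (cdf X n x) = cdf Y n (f n x)"
  by (simp add: chain_maps_def)

lemma f_zero: "f \<in> chain_maps K X Y \<Longrightarrow> f n \<zero>\<^bsub>csp X n\<^esub> = \<zero>\<^bsub>csp Y n\<^esub>"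
  by (rule lin_zero[OF f_lin X.mod Y.mod])

lemma hmap_eq: "x \<in> carrier (harmonic K X n) \<Longrightarrow> hmap K X Y f n x = harm_proj K Y n (f n x)"
  by (simp add: hmap_def)

lemma graded_closed:
  "\<alpha> \<in> graded_maps K X Y \<Longrightarrow> x \<in> carrier (harmonic K X n) \<Longrightarrow> \<alpha> n x \<in> carrier (harmonic K Y n)"
  using lin_closed by (fastforce simp: graded_maps_def)

lemma graded_zero: "\<alpha> \<in> graded_maps K X Y \<Longrightarrow> \<alpha> n \<zero>\<^bsub>csp X n\<^esub> = \<zero>\<^bsub>csp Y n\<^esub>"
  using lin_zero[OF _ X.mod_H Y.mod_H, of "\<alpha> n" n n] by (simp add: graded_maps_def)

lemma graded_eqI:
  assumes "\<alpha> \<in> graded_maps K X Y" "\<beta> \<in> graded_maps K X Y"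
    "\<And>n x. x \<in> carrier (harmonic K X n) \<Longrightarrow> \<alpha> n x = \<beta> n x"
  shows "\<alpha> = \<beta>"
proof
  fix n
  show "\<alpha> n = \<beta> n"
    by (rule lin_eqI[of _ K "harmonic K X n" "harmonic K Y n"]) (use assms in \<open>simp_all add: graded_maps_def\<close>)
qed

lemma hmap_graded: "f \<in> chain_maps K X Y \<Longrightarrow> hmap K X Y f \<in> graded_maps K X Y"
  unfolding graded_maps_def
proof (intro CollectI allI)
  fix n assume f: "f \<in> chain_maps K X Y"
  have "hmap K X Y f n = compose (carrier (harmonic K X n)) (harm_proj K Y n)
      (compose (carrier (harmonic K X n)) (f n) (\<lambda>x\<in>carrier (harmonic K X n). x))"
    by (auto simp: hmap_def compose_def)
  also have "\<dots> \<in> lin_maps K (harmonic K X n) (harmonic K Y n)"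
    by (intro lin_comp[OF Y.p_lin_H] lin_comp[OF f_lin[OF f]] X.incl_lin X.mod_H)
  finally show "hmap K X Y f n \<in> lin_maps K (harmonic K X n) (harmonic K Y n)" .
qed

text \<open>The induced map may be computed on any cocycle: passing to the harmonic representative
  subtracts a coboundary, which f sends to a coboundary, which the projection of Y kills.\<close>

lemma hmap_p:
  assumes f: "f \<in> chain_maps K X Y"
    and x: "x \<in> carrier (csp X n)" "cdf X n x = \<zero>\<^bsub>csp X (n + 1)\<^esub>"
  shows "hmap K X Y f n (harm_proj K X n x) = harm_proj K Y n (f n x)"
proof -
  interpret M: abelian_group "csp Y i" for i by (rule Y.ab)
  have "f n (harm_proj K X n x) = f n x \<ominus>\<^bsub>csp Y n\<^esub> f n (cdf X (n - 1) (X.h n x))"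
    using x by (simp add: X.p_cocycle lin_minus[OF f_lin[OF f] X.mod Y.mod])
  also have "f n (cdf X (n - 1) (X.h n x)) = cdf Y (n - 1) (f (n - 1) (X.h n x))"
    using x by (intro f_d[OF f]) simp_all
  finally show ?thesis
    using x by (simp add: hmap_eq Y.p_minus f_closed[OF f])
qed

text \<open>On a harmonic x the homotopy term containing d x vanishes, and the other term is a
  coboundary, which the projection kills.\<close>

lemma homotopic_hmap:
  assumes f: "f \<in> chain_maps K X Y" and g: "g \<in> chain_maps K X Y" and fg: "homotopic K X Y f g"
  shows "hmap K X Y f = hmap K X Y g"
proof (rule graded_eqI[OF hmap_graded[OF f] hmap_graded[OF g]])
  fix n x assume x: "x \<in> carrier (harmonic K X n)"
  interpret M: abelian_group "csp Y i" for i by (rule Y.ab)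
  note xX = X.H_closed[OF x]
  obtain k where k: "\<And>n. k n \<in> lin_maps K (csp X n) (csp Y (n - 1))"
    "\<And>n x. x \<in> carrier (csp X n) \<Longrightarrow>
      f n x \<ominus>\<^bsub>csp Y n\<^esub> g n x = cdf Y (n - 1) (k n x) \<oplus>\<^bsub>csp Y n\<^esub> k (n + 1) (cdf X n x)"
    using fg by (auto simp: homotopic_def)
  have "k (n + 1) \<zero>\<^bsub>csp X (n + 1)\<^esub> = \<zero>\<^bsub>csp Y n\<^esub>"
    using lin_zero[OF k(1) X.mod Y.mod, of "n + 1"] by simp
  then have "f n x \<ominus>\<^bsub>csp Y n\<^esub> g n x = cdf Y (n - 1) (k n x)"
    using k(2)[OF xX] lin_closed[OF k(1) xX] x by simp
  then have "harm_proj K Y n (f n x \<ominus>\<^bsub>csp Y n\<^esub> g n x) = \<zero>\<^bsub>csp Y n\<^esub>"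
    using Y.p_d[OF lin_closed[OF k(1) xX], of n] by simp
  then show "hmap K X Y f n x = hmap K X Y g n x"
    using x xX by (simp add: hmap_eq Y.p_minus f_closed[OF f] f_closed[OF g])
qed

text \<open>Over a field the cohomology detects homotopy. The difference e of the two maps is spread
  over the identity 1 = p + d h + h d of X: the terms with d h and h d are handled by h of X, the
  term e p by h of Y.\<close>

lemma hmap_homotopic:
  assumes f: "f \<in> chain_maps K X Y" and g: "g \<in> chain_maps K X Y"
    and fg: "hmap K X Y f = hmap K X Y g"
  shows "homotopic K X Y f g"
proof -
  interpret M: abelian_group "csp X i" for i by (rule X.ab)
  interpret N: abelian_group "csp Y i" for i by (rule Y.ab)
  define e where "e = (\<lambda>n. \<lambda>x\<in>carrier (csp X n). f n x \<ominus>\<^bsub>csp Y n\<^esub> g n x)"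
  have e_eq: "e n x = f n x \<ominus>\<^bsub>csp Y n\<^esub> g n x" if "x \<in> carrier (csp X n)" for n x
    using that by (simp add: e_def)
  have e: "e \<in> chain_maps K X Y"
    unfolding chain_maps_def
  proof (intro CollectI conjI allI ballI)
    show "e n \<in> lin_maps K (csp X n) (csp Y n)" for n
      unfolding e_def by (rule lin_minus_map[OF f_lin[OF f] f_lin[OF g] X.mod Y.mod])
    show "e (n + 1) (cdf X n x) = cdf Y n (e n x)" if "x \<in> carrier (csp X n)" for n x
      using that by (simp add: e_eq f_d[OF f] f_d[OF g] Y.d_minus f_closed[OF f] f_closed[OF g])
  qed
  have pe: "harm_proj K Y n (e n x) = \<zero>\<^bsub>csp Y n\<^esub>" if "x \<in> carrier (harmonic K X n)" for n x
    using that X.H_closed[OF that] fun_cong[OF fun_cong[OF fg, of n], of x]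
    by (simp add: hmap_eq e_eq Y.p_minus f_closed[OF f] f_closed[OF g])
  \<comment> \<open>The cocycle \<open>e (p x)\<close> has harmonic part zero, so it is a
    coboundary, with a primitive supplied by the contraction of Y.\<close>
  have ep: "e n (X.p n x) = cdf Y (n - 1) (Y.h n (e n (X.p n x)))" if x: "x \<in> carrier (csp X n)" for n x
  proof -
    have c: "e n (X.p n x) \<in> carrier (csp Y n)" using x by (simp add: f_closed[OF e])
    have "cdf Y n (e n (X.p n x)) = \<zero>\<^bsub>csp Y (n + 1)\<^esub>"
      using f_d[OF e, of "X.p n x" n "n + 1"] x by (simp add: f_zero[OF e])
    from Y.p_cocycle[OF c this] have "\<zero>\<^bsub>csp Y n\<^esub> = e n (X.p n x)
        \<ominus>\<^bsub>csp Y n\<^esub> cdf Y (n - 1) (Y.h n (e n (X.p n x)))"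
      using pe[of "X.p n x" n] x by simp
    from this[symmetric] show "e n (X.p n x) = cdf Y (n - 1) (Y.h n (e n (X.p n x)))"
      by (subst (asm) N.minus_other_side) (use c in simp_all)
  qed
  \<comment> \<open>The homotopy is k = e h + h e p. Indeed d k = e d h + e p by \<open>ep\<close>,
    and k d = e h d because p d = 0; the sum is e.\<close>
  define k where "k n = (\<lambda>x\<in>carrier (csp X n). compose (carrier (csp X n)) (e (n - 1)) (X.h n) x
      \<oplus>\<^bsub>csp Y (n - 1)\<^esub> compose (carrier (csp X n)) (Y.h n) (compose (carrier (csp X n)) (e n) (X.p n)) x)" for n
  have k: "k n \<in> lin_maps K (csp X n) (csp Y (n - 1))" for n
    unfolding k_def
    by (intro lin_plus_map lin_comp[OF f_lin[OF e] X.h_lin] lin_comp[OF Y.h_lin]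
      lin_comp[OF f_lin[OF e] X.p_lin] X.mod Y.mod)
  have k_eq: "k n x = e (n - 1) (X.h n x) \<oplus>\<^bsub>csp Y (n - 1)\<^esub> Y.h n (e n (X.p n x))"
    if "x \<in> carrier (csp X n)" for n x
    using that by (simp add: k_def compose_eq)
  have "f n x \<ominus>\<^bsub>csp Y n\<^esub> g n x = cdf Y (n - 1) (k n x) \<oplus>\<^bsub>csp Y n\<^esub> k (n + 1) (cdf X n x)"
    if x: "x \<in> carrier (csp X n)" for n x
  proof -
    let ?a = "cdf X (n - 1) (X.h n x)" and ?b = "X.h (n + 1) (cdf X n x)"
    note c = f_closed[OF e]
    have ab: "?a \<in> carrier (csp X n)" "?b \<in> carrier (csp X n)" using x by simp_all
    have x_eq: "x = X.p n x \<oplus>\<^bsub>csp X n\<^esub> ?a \<oplus>\<^bsub>csp X n\<^esub> ?b"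
      unfolding X.p_eq[OF x] using x ab by (simp add: M.diff_simps)
    have "cdf Y (n - 1) (k n x) = cdf Y (n - 1) (e (n - 1) (X.h n x))
        \<oplus>\<^bsub>csp Y n\<^esub> cdf Y (n - 1) (Y.h n (e n (X.p n x)))"
      using x lin_add[OF Y.d_lin, of _ "n - 1"] by (simp add: k_eq c)
    also have "\<dots> = e n ?a \<oplus>\<^bsub>csp Y n\<^esub> e n (X.p n x)"
      using x f_d[OF e, of "X.h n x" "n - 1" n] by (simp flip: ep)
    finally have 1: "cdf Y (n - 1) (k n x) = e n ?a \<oplus>\<^bsub>csp Y n\<^esub> e n (X.p n x)" .
    have 2: "k (n + 1) (cdf X n x) = e n ?b"
      using x k_eq[of "cdf X n x" "n + 1"] f_zero[OF e, of "n + 1"] Y.h_zero[of "n + 1"] by (simp add: c)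
    have "e n x = e n (X.p n x) \<oplus>\<^bsub>csp Y n\<^esub> e n ?a \<oplus>\<^bsub>csp Y n\<^esub> e n ?b"
      by (subst x_eq) (use x ab lin_add[OF f_lin[OF e]] in simp)
    then show ?thesis
      unfolding 1 2 e_eq[OF x, symmetric] using x ab by (simp add: N.a_ac c)
  qed
  then show ?thesis unfolding homotopic_def
    by (intro exI[of _ k] conjI allI ballI k)
qed

text \<open>Passing to cosets identifies harmonic elements with cohomology on both sides and
  intertwines the two induced maps, so bijectivity transfers.\<close>

lemma quasi_iso_iff:
  assumes f: "f \<in> chain_maps K X Y"
  shows "f \<in> quasi_isos K X Y \<longleftrightarrow>
    (\<forall>n. bij_betw (hmap K X Y f n) (carrier (harmonic K X n)) (carrier (harmonic K Y n)))"
proof -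
  have "bij_betw (cohomology_map Y f n) (cohomology X n) (cohomology Y n) \<longleftrightarrow>
    bij_betw (hmap K X Y f n) (carrier (harmonic K X n)) (carrier (harmonic K Y n))" for n
  proof -
    let ?\<kappa> = "\<lambda>x. coboundaries X n +>\<^bsub>csp X n\<^esub> x" and ?\<mu> = "\<lambda>x. coboundaries Y n +>\<^bsub>csp Y n\<^esub> x"
    have comm: "(cohomology_map Y f n \<circ> ?\<kappa>) x = (?\<mu> \<circ> hmap K X Y f n) x"
      if x: "x \<in> carrier (harmonic K X n)" for x
    proof -
      interpret M: abelian_group "csp X n" by (rule X.ab)
      interpret B: submodule K "coboundaries X n" "csp X n" by (rule X.submodule_coboundaries)
      note xX = X.H_closed[OF x]
      have fx: "cdf Y n (f n x) = \<zero>\<^bsub>csp Y (n + 1)\<^esub>"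
        using f_d[OF f xX refl] x f_zero[OF f] by simp
      \<comment> \<open>Every member z of the coset of x yields the same coset, so the union that
        defines \<open>cohomology_map\<close> is a single coset.\<close>
      have "?\<mu> (f n z) = ?\<mu> (hmap K X Y f n x)" if z: "z \<in> ?\<kappa> x" for z
      proof -
        obtain b where b: "b \<in> coboundaries X n" "z = b \<oplus>\<^bsub>csp X n\<^esub> x"
          using z by (auto simp: a_r_coset_def')
        then obtain y where y: "y \<in> carrier (csp X (n - 1))" "b = cdf X (n - 1) y"
          by (auto simp: coboundaries_def)
        have "f n b = cdf Y (n - 1) (f (n - 1) y)"
          unfolding y(2) using y(1) by (intro f_d[OF f]) simp_all
        then have "f n b \<in> coboundaries Y n"
          using f_closed[OF f y(1)] by (auto simp: coboundaries_def)
        moreover have "f n z = f n b \<oplus>\<^bsub>csp Y n\<^esub> f n x"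
          using b xX B.subset by (simp add: lin_add[OF f_lin[OF f]] subset_iff)
        ultimately have "?\<mu> (f n z) = ?\<mu> (f n x)"
          using Y.coset_eq[OF f_closed[OF f xX]] by simp
        also have "\<dots> = ?\<mu> (hmap K X Y f n x)"
          using Y.coset_p[OF f_closed[OF f xX] fx] x by (simp add: hmap_eq)
        finally show ?thesis .
      qed
      moreover have "\<zero>\<^bsub>csp X n\<^esub> \<oplus>\<^bsub>csp X n\<^esub> x \<in> ?\<kappa> x"
        using B.zero_closed by (auto simp: a_r_coset_def')
      ultimately show ?thesis unfolding cohomology_map_def comp_def by blast
    qed
    have cl: "hmap K X Y f n ` carrier (harmonic K X n) \<subseteq> carrier (harmonic K Y n)"
      using graded_closed[OF hmap_graded[OF f]] by blast
    have "bij_betw (cohomology_map Y f n) (cohomology X n) (cohomology Y n) \<longleftrightarrow>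
        bij_betw (cohomology_map Y f n \<circ> ?\<kappa>) (carrier (harmonic K X n)) (cohomology Y n)"
      by (rule bij_betw_comp_iff[OF X.harm_cohomology])
    also have "\<dots> \<longleftrightarrow> bij_betw (?\<mu> \<circ> hmap K X Y f n) (carrier (harmonic K X n)) (cohomology Y n)"
      by (rule bij_betw_cong) (rule comm)
    also have "\<dots> \<longleftrightarrow> bij_betw (hmap K X Y f n) (carrier (harmonic K X n)) (carrier (harmonic K Y n))"
      by (rule bij_betw_comp_iff2[OF Y.harm_cohomology cl, symmetric])
    finally show ?thesis .
  qed
  then show ?thesis using f by (simp add: quasi_isos_def)
qed

lemma cm_of_chain:
  assumes \<alpha>: "\<alpha> \<in> graded_maps K X Y"
  shows "cm_of K X \<alpha> \<in> chain_maps K X Y"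
  unfolding chain_maps_def
proof (intro CollectI conjI allI ballI)
  fix n
  have "\<alpha> n \<in> lin_maps K (harmonic K X n) (csp Y n\<lparr>carrier := carrier (harmonic K Y n)\<rparr>)"
    using \<alpha> by (simp add: graded_maps_def harmonic_def)
  then have a: "\<alpha> n \<in> lin_maps K (harmonic K X n) (csp Y n)"
    by (rule lin_of_subspace) (use Y.H_closed in blast)
  show "cm_of K X \<alpha> n \<in> lin_maps K (csp X n) (csp Y n)"
    using lin_comp[OF a X.p_lin_H X.mod] by (simp add: cm_of_def compose_def)
  fix x assume x: "x \<in> carrier (csp X n)"
  then show "cm_of K X \<alpha> (n + 1) (cdf X n x) = cdf Y n (cm_of K X \<alpha> n x)"
    using graded_zero[OF \<alpha>] graded_closed[OF \<alpha>] by (simp add: cm_of_def)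
qed

lemma hmap_cm_of:
  assumes \<alpha>: "\<alpha> \<in> graded_maps K X Y"
  shows "hmap K X Y (cm_of K X \<alpha>) = \<alpha>"
  by (rule graded_eqI[OF hmap_graded[OF cm_of_chain[OF \<alpha>]] \<alpha>])
    (simp add: hmap_eq cm_of_def X.H_closed X.p_H Y.p_H graded_closed[OF \<alpha>])

end

definition graded_comp ::
    "('a, 'r) ring_scheme \<Rightarrow> ('a, 'v) cplx \<Rightarrow> 'v cmap \<Rightarrow> 'v cmap \<Rightarrow> 'v cmap" where
  "graded_comp K X \<beta> \<alpha> = (\<lambda>n. compose (carrier (harmonic K X n)) (\<beta> n) (\<alpha> n))"

locale bounded_complex_triple =
  XY: bounded_complex_pair K X Y + YZ: bounded_complex_pair K Y Z
  for K :: "('a, 'r) ring_scheme" and X Y Z :: "('a, 'v) cplx"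

sublocale bounded_complex_triple \<subseteq> XZ: bounded_complex_pair K X Z ..

context bounded_complex_triple
begin

lemma cm_comp_chain:
  assumes g: "g \<in> chain_maps K Y Z" and f: "f \<in> chain_maps K X Y"
  shows "cm_comp X g f \<in> chain_maps K X Z"
  unfolding chain_maps_def
proof (intro CollectI conjI allI ballI)
  fix n
  show "cm_comp X g f n \<in> lin_maps K (csp X n) (csp Z n)"
    unfolding cm_comp_def by (rule lin_comp[OF YZ.f_lin[OF g] XY.f_lin[OF f] XY.X.mod])
  fix x assume "x \<in> carrier (csp X n)"
  then show "cm_comp X g f (n + 1) (cdf X n x) = cdf Z n (cm_comp X g f n x)"
    using XY.f_d[OF f] YZ.f_d[OF g] XY.f_closed[OF f] by (simp add: cm_comp_def compose_eq)
qed

lemma graded_comp_closed: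
  assumes "\<beta> \<in> graded_maps K Y Z" "\<alpha> \<in> graded_maps K X Y"
  shows "graded_comp K X \<beta> \<alpha> \<in> graded_maps K X Z"
  using assms by (auto simp: graded_maps_def graded_comp_def intro!: lin_comp[OF _ _ XY.X.mod_H])

lemma hmap_comp:
  assumes g: "g \<in> chain_maps K Y Z" and f: "f \<in> chain_maps K X Y"
  shows "hmap K X Z (cm_comp X g f) = graded_comp K X (hmap K Y Z g) (hmap K X Y f)"
proof (rule XZ.graded_eqI[OF XZ.hmap_graded[OF cm_comp_chain[OF g f]]
      graded_comp_closed[OF YZ.hmap_graded[OF g] XY.hmap_graded[OF f]]])
  fix n x assume x: "x \<in> carrier (harmonic K X n)"
  note xX = XY.X.H_closed[OF x]
  have "cdf Y n (f n x) = \<zero>\<^bsub>csp Y (n + 1)\<^esub>"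
    using XY.f_d[OF f xX refl] x XY.f_zero[OF f] by simp
  from YZ.hmap_p[OF g XY.f_closed[OF f xX] this]
  show "hmap K X Z (cm_comp X g f) n x = graded_comp K X (hmap K Y Z g) (hmap K X Y f) n x"
    using x xX by (simp add: XZ.hmap_eq XY.hmap_eq cm_comp_def graded_comp_def compose_eq)
qed

end

section \<open>The derived category as graded vector spaces\<close>

lemma bounded_complex_pairI:
  "field K \<Longrightarrow> X \<in> bounded_complexes K \<Longrightarrow> Y \<in> bounded_complexes K \<Longrightarrow> bounded_complex_pair K X Y"
  by (intro bounded_complex_pair.intro bounded_complex.intro)

lemma bounded_complex_tripleI:
  "field K \<Longrightarrow> X \<in> bounded_complexes K \<Longrightarrow> Y \<in> bounded_complexes K \<Longrightarrow> Z \<in> bounded_complexes K \<Longrightarrow>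
    bounded_complex_triple K X Y Z"
  by (intro bounded_complex_triple.intro bounded_complex_pairI)

lemma hmap_comp_apply:
  assumes "field K" "X \<in> bounded_complexes K" "Y \<in> bounded_complexes K" "Z \<in> bounded_complexes K"
    and "g \<in> chain_maps K Y Z" "f \<in> chain_maps K X Y" "x \<in> carrier (harmonic K X n)"
  shows "hmap K X Z (cm_comp X g f) n x = hmap K Y Z g n (hmap K X Y f n x)"
  using bounded_complex_triple.hmap_comp[OF bounded_complex_tripleI[OF assms(1-4)] assms(5,6)] assms(7)
  by (simp add: graded_comp_def compose_eq)

lemma cm_comp_chain_maps:
  assumes "field K" "X \<in> bounded_complexes K" "Y \<in> bounded_complexes K" "Z \<in> bounded_complexes K"
    and "g \<in> chain_maps K Y Z" "f \<in> chain_maps K X Y"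
  shows "cm_comp X g f \<in> chain_maps K X Z"
  using bounded_complex_triple.cm_comp_chain[OF bounded_complex_tripleI[OF assms(1-4)] assms(5,6)] .

lemma graded_comp_graded_maps:
  assumes "field K" "X \<in> bounded_complexes K" "Y \<in> bounded_complexes K" "Z \<in> bounded_complexes K"
    and "\<beta> \<in> graded_maps K Y Z" "\<alpha> \<in> graded_maps K X Y"
  shows "graded_comp K X \<beta> \<alpha> \<in> graded_maps K X Z"
  using bounded_complex_triple.graded_comp_closed[OF bounded_complex_tripleI[OF assms(1-4)] assms(5,6)] .

lemma quasi_iso_chain: "f \<in> quasi_isos K X Y \<Longrightarrow> f \<in> chain_maps K X Y"
  by (simp add: quasi_isos_def)

lemma quasi_iso_hmap:
  assumes "field K" "X \<in> bounded_complexes K" "Y \<in> bounded_complexes K" "f \<in> quasi_isos K X Y"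
  shows "bij_betw (hmap K X Y f n) (carrier (harmonic K X n)) (carrier (harmonic K Y n))"
  using bounded_complex_pair.quasi_iso_iff[OF bounded_complex_pairI[OF assms(1-3)], of f] assms(4)
  by (simp add: quasi_isos_def)

lemma quasi_isoI:
  assumes "field K" "X \<in> bounded_complexes K" "Y \<in> bounded_complexes K" "f \<in> chain_maps K X Y"
    and "\<And>n. bij_betw (hmap K X Y f n) (carrier (harmonic K X n)) (carrier (harmonic K Y n))"
  shows "f \<in> quasi_isos K X Y"
  using bounded_complex_pair.quasi_iso_iff[OF bounded_complex_pairI[OF assms(1-3)], of f] assms(4,5)
  by simp

lemma quasi_iso_comp:
  assumes "field K" "X \<in> bounded_complexes K" "Y \<in> bounded_complexes K" "Z \<in> bounded_complexes K"
    and g: "g \<in> quasi_isos K Y Z" and f: "f \<in> quasi_isos K X Y"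
  shows "cm_comp X g f \<in> quasi_isos K X Z"
proof (rule quasi_isoI)
  fix n
  have "bij_betw (hmap K Y Z g n \<circ> hmap K X Y f n) (carrier (harmonic K X n)) (carrier (harmonic K Z n))"
    by (rule bij_betw_trans[OF quasi_iso_hmap[OF assms(1-3) f] quasi_iso_hmap[OF assms(1,3,4) g]])
  then show "bij_betw (hmap K X Z (cm_comp X g f) n) (carrier (harmonic K X n)) (carrier (harmonic K Z n))"
    by (rule bij_betw_cong[THEN iffD1, rotated])
      (simp add: hmap_comp_apply[OF assms(1-4) quasi_iso_chain[OF g] quasi_iso_chain[OF f]])
qed (use assms cm_comp_chain_maps[OF assms(1-4) quasi_iso_chain[OF g] quasi_iso_chain[OF f]] in simp_all)

text \<open>Says that the graded map is f s^-1 on cohomology, in a form without inverses. As s is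
  bijective there, each roof represents exactly one graded map.\<close>

fun represents :: "('a, 'r) ring_scheme \<Rightarrow> 'v cmap \<Rightarrow> ('a, 'v) roof \<Rightarrow> bool" where
  "represents K \<alpha> (Roof X W Y s f) \<longleftrightarrow> is_roof K (Roof X W Y s f) \<and> \<alpha> \<in> graded_maps K X Y \<and>
     (\<forall>n. \<forall>x\<in>carrier (harmonic K W n). \<alpha> n (hmap K W X s n x) = hmap K W Y f n x)"

text \<open>A roof acts on cohomology as \<open>\<alpha>\<close>. Since quasi-isomorphisms induce bijections of harmonic parts and
  homotopy classes of chain maps are detected there, the classes of roofs are exactly these sets.\<close>

definition mor ::
    "('a, 'r) ring_scheme \<Rightarrow> ('a, 'v) cplx \<Rightarrow> ('a, 'v) cplx \<Rightarrow> 'v cmap \<Rightarrow> ('a, 'v) roof set" where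
  "mor K X Y \<alpha> = {r. \<exists>W s f. r = Roof X W Y s f \<and> represents K \<alpha> r}"

lemma Roof_in_mor: "Roof X' W Y' s f \<in> mor K X Y \<alpha> \<longleftrightarrow>
    X' = X \<and> Y' = Y \<and> represents K \<alpha> (Roof X W Y s f)"
  by (auto simp: mor_def simp del: represents.simps)

lemma graded_inverse:
  assumes K: "field K" and X: "X \<in> bounded_complexes K" and Y: "Y \<in> bounded_complexes K"
    and \<alpha>: "\<alpha> \<in> graded_maps K X Y"
    and bij: "\<And>n. bij_betw (\<alpha> n) (carrier (harmonic K X n)) (carrier (harmonic K Y n))"
  obtains \<beta> where "\<beta> \<in> graded_maps K Y X"
    "\<And>n x. x \<in> carrier (harmonic K X n) \<Longrightarrow> \<beta> n (\<alpha> n x) = x"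
    "\<And>n y. y \<in> carrier (harmonic K Y n) \<Longrightarrow> \<alpha> n (\<beta> n y) = y"
proof -
  interpret bounded_complex_pair K X Y by (rule bounded_complex_pairI[OF K X Y])
  define \<beta> where "\<beta> n = (\<lambda>y\<in>carrier (harmonic K Y n). inv_into (carrier (harmonic K X n)) (\<alpha> n) y)" for n
  have "\<beta> \<in> graded_maps K Y X"
    unfolding graded_maps_def
  proof (intro CollectI allI)
    fix n show "\<beta> n \<in> lin_maps K (harmonic K Y n) (harmonic K X n)"
      unfolding \<beta>_def using \<alpha> by (intro lin_inv_into bij X.mod_H Y.mod_H) (simp add: graded_maps_def)
  qed
  moreover have "\<beta> n (\<alpha> n x) = x" if "x \<in> carrier (harmonic K X n)" for n x
    using that bij[of n] graded_closed[OF \<alpha> that] by (simp add: \<beta>_def bij_betw_def)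
  moreover have "\<alpha> n (\<beta> n y) = y" if "y \<in> carrier (harmonic K Y n)" for n y
    using that bij[of n] by (simp add: \<beta>_def bij_betw_def f_inv_into_f)
  ultimately show ?thesis using that by blast
qed

lemma is_roofD:
  assumes "is_roof K (Roof X W Y s f)"
  shows "X \<in> bounded_complexes K" "W \<in> bounded_complexes K" "Y \<in> bounded_complexes K"
    "s \<in> quasi_isos K W X" "s \<in> chain_maps K W X" "f \<in> chain_maps K W Y"
  using assms quasi_iso_chain by auto

text \<open>A quasi-isomorphism is inverted on harmonic parts, and \<open>cm_of\<close> lifts the
  inverse to a chain map. This is what allows every roof to be compared over X itself.\<close>

lemma roof_inverse:
  assumes K: "field K" and r: "is_roof K (Roof X W Y s f)"
  obtains u where "u \<in> chain_maps K X W"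
    "\<And>n x. x \<in> carrier (harmonic K X n) \<Longrightarrow> hmap K X W u n x \<in> carrier (harmonic K W n)"
    "\<And>n x. x \<in> carrier (harmonic K X n) \<Longrightarrow> hmap K W X s n (hmap K X W u n x) = x"
proof -
  note r = is_roofD[OF r]
  interpret WX: bounded_complex_pair K W X by (rule bounded_complex_pairI[OF K r(2,1)])
  interpret XW: bounded_complex_pair K X W by (rule bounded_complex_pairI[OF K r(1,2)])
  obtain \<beta> where \<beta>: "\<beta> \<in> graded_maps K X W"
    "\<And>n y. y \<in> carrier (harmonic K X n) \<Longrightarrow> hmap K W X s n (\<beta> n y) = y"
    using graded_inverse[OF K r(2,1) WX.hmap_graded[OF r(5)] quasi_iso_hmap[OF K r(2,1,4)]] by metis
  show ?thesis
  proof (rule that[of "cm_of K X \<beta>"])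
    show "cm_of K X \<beta> \<in> chain_maps K X W" by (rule XW.cm_of_chain[OF \<beta>(1)])
    show "hmap K X W (cm_of K X \<beta>) n x \<in> carrier (harmonic K W n)" if "x \<in> carrier (harmonic K X n)" for n x
      unfolding XW.hmap_cm_of[OF \<beta>(1)] by (rule XW.graded_closed[OF \<beta>(1) that])
    show "hmap K W X s n (hmap K X W (cm_of K X \<beta>) n x) = x" if "x \<in> carrier (harmonic K X n)" for n x
      unfolding XW.hmap_cm_of[OF \<beta>(1)] by (rule \<beta>(2)[OF that])
  qed
qed

lemma represents_exists:
  assumes K: "field K" and r: "is_roof K (Roof X W Y s f)"
  shows "\<exists>\<alpha>. represents K \<alpha> (Roof X W Y s f)"
proof -
  note r' = is_roofD[OF r]
  interpret WX: bounded_complex_pair K W X by (rule bounded_complex_pairI[OF K r'(2,1)])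
  interpret WY: bounded_complex_pair K W Y by (rule bounded_complex_pairI[OF K r'(2,3)])
  obtain \<beta> where \<beta>: "\<beta> \<in> graded_maps K X W"
    "\<And>n x. x \<in> carrier (harmonic K W n) \<Longrightarrow> \<beta> n (hmap K W X s n x) = x"
    using graded_inverse[OF K r'(2,1) WX.hmap_graded[OF r'(5)] quasi_iso_hmap[OF K r'(2,1,4)]] by metis
  have "represents K (graded_comp K X (hmap K W Y f) \<beta>) (Roof X W Y s f)"
    unfolding represents.simps
  proof (intro conjI allI ballI)
    show "graded_comp K X (hmap K W Y f) \<beta> \<in> graded_maps K X Y"
      by (rule graded_comp_graded_maps[OF K r'(1,2,3) WY.hmap_graded[OF r'(6)] \<beta>(1)])
    fix n x assume x: "x \<in> carrier (harmonic K W n)"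
    show "graded_comp K X (hmap K W Y f) \<beta> n (hmap K W X s n x) = hmap K W Y f n x"
      using WX.graded_closed[OF WX.hmap_graded[OF r'(5)] x]
      by (simp add: graded_comp_def compose_eq \<beta>(2)[OF x])
  qed (rule r)
  then show ?thesis by blast
qed

lemma represents_unique:
  assumes K: "field K" and "represents K \<alpha> (Roof X W Y s f)" "represents K \<beta> (Roof X W Y s f)"
  shows "\<alpha> = \<beta>"
proof -
  note r = assms(2,3)[unfolded represents.simps]
  note r' = is_roofD[OF conjunct1[OF r(1)]]
  interpret XY: bounded_complex_pair K X Y by (rule bounded_complex_pairI[OF K r'(1,3)])
  show ?thesis
  proof (rule XY.graded_eqI)
    fix n x assume "x \<in> carrier (harmonic K X n)"
    then obtain w where w: "w \<in> carrier (harmonic K W n)" "x = hmap K W X s n w"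
      using quasi_iso_hmap[OF K r'(2,1,4), of n] by (auto simp: bij_betw_def image_iff)
    have "\<alpha> n (hmap K W X s n w) = hmap K W Y f n w" "\<beta> n (hmap K W X s n w) = hmap K W Y f n w"
      using r w(1) by blast+
    then show "\<alpha> n x = \<beta> n x" using w(2) by simp
  qed (use r in blast)+
qed

text \<open>As s u is a quasi-isomorphism homotopic to s' u', each value s' x equals s' u' v for
  some v over V, and injectivity of s' gives x = u' v. Then, writing a for the graded map, a s' x =
  a s u v = f u v = f' u' v = f' x on harmonic parts.\<close>

lemma roof_equiv_represents:
  assumes K: "field K" and eq: "roof_equiv K (Roof X W Y s f) (Roof X' W' Y' s' f')"
    and rep: "represents K \<alpha> (Roof X W Y s f)"
  shows "represents K \<alpha> (Roof X' W' Y' s' f')"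
proof -
  from eq obtain V u u' where isr: "is_roof K (Roof X W Y s f)" "is_roof K (Roof X W' Y s' f')"
    and e: "X' = X" "Y' = Y" and V: "V \<in> bounded_complexes K"
    and u: "u \<in> chain_maps K V W" "u' \<in> chain_maps K V W'"
    and su: "cm_comp V s u \<in> quasi_isos K V X"
    and hs: "homotopic K V X (cm_comp V s u) (cm_comp V s' u')"
    and hf: "homotopic K V Y (cm_comp V f u) (cm_comp V f' u')"
    unfolding roof_equiv.simps by blast
  note r = is_roofD[OF isr(1)] and r' = is_roofD[OF isr(2)]
  interpret VX: bounded_complex_pair K V X by (rule bounded_complex_pairI[OF K V r(1)])
  interpret VY: bounded_complex_pair K V Y by (rule bounded_complex_pairI[OF K V r(3)])
  interpret VW: bounded_complex_pair K V W by (rule bounded_complex_pairI[OF K V r(2)])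
  interpret VW': bounded_complex_pair K V W' by (rule bounded_complex_pairI[OF K V r'(2)])
  interpret WX': bounded_complex_pair K W' X by (rule bounded_complex_pairI[OF K r'(2,1)])
  have eqs: "hmap K V X (cm_comp V s u) = hmap K V X (cm_comp V s' u')"
    by (rule VX.homotopic_hmap[OF _ _ hs]) (rule cm_comp_chain_maps[OF K V]; use r r' u in blast)+
  have eqf: "hmap K V Y (cm_comp V f u) = hmap K V Y (cm_comp V f' u')"
    by (rule VY.homotopic_hmap[OF _ _ hf]) (rule cm_comp_chain_maps[OF K V]; use r r' u in blast)+
  have 1: "hmap K W X s n (hmap K V W u n v) = hmap K W' X s' n (hmap K V W' u' n v)"
    "hmap K W Y f n (hmap K V W u n v) = hmap K W' Y f' n (hmap K V W' u' n v)"
    if "v \<in> carrier (harmonic K V n)" for n v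
    using fun_cong[OF fun_cong[OF eqs, of n], of v] fun_cong[OF fun_cong[OF eqf, of n], of v] that
    by (simp_all add: hmap_comp_apply[OF K V r(2) r(1) r(5) u(1)] hmap_comp_apply[OF K V r'(2) r(1) r'(5) u(2)]
        hmap_comp_apply[OF K V r(2) r(3) r(6) u(1)] hmap_comp_apply[OF K V r'(2) r(3) r'(6) u(2)])
  have \<alpha>: "\<alpha> \<in> graded_maps K X Y"
    "\<And>n x. x \<in> carrier (harmonic K W n) \<Longrightarrow> \<alpha> n (hmap K W X s n x) = hmap K W Y f n x"
    using rep by auto
  have "\<alpha> n (hmap K W' X s' n x) = hmap K W' Y f' n x" if x: "x \<in> carrier (harmonic K W' n)" for n x
  proof -
    have "hmap K W' X s' n x \<in> carrier (harmonic K X n)"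
      by (rule WX'.graded_closed[OF WX'.hmap_graded[OF r'(5)] x])
    then obtain v where v: "v \<in> carrier (harmonic K V n)"
      "hmap K W' X s' n x = hmap K V X (cm_comp V s u) n v"
      using quasi_iso_hmap[OF K V r(1) su, of n] by (auto simp: bij_betw_def image_iff)
    then have "hmap K W' X s' n x = hmap K W' X s' n (hmap K V W' u' n v)"
      using 1(1)[OF v(1)] by (simp add: hmap_comp_apply[OF K V r(2) r(1) r(5) u(1)])
    then have x_eq: "x = hmap K V W' u' n v"
      using quasi_iso_hmap[OF K r'(2,1,4), of n] x VW'.graded_closed[OF VW'.hmap_graded[OF u(2)] v(1)]
      by (auto simp: bij_betw_def dest: inj_onD)
    show ?thesis
      unfolding x_eq 1(1)[OF v(1), symmetric] 1(2)[OF v(1), symmetric]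
      by (rule \<alpha>(2)[OF VW.graded_closed[OF VW.hmap_graded[OF u(1)] v(1)]])
  qed
  then show ?thesis using \<alpha>(1) isr(2) e by simp
qed

text \<open>The common refinement is X itself, with u and u' the homotopy inverses of s and s'. Both
  s u and s' u' induce the identity on harmonic parts, and f u and f' u' both induce the represented
  map, so the required homotopies come from \<open>hmap_homotopic\<close>.\<close>

lemma represents_roof_equiv:
  assumes K: "field K" and rep: "represents K \<alpha> (Roof X W Y s f)" "represents K \<alpha> (Roof X W' Y s' f')"
  shows "roof_equiv K (Roof X W Y s f) (Roof X W' Y s' f')"
proof -
  have isr: "is_roof K (Roof X W Y s f)" "is_roof K (Roof X W' Y s' f')"
    and \<alpha>: "\<alpha> \<in> graded_maps K X Y"
    "\<And>n x. x \<in> carrier (harmonic K W n) \<Longrightarrow> \<alpha> n (hmap K W X s n x) = hmap K W Y f n x"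
    "\<And>n x. x \<in> carrier (harmonic K W' n) \<Longrightarrow> \<alpha> n (hmap K W' X s' n x) = hmap K W' Y f' n x"
    using rep by auto
  note r = is_roofD[OF isr(1)] and r' = is_roofD[OF isr(2)]
  interpret XX: bounded_complex_pair K X X by (rule bounded_complex_pairI[OF K r(1) r(1)])
  interpret XY: bounded_complex_pair K X Y by (rule bounded_complex_pairI[OF K r(1) r(3)])
  obtain u where u: "u \<in> chain_maps K X W"
    "\<And>n x. x \<in> carrier (harmonic K X n) \<Longrightarrow> hmap K X W u n x \<in> carrier (harmonic K W n)"
    "\<And>n x. x \<in> carrier (harmonic K X n) \<Longrightarrow> hmap K W X s n (hmap K X W u n x) = x"
    using roof_inverse[OF K isr(1)] by metis
  obtain u' where u': "u' \<in> chain_maps K X W'"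
    "\<And>n x. x \<in> carrier (harmonic K X n) \<Longrightarrow> hmap K X W' u' n x \<in> carrier (harmonic K W' n)"
    "\<And>n x. x \<in> carrier (harmonic K X n) \<Longrightarrow> hmap K W' X s' n (hmap K X W' u' n x) = x"
    using roof_inverse[OF K isr(2)] by metis
  have c: "cm_comp X s u \<in> chain_maps K X X" "cm_comp X s' u' \<in> chain_maps K X X"
    "cm_comp X f u \<in> chain_maps K X Y" "cm_comp X f' u' \<in> chain_maps K X Y"
    by (rule cm_comp_chain_maps[OF K r(1) r(2) r(1) r(5) u(1)],
      rule cm_comp_chain_maps[OF K r(1) r'(2) r(1) r'(5) u'(1)],
      rule cm_comp_chain_maps[OF K r(1) r(2) r(3) r(6) u(1)],
      rule cm_comp_chain_maps[OF K r(1) r'(2) r(3) r'(6) u'(1)])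
  have su: "hmap K X X (cm_comp X s u) n x = x" "hmap K X X (cm_comp X s' u') n x = x"
    if "x \<in> carrier (harmonic K X n)" for n x
    using that u(3) u'(3)
    by (simp_all add: hmap_comp_apply[OF K r(1) r(2) r(1) r(5) u(1)] hmap_comp_apply[OF K r(1) r'(2) r(1) r'(5) u'(1)])
  have fu: "hmap K X Y (cm_comp X f u) n x = \<alpha> n x" "hmap K X Y (cm_comp X f' u') n x = \<alpha> n x"
    if x: "x \<in> carrier (harmonic K X n)" for n x
    using x \<alpha>(2)[OF u(2)[OF x]] \<alpha>(3)[OF u'(2)[OF x]] u(3)[OF x] u'(3)[OF x]
    by (simp_all add: hmap_comp_apply[OF K r(1) r(2) r(3) r(6) u(1)] hmap_comp_apply[OF K r(1) r'(2) r(3) r'(6) u'(1)])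
  have q: "cm_comp X s u \<in> quasi_isos K X X"
  proof (rule quasi_isoI[OF K r(1) r(1) c(1)])
    show "bij_betw (hmap K X X (cm_comp X s u) n) (carrier (harmonic K X n)) (carrier (harmonic K X n))" for n
      by (rule bij_betw_cong[THEN iffD1, OF _ bij_betw_id]) (simp add: su)
  qed
  have "homotopic K X X (cm_comp X s u) (cm_comp X s' u')"
    by (rule XX.hmap_homotopic[OF c(1,2) XX.graded_eqI[OF XX.hmap_graded[OF c(1)] XX.hmap_graded[OF c(2)]]])
      (simp add: su)
  moreover have "homotopic K X Y (cm_comp X f u) (cm_comp X f' u')"
    by (rule XY.hmap_homotopic[OF c(3,4) XY.graded_eqI[OF XY.hmap_graded[OF c(3)] XY.hmap_graded[OF c(4)]]])
      (simp add: fu)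
  ultimately show ?thesis
    using isr r(1) u(1) u'(1) q unfolding roof_equiv.simps by blast
qed

lemma roof_class_eq_mor:
  assumes K: "field K" and rep: "represents K \<alpha> (Roof X W Y s f)"
  shows "roof_class K (Roof X W Y s f) = mor K X Y \<alpha>"
proof (intro equalityI subsetI)
  fix r assume r: "r \<in> roof_class K (Roof X W Y s f)"
  obtain X' W' Y' s' f' where r_eq: "r = Roof X' W' Y' s' f'" by (cases r)
  then have eq: "roof_equiv K (Roof X W Y s f) (Roof X' W' Y' s' f')"
    using r by (simp add: roof_class_def del: roof_equiv.simps)
  then have "X' = X" "Y' = Y" by simp_all
  then show "r \<in> mor K X Y \<alpha>"
    using roof_equiv_represents[OF K eq rep] by (simp add: r_eq Roof_in_mor del: represents.simps)
next
  fix r assume "r \<in> mor K X Y \<alpha>"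
  then obtain W' s' f' where "r = Roof X W' Y s' f'" "represents K \<alpha> (Roof X W' Y s' f')"
    unfolding mor_def by blast
  then show "r \<in> roof_class K (Roof X W Y s f)"
    using represents_roof_equiv[OF K rep] by (simp add: roof_class_def del: roof_equiv.simps)
qed

lemma represents_cm_of:
  assumes K: "field K" and X: "X \<in> bounded_complexes K" and Y: "Y \<in> bounded_complexes K"
    and f: "f \<in> chain_maps K X Y"
  shows "represents K (hmap K X Y f) (Roof X X Y (cm_id X) f)"
proof -
  interpret XY: bounded_complex_pair K X Y by (rule bounded_complex_pairI[OF K X Y])
  interpret XX: bounded_complex_pair K X X by (rule bounded_complex_pairI[OF K X X])
  have "cm_id X \<in> quasi_isos K X X"
  proof (rule quasi_isoI[OF K X X XY.X.cm_id_chain])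
    show "bij_betw (hmap K X X (cm_id X) n) (carrier (harmonic K X n)) (carrier (harmonic K X n))" for n
      unfolding XY.X.hmap_id by (rule bij_betw_cong[THEN iffD1, OF _ bij_betw_id]) simp
  qed
  then show ?thesis
    using X Y f XY.hmap_graded[OF f] by (simp add: XY.X.hmap_id)
qed

lemma der_map_eq_mor:
  assumes "field K" "X \<in> bounded_complexes K" "Y \<in> bounded_complexes K" "f \<in> chain_maps K X Y"
  shows "der_map K X Y f = mor K X Y (hmap K X Y f)"
  unfolding der_map_def by (rule roof_class_eq_mor[OF assms(1) represents_cm_of[OF assms]])

lemma der_hom_eq:
  assumes K: "field K" and X: "X \<in> bounded_complexes K" and Y: "Y \<in> bounded_complexes K"
  shows "der_hom K X Y = mor K X Y ` graded_maps K X Y"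
proof (intro equalityI subsetI)
  interpret XY: bounded_complex_pair K X Y by (rule bounded_complex_pairI[OF K X Y])
  fix a assume "a \<in> mor K X Y ` graded_maps K X Y"
  then obtain \<alpha> where \<alpha>: "\<alpha> \<in> graded_maps K X Y" "a = mor K X Y \<alpha>" by blast
  have c: "cm_of K X \<alpha> \<in> chain_maps K X Y" by (rule XY.cm_of_chain[OF \<alpha>(1)])
  have rep: "represents K \<alpha> (Roof X X Y (cm_id X) (cm_of K X \<alpha>))"
    using represents_cm_of[OF K X Y c] unfolding XY.hmap_cm_of[OF \<alpha>(1)] .
  then have "is_roof K (Roof X X Y (cm_id X) (cm_of K X \<alpha>))" by simp
  then show "a \<in> der_hom K X Y"
    unfolding der_hom_def \<alpha>(2) roof_class_eq_mor[OF K rep, symmetric] by blast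
next
  fix a assume "a \<in> der_hom K X Y"
  then obtain W s f where r: "is_roof K (Roof X W Y s f)" "a = roof_class K (Roof X W Y s f)"
    unfolding der_hom_def by blast
  obtain \<alpha> where \<alpha>: "represents K \<alpha> (Roof X W Y s f)" using represents_exists[OF K r(1)] by blast
  then have "\<alpha> \<in> graded_maps K X Y" by simp
  then show "a \<in> mor K X Y ` graded_maps K X Y"
    using r(2) roof_class_eq_mor[OF K \<alpha>] by blast
qed

lemma mor_nonempty:
  assumes K: "field K" and X: "X \<in> bounded_complexes K" and Y: "Y \<in> bounded_complexes K"
    and \<alpha>: "\<alpha> \<in> graded_maps K X Y"
  shows "Roof X X Y (cm_id X) (cm_of K X \<alpha>) \<in> mor K X Y \<alpha>"
proof -
  interpret XY: bounded_complex_pair K X Y by (rule bounded_complex_pairI[OF K X Y])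
  show ?thesis
    using represents_cm_of[OF K X Y XY.cm_of_chain[OF \<alpha>]] unfolding XY.hmap_cm_of[OF \<alpha>] Roof_in_mor
    by simp
qed

lemma mor_inj:
  assumes K: "field K" and X: "X \<in> bounded_complexes K" and Y: "Y \<in> bounded_complexes K"
    and \<alpha>: "\<alpha> \<in> graded_maps K X Y" and eq: "mor K X Y \<alpha> = mor K X Y \<beta>"
  shows "\<alpha> = \<beta>"
  using mor_nonempty[OF K X Y \<alpha>] mor_nonempty[OF K X Y \<alpha>, unfolded eq]
  unfolding Roof_in_mor using represents_unique[OF K] by blast

text \<open>\<open>der_comp\<close> and \<open>der_shift\<close> are unions over all choices of
  representatives. Such a union is one class as soon as a choice exists and all choices lead to the
  same class.\<close>

lemma Union_constant: "S \<noteq> {} \<Longrightarrow> (\<And>c. c \<in> S \<Longrightarrow> c = d) \<Longrightarrow> \<Union>S = d"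
  by blast

text \<open>Writing a and b for the two graded maps, any Ore square gives b a s p = b f p = b t q =
  g q on harmonic parts, so every choice represents the composite. A choice exists because classes
  contain roofs whose left leg is the identity.\<close>

lemma der_comp_mor:
  assumes K: "field K" and X: "X \<in> bounded_complexes K" and Y: "Y \<in> bounded_complexes K"
    and Z: "Z \<in> bounded_complexes K"
    and \<beta>: "\<beta> \<in> graded_maps K Y Z" and \<alpha>: "\<alpha> \<in> graded_maps K X Y"
  shows "der_comp K (mor K Y Z \<beta>) (mor K X Y \<alpha>) = mor K X Z (graded_comp K X \<beta> \<alpha>)"
proof -
  let ?\<gamma> = "graded_comp K X \<beta> \<alpha>"
  let ?S = "{roof_class K (Roof X' V Z' (cm_comp V s p) (cm_comp V g q)) |
     X' W Y' s f W' Z' t g V p q.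
     Roof X' W Y' s f \<in> mor K X Y \<alpha> \<and> Roof Y' W' Z' t g \<in> mor K Y Z \<beta> \<and> V \<in> bounded_complexes K \<and>
     p \<in> quasi_isos K V W \<and> q \<in> chain_maps K V W' \<and>
     homotopic K V Y' (cm_comp V f p) (cm_comp V t q)}"
  have \<gamma>: "?\<gamma> \<in> graded_maps K X Z" by (rule graded_comp_graded_maps[OF K X Y Z \<beta> \<alpha>])
  have all: "c = mor K X Z ?\<gamma>" if c: "c \<in> ?S" for c
  proof -
    from c obtain W s f W' t g V p q where
      c_eq: "c = roof_class K (Roof X V Z (cm_comp V s p) (cm_comp V g q))"
      and rep: "represents K \<alpha> (Roof X W Y s f)" "represents K \<beta> (Roof Y W' Z t g)"
      and V: "V \<in> bounded_complexes K" and pq: "p \<in> quasi_isos K V W" "q \<in> chain_maps K V W'"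
      and hom: "homotopic K V Y (cm_comp V f p) (cm_comp V t q)"
      unfolding Roof_in_mor by blast
    have isr: "is_roof K (Roof X W Y s f)" "is_roof K (Roof Y W' Z t g)"
      and \<alpha>': "\<And>n x. x \<in> carrier (harmonic K W n) \<Longrightarrow> \<alpha> n (hmap K W X s n x) = hmap K W Y f n x"
      and \<beta>': "\<And>n x. x \<in> carrier (harmonic K W' n) \<Longrightarrow> \<beta> n (hmap K W' Y t n x) = hmap K W' Z g n x"
      using rep by auto
    note r = is_roofD[OF isr(1)] and r' = is_roofD[OF isr(2)]
    note p = quasi_iso_chain[OF pq(1)]
    interpret VW: bounded_complex_pair K V W by (rule bounded_complex_pairI[OF K V r(2)])
    interpret VW': bounded_complex_pair K V W' by (rule bounded_complex_pairI[OF K V r'(2)])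
    interpret VY: bounded_complex_pair K V Y by (rule bounded_complex_pairI[OF K V Y])
    interpret WX: bounded_complex_pair K W X by (rule bounded_complex_pairI[OF K r(2) X])
    have h: "hmap K V Y (cm_comp V f p) = hmap K V Y (cm_comp V t q)"
      by (rule VY.homotopic_hmap[OF cm_comp_chain_maps[OF K V r(2) Y r(6) p]
        cm_comp_chain_maps[OF K V r'(2) Y r'(5) pq(2)] hom])
    have "represents K ?\<gamma> (Roof X V Z (cm_comp V s p) (cm_comp V g q))"
      unfolding represents.simps is_roof.simps
    proof (intro conjI allI ballI X V Z \<gamma>)
      show "cm_comp V s p \<in> quasi_isos K V X" by (rule quasi_iso_comp[OF K V r(2) X r(4) pq(1)])
      show "cm_comp V g q \<in> chain_maps K V Z" by (rule cm_comp_chain_maps[OF K V r'(2) Z r'(6) pq(2)])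
      fix n x assume x: "x \<in> carrier (harmonic K V n)"
      note px = VW.graded_closed[OF VW.hmap_graded[OF p] x]
      note qx = VW'.graded_closed[OF VW'.hmap_graded[OF pq(2)] x]
      have "?\<gamma> n (hmap K V X (cm_comp V s p) n x) = \<beta> n (\<alpha> n (hmap K W X s n (hmap K V W p n x)))"
        using WX.graded_closed[OF WX.hmap_graded[OF r(5)] px]
        by (simp add: hmap_comp_apply[OF K V r(2) X r(5) p x] graded_comp_def compose_eq)
      also have "\<dots> = \<beta> n (hmap K W Y f n (hmap K V W p n x))"
        by (simp add: \<alpha>'[OF px])
      also have "\<dots> = \<beta> n (hmap K W' Y t n (hmap K V W' q n x))"
        using fun_cong[OF fun_cong[OF h, of n], of x]
        by (simp add: hmap_comp_apply[OF K V r(2) Y r(6) p x] hmap_comp_apply[OF K V r'(2) Y r'(5) pq(2) x])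
      also have "\<dots> = hmap K V Z (cm_comp V g q) n x"
        by (simp add: \<beta>'[OF qx] hmap_comp_apply[OF K V r'(2) Z r'(6) pq(2) x])
      finally show "?\<gamma> n (hmap K V X (cm_comp V s p) n x) = hmap K V Z (cm_comp V g q) n x" .
    qed
    from roof_class_eq_mor[OF K this] show ?thesis unfolding c_eq .
  qed
  have ex: "?S \<noteq> {}"
  proof -
    interpret XY: bounded_complex_pair K X Y by (rule bounded_complex_pairI[OF K X Y])
    interpret XX: bounded_complex_pair K X X by (rule bounded_complex_pairI[OF K X X])
    interpret YY: bounded_complex_pair K Y Y by (rule bounded_complex_pairI[OF K Y Y])
    have a: "cm_of K X \<alpha> \<in> chain_maps K X Y" by (rule XY.cm_of_chain[OF \<alpha>])
    have "cm_id X \<in> quasi_isos K X X"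
      using represents_cm_of[OF K X X XY.X.cm_id_chain] by simp
    moreover have "homotopic K X Y (cm_comp X (cm_of K X \<alpha>) (cm_id X)) (cm_comp X (cm_id Y) (cm_of K X \<alpha>))"
    proof (rule XY.hmap_homotopic)
      show c1: "cm_comp X (cm_of K X \<alpha>) (cm_id X) \<in> chain_maps K X Y"
        by (rule cm_comp_chain_maps[OF K X X Y a XY.X.cm_id_chain])
      show c2: "cm_comp X (cm_id Y) (cm_of K X \<alpha>) \<in> chain_maps K X Y"
        by (rule cm_comp_chain_maps[OF K X Y Y XY.Y.cm_id_chain a])
      show "hmap K X Y (cm_comp X (cm_of K X \<alpha>) (cm_id X)) = hmap K X Y (cm_comp X (cm_id Y) (cm_of K X \<alpha>))"
        by (rule XY.graded_eqI[OF XY.hmap_graded[OF c1] XY.hmap_graded[OF c2]])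
          (simp add: hmap_comp_apply[OF K X X Y a XY.X.cm_id_chain] hmap_comp_apply[OF K X Y Y XY.Y.cm_id_chain a]
            XY.X.hmap_id XY.Y.hmap_id XY.hmap_cm_of[OF \<alpha>] XY.graded_closed[OF \<alpha>])
    qed
    ultimately show ?thesis
      using mor_nonempty[OF K X Y \<alpha>] mor_nonempty[OF K Y Z \<beta>] X a by blast
  qed
  show ?thesis unfolding der_comp_def by (rule Union_constant[OF ex all])
qed

section \<open>The shift functor\<close>

lemma cx_shift_sel [simp]:
  "csp (cx_shift X) n = csp X (n + 1)"
  "cdf (cx_shift X) n = (\<lambda>x\<in>carrier (csp X (n + 1)). \<ominus>\<^bsub>csp X (n + 2)\<^esub> cdf X (n + 1) x)"
  by (simp_all add: cx_shift_def)

lemma lin_uminus_map: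
  assumes f: "f \<in> lin_maps K V W" and V: "Module.module K V" and W: "Module.module K W"
  shows "(\<lambda>x\<in>carrier V. \<ominus>\<^bsub>W\<^esub> f x) \<in> lin_maps K V W"
proof -
  interpret W: Module.module K W by fact
  note [simp] = lin_closed[OF f]
  show ?thesis
    by (rule lin_restrictI)
      (simp_all add: V lin_add[OF f] lin_smult[OF f] W.smult_r_minus W.M.minus_add)
qed

lemma (in bounded_complex) shift_bounded: "cx_shift X \<in> bounded_complexes K"
  unfolding bounded_complexes_def
proof (intro CollectI conjI allI ballI)
  interpret M: abelian_group "csp X i" for i by (rule ab)
  show "fin_dim_space K (csp (cx_shift X) n)" for n by (simp add: fd)
  show "cdf (cx_shift X) n \<in> lin_maps K (csp (cx_shift X) n) (csp (cx_shift X) (n + 1))" for n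
    using lin_uminus_map[OF d_lin mod mod, of "n + 1"] by (simp add: add.assoc)
  show "cdf (cx_shift X) (n + 1) (cdf (cx_shift X) n x) = \<zero>\<^bsub>csp (cx_shift X) (n + 2)\<^esub>"
    if "x \<in> carrier (csp (cx_shift X) n)" for n x
  proof -
    have x: "x \<in> carrier (csp X (n + 1))" using that by simp
    have dx: "cdf X (n + 1) x \<in> carrier (csp X (n + 2))" using x by simp
    have "\<ominus>\<^bsub>csp X (n + 2)\<^esub> cdf X (n + 1) x = \<zero>\<^bsub>csp X (n + 2)\<^esub> \<ominus>\<^bsub>csp X (n + 2)\<^esub> cdf X (n + 1) x"
      using dx by (simp add: a_minus_def)
    then have "cdf X (n + 2) (\<ominus>\<^bsub>csp X (n + 2)\<^esub> cdf X (n + 1) x) = \<zero>\<^bsub>csp X (n + 3)\<^esub>"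
      using d_minus[OF M.zero_closed dx] d_d[OF x, of "n + 2"] d_zero[of "n + 2"] by (simp add: add.commute)
    then show ?thesis
      using x dx by (simp add: add.assoc)
  qed
  obtain N where "\<forall>n. \<bar>n\<bar> > N \<longrightarrow> carrier (csp X n) = {\<zero>\<^bsub>csp X n\<^esub>}"
    using X by (auto simp: bounded_complexes_def)
  then show "\<exists>N. \<forall>n. \<bar>n\<bar> > N \<longrightarrow> carrier (csp (cx_shift X) n) = {\<zero>\<^bsub>csp (cx_shift X) n\<^esub>}"
    by (intro exI[of _ "N + 1"]) simp
qed

text \<open>The sign in the shifted differential does not change its image, since a subspace is
  closed under negation.\<close>

lemma (in bounded_complex) shift_coboundaries: "coboundaries (cx_shift X) n = coboundaries X (n + 1)"
proof -
  interpret M: abelian_group "csp X i" for i by (rule ab)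
  have e: "n - 1 + 2 = n + 1" by simp
  have "coboundaries (cx_shift X) n = (\<lambda>b. \<ominus>\<^bsub>csp X (n + 1)\<^esub> b) ` coboundaries X (n + 1)"
    unfolding coboundaries_def by (auto simp: e image_image)
  also have "\<dots> = coboundaries X (n + 1)"
  proof (intro equalityI subsetI)
    fix b assume b: "b \<in> coboundaries X (n + 1)"
    then have "\<ominus>\<^bsub>csp X (n + 1)\<^esub> b \<in> coboundaries X (n + 1)" "b \<in> carrier (csp X (n + 1))"
      using submodule_uminus[OF submodule_coboundaries b] submodule.subset[OF submodule_coboundaries, of "n + 1"]
      by blast+
    moreover from this have "b = \<ominus>\<^bsub>csp X (n + 1)\<^esub> (\<ominus>\<^bsub>csp X (n + 1)\<^esub> b)" by simp
    ultimately show "b \<in> (\<lambda>b. \<ominus>\<^bsub>csp X (n + 1)\<^esub> b) ` coboundaries X (n + 1)" by blast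
  qed (use submodule_uminus[OF submodule_coboundaries] in blast)
  finally show ?thesis .
qed

lemma (in bounded_complex) shift_cocycles: "cocycles (cx_shift X) n = cocycles X (n + 1)"
proof -
  interpret M: abelian_group "csp X i" for i by (rule ab)
  have e: "n + 1 + 1 = n + 2" by simp
  have "\<ominus>\<^bsub>csp X (n + 2)\<^esub> y = \<zero>\<^bsub>csp X (n + 2)\<^esub> \<longleftrightarrow> y = \<zero>\<^bsub>csp X (n + 2)\<^esub>"
    if y: "y \<in> carrier (csp X (n + 2))" for y
  proof
    assume "\<ominus>\<^bsub>csp X (n + 2)\<^esub> y = \<zero>\<^bsub>csp X (n + 2)\<^esub>"
    then have "\<ominus>\<^bsub>csp X (n + 2)\<^esub> (\<ominus>\<^bsub>csp X (n + 2)\<^esub> y) = \<ominus>\<^bsub>csp X (n + 2)\<^esub> \<zero>\<^bsub>csp X (n + 2)\<^esub>" by simp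
    then show "y = \<zero>\<^bsub>csp X (n + 2)\<^esub>" using y by simp
  qed simp
  then show ?thesis
    unfolding cocycles_def by (auto simp: e)
qed

lemma (in bounded_complex) shift_cohomology: "cohomology (cx_shift X) n = cohomology X (n + 1)"
  unfolding cohomology_def shift_coboundaries shift_cocycles by simp

lemma (in bounded_complex_pair) shift_cohomology_map:
  "cohomology_map (cx_shift Y) (cm_shift f) n = cohomology_map Y f (n + 1)"
  unfolding cohomology_map_def Y.shift_coboundaries by (simp add: cm_shift_def)

lemma (in bounded_complex_pair) shift_chain_maps:
  assumes f: "f \<in> chain_maps K X Y"
  shows "cm_shift f \<in> chain_maps K (cx_shift X) (cx_shift Y)"
  unfolding chain_maps_def
proof (intro CollectI conjI allI ballI)
  show "cm_shift f n \<in> lin_maps K (csp (cx_shift X) n) (csp (cx_shift Y) n)" for n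
    using f_lin[OF f] by (simp add: cm_shift_def)
  fix n x assume "x \<in> carrier (csp (cx_shift X) n)"
  then have x: "x \<in> carrier (csp X (n + 1))" by simp
  interpret M: abelian_group "csp X i" for i by (rule X.ab)
  interpret N: abelian_group "csp Y i" for i by (rule Y.ab)
  have dx: "cdf X (n + 1) x \<in> carrier (csp X (n + 2))" using x by simp
  have fdx: "f (n + 2) (cdf X (n + 1) x) \<in> carrier (csp Y (n + 2))" by (rule f_closed[OF f dx])
  have "f (n + 2) (\<ominus>\<^bsub>csp X (n + 2)\<^esub> cdf X (n + 1) x) =
      f (n + 2) (\<zero>\<^bsub>csp X (n + 2)\<^esub> \<ominus>\<^bsub>csp X (n + 2)\<^esub> cdf X (n + 1) x)"
    using dx by (simp add: a_minus_def)
  also have "\<dots> = \<ominus>\<^bsub>csp Y (n + 2)\<^esub> f (n + 2) (cdf X (n + 1) x)"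
    using dx fdx lin_minus[OF f_lin[OF f] X.mod Y.mod M.zero_closed dx]
    by (simp add: f_zero[OF f]) (simp add: a_minus_def)
  also have "f (n + 2) (cdf X (n + 1) x) = cdf Y (n + 1) (f (n + 1) x)"
    using f_d[OF f x, of "n + 2"] by simp
  finally show "cm_shift f (n + 1) (cdf (cx_shift X) n x) = cdf (cx_shift Y) n (cm_shift f n x)"
    using x f_closed[OF f x] by (simp add: cm_shift_def add.assoc)
qed

lemma (in bounded_complex_pair) shift_quasi_isos:
  assumes f: "f \<in> quasi_isos K X Y"
  shows "cm_shift f \<in> quasi_isos K (cx_shift X) (cx_shift Y)"
  using f shift_chain_maps[of f]
  by (simp add: quasi_isos_def X.shift_cohomology Y.shift_cohomology shift_cohomology_map)

lemma (in bounded_complex_pair) shift_homotopic: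
  assumes "homotopic K X Y f g"
  shows "homotopic K (cx_shift X) (cx_shift Y) (cm_shift f) (cm_shift g)"
proof -
  interpret M: abelian_group "csp X i" for i by (rule X.ab)
  interpret N: abelian_group "csp Y i" for i by (rule Y.ab)
  obtain k where k: "\<And>n. k n \<in> lin_maps K (csp X n) (csp Y (n - 1))"
    "\<And>n x. x \<in> carrier (csp X n) \<Longrightarrow>
      f n x \<ominus>\<^bsub>csp Y n\<^esub> g n x = cdf Y (n - 1) (k n x) \<oplus>\<^bsub>csp Y n\<^esub> k (n + 1) (cdf X n x)"
    using assms by (auto simp: homotopic_def)
  have kl: "k (n + 1) \<in> lin_maps K (csp X (n + 1)) (csp Y n)" for n
    using k(1)[of "n + 1"] by simp
  \<comment> \<open>The homotopy changes sign together with the differential, so the products d k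
    and k d keep theirs.\<close>
  define k' where "k' n = (\<lambda>x\<in>carrier (csp X (n + 1)). \<ominus>\<^bsub>csp Y n\<^esub> k (n + 1) x)" for n
  have k': "k' n \<in> lin_maps K (csp X (n + 1)) (csp Y n)" for n
    unfolding k'_def by (rule lin_uminus_map[OF kl X.mod Y.mod])
  have neg: "f' (\<ominus>\<^bsub>V\<^esub> x) = \<ominus>\<^bsub>W\<^esub> f' x" if "f' \<in> lin_maps K V W" "Module.module K V" "Module.module K W" "x \<in> carrier V"
    for f' and V W :: "('a, 'v) module" and x
    by (rule mod_hom.f_neg[OF lin_mod_hom[OF that(1-3)] that(4)])
  show ?thesis
    unfolding homotopic_def
  proof (intro exI[of _ k'] conjI allI ballI)
    show "k' n \<in> lin_maps K (csp (cx_shift X) n) (csp (cx_shift Y) (n - 1))" for n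
      using k' by simp
    fix n x assume "x \<in> carrier (csp (cx_shift X) n)"
    then have x: "x \<in> carrier (csp X (n + 1))" by simp
    have dx: "cdf X (n + 1) x \<in> carrier (csp X (n + 2))" using x by simp
    have kx: "k (n + 1) x \<in> carrier (csp Y n)" by (rule lin_closed[OF kl x])
    have kl2: "k (n + 2) \<in> lin_maps K (csp X (n + 2)) (csp Y (n + 1))"
      using kl[of "n + 1"] by (simp add: add.assoc)
    have kdx: "k (n + 2) (cdf X (n + 1) x) \<in> carrier (csp Y (n + 1))" by (rule lin_closed[OF kl2 dx])
    have dkx: "cdf Y n (k (n + 1) x) \<in> carrier (csp Y (n + 1))" using kx by simp
    have e: "n - 1 + 2 = n + 1" by simp
    have 1: "cdf (cx_shift Y) (n - 1) (k' n x) = cdf Y n (k (n + 1) x)"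
      using x kx dkx by (simp add: k'_def neg[OF Y.d_lin Y.mod Y.mod] e)
    have 2: "k' (n + 1) (cdf (cx_shift X) n x) = k (n + 2) (cdf X (n + 1) x)"
      using x dx kdx by (simp add: k'_def add.assoc neg[OF kl2 X.mod Y.mod])
    show "cm_shift f n x \<ominus>\<^bsub>csp (cx_shift Y) n\<^esub> cm_shift g n x =
      cdf (cx_shift Y) (n - 1) (k' n x) \<oplus>\<^bsub>csp (cx_shift Y) n\<^esub> k' (n + 1) (cdf (cx_shift X) n x)"
      unfolding 1 2 using k(2)[OF x] by (simp add: cm_shift_def add.assoc)
  qed
qed

lemma cm_shift_comp: "cm_shift (cm_comp V s u) = cm_comp (cx_shift V) (cm_shift s) (cm_shift u)"
  by (simp add: cm_shift_def cm_comp_def)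

fun roof_shift :: "('a, 'v) roof \<Rightarrow> ('a, 'v) roof" where
  "roof_shift (Roof X W Y s f) = Roof (cx_shift X) (cx_shift W) (cx_shift Y) (cm_shift s) (cm_shift f)"

lemma is_roof_shift:
  assumes K: "field K" and r: "is_roof K r"
  shows "is_roof K (roof_shift r)"
proof (cases r)
  case (Roof X W Y s f)
  note r = is_roofD[OF r[unfolded Roof]]
  interpret WX: bounded_complex_pair K W X by (rule bounded_complex_pairI[OF K r(2,1)])
  interpret WY: bounded_complex_pair K W Y by (rule bounded_complex_pairI[OF K r(2,3)])
  show ?thesis
    unfolding Roof roof_shift.simps is_roof.simps
    by (intro conjI WX.X.shift_bounded WX.Y.shift_bounded WY.Y.shift_bounded WX.shift_quasi_isos
      WY.shift_chain_maps r)
qed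

lemma roof_equiv_shift:
  assumes K: "field K" and eq: "roof_equiv K r r'"
  shows "roof_equiv K (roof_shift r) (roof_shift r')"
proof -
  obtain X W Y s f where r: "r = Roof X W Y s f" by (cases r)
  obtain X' W' Y' s' f' where r': "r' = Roof X' W' Y' s' f'" by (cases r')
  from eq obtain V u u' where isr: "is_roof K r" "is_roof K r'"
    and e: "X' = X" "Y' = Y" and V: "V \<in> bounded_complexes K"
    and u: "u \<in> chain_maps K V W" "u' \<in> chain_maps K V W'"
    and su: "cm_comp V s u \<in> quasi_isos K V X"
    and hs: "homotopic K V X (cm_comp V s u) (cm_comp V s' u')"
    and hf: "homotopic K V Y (cm_comp V f u) (cm_comp V f' u')"
    unfolding r r' roof_equiv.simps by blast
  note R = is_roofD[OF isr(1)[unfolded r]] and R' = is_roofD[OF isr(2)[unfolded r']]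
  interpret VW: bounded_complex_pair K V W by (rule bounded_complex_pairI[OF K V R(2)])
  interpret VW': bounded_complex_pair K V W' by (rule bounded_complex_pairI[OF K V R'(2)])
  interpret VX: bounded_complex_pair K V X by (rule bounded_complex_pairI[OF K V R(1)])
  interpret VY: bounded_complex_pair K V Y by (rule bounded_complex_pairI[OF K V R(3)])
  have "is_roof K (roof_shift r)" "is_roof K (roof_shift r')"
    using is_roof_shift[OF K] isr by blast+
  moreover have "cx_shift V \<in> bounded_complexes K" by (rule VW.X.shift_bounded)
  moreover note VW.shift_chain_maps[OF u(1)] VW'.shift_chain_maps[OF u(2)]
    VX.shift_quasi_isos[OF su, unfolded cm_shift_comp]
    VX.shift_homotopic[OF hs, unfolded cm_shift_comp]
    VY.shift_homotopic[OF hf, unfolded cm_shift_comp]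
  ultimately show ?thesis
    unfolding r r' e roof_shift.simps roof_equiv.simps by blast
qed

text \<open>Shifting respects equivalence of roofs, so the shifted roofs of one class all lie in a
  single class. Some graded map represents it, by \<open>represents_exists\<close>.\<close>

lemma der_shift_closed:
  assumes K: "field K" and X: "X \<in> bounded_complexes K" and Y: "Y \<in> bounded_complexes K"
    and a: "a \<in> der_hom K X Y"
  shows "der_shift K a \<in> der_hom K (cx_shift X) (cx_shift Y)"
proof -
  obtain \<alpha> where \<alpha>: "\<alpha> \<in> graded_maps K X Y" "a = mor K X Y \<alpha>"
    using a unfolding der_hom_eq[OF K X Y] by blast
  let ?r = "Roof X X Y (cm_id X) (cm_of K X \<alpha>)"
  have r: "?r \<in> a" unfolding \<alpha>(2) by (rule mor_nonempty[OF K X Y \<alpha>(1)])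
  then have rep: "represents K \<alpha> ?r" unfolding \<alpha>(2) Roof_in_mor by blast
  then have "is_roof K ?r" by simp
  from is_roof_shift[OF K this] have isr: "is_roof K (roof_shift ?r)" .
  then obtain \<beta> where \<beta>: "represents K \<beta> (roof_shift ?r)"
    unfolding roof_shift.simps using represents_exists[OF K] by blast
  have "der_shift K a = mor K (cx_shift X) (cx_shift Y) \<beta>"
    unfolding der_shift_def
  proof (rule Union_constant)
    show "{roof_class K (Roof (cx_shift X) (cx_shift W) (cx_shift Y) (cm_shift s) (cm_shift f)) |
        X W Y s f. Roof X W Y s f \<in> a} \<noteq> {}" using r by blast
    fix c assume "c \<in> {roof_class K (Roof (cx_shift X) (cx_shift W) (cx_shift Y) (cm_shift s) (cm_shift f)) |
        X W Y s f. Roof X W Y s f \<in> a}"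
    then obtain W s f where c: "represents K \<alpha> (Roof X W Y s f)" and
      c_eq: "c = roof_class K (Roof (cx_shift X) (cx_shift W) (cx_shift Y) (cm_shift s) (cm_shift f))"
      unfolding \<alpha>(2) Roof_in_mor by blast
    have "roof_equiv K (roof_shift ?r) (roof_shift (Roof X W Y s f))"
      by (rule roof_equiv_shift[OF K represents_roof_equiv[OF K rep c]])
    from roof_equiv_represents[OF K this[unfolded roof_shift.simps] \<beta>[unfolded roof_shift.simps]]
    show "c = mor K (cx_shift X) (cx_shift Y) \<beta>"
      unfolding c_eq by (rule roof_class_eq_mor[OF K])
  qed
  moreover have "\<beta> \<in> graded_maps K (cx_shift X) (cx_shift Y)" using \<beta> by simp
  ultimately show ?thesis
    using der_hom_eq[OF K bounded_complex.shift_bounded[OF bounded_complex.intro[OF K X]]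
      bounded_complex.shift_bounded[OF bounded_complex.intro[OF K Y]]] by simp
qed

section \<open>Cohomology dimensions and standard complexes\<close>

definition hdim :: "('a, 'r) ring_scheme \<Rightarrow> ('a, 'v) cplx \<Rightarrow> int \<Rightarrow> nat" where
  "hdim K X n = vectorspace.dim K (harmonic K X n)"

text \<open>The contractions of X and of its shift are separate choices, so the harmonic subspaces
  need not coincide. They are compared through the common cohomology: projecting one onto the other
  does not change the class.\<close>

lemma (in bounded_complex) hdim_shift: "hdim K (cx_shift X) n = hdim K X (n + 1)"
proof -
  interpret S: bounded_complex K "cx_shift X" by (intro bounded_complex.intro K shift_bounded)
  define q where "q = (\<lambda>x\<in>carrier (H (n + 1)). harm_proj K (cx_shift X) n x)"
  have z: "cdf (cx_shift X) n x = \<zero>\<^bsub>csp (cx_shift X) (n + 1)\<^esub>" if "x \<in> carrier (H (n + 1))" for x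
  proof -
    have "x \<in> cocycles X (n + 1)" using that H_closed[OF that] by (simp add: cocycles_def)
    then have "x \<in> cocycles (cx_shift X) n" unfolding shift_cocycles .
    then show ?thesis unfolding cocycles_def by blast
  qed
  have q: "q \<in> lin_maps K (H (n + 1)) (S.H n)"
  proof -
    have "q = compose (carrier (H (n + 1))) (S.p n) (\<lambda>x\<in>carrier (H (n + 1)). x)"
      by (auto simp: q_def compose_def)
    then show ?thesis
      using lin_comp[OF S.p_lin_H[of n, simplified] incl_lin[of "n + 1"] mod_H] by simp
  qed
  have "bij_betw q (carrier (H (n + 1))) (carrier (S.H n))"
  proof -
    have cl: "q ` carrier (H (n + 1)) \<subseteq> carrier (S.H n)" using lin_closed[OF q] by blast
    have "bij_betw (\<lambda>x. coboundaries X (n + 1) +>\<^bsub>csp X (n + 1)\<^esub> x) (carrier (H (n + 1))) (cohomology (cx_shift X) n)"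
      using harm_cohomology[of "n + 1"] by (simp add: shift_cohomology)
    then have "bij_betw ((\<lambda>x. coboundaries (cx_shift X) n +>\<^bsub>csp (cx_shift X) n\<^esub> x) \<circ> q)
        (carrier (H (n + 1))) (cohomology (cx_shift X) n)"
    proof (rule bij_betw_cong[THEN iffD1, rotated])
      fix x assume x: "x \<in> carrier (H (n + 1))"
      then have "x \<in> carrier (csp (cx_shift X) n)" using H_closed by simp
      from S.coset_p[OF this z[OF x]]
      show "coboundaries X (n + 1) +>\<^bsub>csp X (n + 1)\<^esub> x =
        ((\<lambda>x. coboundaries (cx_shift X) n +>\<^bsub>csp (cx_shift X) n\<^esub> x) \<circ> q) x"
        using x by (simp add: q_def shift_coboundaries)
    qed
    then show ?thesis
      by (rule bij_betw_comp_iff2[OF S.harm_cohomology cl, THEN iffD2])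
  qed
  from lin_bij_dim[OF K q fd_H S.mod_H this] show ?thesis by (simp add: hdim_def)
qed

lemma eq_singletonI: "(\<And>x. x \<in> A \<Longrightarrow> x = z) \<Longrightarrow> z \<in> A \<Longrightarrow> A = {z}"
  by blast

definition std_complex :: "('a, 'r) ring_scheme \<Rightarrow> (int \<Rightarrow> nat) \<Rightarrow> ('a, 'a list) cplx" where
  "std_complex K d = \<lparr>csp = (\<lambda>n. std_space K (d n)),
     cdf = (\<lambda>n. \<lambda>x\<in>carrier (std_space K (d n)). \<zero>\<^bsub>std_space K (d (n + 1))\<^esub>)\<rparr>"

lemma std_complex_sel [simp]: "csp (std_complex K d) n = std_space K (d n)"
  by (simp add: std_complex_def)

lemma std_complex_bounded:
  assumes K: "field K" and d: "finite {n. d n \<noteq> 0}"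
  shows "std_complex K d \<in> bounded_complexes K"
proof -
  interpret K: field K by fact
  note m = std_space_module[OF K.is_cring]
  obtain N where N: "\<And>n. d n \<noteq> 0 \<Longrightarrow> \<bar>n\<bar> \<le> N"
  proof
    fix n assume "d n \<noteq> 0"
    then have "\<bar>n\<bar> \<in> abs ` {n. d n \<noteq> 0}" by blast
    then show "\<bar>n\<bar> \<le> Max (abs ` {n. d n \<noteq> 0})" using d by (intro Max_ge) auto
  qed
  show ?thesis
    unfolding bounded_complexes_def
  proof (intro CollectI conjI allI ballI)
    show "\<exists>N. \<forall>n. \<bar>n\<bar> > N \<longrightarrow> carrier (csp (std_complex K d) n) = {\<zero>\<^bsub>csp (std_complex K d) n\<^esub>}"
    proof (intro exI[of _ N] allI impI)
      fix n :: int assume "\<bar>n\<bar> > N"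
      then have "d n = 0" using N[of n] by linarith
      then show "carrier (csp (std_complex K d) n) = {\<zero>\<^bsub>csp (std_complex K d) n\<^esub>}" by auto
    qed
    fix n
    show "fin_dim_space K (csp (std_complex K d) n)"
      unfolding std_complex_sel by (rule std_space_fd[OF K.is_cring])
    show "cdf (std_complex K d) n \<in> lin_maps K (csp (std_complex K d) n) (csp (std_complex K d) (n + 1))"
      unfolding std_complex_sel using lin_zero_map[OF m m] by (simp add: std_complex_def)
    fix x assume "x \<in> carrier (csp (std_complex K d) n)"
    then show "cdf (std_complex K d) (n + 1) (cdf (std_complex K d) n x) = \<zero>\<^bsub>csp (std_complex K d) (n + 2)\<^esub>"
      by (auto simp: std_complex_def add.assoc)
  qed
qed

lemma harm_std_complex:
  assumes "field K" "finite {n. d n \<noteq> 0}"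
  shows "harmonic K (std_complex K d) n = std_space K (d n)"
proof -
  interpret bounded_complex K "std_complex K d"
    by (intro bounded_complex.intro assms std_complex_bounded)
  have "harmonic K (std_complex K d) n = csp (std_complex K d) n"
    by (rule zero_diff) (simp add: std_complex_def)
  then show ?thesis by simp
qed

lemma hdim_std_complex:
  assumes "field K" "finite {n. d n \<noteq> 0}"
  shows "hdim K (std_complex K d) = d"
  by (rule HOL.ext) (simp add: hdim_def harm_std_complex[OF assms] dim_std_space[OF assms(1)])

lemma hdim_finite:
  assumes K: "field K" and X: "X \<in> bounded_complexes K"
  shows "finite {n. hdim K X n \<noteq> 0}"
proof -
  interpret bounded_complex K X by (rule bounded_complex.intro[OF K X])
  obtain N where N: "\<And>n. \<bar>n\<bar> > N \<Longrightarrow> carrier (csp X n) = {\<zero>\<^bsub>csp X n\<^esub>}"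
    using X by (auto simp: bounded_complexes_def)
  have "hdim K X n = 0" if "\<bar>n\<bar> > N" for n
  proof -
    have "carrier (H n) = {\<zero>\<^bsub>H n\<^esub>}"
    proof (intro equalityI subsetI)
      fix x assume "x \<in> carrier (H n)"
      then show "x \<in> {\<zero>\<^bsub>H n\<^esub>}" using H_closed N[OF that] by force
    next
      fix x assume "x \<in> {\<zero>\<^bsub>H n\<^esub>}"
      then have "x = \<zero>\<^bsub>csp X n\<^esub>" by simp
      moreover have "\<zero>\<^bsub>csp X n\<^esub> \<in> carrier (csp X n)" using N[OF that] by simp
      ultimately show "x \<in> carrier (H n)" using p_in_H[of "\<zero>\<^bsub>csp X n\<^esub>" n] by simp
    qed
    then show ?thesis unfolding hdim_def by (rule dim_eq_0_iff[OF K fd_H, THEN iffD2])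
  qed
  then have *: "\<bar>n\<bar> \<le> N" if "hdim K X n \<noteq> 0" for n using that by (meson linorder_not_le)
  have "{n. hdim K X n \<noteq> 0} \<subseteq> {- N..N}"
  proof
    fix n assume "n \<in> {n. hdim K X n \<noteq> 0}"
    then have "\<bar>n\<bar> \<le> N" using *[of n] by simp
    then show "n \<in> {- N..N}" by (simp add: abs_le_iff)
  qed
  then show ?thesis by (rule finite_subset) simp
qed

lemma hdim_0_carrier:
  assumes K: "field K" and X: "X \<in> bounded_complexes K" and "hdim K X n = 0"
    and x: "x \<in> carrier (harmonic K X n)"
  shows "x = \<zero>\<^bsub>csp X n\<^esub>"
  using dim_eq_0_iff[OF K bounded_complex.fd_H[OF bounded_complex.intro[OF K X]], of n] assms(3) x
  by (simp add: hdim_def)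

definition graded_zero :: "('a, 'r) ring_scheme \<Rightarrow> ('a, 'v) cplx \<Rightarrow> ('a, 'v) cplx \<Rightarrow> 'v cmap" where
  "graded_zero K X Y = (\<lambda>n. \<lambda>x\<in>carrier (harmonic K X n). \<zero>\<^bsub>csp Y n\<^esub>)"

definition graded_id :: "('a, 'r) ring_scheme \<Rightarrow> ('a, 'v) cplx \<Rightarrow> 'v cmap" where
  "graded_id K X = (\<lambda>n. \<lambda>x\<in>carrier (harmonic K X n). x)"

lemma graded_zero_maps:
  assumes "field K" "X \<in> bounded_complexes K" "Y \<in> bounded_complexes K"
  shows "graded_zero K X Y \<in> graded_maps K X Y"
proof -
  interpret bounded_complex_pair K X Y by (rule bounded_complex_pairI[OF assms])
  show ?thesis using lin_zero_map[OF X.mod_H Y.mod_H] by (simp add: graded_maps_def graded_zero_def)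
qed

lemma graded_id_maps:
  assumes "field K" "X \<in> bounded_complexes K"
  shows "graded_id K X \<in> graded_maps K X X"
  using bounded_complex.graded_id[OF bounded_complex.intro[OF assms]] by (simp add: graded_id_def)

section \<open>Isomorphisms, zero objects and direct sums read off from dimensions\<close>

locale derived =
  fixes K :: "'a ring"
  assumes K: "field K"
begin

abbreviation "T \<equiv> Db_mod K"
abbreviation "B \<equiv> bounded_complexes K :: ('a, 'a list) cplx set"

lemma T_sel [simp]:
  "tob T = B" "thom T = der_hom K" "tcmp T = der_comp K" "tsh T = cx_shift" "tdt T = der_triangles K"
  by (simp_all add: Db_mod_def der_cat_def)

lemma tid_eq: "X \<in> B \<Longrightarrow> tid T X = mor K X X (graded_id K X)"
  using der_map_eq_mor[OF K _ _ bounded_complex.cm_id_chain, of X] bounded_complex.hmap_id[of K X]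
  by (simp add: Db_mod_def der_cat_def bounded_complex_def K graded_id_def)

lemma pair: "X \<in> B \<Longrightarrow> Y \<in> B \<Longrightarrow> bounded_complex_pair K X Y"
  by (rule bounded_complex_pairI[OF K])

lemma homE:
  assumes "f \<in> der_hom K X Y" "X \<in> B" "Y \<in> B"
  obtains \<alpha> where "\<alpha> \<in> graded_maps K X Y" "f = mor K X Y \<alpha>"
  using assms der_hom_eq[OF K assms(2,3)] by blast

lemma mor_hom: "X \<in> B \<Longrightarrow> Y \<in> B \<Longrightarrow> \<alpha> \<in> graded_maps K X Y \<Longrightarrow> mor K X Y \<alpha> \<in> der_hom K X Y"
  using der_hom_eq[OF K] by blast

lemma mor_eq_iff: "X \<in> B \<Longrightarrow> Y \<in> B \<Longrightarrow> \<alpha> \<in> graded_maps K X Y \<Longrightarrow>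
    mor K X Y \<alpha> = mor K X Y \<beta> \<longleftrightarrow> \<alpha> = \<beta>"
  using mor_inj[OF K] by blast

lemmas comp_mor = der_comp_mor[OF K]
lemmas comp_maps = graded_comp_graded_maps[OF K]

lemma comp_apply: "x \<in> carrier (harmonic K X n) \<Longrightarrow> graded_comp K X \<beta> \<alpha> n x = \<beta> n (\<alpha> n x)"
  by (simp add: graded_comp_def compose_eq)

lemma closed: "X \<in> B \<Longrightarrow> Y \<in> B \<Longrightarrow> \<alpha> \<in> graded_maps K X Y \<Longrightarrow> x \<in> carrier (harmonic K X n) \<Longrightarrow>
    \<alpha> n x \<in> carrier (harmonic K Y n)"
  using bounded_complex_pair.graded_closed[OF pair] .

lemma gzero: "X \<in> B \<Longrightarrow> Y \<in> B \<Longrightarrow> \<alpha> \<in> graded_maps K X Y \<Longrightarrow> \<alpha> n \<zero>\<^bsub>csp X n\<^esub> = \<zero>\<^bsub>csp Y n\<^esub>"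
  using bounded_complex_pair.graded_zero[OF pair] .

lemma graded_eqI: "X \<in> B \<Longrightarrow> Y \<in> B \<Longrightarrow> \<alpha> \<in> graded_maps K X Y \<Longrightarrow> \<beta> \<in> graded_maps K X Y \<Longrightarrow>
    (\<And>n x. x \<in> carrier (harmonic K X n) \<Longrightarrow> \<alpha> n x = \<beta> n x) \<Longrightarrow> \<alpha> = \<beta>"
  using bounded_complex_pair.graded_eqI[OF pair] .

lemmas id_maps = graded_id_maps[OF K]
lemmas zero_maps = graded_zero_maps[OF K]

lemma iso_mor_mor_iff:
  assumes X: "X \<in> B" and Y: "Y \<in> B" and \<alpha>: "\<alpha> \<in> graded_maps K X Y"
  shows "iso_mor T X Y (mor K X Y \<alpha>) \<longleftrightarrow>
    (\<forall>n. bij_betw (\<alpha> n) (carrier (harmonic K X n)) (carrier (harmonic K Y n)))"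
proof
  assume "iso_mor T X Y (mor K X Y \<alpha>)"
  then obtain g where g: "g \<in> der_hom K Y X" "der_comp K g (mor K X Y \<alpha>) = tid T X"
    "der_comp K (mor K X Y \<alpha>) g = tid T Y" unfolding iso_mor_def T_sel by blast
  obtain \<beta> where \<beta>: "\<beta> \<in> graded_maps K Y X" "g = mor K Y X \<beta>" using homE[OF g(1) Y X] by blast
  have 1: "graded_comp K X \<beta> \<alpha> = graded_id K X"
    using g(2) mor_eq_iff[OF X X comp_maps[OF X Y X \<beta>(1) \<alpha>]]
    by (simp add: \<beta>(2) comp_mor[OF X Y X \<beta>(1) \<alpha>] tid_eq[OF X])
  have 2: "graded_comp K Y \<alpha> \<beta> = graded_id K Y"
    using g(3) mor_eq_iff[OF Y Y comp_maps[OF Y X Y \<alpha> \<beta>(1)]]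
    by (simp add: \<beta>(2) comp_mor[OF Y X Y \<alpha> \<beta>(1)] tid_eq[OF Y])
  show "\<forall>n. bij_betw (\<alpha> n) (carrier (harmonic K X n)) (carrier (harmonic K Y n))"
  proof
    fix n
    show "bij_betw (\<alpha> n) (carrier (harmonic K X n)) (carrier (harmonic K Y n))"
    proof (rule bij_betw_byWitness[where f' = "\<beta> n"])
      show "\<forall>a\<in>carrier (harmonic K X n). \<beta> n (\<alpha> n a) = a"
        using fun_cong[OF fun_cong[OF 1, of n]] comp_apply[of _ X n \<beta> \<alpha>] by (simp add: graded_id_def)
      show "\<forall>a\<in>carrier (harmonic K Y n). \<alpha> n (\<beta> n a) = a"
        using fun_cong[OF fun_cong[OF 2, of n]] comp_apply[of _ Y n \<alpha> \<beta>] by (simp add: graded_id_def)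
      show "\<alpha> n ` carrier (harmonic K X n) \<subseteq> carrier (harmonic K Y n)" using closed[OF X Y \<alpha>] by blast
      show "\<beta> n ` carrier (harmonic K Y n) \<subseteq> carrier (harmonic K X n)" using closed[OF Y X \<beta>(1)] by blast
    qed
  qed
next
  assume "\<forall>n. bij_betw (\<alpha> n) (carrier (harmonic K X n)) (carrier (harmonic K Y n))"
  then obtain \<beta> where \<beta>: "\<beta> \<in> graded_maps K Y X"
    "\<And>n x. x \<in> carrier (harmonic K X n) \<Longrightarrow> \<beta> n (\<alpha> n x) = x"
    "\<And>n y. y \<in> carrier (harmonic K Y n) \<Longrightarrow> \<alpha> n (\<beta> n y) = y"
    using graded_inverse[OF K X Y \<alpha>] by metis
  have 1: "graded_comp K X \<beta> \<alpha> = graded_id K X"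
    by (rule graded_eqI[OF X X comp_maps[OF X Y X \<beta>(1) \<alpha>] id_maps[OF X]])
      (simp add: comp_apply graded_id_def \<beta>(2))
  have 2: "graded_comp K Y \<alpha> \<beta> = graded_id K Y"
    by (rule graded_eqI[OF Y Y comp_maps[OF Y X Y \<alpha> \<beta>(1)] id_maps[OF Y]])
      (simp add: comp_apply graded_id_def \<beta>(3))
  show "iso_mor T X Y (mor K X Y \<alpha>)"
    unfolding iso_mor_def T_sel
    by (intro conjI bexI[of _ "mor K Y X \<beta>"] mor_hom X Y \<alpha> \<beta>(1))
      (simp_all add: comp_mor[OF X Y X \<beta>(1) \<alpha>] comp_mor[OF Y X Y \<alpha> \<beta>(1)] 1 2 tid_eq X Y)
qed

lemma iso_of_hdim:
  assumes X: "X \<in> B" and Y: "Y \<in> B" and h: "hdim K X = hdim K Y"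
  obtains \<alpha> where "\<alpha> \<in> graded_maps K X Y" "iso_mor T X Y (mor K X Y \<alpha>)"
proof -
  interpret bounded_complex_pair K X Y by (rule pair[OF X Y])
  have "\<exists>f\<in>lin_maps K (harmonic K X n) (harmonic K Y n). bij_betw f (carrier (harmonic K X n)) (carrier (harmonic K Y n))" for n
    using lin_iso_of_dim_eq[OF K X.fd_H Y.fd_H, of n n] fun_cong[OF h, of n] unfolding hdim_def by metis
  then obtain \<alpha> where "\<And>n. \<alpha> n \<in> lin_maps K (harmonic K X n) (harmonic K Y n)"
    "\<And>n. bij_betw (\<alpha> n) (carrier (harmonic K X n)) (carrier (harmonic K Y n))" by metis
  then show ?thesis
    using that[of \<alpha>] iso_mor_mor_iff[OF X Y, of \<alpha>] by (simp add: graded_maps_def)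
qed

lemma hdim_of_iso:
  assumes X: "X \<in> B" and Y: "Y \<in> B" and iso: "iso_mor T X Y f"
  shows "hdim K X = hdim K Y"
proof
  fix n
  interpret bounded_complex_pair K X Y by (rule pair[OF X Y])
  have "f \<in> der_hom K X Y" using iso by (simp add: iso_mor_def)
  then obtain \<alpha> where \<alpha>: "\<alpha> \<in> graded_maps K X Y" "f = mor K X Y \<alpha>" using homE[OF _ X Y] by blast
  have "bij_betw (\<alpha> n) (carrier (harmonic K X n)) (carrier (harmonic K Y n))"
    using iso iso_mor_mor_iff[OF X Y \<alpha>(1)] \<alpha>(2) by blast
  moreover have "\<alpha> n \<in> lin_maps K (harmonic K X n) (harmonic K Y n)" using \<alpha>(1) by (simp add: graded_maps_def)
  ultimately show "hdim K X n = hdim K Y n"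
    unfolding hdim_def using lin_bij_dim[OF K _ X.fd_H Y.mod_H] by blast
qed

lemma iso_obj_iff: "X \<in> B \<Longrightarrow> Y \<in> B \<Longrightarrow> iso_obj T X Y \<longleftrightarrow> hdim K X = hdim K Y"
  unfolding iso_obj_def T_sel using hdim_of_iso iso_of_hdim by metis

lemma graded_disjoint:
  assumes X: "X \<in> B" and Y: "Y \<in> B" and d: "\<And>n. hdim K X n = 0 \<or> hdim K Y n = 0"
    and \<alpha>: "\<alpha> \<in> graded_maps K X Y"
  shows "\<alpha> = graded_zero K X Y"
proof (rule graded_eqI[OF X Y \<alpha> zero_maps[OF X Y]])
  fix n x assume x: "x \<in> carrier (harmonic K X n)"
  show "\<alpha> n x = graded_zero K X Y n x"
    using d[of n]
  proof
    assume "hdim K X n = 0"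
    then have "x = \<zero>\<^bsub>csp X n\<^esub>" using hdim_0_carrier[OF K X] x by blast
    then show ?thesis using gzero[OF X Y \<alpha>] x by (simp add: graded_zero_def)
  next
    assume "hdim K Y n = 0"
    then show ?thesis using hdim_0_carrier[OF K Y _ closed[OF X Y \<alpha> x]] x by (simp add: graded_zero_def)
  qed
qed

text \<open>If Z has only one endomorphism, its identity is the zero map, so every harmonic element
  is 0. Conversely, graded maps into or out of vanishing cohomology are unique.\<close>

lemma zero_obj_iff: "zero_obj T Z \<longleftrightarrow> Z \<in> B \<and> (\<forall>n. hdim K Z n = 0)"
proof
  assume z: "zero_obj T Z"
  then have Z: "Z \<in> B" and u: "\<exists>!f. f \<in> der_hom K Z Z" by (auto simp: zero_obj_def)
  have "mor K Z Z (graded_id K Z) = mor K Z Z (graded_zero K Z Z)"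
    using u mor_hom[OF Z Z id_maps[OF Z]] mor_hom[OF Z Z zero_maps[OF Z Z]] by blast
  then have e: "graded_id K Z = graded_zero K Z Z"
    using mor_eq_iff[OF Z Z id_maps[OF Z]] by blast
  interpret bounded_complex K Z by (rule bounded_complex.intro[OF K Z])
  have "hdim K Z n = 0" for n
  proof -
    have "x = \<zero>\<^bsub>csp Z n\<^esub>" if "x \<in> carrier (H n)" for x
      using fun_cong[OF fun_cong[OF e, of n], of x] that by (simp add: graded_id_def graded_zero_def)
    moreover have "\<zero>\<^bsub>csp Z n\<^esub> \<in> carrier (H n)"
    proof -
      interpret M: Module.module K "H n" by (rule mod_H)
      show ?thesis using M.M.zero_closed by simp
    qed
    ultimately have "carrier (H n) = {\<zero>\<^bsub>csp Z n\<^esub>}" by (rule eq_singletonI)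
    then have "carrier (H n) = {\<zero>\<^bsub>H n\<^esub>}" by simp
    then show ?thesis unfolding hdim_def by (rule dim_eq_0_iff[OF K fd_H, THEN iffD2])
  qed
  with Z show "Z \<in> B \<and> (\<forall>n. hdim K Z n = 0)" by blast
next
  assume *: "Z \<in> B \<and> (\<forall>n. hdim K Z n = 0)"
  then have Z: "Z \<in> B" and h: "\<And>n. hdim K Z n = 0" by auto
  show "zero_obj T Z"
    unfolding zero_obj_def T_sel
  proof (intro conjI ballI Z)
    fix X assume X: "X \<in> B"
    show "\<exists>!f. f \<in> der_hom K X Z"
    proof
      show "mor K X Z (graded_zero K X Z) \<in> der_hom K X Z" by (rule mor_hom[OF X Z zero_maps[OF X Z]])
      show "f = mor K X Z (graded_zero K X Z)" if "f \<in> der_hom K X Z" for f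
        using homE[OF that X Z] graded_disjoint[OF X Z] h by metis
    qed
    show "\<exists>!f. f \<in> der_hom K Z X"
    proof
      show "mor K Z X (graded_zero K Z X) \<in> der_hom K Z X" by (rule mor_hom[OF Z X zero_maps[OF Z X]])
      show "f = mor K Z X (graded_zero K Z X)" if "f \<in> der_hom K Z X" for f
        using homE[OF that Z X] graded_disjoint[OF Z X] h by metis
    qed
  qed
qed

lemma object_exists:
  assumes "finite {n. d n \<noteq> 0}"
  shows "\<exists>X\<in>B. hdim K X = d"
  using std_complex_bounded[OF K assms] hdim_std_complex[OF K assms] by blast

text \<open>Zero morphisms are defined by a factorization through a zero object, and on harmonic
  parts such a factorization sends everything through 0.\<close>

lemma zero_mor_iff:
  assumes X: "X \<in> B" and Y: "Y \<in> B" and \<alpha>: "\<alpha> \<in> graded_maps K X Y"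
  shows "zero_mor T X Y (mor K X Y \<alpha>) \<longleftrightarrow> \<alpha> = graded_zero K X Y"
proof
  assume "zero_mor T X Y (mor K X Y \<alpha>)"
  then obtain Z g h where *: "zero_obj T Z" "g \<in> der_hom K X Z" "h \<in> der_hom K Z Y"
    "mor K X Y \<alpha> = der_comp K h g" unfolding zero_mor_def T_sel by blast
  then have Z: "Z \<in> B" "\<And>n. hdim K Z n = 0" by (simp_all add: zero_obj_iff)
  obtain \<gamma> where \<gamma>: "\<gamma> \<in> graded_maps K X Z" "g = mor K X Z \<gamma>" using homE[OF *(2) X Z(1)] by blast
  obtain \<eta> where \<eta>: "\<eta> \<in> graded_maps K Z Y" "h = mor K Z Y \<eta>" using homE[OF *(3) Z(1) Y] by blast
  have "\<alpha> = graded_comp K X \<eta> \<gamma>"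
    using *(4) mor_eq_iff[OF X Y \<alpha>] by (simp add: \<gamma>(2) \<eta>(2) comp_mor[OF X Z(1) Y \<eta>(1) \<gamma>(1)])
  moreover have "graded_comp K X \<eta> \<gamma> = graded_zero K X Y"
  proof (rule graded_eqI[OF X Y comp_maps[OF X Z(1) Y \<eta>(1) \<gamma>(1)] zero_maps[OF X Y]])
    fix n x assume x: "x \<in> carrier (harmonic K X n)"
    have "\<gamma> n x = \<zero>\<^bsub>csp Z n\<^esub>"
      by (rule hdim_0_carrier[OF K Z(1) Z(2) closed[OF X Z(1) \<gamma>(1) x]])
    then show "graded_comp K X \<eta> \<gamma> n x = graded_zero K X Y n x"
      using x by (simp add: comp_apply graded_zero_def gzero[OF Z(1) Y \<eta>(1)])
  qed
  ultimately show "\<alpha> = graded_zero K X Y" by simp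
next
  assume \<alpha>0: "\<alpha> = graded_zero K X Y"
  obtain Z where Z: "Z \<in> B" "hdim K Z = (\<lambda>_. 0)" using object_exists[of "\<lambda>_. 0"] by auto
  let ?g = "graded_zero K X Z" and ?h = "graded_zero K Z Y"
  note g = zero_maps[OF X Z(1)] and h = zero_maps[OF Z(1) Y]
  have "graded_comp K X ?h ?g = \<alpha>"
  proof (rule graded_eqI[OF X Y comp_maps[OF X Z(1) Y h g] \<alpha>])
    fix n x assume x: "x \<in> carrier (harmonic K X n)"
    have "?h n \<zero>\<^bsub>csp Z n\<^esub> = \<zero>\<^bsub>csp Y n\<^esub>" by (rule gzero[OF Z(1) Y h])
    then show "graded_comp K X ?h ?g n x = \<alpha> n x"
      using x unfolding comp_apply[OF x] \<alpha>0 by (simp add: graded_zero_def[of K X])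
  qed
  then have "mor K X Y \<alpha> = der_comp K (mor K Z Y ?h) (mor K X Z ?g)"
    by (simp add: comp_mor[OF X Z(1) Y h g])
  then show "zero_mor T X Y (mor K X Y \<alpha>)"
    unfolding zero_mor_def T_sel zero_obj_iff
    using Z mor_hom[OF X Z(1) g] mor_hom[OF Z(1) Y h] by force
qed

lemma homs_disjoint:
  assumes "X \<in> B" "Y \<in> B" "f \<in> der_hom K X Y" "\<And>n. hdim K X n = 0 \<or> hdim K Y n = 0"
  shows "zero_mor T X Y f"
  using homE[OF assms(3,1,2)] graded_disjoint[OF assms(1,2,4)] zero_mor_iff[OF assms(1,2)] by metis

text \<open>In degree m, after a choice of coordinates on both sides, the map keeps the first
  coordinate and clears the others; in all other degrees it is zero.\<close>

lemma nonzero_hom: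
  assumes X: "X \<in> B" and Y: "Y \<in> B" and hX: "hdim K X m \<noteq> 0" and hY: "hdim K Y m \<noteq> 0"
  obtains \<alpha> where "\<alpha> \<in> graded_maps K X Y" "\<alpha> \<noteq> graded_zero K X Y"
proof -
  interpret bounded_complex_pair K X Y by (rule pair[OF X Y])
  interpret K: field K by (rule K)
  note m = std_space_module[OF K.is_cring]
  obtain a where a: "hdim K X m = Suc a" using hX not0_implies_Suc by blast
  obtain b where b: "hdim K Y m = Suc b" using hY not0_implies_Suc by blast
  obtain \<phi> where \<phi>: "\<phi> \<in> lin_maps K (std_space K (Suc a)) (harmonic K X m)"
    "bij_betw \<phi> (carrier (std_space K (Suc a))) (carrier (harmonic K X m))"
    using std_space_iso[OF K X.fd_H] a unfolding hdim_def by metis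
  obtain \<psi> where \<psi>: "\<psi> \<in> lin_maps K (std_space K (Suc b)) (harmonic K Y m)"
    "bij_betw \<psi> (carrier (std_space K (Suc b))) (carrier (harmonic K Y m))"
    using std_space_iso[OF K Y.fd_H] b unfolding hdim_def by metis
  define t where "t = (\<lambda>x\<in>carrier (std_space K (Suc a)). hd x # replicate b \<zero>\<^bsub>K\<^esub>)"
  have zip0: "map2 (\<oplus>\<^bsub>K\<^esub>) (replicate b \<zero>\<^bsub>K\<^esub>) (replicate b \<zero>\<^bsub>K\<^esub>) = replicate b \<zero>\<^bsub>K\<^esub>"
    by (auto simp: list_eq_iff_nth_eq)
  have t: "t \<in> lin_maps K (std_space K (Suc a)) (std_space K (Suc b))"
    unfolding t_def
  proof (rule lin_restrictI)
    show "Module.module K (std_space K (Suc a))" by (rule m)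
  qed (auto simp: length_Suc_conv zip0)
  define i where "i = (\<lambda>y\<in>carrier (harmonic K X m). inv_into (carrier (std_space K (Suc a))) \<phi> y)"
  have i: "i \<in> lin_maps K (harmonic K X m) (std_space K (Suc a))"
    unfolding i_def by (rule lin_inv_into[OF \<phi> m X.mod_H])
  define \<tau> where "\<tau> = compose (carrier (harmonic K X m)) \<psi> (compose (carrier (harmonic K X m)) t i)"
  have \<tau>: "\<tau> \<in> lin_maps K (harmonic K X m) (harmonic K Y m)"
    unfolding \<tau>_def by (intro lin_comp[OF \<psi>(1)] lin_comp[OF t i] X.mod_H)
  define \<alpha> where "\<alpha> = (graded_zero K X Y)(m := \<tau>)"
  have \<alpha>: "\<alpha> \<in> graded_maps K X Y"
    using zero_maps[OF X Y] \<tau> by (simp add: \<alpha>_def graded_maps_def)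
  let ?e = "\<one>\<^bsub>K\<^esub> # replicate a \<zero>\<^bsub>K\<^esub>" and ?e' = "\<one>\<^bsub>K\<^esub> # replicate b \<zero>\<^bsub>K\<^esub>"
  have e: "?e \<in> carrier (std_space K (Suc a))" "?e' \<in> carrier (std_space K (Suc b))" by auto
  have \<phi>e: "\<phi> ?e \<in> carrier (harmonic K X m)" by (rule lin_closed[OF \<phi>(1) e(1)])
  have "i (\<phi> ?e) = ?e"
    using \<phi>e e(1) \<phi>(2) by (simp add: i_def bij_betw_def)
  then have 1: "\<tau> (\<phi> ?e) = \<psi> ?e'"
    using \<phi>e e by (simp add: \<tau>_def compose_eq t_def)
  have "\<psi> ?e' \<noteq> \<psi> \<zero>\<^bsub>std_space K (Suc b)\<^esub>"
  proof
    assume "\<psi> ?e' = \<psi> \<zero>\<^bsub>std_space K (Suc b)\<^esub>"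
    then have "?e' = \<zero>\<^bsub>std_space K (Suc b)\<^esub>"
      by (rule inj_onD[OF bij_betw_imp_inj_on[OF \<psi>(2)] _ e(2)]) auto
    then show False by simp
  qed
  then have "\<tau> (\<phi> ?e) \<noteq> \<zero>\<^bsub>csp Y m\<^esub>"
    unfolding 1 using lin_zero[OF \<psi>(1) m Y.mod_H] by simp
  then have "\<alpha> m (\<phi> ?e) \<noteq> graded_zero K X Y m (\<phi> ?e)"
    using \<phi>e by (simp add: \<alpha>_def graded_zero_def)
  then show ?thesis using that \<alpha> by metis
qed

lemma homs_nonzero:
  assumes X: "X \<in> B" and Y: "Y \<in> B" and "hdim K X m \<noteq> 0" "hdim K Y m \<noteq> 0"
  shows "\<exists>f\<in>der_hom K X Y. \<not> zero_mor T X Y f"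
  using nonzero_hom[OF assms] zero_mor_iff[OF X Y] mor_hom[OF X Y] by metis

text \<open>Tested on an object W with one-dimensional cohomology in degree m only: all maps from W
  to the two summands vanish, so the universal property leaves just one map from W to S, while
  cohomology of S in degree m would provide two.\<close>

lemma direct_sum_hdim:
  assumes A: "A \<in> B" and C: "C \<in> B" and s: "direct_sum T A C S" and n: "hdim K S m \<noteq> 0"
  shows "hdim K A m \<noteq> 0 \<or> hdim K C m \<noteq> 0"
proof (rule ccontr)
  assume "\<not> (hdim K A m \<noteq> 0 \<or> hdim K C m \<noteq> 0)"
  then have 0: "hdim K A m = 0" "hdim K C m = 0" by auto
  have S: "S \<in> B" using s by (simp add: direct_sum_def)
  obtain p q where pq: "p \<in> der_hom K S A" "q \<in> der_hom K S C"
    and univ: "\<forall>W\<in>B. \<forall>f\<in>der_hom K W A. \<forall>g\<in>der_hom K W C.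
      \<exists>!h. h \<in> der_hom K W S \<and> der_comp K p h = f \<and> der_comp K q h = g"
    using s unfolding direct_sum_def T_sel by (elim conjE bexE) (rule that)
  have "finite {i. (if i = m then 1 else 0 :: nat) \<noteq> 0}" by (rule finite_subset[of _ "{m}"]) auto
  then obtain W where W: "W \<in> B" "hdim K W = (\<lambda>i. if i = m then 1 else 0)"
    using object_exists[of "\<lambda>i. if i = m then 1 else 0"] by blast
  obtain \<alpha> where \<alpha>: "\<alpha> \<in> graded_maps K W S" "\<alpha> \<noteq> graded_zero K W S"
    using nonzero_hom[OF W(1) S _ n] W(2) by (metis one_neq_zero)
  obtain \<pi> where \<pi>: "\<pi> \<in> graded_maps K S A" "p = mor K S A \<pi>" using homE[OF pq(1) S A] by blast
  obtain \<theta> where \<theta>: "\<theta> \<in> graded_maps K S C" "q = mor K S C \<theta>" using homE[OF pq(2) S C] by blast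
  have WA: "\<gamma> = graded_zero K W A" if "\<gamma> \<in> graded_maps K W A" for \<gamma>
    by (rule graded_disjoint[OF W(1) A _ that]) (use W(2) 0 in auto)
  have WC: "\<gamma> = graded_zero K W C" if "\<gamma> \<in> graded_maps K W C" for \<gamma>
    by (rule graded_disjoint[OF W(1) C _ that]) (use W(2) 0 in auto)
  have *: "der_comp K p (mor K W S \<gamma>) = mor K W A (graded_zero K W A)"
    "der_comp K q (mor K W S \<gamma>) = mor K W C (graded_zero K W C)"
    if \<gamma>: "\<gamma> \<in> graded_maps K W S" for \<gamma>
    using WA[OF comp_maps[OF W(1) S A \<pi>(1) \<gamma>]] WC[OF comp_maps[OF W(1) S C \<theta>(1) \<gamma>]]
    by (simp_all add: \<pi>(2) \<theta>(2) comp_mor[OF W(1) S A \<pi>(1) \<gamma>] comp_mor[OF W(1) S C \<theta>(1) \<gamma>])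
  have z: "graded_zero K W S \<in> graded_maps K W S" by (rule zero_maps[OF W(1) S])
  have "mor K W S \<alpha> = mor K W S (graded_zero K W S)"
    using univ[rule_format, OF W(1) mor_hom[OF W(1) A zero_maps[OF W(1) A]] mor_hom[OF W(1) C zero_maps[OF W(1) C]]]
      *[OF \<alpha>(1)] *[OF z] mor_hom[OF W(1) S \<alpha>(1)] mor_hom[OF W(1) S z] by metis
  then show False using mor_eq_iff[OF W(1) S \<alpha>(1)] \<alpha>(2) by blast
qed

end

section \<open>Distinguished triangles\<close>

locale split_sequence =
  A: bounded_complex K A + B: bounded_complex K B + C: bounded_complex K C
  for K :: "('a, 'r) ring_scheme" and A B C :: "('a, 'v) cplx" +
  fixes \<alpha> \<beta> \<pi> \<sigma> :: "'v cmap"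
  assumes split: "termwise_split K A B C \<alpha> \<beta> \<pi> \<sigma>"
begin

sublocale AB: bounded_complex_pair K A B ..
sublocale BC: bounded_complex_pair K B C ..

lemma \<alpha>: "\<alpha> \<in> chain_maps K A B" and \<beta>: "\<beta> \<in> chain_maps K B C"
  using split by (simp_all add: termwise_split_def)

lemma \<pi>_lin: "\<pi> n \<in> lin_maps K (csp B n) (csp A n)" and \<sigma>_lin: "\<sigma> n \<in> lin_maps K (csp C n) (csp B n)"
  using split by (simp_all add: termwise_split_def)

lemma \<pi>_\<alpha>: "a \<in> carrier (csp A n) \<Longrightarrow> \<pi> n (\<alpha> n a) = a"
  and \<beta>_\<alpha>: "a \<in> carrier (csp A n) \<Longrightarrow> \<beta> n (\<alpha> n a) = \<zero>\<^bsub>csp C n\<^esub>"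
  and \<beta>_\<sigma>: "c \<in> carrier (csp C n) \<Longrightarrow> \<beta> n (\<sigma> n c) = c"
  and \<alpha>_\<pi>: "b \<in> carrier (csp B n) \<Longrightarrow> \<alpha> n (\<pi> n b) \<oplus>\<^bsub>csp B n\<^esub> \<sigma> n (\<beta> n b) = b"
  using split by (simp_all add: termwise_split_def)

lemma exact:
  assumes b: "b \<in> carrier (csp B n)" and "\<beta> n b = \<zero>\<^bsub>csp C n\<^esub>"
  shows "\<pi> n b \<in> carrier (csp A n)" "\<alpha> n (\<pi> n b) = b"
proof -
  interpret M: abelian_group "csp B n" by (rule B.ab)
  show 1: "\<pi> n b \<in> carrier (csp A n)" by (rule lin_closed[OF \<pi>_lin b])
  have "\<sigma> n \<zero>\<^bsub>csp C n\<^esub> = \<zero>\<^bsub>csp B n\<^esub>" by (rule lin_zero[OF \<sigma>_lin C.mod B.mod])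
  then show "\<alpha> n (\<pi> n b) = b" using \<alpha>_\<pi>[OF b] assms(2) AB.f_closed[OF \<alpha> 1] by simp
qed

lemma \<alpha>_zeroD: "a \<in> carrier (csp A n) \<Longrightarrow> \<alpha> n a = \<zero>\<^bsub>csp B n\<^esub> \<Longrightarrow> a = \<zero>\<^bsub>csp A n\<^esub>"
  using \<pi>_\<alpha>[of a n] lin_zero[OF \<pi>_lin B.mod A.mod, of n] by simp

lemma d_\<alpha>_zeroD:
  assumes a: "a \<in> carrier (csp A n)" and "cdf B n (\<alpha> n a) = \<zero>\<^bsub>csp B (n + 1)\<^esub>"
  shows "cdf A n a = \<zero>\<^bsub>csp A (n + 1)\<^esub>"
  using \<alpha>_zeroD[of "cdf A n a" "n + 1"] AB.f_d[OF \<alpha> a refl] assms by simp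

abbreviation "H\<alpha> \<equiv> hmap K A B \<alpha>"
abbreviation "H\<beta> \<equiv> hmap K B C \<beta>"

text \<open>The connecting map of the long exact sequence, written with the given splittings: lift
  to B, apply the differential, pull back to A, project.\<close>

definition \<delta> :: "int \<Rightarrow> 'v \<Rightarrow> 'v" where
  "\<delta> n = (\<lambda>z\<in>carrier (C.H n). A.p (n + 1) (\<pi> (n + 1) (cdf B n (\<sigma> n z))))"

lemma \<delta>_lin: "\<delta> n \<in> lin_maps K (C.H n) (A.H (n + 1))"
proof -
  have "\<delta> n = compose (carrier (C.H n)) (A.p (n + 1)) (compose (carrier (C.H n)) (\<pi> (n + 1))
    (compose (carrier (C.H n)) (cdf B n) (compose (carrier (C.H n)) (\<sigma> n) (\<lambda>z\<in>carrier (C.H n). z))))"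
    by (auto simp: \<delta>_def compose_def)
  also have "\<dots> \<in> lin_maps K (C.H n) (A.H (n + 1))"
    by (intro lin_comp[OF A.p_lin_H] lin_comp[OF \<pi>_lin] lin_comp[OF B.d_lin] lin_comp[OF \<sigma>_lin]
      C.incl_lin C.mod_H)
  finally show ?thesis .
qed

text \<open>The connecting map may be computed with any lift b instead of the one given by the
  splitting. The two lifts differ by an element from A and a coboundary, which changes the result by
  a coboundary.\<close>

lemma \<delta>_eqI:
  assumes b: "b \<in> carrier (csp B n)" and a: "a \<in> carrier (csp A (n + 1))" and db: "cdf B n b = \<alpha> (n + 1) a"
  shows "cdf C n (\<beta> n b) = \<zero>\<^bsub>csp C (n + 1)\<^esub>" "\<delta> n (C.p n (\<beta> n b)) = A.p (n + 1) a"
proof -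
  interpret MA: abelian_group "csp A i" for i by (rule A.ab)
  interpret MB: abelian_group "csp B i" for i by (rule B.ab)
  interpret MC: abelian_group "csp C i" for i by (rule C.ab)
  have \<beta>b: "\<beta> n b \<in> carrier (csp C n)" by (rule BC.f_closed[OF \<beta> b])
  show d\<beta>b: "cdf C n (\<beta> n b) = \<zero>\<^bsub>csp C (n + 1)\<^esub>"
    using BC.f_d[OF \<beta> b refl] db \<beta>_\<alpha>[OF a] by simp
  let ?z = "C.p n (\<beta> n b)" and ?c = "C.h n (\<beta> n b)"
  have z: "?z \<in> carrier (csp C n)" and c: "?c \<in> carrier (csp C (n - 1))" using \<beta>b by simp_all
  have z_eq: "?z = \<beta> n b \<ominus>\<^bsub>csp C n\<^esub> cdf C (n - 1) ?c" by (rule C.p_cocycle[OF \<beta>b d\<beta>b])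
  have \<sigma>z: "\<sigma> n ?z \<in> carrier (csp B n)" by (rule lin_closed[OF \<sigma>_lin z])
  have \<sigma>c: "\<sigma> (n - 1) ?c \<in> carrier (csp B (n - 1))" by (rule lin_closed[OF \<sigma>_lin c])
  let ?e = "cdf B (n - 1) (\<sigma> (n - 1) ?c)"
  have e: "?e \<in> carrier (csp B n)" using \<sigma>c by simp
  have \<beta>e: "\<beta> n ?e = cdf C (n - 1) ?c"
    using BC.f_d[OF \<beta> \<sigma>c, of n] \<beta>_\<sigma>[OF c] by simp
  have dc: "cdf C (n - 1) ?c \<in> carrier (csp C n)" using c by simp
  \<comment> \<open>Since \<open>?z\<close> is the image of b minus the differential of
    \<open>?c\<close>, adding the differential of a lift of \<open>?c\<close> makes the image in C
    vanish. So \<open>?w\<close> comes from A.\<close>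
  let ?w = "\<sigma> n ?z \<ominus>\<^bsub>csp B n\<^esub> b \<oplus>\<^bsub>csp B n\<^esub> ?e"
  have w: "?w \<in> carrier (csp B n)" using \<sigma>z b e by simp
  have "\<beta> n ?w = ?z \<ominus>\<^bsub>csp C n\<^esub> \<beta> n b \<oplus>\<^bsub>csp C n\<^esub> cdf C (n - 1) ?c"
    using \<sigma>z b e lin_add[OF BC.f_lin[OF \<beta>], of _ n ?e]
    by (simp add: lin_minus[OF BC.f_lin[OF \<beta>] B.mod C.mod] \<beta>e \<beta>_\<sigma>[OF z])
  also have "\<dots> = \<zero>\<^bsub>csp C n\<^esub>"
    unfolding z_eq using \<beta>b dc by (simp add: MC.diff_simps)
  finally have \<beta>w: "\<beta> n ?w = \<zero>\<^bsub>csp C n\<^esub>" .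
  let ?a = "\<pi> n ?w"
  have a': "?a \<in> carrier (csp A n)" and \<alpha>a': "\<alpha> n ?a = ?w" by (rule exact[OF w \<beta>w])+
  have da': "cdf A n ?a \<in> carrier (csp A (n + 1))" using a' by simp
  have dde: "cdf B n ?e = \<zero>\<^bsub>csp B (n + 1)\<^esub>"
    using B.d_d[OF \<sigma>c, of n] by (simp add: add.commute)
  have "cdf B n ?w = cdf B n (\<sigma> n ?z) \<ominus>\<^bsub>csp B (n + 1)\<^esub> \<alpha> (n + 1) a"
    using \<sigma>z b e lin_add[OF B.d_lin, of _ n ?e] by (simp add: B.d_minus db dde)
  moreover have "cdf B n ?w = \<alpha> (n + 1) (cdf A n ?a)"
    using AB.f_d[OF \<alpha> a' refl] \<alpha>a' by simp
  ultimately have "cdf B n (\<sigma> n ?z) = \<alpha> (n + 1) (cdf A n ?a) \<oplus>\<^bsub>csp B (n + 1)\<^esub> \<alpha> (n + 1) a"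
    using \<sigma>z AB.f_closed[OF \<alpha> a] AB.f_closed[OF \<alpha> da'] by (metis B.d_closed MB.minus_cancel)
  also have "\<dots> = \<alpha> (n + 1) (cdf A n ?a \<oplus>\<^bsub>csp A (n + 1)\<^esub> a)"
    by (rule lin_add[OF AB.f_lin[OF \<alpha>] da' a, symmetric])
  finally have "\<pi> (n + 1) (cdf B n (\<sigma> n ?z)) = cdf A n ?a \<oplus>\<^bsub>csp A (n + 1)\<^esub> a"
    using da' a by (simp add: \<pi>_\<alpha>)
  then have "\<delta> n ?z = A.p (n + 1) (cdf A n ?a \<oplus>\<^bsub>csp A (n + 1)\<^esub> a)"
    using \<beta>b by (simp add: \<delta>_def)
  also have "\<dots> = A.p (n + 1) a"
    using lin_add[OF A.p_lin da' a] A.p_d[OF a', of "n + 1"] a by simp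
  finally show "\<delta> n ?z = A.p (n + 1) a" .
qed

lemma exact_B: "{y \<in> carrier (B.H n). H\<beta> n y = \<zero>\<^bsub>C.H n\<^esub>} = H\<alpha> n ` carrier (A.H n)"
proof (intro equalityI subsetI)
  fix y assume "y \<in> H\<alpha> n ` carrier (A.H n)"
  then obtain x where x: "x \<in> carrier (A.H n)" "y = H\<alpha> n x" by blast
  have xA: "x \<in> carrier (csp A n)" by (rule A.H_closed[OF x(1)])
  have y: "y \<in> carrier (B.H n)" unfolding x(2) by (rule AB.graded_closed[OF AB.hmap_graded[OF \<alpha>] x(1)])
  have "cdf B n (\<alpha> n x) = \<zero>\<^bsub>csp B (n + 1)\<^esub>"
    using AB.f_d[OF \<alpha> xA refl] x(1) AB.f_zero[OF \<alpha>] by simp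
  from BC.hmap_p[OF \<beta> AB.f_closed[OF \<alpha> xA] this]
  have "H\<beta> n y = \<zero>\<^bsub>csp C n\<^esub>"
    unfolding x(2) AB.hmap_eq[OF x(1)] by (simp add: \<beta>_\<alpha>[OF xA])
  then show "y \<in> {y \<in> carrier (B.H n). H\<beta> n y = \<zero>\<^bsub>C.H n\<^esub>}" using y by simp
next
  fix y assume "y \<in> {y \<in> carrier (B.H n). H\<beta> n y = \<zero>\<^bsub>C.H n\<^esub>}"
  then have y: "y \<in> carrier (B.H n)" and \<beta>y: "C.p n (\<beta> n y) = \<zero>\<^bsub>csp C n\<^esub>"
    using BC.hmap_eq[of y n \<beta>] by simp_all
  interpret MB: abelian_group "csp B i" for i by (rule B.ab)
  interpret MC: abelian_group "csp C i" for i by (rule C.ab)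
  have yB: "y \<in> carrier (csp B n)" by (rule B.H_closed[OF y])
  have c\<beta>: "\<beta> n y \<in> carrier (csp C n)" by (rule BC.f_closed[OF \<beta> yB])
  have "cdf C n (\<beta> n y) = \<zero>\<^bsub>csp C (n + 1)\<^esub>"
    using BC.f_d[OF \<beta> yB refl] y BC.f_zero[OF \<beta>] by simp
  from C.p_cocycle[OF c\<beta> this] \<beta>y
  have "\<zero>\<^bsub>csp C n\<^esub> = \<beta> n y \<ominus>\<^bsub>csp C n\<^esub> cdf C (n - 1) (C.h n (\<beta> n y))" by simp
  then have eq: "\<beta> n y = cdf C (n - 1) (C.h n (\<beta> n y))"
    using c\<beta> by (subst (asm) eq_commute, subst (asm) MC.minus_other_side) simp_all
  let ?c = "C.h n (\<beta> n y)"
  have c: "?c \<in> carrier (csp C (n - 1))" using c\<beta> by simp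
  have \<sigma>c: "\<sigma> (n - 1) ?c \<in> carrier (csp B (n - 1))" by (rule lin_closed[OF \<sigma>_lin c])
  \<comment> \<open>The image of y in C is a coboundary. Lifting a primitive of it to B and
    subtracting its differential from y yields an element that comes from A, in the same class as
    y.\<close>
  let ?e = "cdf B (n - 1) (\<sigma> (n - 1) ?c)"
  have e: "?e \<in> carrier (csp B n)" using \<sigma>c by simp
  have \<beta>e: "\<beta> n ?e = \<beta> n y"
    using BC.f_d[OF \<beta> \<sigma>c, of n] \<beta>_\<sigma>[OF c] eq by simp
  have dde: "cdf B n ?e = \<zero>\<^bsub>csp B (n + 1)\<^esub>"
    using B.d_d[OF \<sigma>c, of n] by (simp add: add.commute)
  let ?w = "y \<ominus>\<^bsub>csp B n\<^esub> ?e"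
  have w: "?w \<in> carrier (csp B n)" using yB e by simp
  have "\<beta> n ?w = \<zero>\<^bsub>csp C n\<^esub>"
    using yB e c\<beta> by (simp add: lin_minus[OF BC.f_lin[OF \<beta>] B.mod C.mod] \<beta>e)
  note a = exact[OF w this]
  have "cdf B n ?w = \<zero>\<^bsub>csp B (n + 1)\<^esub>"
    using yB e y by (simp add: B.d_minus dde)
  then have "cdf A n (\<pi> n ?w) = \<zero>\<^bsub>csp A (n + 1)\<^esub>"
    using d_\<alpha>_zeroD[OF a(1)] a(2) by simp
  from AB.hmap_p[OF \<alpha> a(1) this] have "H\<alpha> n (A.p n (\<pi> n ?w)) = B.p n ?w" using a(2) by simp
  also have "\<dots> = y"
    using yB e B.p_d[OF \<sigma>c, of n] B.p_H[OF y] by (simp add: B.p_minus)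
  finally have "y = H\<alpha> n (A.p n (\<pi> n ?w))" by simp
  then show "y \<in> H\<alpha> n ` carrier (A.H n)" using A.p_in_H[OF a(1)] by blast
qed

lemma exact_C: "{z \<in> carrier (C.H n). \<delta> n z = \<zero>\<^bsub>A.H (n + 1)\<^esub>} = H\<beta> n ` carrier (B.H n)"
proof (intro equalityI subsetI)
  fix z assume "z \<in> H\<beta> n ` carrier (B.H n)"
  then obtain y where y: "y \<in> carrier (B.H n)" "z = H\<beta> n y" by blast
  have yB: "y \<in> carrier (csp B n)" by (rule B.H_closed[OF y(1)])
  have z: "z \<in> carrier (C.H n)" unfolding y(2) by (rule BC.graded_closed[OF BC.hmap_graded[OF \<beta>] y(1)])
  interpret MA: abelian_group "csp A i" for i by (rule A.ab)
  have "cdf B n y = \<alpha> (n + 1) \<zero>\<^bsub>csp A (n + 1)\<^esub>" using y(1) AB.f_zero[OF \<alpha>] by simp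
  from \<delta>_eqI(2)[OF yB MA.zero_closed this]
  have "\<delta> n z = \<zero>\<^bsub>csp A (n + 1)\<^esub>" unfolding y(2) BC.hmap_eq[OF y(1)] by simp
  then show "z \<in> {z \<in> carrier (C.H n). \<delta> n z = \<zero>\<^bsub>A.H (n + 1)\<^esub>}" using z by simp
next
  fix z assume "z \<in> {z \<in> carrier (C.H n). \<delta> n z = \<zero>\<^bsub>A.H (n + 1)\<^esub>}"
  then have z: "z \<in> carrier (C.H n)" and \<delta>z: "\<delta> n z = \<zero>\<^bsub>csp A (n + 1)\<^esub>" by simp_all
  interpret MA: abelian_group "csp A i" for i by (rule A.ab)
  interpret MB: abelian_group "csp B i" for i by (rule B.ab)
  interpret MC: abelian_group "csp C i" for i by (rule C.ab)
  have zC: "z \<in> carrier (csp C n)" by (rule C.H_closed[OF z])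
  have \<sigma>z: "\<sigma> n z \<in> carrier (csp B n)" by (rule lin_closed[OF \<sigma>_lin zC])
  let ?w = "cdf B n (\<sigma> n z)"
  have w: "?w \<in> carrier (csp B (n + 1))" using \<sigma>z by simp
  have "\<beta> (n + 1) ?w = \<zero>\<^bsub>csp C (n + 1)\<^esub>"
    using BC.f_d[OF \<beta> \<sigma>z refl] \<beta>_\<sigma>[OF zC] z by simp
  note a = exact[OF w this]
  let ?a = "\<pi> (n + 1) ?w"
  have "cdf B (n + 1) ?w = \<zero>\<^bsub>csp B (n + 1 + 1)\<^esub>"
    using B.d_d[OF \<sigma>z refl] by (simp add: add.commute)
  then have da: "cdf A (n + 1) ?a = \<zero>\<^bsub>csp A (n + 1 + 1)\<^esub>"
    using d_\<alpha>_zeroD[OF a(1)] a(2) by simp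
  have "A.p (n + 1) ?a = \<zero>\<^bsub>csp A (n + 1)\<^esub>" using \<delta>z z by (simp add: \<delta>_def)
  with A.p_cocycle[OF a(1) da]
  have "\<zero>\<^bsub>csp A (n + 1)\<^esub> = ?a \<ominus>\<^bsub>csp A (n + 1)\<^esub> cdf A n (A.h (n + 1) ?a)" by simp
  then have a_eq: "?a = cdf A n (A.h (n + 1) ?a)"
    using a(1) by (subst (asm) eq_commute, subst (asm) MA.minus_other_side) simp_all
  let ?a' = "A.h (n + 1) ?a"
  have a': "?a' \<in> carrier (csp A n)" using a(1) by simp
  have \<alpha>a': "\<alpha> n ?a' \<in> carrier (csp B n)" by (rule AB.f_closed[OF \<alpha> a'])
  \<comment> \<open>Vanishing of the connecting map gives a primitive \<open>?a'\<close> of the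
    element that obstructs the lift of z from being a cocycle. Subtracting its image corrects the
    lift and leaves its value z in C unchanged.\<close>
  let ?y = "\<sigma> n z \<ominus>\<^bsub>csp B n\<^esub> \<alpha> n ?a'"
  have y: "?y \<in> carrier (csp B n)" using \<sigma>z \<alpha>a' by simp
  have "cdf B n (\<alpha> n ?a') = ?w"
    using AB.f_d[OF \<alpha> a' refl] a(2) a_eq by simp
  then have dy: "cdf B n ?y = \<zero>\<^bsub>csp B (n + 1)\<^esub>"
    using \<sigma>z \<alpha>a' w by (simp add: B.d_minus)
  have "\<beta> n ?y = z"
    using \<sigma>z \<alpha>a' zC by (simp add: lin_minus[OF BC.f_lin[OF \<beta>] B.mod C.mod] \<beta>_\<alpha>[OF a'] \<beta>_\<sigma>[OF zC])
  then have "z = H\<beta> n (B.p n ?y)" using BC.hmap_p[OF \<beta> y dy] C.p_H[OF z] by simp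
  then show "z \<in> H\<beta> n ` carrier (B.H n)" using B.p_in_H[OF y] by blast
qed

lemma exact_A: "{x \<in> carrier (A.H (n + 1)). H\<alpha> (n + 1) x = \<zero>\<^bsub>B.H (n + 1)\<^esub>} = \<delta> n ` carrier (C.H n)"
proof (intro equalityI subsetI)
  fix x assume "x \<in> \<delta> n ` carrier (C.H n)"
  then obtain z where z: "z \<in> carrier (C.H n)" "x = \<delta> n z" by blast
  have x: "x \<in> carrier (A.H (n + 1))" unfolding z(2) by (rule lin_closed[OF \<delta>_lin z(1)])
  have zC: "z \<in> carrier (csp C n)" by (rule C.H_closed[OF z(1)])
  have \<sigma>z: "\<sigma> n z \<in> carrier (csp B n)" by (rule lin_closed[OF \<sigma>_lin zC])
  let ?w = "cdf B n (\<sigma> n z)"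
  have w: "?w \<in> carrier (csp B (n + 1))" using \<sigma>z by simp
  have "\<beta> (n + 1) ?w = \<zero>\<^bsub>csp C (n + 1)\<^esub>"
    using BC.f_d[OF \<beta> \<sigma>z refl] \<beta>_\<sigma>[OF zC] z(1) by simp
  note a = exact[OF w this]
  have "cdf B (n + 1) ?w = \<zero>\<^bsub>csp B (n + 1 + 1)\<^esub>"
    using B.d_d[OF \<sigma>z refl] by (simp add: add.commute)
  then have da: "cdf A (n + 1) (\<pi> (n + 1) ?w) = \<zero>\<^bsub>csp A (n + 1 + 1)\<^esub>"
    using d_\<alpha>_zeroD[OF a(1)] a(2) by simp
  have "H\<alpha> (n + 1) x = B.p (n + 1) ?w"
    unfolding z(2) using AB.hmap_p[OF \<alpha> a(1) da] a(2) z(1) by (simp add: \<delta>_def)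
  also have "\<dots> = \<zero>\<^bsub>csp B (n + 1)\<^esub>" using B.p_d[OF \<sigma>z refl] by simp
  finally show "x \<in> {x \<in> carrier (A.H (n + 1)). H\<alpha> (n + 1) x = \<zero>\<^bsub>B.H (n + 1)\<^esub>}" using x by simp
next
  fix x assume "x \<in> {x \<in> carrier (A.H (n + 1)). H\<alpha> (n + 1) x = \<zero>\<^bsub>B.H (n + 1)\<^esub>}"
  then have x: "x \<in> carrier (A.H (n + 1))" and px: "B.p (n + 1) (\<alpha> (n + 1) x) = \<zero>\<^bsub>csp B (n + 1)\<^esub>"
    using AB.hmap_eq[of x "n + 1" \<alpha>] by simp_all
  interpret MB: abelian_group "csp B i" for i by (rule B.ab)
  have xA: "x \<in> carrier (csp A (n + 1))" by (rule A.H_closed[OF x])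
  have c: "\<alpha> (n + 1) x \<in> carrier (csp B (n + 1))" by (rule AB.f_closed[OF \<alpha> xA])
  have "cdf B (n + 1) (\<alpha> (n + 1) x) = \<zero>\<^bsub>csp B (n + 1 + 1)\<^esub>"
    using AB.f_d[OF \<alpha> xA refl] x AB.f_zero[OF \<alpha>, of "n + 1 + 1"] A.d_H[OF x] by simp
  with B.p_cocycle[OF c this] px
  have "\<zero>\<^bsub>csp B (n + 1)\<^esub> = \<alpha> (n + 1) x \<ominus>\<^bsub>csp B (n + 1)\<^esub> cdf B n (B.h (n + 1) (\<alpha> (n + 1) x))" by simp
  then have eq: "\<alpha> (n + 1) x = cdf B n (B.h (n + 1) (\<alpha> (n + 1) x))"
    using c by (subst (asm) eq_commute, subst (asm) MB.minus_other_side) simp_all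
  \<comment> \<open>A primitive in B of the image of x is a lift in the sense of
    \<open>\<delta>_eqI\<close>, so its image in C is a class whose connecting value is x.\<close>
  let ?b = "B.h (n + 1) (\<alpha> (n + 1) x)"
  have b: "?b \<in> carrier (csp B n)" using c by simp
  have "\<delta> n (C.p n (\<beta> n ?b)) = x"
    using \<delta>_eqI(2)[OF b xA eq[symmetric]] A.p_H[OF x] by simp
  moreover have "C.p n (\<beta> n ?b) \<in> carrier (C.H n)" by (rule C.p_in_H[OF BC.f_closed[OF \<beta> b]])
  ultimately show "x \<in> \<delta> n ` carrier (C.H n)" by (metis imageI)
qed

text \<open>The number \<open>k n\<close> is the rank of the connecting map in degree n.
  Rank-nullity holds for each of the three maps of the long exact sequence, and exactness identifies
  each kernel with the preceding image; the ranks of the other two maps cancel.\<close>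

lemma hdim_exact:
  "\<exists>k. \<forall>n. hdim K B n + k n + k (n - 1) = hdim K A n + hdim K C n \<and> k n \<le> hdim K C n \<and> k n \<le> hdim K A (n + 1)"
proof -
  define ra where "ra n = vectorspace.dim K (B.H n\<lparr>carrier := H\<alpha> n ` carrier (A.H n)\<rparr>)" for n
  define rb where "rb n = vectorspace.dim K (C.H n\<lparr>carrier := H\<beta> n ` carrier (B.H n)\<rparr>)" for n
  define k where "k n = vectorspace.dim K (A.H (n + 1)\<lparr>carrier := \<delta> n ` carrier (C.H n)\<rparr>)" for n
  have l: "H\<alpha> n \<in> lin_maps K (A.H n) (B.H n)" "H\<beta> n \<in> lin_maps K (B.H n) (C.H n)" for n
    using AB.hmap_graded[OF \<alpha>] BC.hmap_graded[OF \<beta>] by (simp_all add: graded_maps_def)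
  have 1: "rb n + ra n = hdim K B n" for n
    using lin_rank_nullity[OF A.K l(2) B.fd_H C.mod_H, of n] unfolding exact_B hdim_def ra_def rb_def .
  have 2: "k n + rb n = hdim K C n" for n
    using lin_rank_nullity[OF A.K \<delta>_lin C.fd_H A.mod_H, of n] unfolding exact_C hdim_def rb_def k_def .
  have 3: "ra (n + 1) + k n = hdim K A (n + 1)" for n
    using lin_rank_nullity[OF A.K l(1) A.fd_H B.mod_H, of "n + 1"] unfolding exact_A hdim_def ra_def k_def .
  have "hdim K B n + k n + k (n - 1) = hdim K A n + hdim K C n" for n
    using 1[of n] 2[of n] 3[of "n - 1"] by simp
  moreover have "k n \<le> hdim K C n" "k n \<le> hdim K A (n + 1)" for n
    using 2[of n] 3[of n] by linarith+
  ultimately show ?thesis by blast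
qed

end

section \<open>Dimensions along triangles, and existence of split triangles\<close>

context derived
begin

lemma iso_mor_der_cat: "iso_mor (der_cat K) X Y f \<longleftrightarrow> iso_mor T X Y f"
  by (simp add: iso_mor_def Db_mod_def)

lemma triangle_objects:
  fixes X :: "('a, 'a list) cplx"
  shows "(X, Y, Z, u, v, w) \<in> der_triangles K \<Longrightarrow> X \<in> B \<and> Y \<in> B \<and> Z \<in> B"
  by (simp add: der_triangles_def)

lemma triangle_hdim:
  fixes X :: "('a, 'a list) cplx"
  assumes "(X, Y, Z, u, v, w) \<in> der_triangles K"
  shows "\<exists>k. \<forall>n. hdim K Y n + k n + k (n - 1) = hdim K X n + hdim K Z n \<and> k n \<le> hdim K Z n \<and> k n \<le> hdim K X (n + 1)"
proof -
  have obs: "X \<in> B" "Y \<in> B" "Z \<in> B" using triangle_objects[OF assms] by auto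
  from assms obtain A B' C \<alpha> \<beta> \<pi> \<sigma> a b c where sp: "termwise_split K A B' C \<alpha> \<beta> \<pi> \<sigma>"
    and iso: "iso_mor T X A a" "iso_mor T Y B' b" "iso_mor T Z C c"
    unfolding der_triangles_def iso_mor_der_cat by blast
  have ABC: "A \<in> B" "B' \<in> B" "C \<in> B" using sp by (simp_all add: termwise_split_def)
  interpret split_sequence K A B' C \<alpha> \<beta> \<pi> \<sigma>
    by (intro split_sequence.intro split_sequence_axioms.intro bounded_complex.intro K ABC sp)
  show ?thesis
    using hdim_exact hdim_of_iso[OF obs(1) ABC(1) iso(1)] hdim_of_iso[OF obs(2) ABC(2) iso(2)]
      hdim_of_iso[OF obs(3) ABC(3) iso(3)] by simp
qed

text \<open>Lists of length p + q split by \<open>take\<close> and \<open>drop\<close>, so the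
  standard complexes with zero differential form a termwise split sequence. It is transported to X,
  Y, Z along isomorphisms that exist because the dimensions agree.\<close>

lemma triangle_exists:
  assumes X: "X \<in> B" and Y: "Y \<in> B" and Z: "Z \<in> B" and h: "\<And>n. hdim K Y n = hdim K X n + hdim K Z n"
  shows "\<exists>u v w. (X, Y, Z, u, v, w) \<in> der_triangles K"
proof -
  interpret K: field K by (rule K)
  note m = std_space_module[OF K.is_cring]
  define p where "p = hdim K X"
  define q where "q = hdim K Z"
  have fin: "finite {n. p n \<noteq> 0}" "finite {n. q n \<noteq> 0}" "finite {n. p n + q n \<noteq> 0}"
    using hdim_finite[OF K X] hdim_finite[OF K Z] hdim_finite[OF K Y] by (simp_all add: p_def q_def h)
  let ?A = "std_complex K p" and ?C = "std_complex K q" and ?D = "std_complex K (\<lambda>n. p n + q n)"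
  have A: "?A \<in> B" and C: "?C \<in> B" and D: "?D \<in> B"
    by (rule std_complex_bounded[OF K fin(1)], rule std_complex_bounded[OF K fin(2)],
      rule std_complex_bounded[OF K fin(3)])
  define \<alpha> where "\<alpha> = (\<lambda>n. \<lambda>x\<in>carrier (std_space K (p n)). x @ replicate (q n) \<zero>\<^bsub>K\<^esub>)"
  define \<sigma> where "\<sigma> = (\<lambda>n. \<lambda>x\<in>carrier (std_space K (q n)). replicate (p n) \<zero>\<^bsub>K\<^esub> @ x)"
  define \<pi> where "\<pi> = (\<lambda>n. \<lambda>x\<in>carrier (std_space K (p n + q n)). take (p n) x)"
  define \<beta> where "\<beta> = (\<lambda>n. \<lambda>x\<in>carrier (std_space K (p n + q n)). drop (p n) x)"
  have zip0: "map2 (\<oplus>\<^bsub>K\<^esub>) (replicate n \<zero>\<^bsub>K\<^esub>) (replicate n \<zero>\<^bsub>K\<^esub>) = replicate n \<zero>\<^bsub>K\<^esub>" for n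
    by (auto simp: list_eq_iff_nth_eq)
  have \<alpha>l: "\<alpha> n \<in> lin_maps K (std_space K (p n)) (std_space K (p n + q n))" for n
    unfolding \<alpha>_def by (rule lin_restrictI[OF _ _ _ m]) (auto simp: zip0)
  have \<sigma>l: "\<sigma> n \<in> lin_maps K (std_space K (q n)) (std_space K (p n + q n))" for n
    unfolding \<sigma>_def by (rule lin_restrictI[OF _ _ _ m]) (auto simp: zip0)
  have \<pi>l: "\<pi> n \<in> lin_maps K (std_space K (p n + q n)) (std_space K (p n))" for n
    unfolding \<pi>_def
    by (rule lin_restrictI[OF _ _ _ m]) (auto simp: take_map take_zip dest: in_set_takeD)
  have \<beta>l: "\<beta> n \<in> lin_maps K (std_space K (p n + q n)) (std_space K (q n))" for n
    unfolding \<beta>_def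
    by (rule lin_restrictI[OF _ _ _ m]) (auto simp: drop_map drop_zip dest: in_set_dropD)
  have d0: "cdf (std_complex K d) n x = \<zero>\<^bsub>std_space K (d (n + 1))\<^esub>" if "x \<in> carrier (std_space K (d n))" for d n x
    using that by (simp add: std_complex_def)
  have \<alpha>: "\<alpha> \<in> chain_maps K ?A ?D"
    unfolding chain_maps_def
    by (intro CollectI conjI allI ballI)
      (use \<alpha>l lin_zero[OF \<alpha>l m m] lin_closed[OF \<alpha>l] d0 in \<open>simp_all del: std_space_sel\<close>)
  have \<beta>: "\<beta> \<in> chain_maps K ?D ?C"
    unfolding chain_maps_def
    by (intro CollectI conjI allI ballI)
      (use \<beta>l lin_zero[OF \<beta>l m m] lin_closed[OF \<beta>l] d0[of _ "\<lambda>n. p n + q n"] d0 in \<open>simp_all del: std_space_sel\<close>)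
  have nth: "xs ! i \<in> carrier K" if "set xs \<subseteq> carrier K" "i < length xs" for xs i
    using that nth_mem by blast
  have sp: "termwise_split K ?A ?D ?C \<alpha> \<beta> \<pi> \<sigma>"
    unfolding termwise_split_def
  proof (intro conjI allI ballI A C D \<alpha> \<beta>)
    fix n
    show "\<pi> n \<in> lin_maps K (csp ?D n) (csp ?A n)" "\<sigma> n \<in> lin_maps K (csp ?C n) (csp ?D n)"
      using \<pi>l \<sigma>l by simp_all
    show "\<pi> n (\<alpha> n x) = x" "\<beta> n (\<alpha> n x) = \<zero>\<^bsub>csp ?C n\<^esub>" if "x \<in> carrier (csp ?A n)" for x
      using that by (auto simp: \<pi>_def \<alpha>_def \<beta>_def)
    show "\<beta> n (\<sigma> n x) = x" if "x \<in> carrier (csp ?C n)" for x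
      using that by (auto simp: \<sigma>_def \<beta>_def)
    show "\<alpha> n (\<pi> n x) \<oplus>\<^bsub>csp ?D n\<^esub> \<sigma> n (\<beta> n x) = x" if "x \<in> carrier (csp ?D n)" for x
    proof -
      have x: "length x = p n + q n" "set x \<subseteq> carrier K" using that by auto
      have t: "take (p n) x \<in> carrier (std_space K (p n))" "drop (p n) x \<in> carrier (std_space K (q n))"
        using x by (auto dest: in_set_takeD in_set_dropD)
      have "map2 (\<oplus>\<^bsub>K\<^esub>) (take (p n) x @ replicate (q n) \<zero>\<^bsub>K\<^esub>) (replicate (p n) \<zero>\<^bsub>K\<^esub> @ drop (p n) x) = x"
      proof (rule nth_equalityI)
        fix i assume "i < length (map2 (\<oplus>\<^bsub>K\<^esub>) (take (p n) x @ replicate (q n) \<zero>\<^bsub>K\<^esub>) (replicate (p n) \<zero>\<^bsub>K\<^esub> @ drop (p n) x))"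
        then have i: "i < p n + q n" using x by simp
        then have "x ! i \<in> carrier K" using nth x by simp
        then show "map2 (\<oplus>\<^bsub>K\<^esub>) (take (p n) x @ replicate (q n) \<zero>\<^bsub>K\<^esub>) (replicate (p n) \<zero>\<^bsub>K\<^esub> @ drop (p n) x) ! i = x ! i"
          using x i by (auto simp: nth_append)
      qed (use x in simp)
      then show ?thesis
        using x t that by (simp add: \<alpha>_def \<pi>_def \<sigma>_def \<beta>_def)
    qed
  qed
  obtain a where a: "a \<in> graded_maps K X ?A" "iso_mor T X ?A (mor K X ?A a)"
    using iso_of_hdim[OF X A] hdim_std_complex[OF K fin(1)] by (metis p_def)
  have hD: "hdim K Y = hdim K ?D" unfolding hdim_std_complex[OF K fin(3)] by (rule HOL.ext) (simp add: h p_def q_def)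
  obtain b where b: "b \<in> graded_maps K Y ?D" "iso_mor T Y ?D (mor K Y ?D b)"
    using iso_of_hdim[OF Y D hD] by blast
  obtain c where c: "c \<in> graded_maps K Z ?C" "iso_mor T Z ?C (mor K Z ?C c)"
    using iso_of_hdim[OF Z C] hdim_std_complex[OF K fin(2)] by (metis q_def)
  have bb: "\<And>n. bij_betw (b n) (carrier (harmonic K Y n)) (carrier (harmonic K ?D n))"
    using iso_mor_mor_iff[OF Y D b(1)] b(2) by blast
  obtain b' where b': "b' \<in> graded_maps K ?D Y" "\<And>n y. y \<in> carrier (harmonic K ?D n) \<Longrightarrow> b n (b' n y) = y"
    using graded_inverse[OF K Y D b(1) bb] by metis
  have cc: "\<And>n. bij_betw (c n) (carrier (harmonic K Z n)) (carrier (harmonic K ?C n))"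
    using iso_mor_mor_iff[OF Z C c(1)] c(2) by blast
  obtain c' where c': "c' \<in> graded_maps K ?C Z" "\<And>n y. y \<in> carrier (harmonic K ?C n) \<Longrightarrow> c n (c' n y) = y"
    using graded_inverse[OF K Z C c(1) cc] by metis
  let ?f = "hmap K ?A ?D \<alpha>" and ?g = "hmap K ?D ?C \<beta>"
  have f: "?f \<in> graded_maps K ?A ?D" by (rule bounded_complex_pair.hmap_graded[OF pair[OF A D] \<alpha>])
  have g: "?g \<in> graded_maps K ?D ?C" by (rule bounded_complex_pair.hmap_graded[OF pair[OF D C] \<beta>])
  note fa = comp_maps[OF X A D f a(1)]
  note gb = comp_maps[OF Y D C g b(1)]
  \<comment> \<open>The first two morphisms are forced by the commuting squares: the maps of the
    standard sequence, conjugated by the chosen isomorphisms.\<close>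
  define u where "u = graded_comp K X b' (graded_comp K X ?f a)"
  define v where "v = graded_comp K Y c' (graded_comp K Y ?g b)"
  have u: "u \<in> graded_maps K X Y" unfolding u_def by (rule comp_maps[OF X D Y b'(1) fa])
  have v: "v \<in> graded_maps K Y Z" unfolding v_def by (rule comp_maps[OF Y C Z c'(1) gb])
  have bu: "graded_comp K X b u = graded_comp K X ?f a"
    by (rule graded_eqI[OF X D comp_maps[OF X Y D b(1) u] fa])
      (simp add: u_def comp_apply b'(2) closed[OF A D f] closed[OF X A a(1)])
  have cv: "graded_comp K Y c v = graded_comp K Y ?g b"
    by (rule graded_eqI[OF Y C comp_maps[OF Y Z C c(1) v] gb])
      (simp add: v_def comp_apply c'(2) closed[OF D C g] closed[OF Y D b(1)])
  have sX: "cx_shift X \<in> B" and sA: "cx_shift ?A \<in> B"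
    using bounded_complex.shift_bounded[OF bounded_complex.intro[OF K]] X A by blast+
  let ?w = "graded_zero K Z (cx_shift X)"
  have w: "?w \<in> graded_maps K Z (cx_shift X)" by (rule zero_maps[OF Z sX])
  let ?t = "split_connecting ?D ?C \<pi> \<sigma>"
  \<comment> \<open>The differential of the middle complex is zero, hence so is the connecting
    map.\<close>
  have t_eq: "?t = (\<lambda>n. \<lambda>x\<in>carrier (csp ?C n). \<zero>\<^bsub>csp (cx_shift ?A) n\<^esub>)"
  proof
    fix n
    show "?t n = (\<lambda>x\<in>carrier (csp ?C n). \<zero>\<^bsub>csp (cx_shift ?A) n\<^esub>)"
      unfolding split_connecting_def
    proof (rule restrict_ext)
      fix x assume x: "x \<in> carrier (csp ?C n)"
      then have "\<sigma> n x \<in> carrier (std_space K (p n + q n))" using lin_closed[OF \<sigma>l] by (simp del: std_space_sel)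
      then show "\<pi> (n + 1) (cdf ?D n (\<sigma> n x)) = \<zero>\<^bsub>csp (cx_shift ?A) n\<^esub>"
        using lin_zero[OF \<pi>l m m, of "n + 1"] d0[of "\<sigma> n x" "\<lambda>n. p n + q n" n] by (simp del: std_space_sel)
    qed
  qed
  interpret CA: bounded_complex_pair K ?C "cx_shift ?A" by (rule pair[OF C sA])
  have t: "?t \<in> chain_maps K ?C (cx_shift ?A)"
    unfolding chain_maps_def
  proof (intro CollectI conjI allI ballI)
    fix n
    show "?t n \<in> lin_maps K (csp ?C n) (csp (cx_shift ?A) n)"
      unfolding t_eq by (rule lin_zero_map[OF CA.X.mod CA.Y.mod])
    fix x assume x: "x \<in> carrier (csp ?C n)"
    have "?t (n + 1) (cdf ?C n x) = \<zero>\<^bsub>csp (cx_shift ?A) (n + 1)\<^esub>"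
      unfolding t_eq by (rule restrict_apply'[OF CA.X.d_closed[OF x refl]])
    moreover have "cdf (cx_shift ?A) n (?t n x) = \<zero>\<^bsub>csp (cx_shift ?A) (n + 1)\<^esub>"
      unfolding t_eq restrict_apply'[OF x] by (rule CA.Y.d_zero)
    ultimately show "?t (n + 1) (cdf ?C n x) = cdf (cx_shift ?A) n (?t n x)" by simp
  qed
  let ?h = "hmap K ?C (cx_shift ?A) ?t"
  have h: "?h \<in> graded_maps K ?C (cx_shift ?A)" by (rule CA.hmap_graded[OF t])
  have h0: "?h n x = \<zero>\<^bsub>csp (cx_shift ?A) n\<^esub>" if "x \<in> carrier (harmonic K ?C n)" for n x
    unfolding CA.hmap_eq[OF that] t_eq restrict_apply'[OF CA.X.H_closed[OF that]] by (rule CA.Y.p_zero)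
  have "der_shift K (mor K X ?A a) \<in> der_hom K (cx_shift X) (cx_shift ?A)"
    by (rule der_shift_closed[OF K X A mor_hom[OF X A a(1)]])
  then obtain s where s: "s \<in> graded_maps K (cx_shift X) (cx_shift ?A)"
    "der_shift K (mor K X ?A a) = mor K (cx_shift X) (cx_shift ?A) s"
    using homE[OF _ sX sA] by blast
  \<comment> \<open>Both ways around the third square are zero, whichever graded map s represents
    the shifted isomorphism.\<close>
  have sw: "graded_comp K Z s ?w = graded_comp K Z ?h c"
  proof (rule graded_eqI[OF Z sA comp_maps[OF Z sX sA s(1) w] comp_maps[OF Z C sA h c(1)]])
    fix n x assume x: "x \<in> carrier (harmonic K Z n)"
    have "?w n x = \<zero>\<^bsub>csp (cx_shift X) n\<^esub>" using x by (simp add: graded_zero_def)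
    then show "graded_comp K Z s ?w n x = graded_comp K Z ?h c n x"
      unfolding comp_apply[OF x] h0[OF closed[OF Z C c(1) x]] by (simp only: gzero[OF sX sA s(1)])
  qed
  have e1: "der_comp K (mor K Y ?D b) (mor K X Y u) = der_comp K (der_map K ?A ?D \<alpha>) (mor K X ?A a)"
    unfolding der_map_eq_mor[OF K A D \<alpha>] comp_mor[OF X Y D b(1) u] comp_mor[OF X A D f a(1)] bu ..
  have e2: "der_comp K (mor K Z ?C c) (mor K Y Z v) = der_comp K (der_map K ?D ?C \<beta>) (mor K Y ?D b)"
    unfolding der_map_eq_mor[OF K D C \<beta>] comp_mor[OF Y Z C c(1) v] comp_mor[OF Y D C g b(1)] cv ..
  have e3: "der_comp K (der_shift K (mor K X ?A a)) (mor K Z (cx_shift X) ?w) =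
      der_comp K (der_map K ?C (cx_shift ?A) ?t) (mor K Z ?C c)"
    unfolding der_map_eq_mor[OF K C sA t] s(2) comp_mor[OF Z sX sA s(1) w] comp_mor[OF Z C sA h c(1)] sw ..
  have "(X, Y, Z, mor K X Y u, mor K Y Z v, mor K Z (cx_shift X) ?w) \<in> der_triangles K"
    unfolding der_triangles_def
    by (rule CollectI, intro exI conjI, rule refl)
      (rule X Y Z mor_hom[OF X Y u] mor_hom[OF Y Z v] mor_hom[OF Z sX w] sp
        a(2)[folded iso_mor_der_cat] b(2)[folded iso_mor_der_cat] c(2)[folded iso_mor_der_cat] e1 e2 e3)+
  then show ?thesis by blast
qed

section \<open>Finite length of full subcategories\<close>

lemma split_mono:
  assumes X: "X \<in> B" and Y: "Y \<in> B" and \<alpha>: "\<alpha> \<in> graded_maps K X Y"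
    and inj: "\<And>n. inj_on (\<alpha> n) (carrier (harmonic K X n))"
  shows "hdim K X n \<le> hdim K Y n"
    and "(\<And>n. hdim K X n = hdim K Y n) \<Longrightarrow> iso_mor T X Y (mor K X Y \<alpha>)"
proof -
  interpret bounded_complex_pair K X Y by (rule pair[OF X Y])
  have l: "\<alpha> n \<in> lin_maps K (X.H n) (Y.H n)" for n using \<alpha> by (simp add: graded_maps_def)
  show "hdim K X n \<le> hdim K Y n"
    unfolding hdim_def by (rule lin_inj_dim(1)[OF K l X.fd_H Y.fd_H inj])
  assume "\<And>n. hdim K X n = hdim K Y n"
  then have "bij_betw (\<alpha> n) (carrier (X.H n)) (carrier (Y.H n))" for n
    unfolding hdim_def by (intro lin_inj_dim(2)[OF K l X.fd_H Y.fd_H inj])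
  then show "iso_mor T X Y (mor K X Y \<alpha>)" using iso_mor_mor_iff[OF X Y \<alpha>] by blast
qed

text \<open>Every graded map has a generalized inverse, so a monomorphism that is tested on its own
  source is already injective on cohomology.\<close>

lemma mono_injective:
  assumes S: "S \<subseteq> B" and X: "X \<in> S" and Y: "Y \<in> S" and \<alpha>: "\<alpha> \<in> graded_maps K X Y"
    and mono: "mono_mor (full_sub T S) X Y (mor K X Y \<alpha>)"
  shows "inj_on (\<alpha> n) (carrier (harmonic K X n))"
proof -
  have XB: "X \<in> B" and YB: "Y \<in> B" using S X Y by auto
  interpret bounded_complex_pair K X Y by (rule pair[OF XB YB])
  have l: "\<alpha> i \<in> lin_maps K (X.H i) (Y.H i)" for i using \<alpha> by (simp add: graded_maps_def)
  have "\<exists>g\<in>lin_maps K (Y.H i) (X.H i). \<forall>x\<in>carrier (X.H i). \<alpha> i (g (\<alpha> i x)) = \<alpha> i x" for i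
    using lin_generalized_inverse[OF K l X.fd_H Y.fd_H] by metis
  then obtain \<gamma> where \<gamma>: "\<And>i. \<gamma> i \<in> lin_maps K (Y.H i) (X.H i)"
    "\<And>i x. x \<in> carrier (X.H i) \<Longrightarrow> \<alpha> i (\<gamma> i (\<alpha> i x)) = \<alpha> i x" by metis
  have g: "\<gamma> \<in> graded_maps K Y X" using \<gamma>(1) by (simp add: graded_maps_def)
  let ?e = "graded_comp K X \<gamma> \<alpha>"
  have e: "?e \<in> graded_maps K X X" by (rule comp_maps[OF XB YB XB g \<alpha>])
  have i: "graded_id K X \<in> graded_maps K X X" by (rule id_maps[OF XB])
  have "graded_comp K X \<alpha> ?e = graded_comp K X \<alpha> (graded_id K X)"
    by (rule derived.graded_eqI[OF derived_axioms XB YB comp_maps[OF XB XB YB \<alpha> e] comp_maps[OF XB XB YB \<alpha> i]])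
      (simp add: comp_apply \<gamma>(2) graded_id_def)
  then have "der_comp K (mor K X Y \<alpha>) (mor K X X ?e) = der_comp K (mor K X Y \<alpha>) (mor K X X (graded_id K X))"
    by (simp add: comp_mor[OF XB XB YB \<alpha> e] comp_mor[OF XB XB YB \<alpha> i])
  moreover have "\<forall>g\<in>der_hom K X X. \<forall>h\<in>der_hom K X X.
      der_comp K (mor K X Y \<alpha>) g = der_comp K (mor K X Y \<alpha>) h \<longrightarrow> g = h"
    using mono X unfolding mono_mor_def by simp
  ultimately have "mor K X X ?e = mor K X X (graded_id K X)"
    using mor_hom[OF XB XB e] mor_hom[OF XB XB i] by blast
  then have eq: "?e = graded_id K X" using mor_eq_iff[OF XB XB e] by blast
  have "\<gamma> n (\<alpha> n x) = x" if "x \<in> carrier (harmonic K X n)" for x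
    using fun_cong[OF fun_cong[OF eq, of n], of x] that by (simp add: comp_apply graded_id_def)
  then show ?thesis by (rule inj_on_inverseI)
qed

text \<open>The sum over the finite support is a monotone bounded sequence of natural numbers, hence
  eventually constant, and terms that move in one direction only cannot change while their sum stays
  fixed.\<close>

lemma eventually_constant_dims:
  fixes t :: "nat \<Rightarrow> int \<Rightarrow> nat"
  assumes E: "finite {i. e i \<noteq> 0}" and le: "\<And>n i. t n i \<le> e i"
    and mono: "(\<forall>n i. t (Suc n) i \<le> t n i) \<or> (\<forall>n i. t n i \<le> t (Suc n) i)"
  shows "\<exists>N. \<forall>n\<ge>N. \<forall>i. t (Suc n) i = t n i"
proof -
  let ?I = "{i. e i \<noteq> 0}"
  define s where "s n = (\<Sum>i\<in>?I. t n i)" for n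
  have out: "t n i = 0" if "i \<notin> ?I" for n i using le[of n i] that by simp
  have sle: "s n \<le> (\<Sum>i\<in>?I. e i)" for n unfolding s_def by (rule sum_mono) (rule le)
  have step: "t (Suc n) i = t n i" if "s (Suc n) = s n" for n i
  proof (cases "i \<in> ?I")
    case True
    from mono show ?thesis
    proof
      assume m: "\<forall>n i. t (Suc n) i \<le> t n i"
      have "s n = s (Suc n)" using that by simp
      then show ?thesis
        using sum_mono_inv[of "\<lambda>i. t (Suc n) i" ?I "\<lambda>i. t n i" i] that m True E by (simp add: s_def)
    next
      assume m: "\<forall>n i. t n i \<le> t (Suc n) i"
      then show ?thesis
        using sum_mono_inv[of "\<lambda>i. t n i" ?I "\<lambda>i. t (Suc n) i" i] that True E by (simp add: s_def)
    qed
  qed (simp add: out)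
  have "\<exists>N. \<forall>n\<ge>N. s (Suc n) = s n"
    using mono
  proof
    assume m: "\<forall>n i. t (Suc n) i \<le> t n i"
    have dec: "s (Suc n) \<le> s n" for n unfolding s_def by (rule sum_mono) (use m in blast)
    have dec': "s n \<le> s N" if "N \<le> n" for n N using that by (induction rule: dec_induct) (use dec le_trans in blast)+
    obtain N where N: "\<And>n. s N \<le> s n" using ex_has_least_nat[of "\<lambda>_. True" _ s] by blast
    show ?thesis
    proof (intro exI[of _ N] allI impI)
      fix n assume "N \<le> n"
      then show "s (Suc n) = s n" using dec'[of N n] dec[of n] N[of "Suc n"] by linarith
    qed
  next
    assume m: "\<forall>n i. t n i \<le> t (Suc n) i"
    have inc: "s n \<le> s (Suc n)" for n unfolding s_def by (rule sum_mono) (use m in blast)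
    have inc': "s N \<le> s n" if "N \<le> n" for n N using that by (induction rule: dec_induct) (use inc le_trans in blast)+
    \<comment> \<open>Minimizing the gap to the upper bound is maximizing s.\<close>
    obtain N where N: "\<And>n. (\<Sum>i\<in>?I. e i) - s N \<le> (\<Sum>i\<in>?I. e i) - s n"
      using ex_has_least_nat[of "\<lambda>_. True" _ "\<lambda>n. (\<Sum>i\<in>?I. e i) - s n"] by blast
    show ?thesis
    proof (intro exI[of _ N] allI impI)
      fix n assume "N \<le> n"
      then show "s (Suc n) = s n"
        using inc'[of N n] inc[of n] N[of "Suc n"] sle[of "Suc n"] sle[of N] by linarith
    qed
  qed
  then show ?thesis using step by blast
qed

text \<open>Along a chain of strict subobjects of E all maps are injective on cohomology, so the
  dimensions are monotone and bounded by those of E. Once they are constant, the maps of the chain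
  are isomorphisms. This settles local finiteness of every slicing at once.\<close>

lemma full_sub_finite_length:
  assumes S: "S \<subseteq> B"
  shows "finite_length (full_sub T S)"
proof -
  let ?C = "full_sub T S"
  have C_sel: "tob ?C = S" "thom ?C = der_hom K" "tcmp ?C = der_comp K" by simp_all
  have iso_C: "iso_mor ?C X Y f = iso_mor T X Y f" for X Y f by (simp add: iso_mor_def)
  have sub: "X \<in> S \<and> mono_mor ?C X E i \<and> i \<in> der_hom K X E" if "strict_sub ?C E X i" for E X i
    using that by (simp add: strict_sub_def mono_mor_def)
  \<comment> \<open>The inclusion i = j u is injective on harmonic parts, and therefore so is its
    first factor u.\<close>
  have inj: "inj_on (u n) (carrier (harmonic K X n))"
    if X: "X \<in> S" and Y: "Y \<in> S" and E: "E \<in> S" and i: "i \<in> graded_maps K X E" and j: "j \<in> graded_maps K Y E"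
      and u: "u \<in> graded_maps K X Y" and mono: "mono_mor ?C X E (mor K X E i)"
      and eq: "der_comp K (mor K Y E j) (mor K X Y u) = mor K X E i" for X Y E i j u n
  proof -
    have XB: "X \<in> B" and YB: "Y \<in> B" and EB: "E \<in> B" using S X Y E by auto
    have "graded_comp K X j u = i"
      using eq mor_eq_iff[OF XB EB comp_maps[OF XB YB EB j u]] by (simp add: comp_mor[OF XB YB EB j u])
    then have "j n (u n x) = i n x" if "x \<in> carrier (harmonic K X n)" for x
      using comp_apply[OF that, of j u] by simp
    moreover have "inj_on (i n) (carrier (harmonic K X n))" by (rule mono_injective[OF S X E i mono])
    ultimately show ?thesis unfolding inj_on_def by metis
  qed
  have art: "strict_artinian ?C"
    unfolding strict_artinian_def C_sel iso_C
  proof (intro ballI allI impI)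
    fix E A i u
    assume E: "E \<in> S" and *: "\<forall>n::nat. strict_sub ?C E (A n) (i n) \<and> u n \<in> der_hom K (A (Suc n)) (A n) \<and>
      der_comp K (i n) (u n) = i (Suc n)"
    have AS: "A n \<in> S" and mono: "mono_mor ?C (A n) E (i n)" and ih: "i n \<in> der_hom K (A n) E" for n
      using sub[of E "A n" "i n"] * by blast+
    have AB: "A n \<in> B" for n using AS S by blast
    have EB: "E \<in> B" using E S by blast
    have "\<exists>\<iota>. \<iota> \<in> graded_maps K (A n) E \<and> i n = mor K (A n) E \<iota>" for n using homE[OF ih AB EB] by metis
    then obtain \<iota> where \<iota>: "\<And>n. \<iota> n \<in> graded_maps K (A n) E" "\<And>n. i n = mor K (A n) E (\<iota> n)" by metis
    have "\<exists>\<upsilon>. \<upsilon> \<in> graded_maps K (A (Suc n)) (A n) \<and> u n = mor K (A (Suc n)) (A n) \<upsilon>" for n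
      using * homE[OF _ AB AB, of "u n" "Suc n" n] by metis
    then obtain \<upsilon> where \<upsilon>: "\<And>n. \<upsilon> n \<in> graded_maps K (A (Suc n)) (A n)" "\<And>n. u n = mor K (A (Suc n)) (A n) (\<upsilon> n)"
      by metis
    have in\<upsilon>: "inj_on (\<upsilon> n m) (carrier (harmonic K (A (Suc n)) m))" for n m
      by (rule inj[OF AS AS E \<iota>(1) \<iota>(1) \<upsilon>(1)]) (use mono * \<iota>(2) \<upsilon>(2) in metis)+
    have in\<iota>: "inj_on (\<iota> n m) (carrier (harmonic K (A n) m))" for n m
      by (rule mono_injective[OF S AS E \<iota>(1)]) (use mono \<iota>(2) in metis)
    have "\<exists>N. \<forall>n\<ge>N. \<forall>m. hdim K (A (Suc n)) m = hdim K (A n) m"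
    proof (rule eventually_constant_dims[OF hdim_finite[OF K EB]])
      show "hdim K (A n) m \<le> hdim K E m" for n m by (rule split_mono(1)[OF AB EB \<iota>(1) in\<iota>])
      have "hdim K (A (Suc n)) m \<le> hdim K (A n) m" for n m by (rule split_mono(1)[OF AB AB \<upsilon>(1) in\<upsilon>])
      then show "(\<forall>n m. hdim K (A (Suc n)) m \<le> hdim K (A n) m) \<or> (\<forall>n m. hdim K (A n) m \<le> hdim K (A (Suc n)) m)"
        by blast
    qed
    then obtain N where N: "\<And>n m. n \<ge> N \<Longrightarrow> hdim K (A (Suc n)) m = hdim K (A n) m" by blast
    have "iso_mor T (A (Suc n)) (A n) (u n)" if "n \<ge> N" for n
      unfolding \<upsilon>(2) by (rule split_mono(2)[OF AB AB \<upsilon>(1) in\<upsilon> N[OF that]])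
    then show "\<exists>N. \<forall>n\<ge>N. iso_mor T (A (Suc n)) (A n) (u n)" by blast
  qed
  have noeth: "strict_noetherian ?C"
    unfolding strict_noetherian_def C_sel iso_C
  proof (intro ballI allI impI)
    fix E A i u
    assume E: "E \<in> S" and *: "\<forall>n::nat. strict_sub ?C E (A n) (i n) \<and> u n \<in> der_hom K (A n) (A (Suc n)) \<and>
      der_comp K (i (Suc n)) (u n) = i n"
    have AS: "A n \<in> S" and mono: "mono_mor ?C (A n) E (i n)" and ih: "i n \<in> der_hom K (A n) E" for n
      using sub[of E "A n" "i n"] * by blast+
    have AB: "A n \<in> B" for n using AS S by blast
    have EB: "E \<in> B" using E S by blast
    have "\<exists>\<iota>. \<iota> \<in> graded_maps K (A n) E \<and> i n = mor K (A n) E \<iota>" for n using homE[OF ih AB EB] by metis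
    then obtain \<iota> where \<iota>: "\<And>n. \<iota> n \<in> graded_maps K (A n) E" "\<And>n. i n = mor K (A n) E (\<iota> n)" by metis
    have "\<exists>\<upsilon>. \<upsilon> \<in> graded_maps K (A n) (A (Suc n)) \<and> u n = mor K (A n) (A (Suc n)) \<upsilon>" for n
      using * homE[OF _ AB AB, of "u n" n "Suc n"] by metis
    then obtain \<upsilon> where \<upsilon>: "\<And>n. \<upsilon> n \<in> graded_maps K (A n) (A (Suc n))" "\<And>n. u n = mor K (A n) (A (Suc n)) (\<upsilon> n)"
      by metis
    have in\<upsilon>: "inj_on (\<upsilon> n m) (carrier (harmonic K (A n) m))" for n m
      by (rule inj[OF AS AS E \<iota>(1) \<iota>(1) \<upsilon>(1)]) (use mono * \<iota>(2) \<upsilon>(2) in metis)+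
    have in\<iota>: "inj_on (\<iota> n m) (carrier (harmonic K (A n) m))" for n m
      by (rule mono_injective[OF S AS E \<iota>(1)]) (use mono \<iota>(2) in metis)
    have "\<exists>N. \<forall>n\<ge>N. \<forall>m. hdim K (A (Suc n)) m = hdim K (A n) m"
    proof (rule eventually_constant_dims[OF hdim_finite[OF K EB]])
      show "hdim K (A n) m \<le> hdim K E m" for n m by (rule split_mono(1)[OF AB EB \<iota>(1) in\<iota>])
      have "hdim K (A n) m \<le> hdim K (A (Suc n)) m" for n m by (rule split_mono(1)[OF AB AB \<upsilon>(1) in\<upsilon>])
      then show "(\<forall>n m. hdim K (A (Suc n)) m \<le> hdim K (A n) m) \<or> (\<forall>n m. hdim K (A n) m \<le> hdim K (A (Suc n)) m)"
        by blast
    qed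
    then obtain N where N: "\<And>n m. n \<ge> N \<Longrightarrow> hdim K (A (Suc n)) m = hdim K (A n) m" by blast
    have "iso_mor T (A n) (A (Suc n)) (u n)" if "n \<ge> N" for n
      unfolding \<upsilon>(2) by (rule split_mono(2)[OF AB AB \<upsilon>(1) in\<upsilon> N[OF that, symmetric]])
    then show "\<exists>N. \<forall>n\<ge>N. iso_mor T (A n) (A (Suc n)) (u n)" by blast
  qed
  show ?thesis unfolding finite_length_def using art noeth by blast
qed

end

section \<open>The triangle over an acyclic two-term complex\<close>

lemma (in bounded_complex) hdim_acyclic:
  assumes "cocycles X n \<subseteq> coboundaries X n"
  shows "hdim K X n = 0"
proof -
  have "x = \<zero>\<^bsub>H n\<^esub>" if x: "x \<in> carrier (H n)" for x
  proof -
    have "x \<in> cocycles X n" using H_closed[OF x] d_H[OF x] by (simp add: cocycles_def)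
    then have "x \<in> cdf X (n - 1) ` carrier (csp X (n - 1))"
      using assms by (auto simp: coboundaries_def)
    then obtain y where y: "y \<in> carrier (csp X (n - 1))" "x = cdf X (n - 1) y" by (rule imageE)
    then have "p n x = \<zero>\<^bsub>csp X n\<^esub>" using p_d[OF y(1), of n] by simp
    then show ?thesis using p_H[OF x] by simp
  qed
  moreover have "\<zero>\<^bsub>H n\<^esub> \<in> carrier (H n)"
    using abelian_group.axioms(1)[OF module.axioms(2)[OF mod_H]] by (rule abelian_monoid.zero_closed)
  ultimately have "carrier (H n) = {\<zero>\<^bsub>H n\<^esub>}" by (rule eq_singletonI)
  then show ?thesis unfolding hdim_def by (rule dim_eq_0_iff[OF K fd_H, THEN iffD2])
qed

text \<open>Identity and zero in one constant: families of maps that are the identity in a single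
  degree and zero elsewhere need no case distinction on the degree.\<close>

definition std_map :: "('a, 'r) ring_scheme \<Rightarrow> bool \<Rightarrow> nat \<Rightarrow> nat \<Rightarrow> 'a list \<Rightarrow> 'a list" where
  "std_map K P a b = (\<lambda>x\<in>carrier (std_space K a). if P then x else replicate b \<zero>\<^bsub>K\<^esub>)"

lemma std_map_lin:
  assumes "cring K" "P \<Longrightarrow> a = b"
  shows "std_map K P a b \<in> lin_maps K (std_space K a) (std_space K b)"
proof (cases P)
  case True
  then show ?thesis using lin_id[OF std_space_module[OF assms(1)]] assms(2) by (simp add: std_map_def)
next
  case False
  then show ?thesis
    using lin_zero_map[OF std_space_module[OF assms(1)] std_space_module[OF assms(1)], of b a]
    by (simp add: std_map_def)
qed

context derived
begin

text \<open>Used where a standard triangle is compared with itself by identities: the third square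
  then contains the shift of an identity.\<close>

lemma der_shift_id:
  assumes X: "X \<in> B"
  shows "der_shift K (mor K X X (graded_id K X)) = mor K (cx_shift X) (cx_shift X) (graded_id K (cx_shift X))"
proof -
  have sX: "cx_shift X \<in> B" by (rule bounded_complex.shift_bounded[OF bounded_complex.intro[OF K X]])
  let ?r = "Roof X X X (cm_id X) (cm_id X)"
  have hid: "hmap K X X (cm_id X) = graded_id K X" if "X \<in> B" for X
    using bounded_complex.hmap_id[OF bounded_complex.intro[OF K that]] by (simp add: graded_id_def)
  have rep: "represents K (graded_id K X) (Roof X X X (cm_id X) (cm_id X))" if "X \<in> B" for X
    using represents_cm_of[OF K that that bounded_complex.cm_id_chain[OF bounded_complex.intro[OF K that]]]
    by (simp only: hid[OF that])
  have sid: "cm_shift (cm_id X) = cm_id (cx_shift X)" by (simp add: cm_shift_def cm_id_def restrict_def fun_eq_iff)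
  have rs: "roof_shift ?r = Roof (cx_shift X) (cx_shift X) (cx_shift X) (cm_id (cx_shift X)) (cm_id (cx_shift X))"
    by (simp add: sid)
  show ?thesis
    unfolding der_shift_def
  proof (rule Union_constant)
    show "{roof_class K (Roof (cx_shift X') (cx_shift W) (cx_shift Y) (cm_shift s) (cm_shift f)) |
        X' W Y s f. Roof X' W Y s f \<in> mor K X X (graded_id K X)} \<noteq> {}"
      using rep[OF X] Roof_in_mor[of X X X "cm_id X" "cm_id X" K X X "graded_id K X"] by blast
    fix c assume "c \<in> {roof_class K (Roof (cx_shift X') (cx_shift W) (cx_shift Y) (cm_shift s) (cm_shift f)) |
        X' W Y s f. Roof X' W Y s f \<in> mor K X X (graded_id K X)}"
    then obtain W s f where c: "represents K (graded_id K X) (Roof X W X s f)" and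
      c_eq: "c = roof_class K (Roof (cx_shift X) (cx_shift W) (cx_shift X) (cm_shift s) (cm_shift f))"
      unfolding Roof_in_mor by blast
    have "roof_equiv K (roof_shift ?r) (roof_shift (Roof X W X s f))"
      by (rule roof_equiv_shift[OF K represents_roof_equiv[OF K rep[OF X] c]])
    from roof_equiv_represents[OF K this[unfolded rs roof_shift.simps(1)[of X W X s f]] rep[OF sX]]
    show "c = mor K (cx_shift X) (cx_shift X) (graded_id K (cx_shift X))"
      unfolding c_eq by (rule roof_class_eq_mor[OF K])
  qed
qed

text \<open>The middle term is the acyclic complex k -> k in degrees n and n + 1 with the identity
  as differential; its subcomplex is the line in degree n + 1, its quotient the line in degree n. In
  K0 this triangle makes the two lines opposite.\<close>

lemma shift_triangle_exists:
  "\<exists>X Y Z u v w. (X, Y, Z, u, v, w) \<in> tdt T \<and>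
     hdim K X = (\<lambda>i. if i = n + 1 then 1 else 0) \<and> hdim K Y = (\<lambda>_. 0) \<and>
     hdim K Z = (\<lambda>i. if i = n then 1 else 0)"
proof -
  interpret K: field K by (rule K)
  note m = std_space_module[OF K.is_cring]
  define p :: "int \<Rightarrow> nat" where "p = (\<lambda>i. if i = n + 1 then 1 else 0)"
  define q :: "int \<Rightarrow> nat" where "q = (\<lambda>i. if i = n then 1 else 0)"
  define r :: "int \<Rightarrow> nat" where "r = (\<lambda>i. if i = n \<or> i = n + 1 then 1 else 0)"
  note pqr = p_def q_def r_def
  have fin: "finite {i. p i \<noteq> 0}" "finite {i. q i \<noteq> 0}"
    by (rule finite_subset[of _ "{n, n + 1}"], auto simp: pqr)+
  let ?A = "std_complex K p" and ?C = "std_complex K q"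
  define D where "D = \<lparr>csp = (\<lambda>i. std_space K (r i)), cdf = (\<lambda>i. std_map K (i = n) (r i) (r (i + 1)))\<rparr>"
  have D_sel [simp]: "csp D i = std_space K (r i)" "cdf D i = std_map K (i = n) (r i) (r (i + 1))" for i
    by (simp_all add: D_def)
  have A_d [simp]: "cdf ?A i = std_map K False (p i) (p (i + 1))"
    and C_d [simp]: "cdf ?C i = std_map K False (q i) (q (i + 1))" for i
    by (simp_all add: std_complex_def std_map_def)
  note sm = std_map_lin[OF K.is_cring]
  have A: "?A \<in> B" and C: "?C \<in> B"
    by (rule std_complex_bounded[OF K fin(1)], rule std_complex_bounded[OF K fin(2)])
  have D: "D \<in> B"
    unfolding bounded_complexes_def
  proof (intro CollectI conjI allI ballI)
    show "\<exists>N. \<forall>i. \<bar>i\<bar> > N \<longrightarrow> carrier (csp D i) = {\<zero>\<^bsub>csp D i\<^esub>}"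
      by (intro exI[of _ "\<bar>n\<bar> + 1"]) (auto simp: r_def)
    fix i
    show "fin_dim_space K (csp D i)" using std_space_fd[OF K.is_cring] by simp
    show "cdf D i \<in> lin_maps K (csp D i) (csp D (i + 1))"
      unfolding D_sel by (rule sm) (simp add: r_def)
    fix x assume "x \<in> carrier (csp D i)"
    then show "cdf D (i + 1) (cdf D i x) = \<zero>\<^bsub>csp D (i + 2)\<^esub>"
      by (auto simp: std_map_def r_def add.assoc)
  qed
  interpret D: bounded_complex K D by (rule bounded_complex.intro[OF K D])
  have hD: "hdim K D = (\<lambda>_. 0)"
  proof
    fix i
    show "hdim K D i = 0"
    proof (rule D.hdim_acyclic, rule subsetI)
      fix x assume x: "x \<in> cocycles D i"
      consider "i = n" | "i = n + 1" | "i \<noteq> n" "i \<noteq> n + 1" by blast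
      then show "x \<in> coboundaries D i"
      proof cases
        case 1
        then have "x = [\<zero>\<^bsub>K\<^esub>]" using x by (auto simp: cocycles_def std_map_def r_def split: if_splits)
        then show ?thesis unfolding coboundaries_def using 1
          by (intro image_eqI[of _ _ "[]"]) (simp_all add: std_map_def r_def)
      next
        case 2
        then show ?thesis unfolding coboundaries_def using x
          by (intro image_eqI[of _ _ x]) (simp_all add: std_map_def r_def cocycles_def)
      next
        case 3
        then have "x = []" using x by (simp add: cocycles_def r_def)
        moreover have "\<zero>\<^bsub>csp D (i - 1)\<^esub> \<in> carrier (csp D (i - 1))" by auto
        then have "cdf D (i - 1) \<zero>\<^bsub>csp D (i - 1)\<^esub> \<in> coboundaries D i" unfolding coboundaries_def by (rule imageI)
        ultimately show ?thesis using D.d_zero[of "i - 1"] 3 by (simp add: r_def)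
      qed
    qed
  qed
  define \<alpha> where "\<alpha> = (\<lambda>i. std_map K (i = n + 1) (p i) (r i))"
  define \<beta> where "\<beta> = (\<lambda>i. std_map K (i = n) (r i) (q i))"
  define \<pi> where "\<pi> = (\<lambda>i. std_map K (i = n + 1) (r i) (p i))"
  define \<sigma> where "\<sigma> = (\<lambda>i. std_map K (i = n) (q i) (r i))"
  have \<alpha>: "\<alpha> \<in> chain_maps K ?A D"
    unfolding chain_maps_def
  proof (intro CollectI conjI allI ballI)
    fix i
    show "\<alpha> i \<in> lin_maps K (csp ?A i) (csp D i)"
      unfolding \<alpha>_def std_complex_sel D_sel by (rule sm) (simp add: pqr)
    fix x assume "x \<in> carrier (csp ?A i)"
    then show "\<alpha> (i + 1) (cdf ?A i x) = cdf D i (\<alpha> i x)"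
      unfolding A_d D_sel std_complex_sel by (auto simp: \<alpha>_def std_map_def pqr)
  qed
  have \<beta>: "\<beta> \<in> chain_maps K D ?C"
    unfolding chain_maps_def
  proof (intro CollectI conjI allI ballI)
    fix i
    show "\<beta> i \<in> lin_maps K (csp D i) (csp ?C i)"
      unfolding \<beta>_def std_complex_sel D_sel by (rule sm) (simp add: pqr)
    fix x assume "x \<in> carrier (csp D i)"
    then show "\<beta> (i + 1) (cdf D i x) = cdf ?C i (\<beta> i x)"
      unfolding C_d D_sel std_complex_sel by (auto simp: \<beta>_def std_map_def pqr)
  qed
  have sp: "termwise_split K ?A D ?C \<alpha> \<beta> \<pi> \<sigma>"
    unfolding termwise_split_def
  proof (intro conjI allI ballI A C D \<alpha> \<beta>)
    fix i
    show "\<pi> i \<in> lin_maps K (csp D i) (csp ?A i)" "\<sigma> i \<in> lin_maps K (csp ?C i) (csp D i)"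
      unfolding \<pi>_def \<sigma>_def std_complex_sel D_sel by (rule sm, simp add: pqr)+
    show "\<pi> i (\<alpha> i x) = x" "\<beta> i (\<alpha> i x) = \<zero>\<^bsub>csp ?C i\<^esub>" if "x \<in> carrier (csp ?A i)" for x
      using that by (auto simp: \<pi>_def \<alpha>_def \<beta>_def std_map_def pqr)
    show "\<beta> i (\<sigma> i x) = x" if "x \<in> carrier (csp ?C i)" for x
      using that by (auto simp: \<sigma>_def \<beta>_def std_map_def pqr)
    show "\<alpha> i (\<pi> i x) \<oplus>\<^bsub>csp D i\<^esub> \<sigma> i (\<beta> i x) = x" if "x \<in> carrier (csp D i)" for x
      using that by (auto simp: \<pi>_def \<alpha>_def \<sigma>_def \<beta>_def std_map_def pqr length_Suc_conv)
  qed
  have sA: "cx_shift ?A \<in> B" by (rule bounded_complex.shift_bounded[OF bounded_complex.intro[OF K A]])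
  let ?t = "split_connecting D ?C \<pi> \<sigma>"
  \<comment> \<open>In degree n the connecting map is the differential of the middle complex between
    its two lines, that is, the identity.\<close>
  have t_eq: "?t = (\<lambda>i. std_map K (i = n) (q i) (p (i + 1)))"
    by (rule HOL.ext) (auto simp: split_connecting_def std_map_def \<pi>_def \<sigma>_def pqr fun_eq_iff restrict_def)
  have t: "?t \<in> chain_maps K ?C (cx_shift ?A)"
    unfolding chain_maps_def t_eq
  proof (intro CollectI conjI allI ballI)
    fix i
    show "std_map K (i = n) (q i) (p (i + 1)) \<in> lin_maps K (csp ?C i) (csp (cx_shift ?A) i)"
      unfolding cx_shift_sel std_complex_sel by (rule sm) (simp add: pqr)
    fix x assume x: "x \<in> carrier (csp ?C i)"
    have "std_map K (i = n) (q i) (p (i + 1)) x \<in> carrier (std_space K (p (i + 1)))"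
      using lin_closed[OF sm, of "i = n" "q i" "p (i + 1)" x] x by (auto simp: pqr)
    then have "cdf (cx_shift ?A) i (std_map K (i = n) (q i) (p (i + 1)) x) =
        \<ominus>\<^bsub>std_space K (p (i + 2))\<^esub> \<zero>\<^bsub>std_space K (p (i + 2))\<^esub>"
      by (simp add: cx_shift_def std_map_def add.assoc)
    also have "\<dots> = \<zero>\<^bsub>std_space K (p (i + 2))\<^esub>"
    proof -
      interpret S: Module.module K "std_space K (p (i + 2))" by (rule m)
      show ?thesis by (rule S.minus_equality[OF S.l_zero]) (rule S.zero_closed)+
    qed
    also have "\<dots> = std_map K (i + 1 = n) (q (i + 1)) (p (i + 1 + 1)) (cdf ?C i x)"
      using x unfolding C_d std_complex_sel by (auto simp: std_map_def add.assoc pqr)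
    finally show "std_map K (i + 1 = n) (q (i + 1)) (p (i + 1 + 1)) (cdf ?C i x) =
        cdf (cx_shift ?A) i (std_map K (i = n) (q i) (p (i + 1)) x)" ..
  qed
  have f: "hmap K ?A D \<alpha> \<in> graded_maps K ?A D" by (rule bounded_complex_pair.hmap_graded[OF pair[OF A D] \<alpha>])
  have g: "hmap K D ?C \<beta> \<in> graded_maps K D ?C" by (rule bounded_complex_pair.hmap_graded[OF pair[OF D C] \<beta>])
  have h: "hmap K ?C (cx_shift ?A) ?t \<in> graded_maps K ?C (cx_shift ?A)"
    by (rule bounded_complex_pair.hmap_graded[OF pair[OF C sA] t])
  have idl: "graded_comp K X (graded_id K Y) \<gamma> = \<gamma>" if "X \<in> B" "Y \<in> B" "\<gamma> \<in> graded_maps K X Y" for X Y \<gamma>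
    by (rule graded_eqI[OF that(1,2) comp_maps[OF that(1,2,2) id_maps[OF that(2)] that(3)] that(3)])
      (simp add: comp_apply graded_id_def closed[OF that(1,2,3)])
  have idr: "graded_comp K X \<gamma> (graded_id K X) = \<gamma>" if "X \<in> B" "Y \<in> B" "\<gamma> \<in> graded_maps K X Y" for X Y \<gamma>
    by (rule graded_eqI[OF that(1,2) comp_maps[OF that(1,1,2) that(3) id_maps[OF that(1)]] that(3)])
      (simp add: comp_apply graded_id_def)
  let ?i = "\<lambda>X. mor K X X (graded_id K X)"
  have iso: "iso_mor (der_cat K) X X (?i X)" if "X \<in> B" for X
    unfolding iso_mor_der_cat iso_mor_mor_iff[OF that that id_maps[OF that]]
    by (auto simp: graded_id_def bij_betw_def inj_on_def)
  have e1: "der_comp K (?i D) (der_map K ?A D \<alpha>) = der_comp K (der_map K ?A D \<alpha>) (?i ?A)"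
    unfolding der_map_eq_mor[OF K A D \<alpha>] comp_mor[OF A D D id_maps[OF D] f] comp_mor[OF A A D f id_maps[OF A]]
      idl[OF A D f] idr[OF A D f] ..
  have e2: "der_comp K (?i ?C) (der_map K D ?C \<beta>) = der_comp K (der_map K D ?C \<beta>) (?i D)"
    unfolding der_map_eq_mor[OF K D C \<beta>] comp_mor[OF D C C id_maps[OF C] g] comp_mor[OF D D C g id_maps[OF D]]
      idl[OF D C g] idr[OF D C g] ..
  have e3: "der_comp K (der_shift K (?i ?A)) (der_map K ?C (cx_shift ?A) ?t) =
      der_comp K (der_map K ?C (cx_shift ?A) ?t) (?i ?C)"
    unfolding der_shift_id[OF A] der_map_eq_mor[OF K C sA t] comp_mor[OF C sA sA id_maps[OF sA] h]
      comp_mor[OF C C sA h id_maps[OF C]] idl[OF C sA h] idr[OF C sA h] ..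
  have tri: "(?A, D, ?C, der_map K ?A D \<alpha>, der_map K D ?C \<beta>, der_map K ?C (cx_shift ?A) ?t) \<in> der_triangles K"
    unfolding der_triangles_def
    by (rule CollectI, intro exI conjI, rule refl)
      (rule A D C sp iso[OF A] iso[OF D] iso[OF C] e1 e2 e3 mor_hom[OF A D f, folded der_map_eq_mor[OF K A D \<alpha>]]
        mor_hom[OF D C g, folded der_map_eq_mor[OF K D C \<beta>]]
        mor_hom[OF C sA h, folded der_map_eq_mor[OF K C sA t]])+
  have hd: "hdim K ?A = (\<lambda>i. if i = n + 1 then 1 else 0)" "hdim K ?C = (\<lambda>i. if i = n then 1 else 0)"
    unfolding hdim_std_complex[OF K fin(1)] hdim_std_complex[OF K fin(2)] by (fact p_def q_def)+
  show ?thesis by (intro exI conjI, unfold T_sel, rule tri, fact hd, fact hD, fact hd)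
qed

end

section \<open>Grothendieck group\<close>

definition koszul_sign :: "int \<Rightarrow> int" where
  "koszul_sign n = (if even n then 1 else -1)"

lemma koszul_sign_Suc: "koszul_sign (n + 1) = - koszul_sign n"
  by (simp add: koszul_sign_def)

text \<open>Here \<open>h X n\<close> is the dimension of \<open>H\<^sup>n X\<close>, and \<open>k n\<close> in \<open>triangle_exact\<close> is the rank of the
  connecting map \<open>H\<^sup>n Z \<rightarrow> H\<^sup>n\<^sup>+\<^sup>1 X\<close>.\<close>

locale graded_tricat =
  fixes T :: "('o, 'm) tricat" and h :: "'o \<Rightarrow> int \<Rightarrow> nat"
  assumes fin: "X \<in> tob T \<Longrightarrow> finite {n. h X n \<noteq> 0}"
    and object_ex: "finite {n. d n \<noteq> 0} \<Longrightarrow> \<exists>X\<in>tob T. h X = d"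
    and iso_iff: "X \<in> tob T \<Longrightarrow> Y \<in> tob T \<Longrightarrow> iso_obj T X Y \<longleftrightarrow> h X = h Y"
    and zero_iff: "zero_obj T X \<longleftrightarrow> X \<in> tob T \<and> (\<forall>n. h X n = 0)"
    and hom_nonzero: "X \<in> tob T \<Longrightarrow> Y \<in> tob T \<Longrightarrow> h X n \<noteq> 0 \<Longrightarrow> h Y n \<noteq> 0 \<Longrightarrow>
      \<exists>f\<in>thom T X Y. \<not> zero_mor T X Y f"
    and hom_disjoint: "X \<in> tob T \<Longrightarrow> Y \<in> tob T \<Longrightarrow> f \<in> thom T X Y \<Longrightarrow>
      (\<And>n. h X n = 0 \<or> h Y n = 0) \<Longrightarrow> zero_mor T X Y f"
    and sum_support: "X \<in> tob T \<Longrightarrow> Y \<in> tob T \<Longrightarrow> direct_sum T X Y S \<Longrightarrow> h S n \<noteq> 0 \<Longrightarrow>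
      h X n \<noteq> 0 \<or> h Y n \<noteq> 0"
    and shift_ob: "X \<in> tob T \<Longrightarrow> tsh T X \<in> tob T"
    and shift: "X \<in> tob T \<Longrightarrow> h (tsh T X) n = h X (n + 1)"
    and triangle_obs: "(X, Y, Z, u, v, w) \<in> tdt T \<Longrightarrow> X \<in> tob T \<and> Y \<in> tob T \<and> Z \<in> tob T"
    and triangle_exact: "(X, Y, Z, u, v, w) \<in> tdt T \<Longrightarrow>
      \<exists>k. \<forall>n. h Y n + k n + k (n - 1) = h X n + h Z n \<and> k n \<le> h Z n \<and> k n \<le> h X (n + 1)"
    and triangle_ex: "X \<in> tob T \<Longrightarrow> Y \<in> tob T \<Longrightarrow> Z \<in> tob T \<Longrightarrow>
      (\<And>n. h Y n = h X n + h Z n) \<Longrightarrow> \<exists>u v w. (X, Y, Z, u, v, w) \<in> tdt T"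
    and shift_triangle_ex: "\<exists>X Y Z u v w. (X, Y, Z, u, v, w) \<in> tdt T \<and>
      h X = (\<lambda>i. if i = n + 1 then 1 else 0) \<and> h Y = (\<lambda>_. 0) \<and> h Z = (\<lambda>i. if i = n then 1 else 0)"
    and full_sub_length: "A \<subseteq> tob T \<Longrightarrow> finite_length (full_sub T A)"
begin

definition euler_char :: "'o \<Rightarrow> int" where
  "euler_char X = (\<Sum>n | h X n \<noteq> 0. koszul_sign n * int (h X n))"

lemma euler_char_eq:
  assumes "finite S" "{n. h X n \<noteq> 0} \<subseteq> S"
  shows "euler_char X = (\<Sum>n\<in>S. koszul_sign n * int (h X n))"
  unfolding euler_char_def by (rule sum.mono_neutral_left[OF assms]) auto

text \<open>The rank of the connecting map out of degree n contributes once in degree n and once in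
  degree n + 1, with opposite signs.\<close>

lemma euler_char_triangle:
  assumes t: "(X, Y, Z, u, v, w) \<in> tdt T"
  shows "euler_char Y = euler_char X + euler_char Z"
proof -
  obtain k where k: "\<And>n. h Y n + k n + k (n - 1) = h X n + h Z n" "\<And>n. k n \<le> h Z n"
    using triangle_exact[OF t] by blast
  have obs: "X \<in> tob T" "Y \<in> tob T" "Z \<in> tob T" using triangle_obs[OF t] by auto
  let ?U = "{n. h X n \<noteq> 0} \<union> {n. h Y n \<noteq> 0} \<union> {n. h Z n \<noteq> 0}"
  have fU: "finite ?U" using fin obs by simp
  \<comment> \<open>The supports are enlarged by their translate by 1, so that the shifted ranks
    \<open>k (n - 1)\<close> are supported in the same finite set.\<close>
  let ?S = "?U \<union> (\<lambda>n. n + 1) ` ?U"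
  let ?K = "{n. k n \<noteq> 0}"
  have kU: "?K \<subseteq> ?U"
  proof
    fix n assume "n \<in> ?K"
    then have "h Z n \<noteq> 0" using k(2)[of n] by simp
    then show "n \<in> ?U" by blast
  qed
  have fS: "finite ?S" using fU by simp
  have e: "euler_char A = (\<Sum>n\<in>?S. koszul_sign n * int (h A n))" if "A \<in> {X, Y, Z}" for A
    by (rule euler_char_eq[OF fS]) (use that in auto)
  have "(\<Sum>n\<in>?S. koszul_sign n * int (k (n - 1))) = (\<Sum>n\<in>(\<lambda>n. n + 1) ` ?K. koszul_sign n * int (k (n - 1)))"
  proof (rule sum.mono_neutral_right[OF fS])
    show "(\<lambda>n. n + 1) ` ?K \<subseteq> ?S" using kU by blast
    show "\<forall>i\<in>?S - (\<lambda>n. n + 1) ` ?K. koszul_sign i * int (k (i - 1)) = 0"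
    proof
      fix i assume i: "i \<in> ?S - (\<lambda>n. n + 1) ` ?K"
      have "k (i - 1) = 0"
      proof (rule ccontr)
        assume "k (i - 1) \<noteq> 0"
        then have "i - 1 + 1 \<in> (\<lambda>n. n + 1) ` ?K" by blast
        then show False using i by simp
      qed
      then show "koszul_sign i * int (k (i - 1)) = 0" by simp
    qed
  qed
  also have "\<dots> = (\<Sum>n\<in>?K. - (koszul_sign n * int (k n)))"
    by (subst sum.reindex) (auto simp: inj_on_def koszul_sign_Suc)
  also have "\<dots> = - (\<Sum>n\<in>?S. koszul_sign n * int (k n))"
    unfolding sum_negf by (intro arg_cong[where f = uminus] sum.mono_neutral_left[OF fS]) (use kU in auto)
  finally have 0: "(\<Sum>n\<in>?S. koszul_sign n * int (k n)) + (\<Sum>n\<in>?S. koszul_sign n * int (k (n - 1))) = 0"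
    by simp
  have hY: "koszul_sign n * int (h Y n) = koszul_sign n * int (h X n) + koszul_sign n * int (h Z n)
      - koszul_sign n * int (k n) - koszul_sign n * int (k (n - 1))" for n
  proof -
    have "int (h Y n) = int (h X n) + int (h Z n) - int (k n) - int (k (n - 1))"
      using k(1)[of n] by linarith
    then show ?thesis by (simp only:) (simp add: algebra_simps)
  qed
  have "euler_char Y = (\<Sum>n\<in>?S. koszul_sign n * int (h X n) + koszul_sign n * int (h Z n)
      - koszul_sign n * int (k n) - koszul_sign n * int (k (n - 1)))"
    by (subst e) (simp_all only: hY, simp)
  also have "\<dots> = euler_char X + euler_char Z - ((\<Sum>n\<in>?S. koszul_sign n * int (k n)) + (\<Sum>n\<in>?S. koszul_sign n * int (k (n - 1))))"
    by (simp add: e sum.distrib sum_subtractf)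
  finally show ?thesis using 0 by simp
qed

text \<open>The linear extension of \<open>euler_char\<close> to formal sums.
  \<open>frag_extend\<close> takes values in free abelian groups, so the integers are modelled as
  the free group on one generator and the coefficient is read off.\<close>

definition euler :: "('o \<Rightarrow>\<^sub>0 int) \<Rightarrow> int" where
  "euler x = Poly_Mapping.lookup (frag_extend (\<lambda>E. frag_cmul (euler_char E) (frag_of ())) x) ()"

lemma euler_simps [simp]:
  "euler (frag_of E) = euler_char E" "euler 0 = 0" "euler (x - y) = euler x - euler y"
  "euler (x + y) = euler x + euler y" "euler (- x) = - euler x"
  by (simp_all add: euler_def frag_extend_diff frag_extend_add frag_extend_minus lookup_minus lookup_add)

abbreviation "G \<equiv> free_Abelian_group (tob T)"
abbreviation "N \<equiv> K0_rel T"

lemma subgroup_N: "subgroup N G"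
  unfolding K0_rel_def
  by (rule group.generate_is_subgroup[OF group_free_Abelian_group])
    (use triangle_obs in \<open>force dest!: subsetD[OF keys_diff]\<close>)

lemma normal_N: "N \<lhd> G"
  by (rule comm_group.subgroup_imp_normal[OF abelian_free_Abelian_group subgroup_N])

text \<open>Additivity on triangles makes the extension vanish on the relations, so that it descends
  to K0.\<close>

lemma euler_N: "x \<in> N \<Longrightarrow> euler x = 0"
  unfolding K0_rel_def
proof (induction rule: generate.induct)
  case (inv x)
  then obtain X Y Z u v w where x: "x = frag_of Y - frag_of X - frag_of Z" "(X, Y, Z, u, v, w) \<in> tdt T"
    by blast
  then have "Poly_Mapping.keys x \<subseteq> tob T"
    using triangle_obs[OF x(2)] by (force dest!: subsetD[OF keys_diff])
  then show ?case using euler_char_triangle[OF x(2)] x(1) by simp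
qed (use euler_char_triangle in fastforce)+

lemma coset_class: "x \<in> carrier G \<Longrightarrow> N #>\<^bsub>G\<^esub> x \<in> carrier (K0 T)"
  by (auto simp: K0_def FactGroup_def RCOSETS_def)

lemma K0_carrierE:
  assumes "C \<in> carrier (K0 T)"
  obtains x where "x \<in> carrier G" "C = N #>\<^bsub>G\<^esub> x"
  using assms unfolding K0_def FactGroup_def RCOSETS_def by auto

lemma K0_mult: "x \<in> carrier G \<Longrightarrow> y \<in> carrier G \<Longrightarrow>
    (N #>\<^bsub>G\<^esub> x) \<otimes>\<^bsub>K0 T\<^esub> (N #>\<^bsub>G\<^esub> y) = N #>\<^bsub>G\<^esub> (x + y)"
  using normal.rcos_sum[OF normal_N, of x y] by (simp add: K0_def FactGroup_def)

definition euler_class :: "('o \<Rightarrow>\<^sub>0 int) set \<Rightarrow> int" where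
  "euler_class C = euler (SOME x. x \<in> C)"

lemma euler_class_coset:
  assumes "x \<in> carrier G"
  shows "euler_class (N #>\<^bsub>G\<^esub> x) = euler x"
proof -
  have "x \<in> N #>\<^bsub>G\<^esub> x" by (rule group.rcos_self[OF group_free_Abelian_group assms subgroup_N])
  then have "(SOME y. y \<in> N #>\<^bsub>G\<^esub> x) \<in> N #>\<^bsub>G\<^esub> x" by (rule someI)
  then obtain r where "r \<in> N" "(SOME y. y \<in> N #>\<^bsub>G\<^esub> x) = r + x" by (auto simp: r_coset_def)
  then show ?thesis by (simp add: euler_class_def euler_N)
qed

text \<open>The homomorphism that takes the class of the simple object in degree 0 to c. The
  restriction to the carrier is what membership in \<open>K0_dual\<close> demands.\<close>

definition charge :: "complex \<Rightarrow> ('o \<Rightarrow>\<^sub>0 int) set \<Rightarrow> complex" where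
  "charge c = (\<lambda>C\<in>carrier (K0 T). c * of_int (euler_class C))"

lemma charge_dual: "charge c \<in> K0_dual T"
  unfolding K0_dual_def
proof
  show "charge c \<in> hom (K0 T) complex_add"
  proof (rule homI)
    fix C D assume "C \<in> carrier (K0 T)" "D \<in> carrier (K0 T)"
    then obtain x y where xy: "x \<in> carrier G" "y \<in> carrier G" and C: "C = N #>\<^bsub>G\<^esub> x" "D = N #>\<^bsub>G\<^esub> y"
      by (metis K0_carrierE)
    have s: "x + y \<in> carrier G" using xy keys_add[of x y] by auto
    show "charge c (C \<otimes>\<^bsub>K0 T\<^esub> D) = charge c C \<otimes>\<^bsub>complex_add\<^esub> charge c D"
      unfolding C K0_mult[OF xy]
      by (simp add: charge_def coset_class[OF s] coset_class[OF xy(1)] coset_class[OF xy(2)]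
        euler_class_coset[OF s] euler_class_coset[OF xy(1)] euler_class_coset[OF xy(2)] complex_add_def algebra_simps
        del: carrier_free_Abelian_group_iff)
  qed (simp add: complex_add_def)
qed (simp add: charge_def)

lemma K0_class_carrier: "E \<in> tob T \<Longrightarrow> K0_class T E \<in> carrier (K0 T)"
  unfolding K0_class_def by (rule coset_class) simp

lemma charge_class: "E \<in> tob T \<Longrightarrow> charge c (K0_class T E) = c * of_int (euler_char E)"
  using K0_class_carrier euler_class_coset[of "frag_of E"] by (simp add: charge_def K0_class_def)

section \<open>Objects with prescribed dimensions, and generation of K0 by one class\<close>

lemma ob_ex: "finite {n. d n \<noteq> 0} \<Longrightarrow> \<exists>X. X \<in> tob T \<and> h X = d"
  using object_ex by blast

text \<open>For finitely supported d the choice is unique up to isomorphism, by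
  \<open>iso_iff\<close>.\<close>

definition ob :: "(int \<Rightarrow> nat) \<Rightarrow> 'o" where
  "ob d = (SOME X. X \<in> tob T \<and> h X = d)"

lemma ob: "finite {n. d n \<noteq> 0} \<Longrightarrow> ob d \<in> tob T" "finite {n. d n \<noteq> 0} \<Longrightarrow> h (ob d) = d"
  using someI_ex[OF ob_ex] by (simp_all add: ob_def)

abbreviation unit_at :: "int \<Rightarrow> int \<Rightarrow> nat" where
  "unit_at n \<equiv> \<lambda>i. if i = n then 1 else 0"

lemma fin_unit: "finite {i. unit_at n i \<noteq> 0}"
  by (rule finite_subset[of _ "{n}"]) auto

text \<open>In the derived category this is the ground field placed in degree n, that is k[-n] up to
  isomorphism.\<close>

abbreviation simple :: "int \<Rightarrow> 'o" where "simple n \<equiv> ob (unit_at n)"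

lemma simple: "simple n \<in> tob T" "h (simple n) = unit_at n"
  using ob[OF fin_unit] by blast+

lemma euler_char_concentrated:
  assumes "\<And>i. i \<noteq> n \<Longrightarrow> h X i = 0"
  shows "euler_char X = koszul_sign n * int (h X n)"
proof -
  have "euler_char X = (\<Sum>i\<in>{n}. koszul_sign i * int (h X i))"
  proof (rule euler_char_eq)
    show "{i. h X i \<noteq> 0} \<subseteq> {n}"
    proof
      fix i assume "i \<in> {i. h X i \<noteq> 0}"
      then show "i \<in> {n}" using assms[of i] by auto
    qed
  qed simp
  then show ?thesis by simp
qed

lemma euler_char_simple: "euler_char (simple n) = koszul_sign n"
  using euler_char_concentrated[of n "simple n"] by (simp add: simple)

lemma dual_triangle:
  assumes U: "U \<in> K0_dual T" and t: "(X, Y, Z, u, v, w) \<in> tdt T"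
  shows "U (K0_class T Y) = U (K0_class T X) + U (K0_class T Z)"
proof -
  have obs: "X \<in> tob T" "Y \<in> tob T" "Z \<in> tob T" using triangle_obs[OF t] by auto
  have s: "frag_of X + frag_of Z \<in> carrier G" using keys_add[of "frag_of X" "frag_of Z"] obs by auto
  have n: "frag_of Y - frag_of X - frag_of Z \<in> N"
    unfolding K0_rel_def by (rule generate.incl) (use t in blast)
  have "N #>\<^bsub>G\<^esub> frag_of Y = N #>\<^bsub>G\<^esub> (frag_of X + frag_of Z)"
  proof (rule group.repr_independence[OF group_free_Abelian_group _ s subgroup_N, symmetric])
    show "frag_of Y \<in> N #>\<^bsub>G\<^esub> (frag_of X + frag_of Z)"
      unfolding r_coset_def using n by (intro UN_I[OF n]) simp
  qed
  then have "K0_class T Y = K0_class T X \<otimes>\<^bsub>K0 T\<^esub> K0_class T Z"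
    using K0_mult[of "frag_of X" "frag_of Z"] obs by (simp add: K0_class_def)
  then show ?thesis
    using hom_mult[of U "K0 T" complex_add] U K0_class_carrier obs by (simp add: K0_dual_def complex_add_def)
qed

text \<open>The class of the simple object in degree 0 generates K0. The triangle with acyclic
  middle term relates simple objects of neighbouring degrees by a sign, and split triangles build
  every object from simple ones, by induction on the total dimension.\<close>

lemma dual_eq_charge:
  assumes U: "U \<in> K0_dual T"
  shows "U = charge (U (K0_class T (simple 0)))"
proof -
  define c where "c = U (K0_class T (simple 0))"
  let ?u = "\<lambda>X. U (K0_class T X)"
  have add: "?u Y = ?u X + ?u Z" if "X \<in> tob T" "Y \<in> tob T" "Z \<in> tob T" "\<And>n. h Y n = h X n + h Z n" for X Y Z
    using triangle_ex[OF that] dual_triangle[OF U] by blast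
  \<comment> \<open>An object without cohomology fits into a triangle all of whose three terms are
    that object, whence its value v satisfies v = v + v.\<close>
  have zero: "?u X = 0" if "X \<in> tob T" "\<And>n. h X n = 0" for X
    using add[of X X X] that by simp
  have cong: "?u X = ?u Y" if "X \<in> tob T" "Y \<in> tob T" "h X = h Y" for X Y
  proof -
    have "finite {i::int. (0::nat) \<noteq> 0}" by simp
    from ob[OF this] have o: "ob (\<lambda>_. 0) \<in> tob T" "h (ob (\<lambda>_. 0)) = (\<lambda>_. 0)" .
    then show ?thesis using add[of X Y "ob (\<lambda>_. 0)"] zero[OF o(1)] that by simp
  qed
  \<comment> \<open>The acyclic middle term has value zero, so the outer terms cancel.\<close>
  have step: "?u (simple (n + 1)) = - ?u (simple n)" for n
  proof -
    obtain X Y Z u v w where t: "(X, Y, Z, u, v, w) \<in> tdt T" and hX: "h X = unit_at (n + 1)"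
      and hY: "h Y = (\<lambda>_. 0)" and hZ: "h Z = unit_at n" using shift_triangle_ex by blast
    have obs: "X \<in> tob T" "Y \<in> tob T" "Z \<in> tob T" using triangle_obs[OF t] by auto
    have "?u X = ?u (simple (n + 1))" by (rule cong[OF obs(1) simple(1)]) (simp only: hX simple)
    moreover have "?u Z = ?u (simple n)" by (rule cong[OF obs(3) simple(1)]) (simp only: hZ simple)
    moreover have "?u Y = 0" by (rule zero[OF obs(2)]) (simp add: hY)
    ultimately show ?thesis using dual_triangle[OF U t] by (simp add: add_eq_0_iff)
  qed
  have simp_val: "?u (simple n) = of_int (koszul_sign n) * c" for n
  proof (induction n rule: int_induct[where k = 0])
    case base
    then show ?case by (simp add: c_def koszul_sign_def)
  next
    case (step1 i)
    then show ?case using step[of i] by (simp add: koszul_sign_Suc)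
  next
    case (step2 i)
    then show ?case using step[of "i - 1"] koszul_sign_Suc[of "i - 1"] by simp
  qed
  have val: "?u X = of_int (euler_char X) * c" if "X \<in> tob T" "m = (\<Sum>n | h X n \<noteq> 0. h X n)" for X m
    using that
  proof (induction m arbitrary: X)
    case 0
    then have "h X n = 0" for n using fin[OF 0(1)] by (cases "h X n = 0") auto
    then show ?case using zero[OF 0(1)] by (simp add: euler_char_def)
  next
    case (Suc m)
    then obtain n where n: "h X n \<noteq> 0" by (cases "{n. h X n \<noteq> 0} = {}") auto
    \<comment> \<open>One dimension is removed in degree n; it is restored by the simple object of
      that degree through a split triangle.\<close>
    define d where "d = (h X)(n := h X n - 1)"
    have sub: "{i. d i \<noteq> 0} \<subseteq> {i. h X i \<noteq> 0}" by (auto simp: d_def)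
    then have fd: "finite {i. d i \<noteq> 0}" using fin[OF Suc(2)] finite_subset by blast
    note Y = ob[OF fd]
    have h_eq: "h X i = h (ob d) i + h (simple n) i" for i
    proof -
      have "h (ob d) i = d i" by (simp only: Y(2))
      moreover have "h (simple n) i = unit_at n i" by (simp only: simple)
      ultimately show ?thesis using n by (simp add: d_def)
    qed
    have "(\<Sum>i | d i \<noteq> 0. d i) = (\<Sum>i | h X i \<noteq> 0. d i)"
      by (rule sum.mono_neutral_left[OF fin[OF Suc(2)] sub]) auto
    moreover have "(\<Sum>i | h X i \<noteq> 0. h X i) = (\<Sum>i | h X i \<noteq> 0. d i + unit_at n i)"
      by (rule sum.cong) (use n in \<open>auto simp: d_def\<close>)
    moreover have "(\<Sum>i | h X i \<noteq> 0. unit_at n i) = 1"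
      using n fin[OF Suc(2)] by simp
    ultimately have "m = (\<Sum>i | h (ob d) i \<noteq> 0. h (ob d) i)"
      using Suc(3) by (simp add: Y(2) sum.distrib)
    from Suc.IH[OF Y(1) this] have "?u (ob d) = of_int (euler_char (ob d)) * c" .
    moreover obtain u v w where t: "(ob d, X, simple n, u, v, w) \<in> tdt T"
      using triangle_ex[OF Y(1) Suc(2) simple(1) h_eq] by blast
    ultimately show ?case
      using dual_triangle[OF U t] euler_char_triangle[OF t] by (simp add: simp_val euler_char_simple algebra_simps)
  qed
  have coset: "U (N #>\<^bsub>G\<^esub> x) = c * of_int (euler x)" if "Poly_Mapping.keys x \<subseteq> tob T" for x
    using that
  proof (rule free_Abelian_group_induct)
    have z: "0 \<in> carrier G" by simp
    have "U (N #>\<^bsub>G\<^esub> 0) = U (N #>\<^bsub>G\<^esub> 0) + U (N #>\<^bsub>G\<^esub> 0)"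
      using hom_mult[of U "K0 T" complex_add, OF _ coset_class[OF z] coset_class[OF z]] U K0_mult[OF z z]
      by (simp add: K0_dual_def complex_add_def)
    then show "U (N #>\<^bsub>G\<^esub> 0) = c * of_int (euler 0)" by simp
  next
    fix x y assume 2: "Poly_Mapping.keys x \<subseteq> tob T" "Poly_Mapping.keys y \<subseteq> tob T"
      "U (N #>\<^bsub>G\<^esub> x) = c * of_int (euler x)" "U (N #>\<^bsub>G\<^esub> y) = c * of_int (euler y)"
    have x: "x \<in> carrier G" "y \<in> carrier G" "x - y \<in> carrier G" using 2(1,2) keys_diff[of x y] by auto
    have "U (N #>\<^bsub>G\<^esub> (x - y + y)) = U (N #>\<^bsub>G\<^esub> (x - y)) + U (N #>\<^bsub>G\<^esub> y)"
      using hom_mult[of U "K0 T" complex_add, OF _ coset_class[OF x(3)] coset_class[OF x(2)]] U K0_mult[OF x(3,2)]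
      by (simp add: K0_dual_def complex_add_def)
    then show "U (N #>\<^bsub>G\<^esub> (x - y)) = c * of_int (euler (x - y))"
      using 2(3,4) by (simp add: algebra_simps)
  next
    fix a assume "a \<in> tob T"
    then show "U (N #>\<^bsub>G\<^esub> frag_of a) = c * of_int (euler (frag_of a))"
      using val[of a, OF _ refl] by (simp add: K0_class_def mult.commute)
  qed
  show ?thesis
    unfolding c_def[symmetric]
  proof (rule extensionalityI[of _ "carrier (K0 T)"])
    show "U \<in> extensional (carrier (K0 T))" using U by (simp add: K0_dual_def)
    show "charge c \<in> extensional (carrier (K0 T))" by (simp add: charge_def)
    fix C assume "C \<in> carrier (K0 T)"
    then obtain x where x: "x \<in> carrier G" "C = N #>\<^bsub>G\<^esub> x" by (rule K0_carrierE)
    show "U C = charge c C"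
      unfolding x(2) using x(1) coset[of x] by (simp add: charge_def coset_class euler_class_coset)
  qed
qed

end

section \<open>Stability conditions\<close>

context graded_tricat
begin

text \<open>The phase is \<open>\<phi>\<^sub>0\<close> in degree 0; as the shift lowers degrees, it drops by one with the degree.\<close>

definition std_slicing :: "real \<Rightarrow> real \<Rightarrow> 'o set" where
  "std_slicing \<phi>\<^sub>0 \<phi> = {E \<in> tob T. \<forall>n. h E n \<noteq> 0 \<longrightarrow> \<phi> = \<phi>\<^sub>0 - real_of_int n}"

lemma iso_objI: "X \<in> tob T \<Longrightarrow> Y \<in> tob T \<Longrightarrow> h X = h Y \<Longrightarrow> iso_obj T X Y"
  using iso_iff by blast

lemma iso_objD: "iso_obj T X Y \<Longrightarrow> X \<in> tob T \<and> Y \<in> tob T \<and> h X = h Y"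
  using iso_iff by (auto simp: iso_obj_def)

lemma zero_ob: "zero_obj T (ob (\<lambda>_. 0))" "h (ob (\<lambda>_. 0)) = (\<lambda>_. 0)" "ob (\<lambda>_. 0) \<in> tob T"
  using ob[of "\<lambda>_. 0"] by (simp_all add: zero_iff)

lemma std_slicing_additive: "additive_subcat T (std_slicing \<phi>\<^sub>0 \<phi>)"
  unfolding additive_subcat_def
proof (intro conjI ballI allI impI)
  show "std_slicing \<phi>\<^sub>0 \<phi> \<subseteq> tob T" by (auto simp: std_slicing_def)
  show "B \<in> std_slicing \<phi>\<^sub>0 \<phi>" if "A \<in> std_slicing \<phi>\<^sub>0 \<phi>" "iso_obj T A B" for A B
    using that(1) iso_objD[OF that(2)] by (simp add: std_slicing_def)
  show "\<exists>Z\<in>std_slicing \<phi>\<^sub>0 \<phi>. zero_obj T Z"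
    using zero_ob by (intro bexI[of _ "ob (\<lambda>_. 0)"]) (simp_all add: std_slicing_def)
  show "D \<in> std_slicing \<phi>\<^sub>0 \<phi>" if "A \<in> std_slicing \<phi>\<^sub>0 \<phi>" "B \<in> std_slicing \<phi>\<^sub>0 \<phi>" "direct_sum T A B D" for A B D
  proof -
    have AB: "A \<in> tob T" "B \<in> tob T" using that by (auto simp: std_slicing_def)
    have "D \<in> tob T" using that(3) by (simp add: direct_sum_def)
    then show ?thesis using sum_support[OF AB that(3)] that(1,2) unfolding std_slicing_def by blast
  qed
qed

lemma std_slicing_shift:
  "std_slicing \<phi>\<^sub>0 (\<phi> + 1) = {E \<in> tob T. \<exists>A\<in>std_slicing \<phi>\<^sub>0 \<phi>. iso_obj T E (tsh T A)}" (is "_ = ?R")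
proof (intro equalityI subsetI)
  fix E assume E: "E \<in> std_slicing \<phi>\<^sub>0 (\<phi> + 1)"
  then have Eo: "E \<in> tob T" and Es: "\<And>n. h E n \<noteq> 0 \<Longrightarrow> \<phi> + 1 = \<phi>\<^sub>0 - real_of_int n"
    by (auto simp: std_slicing_def)
  \<comment> \<open>The dimensions of the desuspension E[-1]; an object with these dimensions has a
    shift isomorphic to E.\<close>
  let ?d = "\<lambda>n. h E (n - 1)"
  have "{n. ?d n \<noteq> 0} \<subseteq> (\<lambda>n. n + 1) ` {n. h E n \<noteq> 0}"
    by (auto intro!: image_eqI[of _ _ "_ - 1"])
  then have "finite {n. ?d n \<noteq> 0}" using fin[OF Eo] by (meson finite_imageI finite_subset)
  note A = ob[OF this]
  have "ob ?d \<in> std_slicing \<phi>\<^sub>0 \<phi>" unfolding std_slicing_def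
  proof (intro CollectI conjI A(1) allI impI)
    fix n assume "h (ob ?d) n \<noteq> 0"
    then have "h E (n - 1) \<noteq> 0" by (simp add: A(2))
    from Es[OF this] show "\<phi> = \<phi>\<^sub>0 - real_of_int n" by simp
  qed
  moreover have "iso_obj T E (tsh T (ob ?d))"
    by (rule iso_objI[OF Eo shift_ob[OF A(1)]]) (simp add: fun_eq_iff shift[OF A(1)] A(2))
  ultimately show "E \<in> ?R" using Eo by blast
next
  fix E assume "E \<in> ?R"
  then obtain A where A: "A \<in> std_slicing \<phi>\<^sub>0 \<phi>" "iso_obj T E (tsh T A)" by blast
  have Ao: "A \<in> tob T" using A(1) by (simp add: std_slicing_def)
  from iso_objD[OF A(2)] have E: "E \<in> tob T" "h E = h (tsh T A)" by auto
  show "E \<in> std_slicing \<phi>\<^sub>0 (\<phi> + 1)" unfolding std_slicing_def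
  proof (intro CollectI conjI E(1) allI impI)
    fix n assume "h E n \<noteq> 0"
    then have "h A (n + 1) \<noteq> 0" unfolding E(2) shift[OF Ao] .
    then have "\<phi> = \<phi>\<^sub>0 - real_of_int (n + 1)" using A(1) unfolding std_slicing_def by blast
    then show "\<phi> + 1 = \<phi>\<^sub>0 - real_of_int n" by simp
  qed
qed

lemma std_slicing_homs:
  assumes "\<phi> > \<psi>" "A \<in> std_slicing \<phi>\<^sub>0 \<phi>" "B \<in> std_slicing \<phi>\<^sub>0 \<psi>" "f \<in> thom T A B"
  shows "zero_mor T A B f"
proof (rule hom_disjoint[OF _ _ assms(4)])
  show "A \<in> tob T" "B \<in> tob T" using assms(2,3) by (simp_all add: std_slicing_def)
  fix n
  have "\<phi> = \<phi>\<^sub>0 - real_of_int n" if "h A n \<noteq> 0" using assms(2) that unfolding std_slicing_def by blast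
  moreover have "\<psi> = \<phi>\<^sub>0 - real_of_int n" if "h B n \<noteq> 0" using assms(3) that unfolding std_slicing_def by blast
  ultimately show "h A n = 0 \<or> h B n = 0" using assms(1) by (metis order_less_irrefl)
qed

text \<open>A nonzero connecting rank in degree n would need cohomology of the factor in degree n
  and of the earlier step in degree n + 1. The latter belongs to an earlier factor of phase smaller
  by one, but earlier phases are larger. So dimensions add up along the filtration. Only an
  inclusion of P is assumed, in order to apply this to a slicing that is not yet identified.\<close>

lemma hn_phases:
  assumes P: "\<And>\<phi>. P \<phi> \<subseteq> std_slicing \<phi>\<^sub>0 \<phi>" and hn: "hn_filtration T P E \<phi>s"
  shows "set \<phi>s = (\<lambda>n. \<phi>\<^sub>0 - real_of_int n) ` {n. h E n \<noteq> 0}"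
proof -
  from hn obtain F A where s: "sorted_wrt (>) \<phi>s" and F0: "zero_obj T (F 0)" and FE: "F (length \<phi>s) = E"
    and A: "\<And>j. j < length \<phi>s \<Longrightarrow> A j \<in> P (\<phi>s ! j)" "\<And>j. j < length \<phi>s \<Longrightarrow> \<not> zero_obj T (A j)"
    and t: "\<And>j. j < length \<phi>s \<Longrightarrow> \<exists>u v w. (F j, F (Suc j), A j, u, v, w) \<in> tdt T"
    unfolding hn_filtration_def by blast
  have "set (take j \<phi>s) = (\<lambda>n. \<phi>\<^sub>0 - real_of_int n) ` {n. h (F j) n \<noteq> 0}" if "j \<le> length \<phi>s" for j
    using that
  proof (induction j)
    case 0
    then show ?case using F0 by (simp add: zero_iff)
  next
    case (Suc j)
    then have j: "j < length \<phi>s" by simp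
    from t[OF j] obtain u v w where "(F j, F (Suc j), A j, u, v, w) \<in> tdt T" by blast
    from triangle_exact[OF this] obtain k where k: "\<And>n. h (F (Suc j)) n + k n + k (n - 1) = h (F j) n + h (A j) n"
      "\<And>n. k n \<le> h (A j) n" "\<And>n. k n \<le> h (F j) (n + 1)" by blast
    have Aj: "A j \<in> tob T" "\<And>n. h (A j) n \<noteq> 0 \<Longrightarrow> \<phi>s ! j = \<phi>\<^sub>0 - real_of_int n"
      using A(1)[OF j] P unfolding std_slicing_def by blast+
    obtain m where m: "h (A j) m \<noteq> 0" using A(2)[OF j] Aj(1) by (auto simp: zero_iff)
    have m': "h (A j) n \<noteq> 0 \<longleftrightarrow> n = m" for n using Aj(2)[OF m] Aj(2)[of n] m by auto
    have k0: "k n = 0" for n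
    proof (rule ccontr)
      assume n: "k n \<noteq> 0"
      then have "h (A j) n \<noteq> 0" "h (F j) (n + 1) \<noteq> 0" using k(2,3)[of n] by simp_all
      then have "\<phi>s ! j = \<phi>\<^sub>0 - real_of_int n" "n + 1 \<in> {n. h (F j) n \<noteq> 0}"
        using Aj(2) by auto
      moreover from this(2) have "\<phi>\<^sub>0 - real_of_int (n + 1) \<in> set (take j \<phi>s)"
        unfolding Suc.IH[OF less_imp_le[OF j]] by (rule imageI)
      moreover have "x > \<phi>s ! j" if "x \<in> set (take j \<phi>s)" for x
        using that sorted_wrt_nth_less[OF s _ j] j by (auto simp: in_set_conv_nth)
      ultimately show False by fastforce
    qed
    have "h (F (Suc j)) n \<noteq> 0 \<longleftrightarrow> h (F j) n \<noteq> 0 \<or> n = m" for n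
      using k(1)[of n] m'[of n] k0 by auto
    then have "{n. h (F (Suc j)) n \<noteq> 0} = insert m {n. h (F j) n \<noteq> 0}" by blast
    then show ?case using Suc.IH j Aj(2)[OF m] by (simp add: take_Suc_conv_app_nth)
  qed
  from this[of "length \<phi>s"] show ?thesis by (simp add: FE)
qed

text \<open>The filtration by truncation: degrees are added in increasing order, which is decreasing
  order of phases.\<close>

lemma std_slicing_hn:
  assumes E: "E \<in> tob T"
  shows "\<exists>\<phi>s. hn_filtration T (std_slicing \<phi>\<^sub>0) E \<phi>s"
proof -
  define ns where "ns = sorted_list_of_set {n. h E n \<noteq> 0}"
  have ns: "set ns = {n. h E n \<noteq> 0}" "sorted_wrt (<) ns" "distinct ns"
    using fin[OF E] by (simp_all add: ns_def strict_sorted_list_of_set)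
  define d where "d = (\<lambda>j n. if n \<in> set (take j ns) then h E n else 0)"
  \<comment> \<open>The last step has to be E itself, not just an object isomorphic to it; the
    earlier steps are fixed only by their dimensions.\<close>
  define F where "F = (\<lambda>j. if j = length ns then E else ob (d j))"
  define A where "A = (\<lambda>j. ob (\<lambda>n. if n = ns ! j then h E n else 0))"
  have "finite {n. d j n \<noteq> 0}" for j
    by (rule finite_subset[OF _ fin[OF E]]) (auto simp: d_def)
  note od = ob[OF this]
  have F: "F j \<in> tob T" "h (F j) = d j" for j
    using E od ns(1) by (auto simp: F_def d_def fun_eq_iff)
  have "finite {n. (if n = ns ! j then h E n else 0) \<noteq> 0}" for j
    by (rule finite_subset[OF _ fin[OF E]]) auto
  note A = ob[OF this, folded A_def]
  have Ao: "A j \<in> tob T" and Ah: "h (A j) n = (if n = ns ! j then h E n else 0)" for j n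
    using A by (simp_all add: A_def)
  have "hn_filtration T (std_slicing \<phi>\<^sub>0) E (map (\<lambda>n. \<phi>\<^sub>0 - real_of_int n) ns)"
    unfolding hn_filtration_def length_map
  proof (rule conjI, goal_cases)
    case 1
    show "sorted_wrt (>) (map (\<lambda>n. \<phi>\<^sub>0 - real_of_int n) ns)"
      using ns(2) by (simp add: sorted_wrt_map)
  next
    case 2
    show ?case
    proof (rule exI[of _ F], rule exI[of _ A], intro conjI allI impI)
    show "zero_obj T (F 0)" using F[of 0] by (simp add: zero_iff d_def)
    show "F (length ns) = E" by (simp add: F_def)
    fix j assume j: "j < length ns"
    then have nz: "h E (ns ! j) \<noteq> 0" using ns(1) nth_mem by blast
    show "A j \<in> std_slicing \<phi>\<^sub>0 (map (\<lambda>n. \<phi>\<^sub>0 - real_of_int n) ns ! j)"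
      using j Ao Ah by (auto simp: std_slicing_def split: if_splits)
    show "\<not> zero_obj T (A j)" using nz Ah[of j "ns ! j"] by (auto simp: zero_iff intro!: exI[of _ "ns ! j"])
    have "ns ! j \<notin> set (take j ns)"
      using j by (auto simp: in_set_conv_nth nth_eq_iff_index_eq[OF ns(3)])
    then show "\<exists>u v w. (F j, F (Suc j), A j, u, v, w) \<in> tdt T"
      by (intro triangle_ex F(1) Ao) (use j in \<open>auto simp: F(2) Ah d_def take_Suc_conv_app_nth\<close>)
    qed
  qed
  then show ?thesis by blast
qed

lemma slicing_std_slicing: "slicing T (std_slicing \<phi>\<^sub>0)"
  unfolding slicing_def
  using std_slicing_additive std_slicing_shift std_slicing_homs std_slicing_hn by blast

text \<open>By \<open>hn_phases\<close> every filtration has the same set of phases, so the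
  descriptions by \<open>THE\<close> are determined. Phases fall as degrees rise, hence the largest
  phase belongs to the lowest degree.\<close>

lemma phi_std_slicing:
  assumes E: "E \<in> tob T" "\<not> zero_obj T E"
  shows "phi_plus T (std_slicing \<phi>\<^sub>0) E = \<phi>\<^sub>0 - real_of_int (Min {n. h E n \<noteq> 0})" (is ?p)
    and "phi_minus T (std_slicing \<phi>\<^sub>0) E = \<phi>\<^sub>0 - real_of_int (Max {n. h E n \<noteq> 0})" (is ?m)
proof -
  let ?S = "{n. h E n \<noteq> 0}"
  have S: "finite ?S" "?S \<noteq> {}" using fin[OF E(1)] E by (auto simp: zero_iff)
  have *: "hd \<phi>s = \<phi>\<^sub>0 - real_of_int (Min ?S) \<and> last \<phi>s = \<phi>\<^sub>0 - real_of_int (Max ?S)"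
    if hn: "hn_filtration T (std_slicing \<phi>\<^sub>0) E \<phi>s" for \<phi>s
  proof -
    have set: "set \<phi>s = (\<lambda>n. \<phi>\<^sub>0 - real_of_int n) ` ?S" by (rule hn_phases[OF _ hn]) simp
    then have ne: "\<phi>s \<noteq> []" using S(2) by auto
    have s: "sorted_wrt (>) \<phi>s" using hn by (simp add: hn_filtration_def)
    have "x \<le> hd \<phi>s" if "x \<in> set \<phi>s" for x
      using that s by (cases \<phi>s) auto
    moreover have "last \<phi>s \<le> x" if "x \<in> set \<phi>s" for x
      using that s ne by (induction \<phi>s rule: rev_induct) (auto simp: sorted_wrt_append)
    moreover have "hd \<phi>s \<in> set \<phi>s" "last \<phi>s \<in> set \<phi>s" using ne by simp_all
    ultimately obtain a b where ab: "a \<in> ?S" "hd \<phi>s = \<phi>\<^sub>0 - real_of_int a" "b \<in> ?S" "last \<phi>s = \<phi>\<^sub>0 - real_of_int b"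
      "\<And>n. n \<in> ?S \<Longrightarrow> a \<le> n" "\<And>n. n \<in> ?S \<Longrightarrow> n \<le> b"
      unfolding set by fastforce
    have "Min ?S = a" by (rule Min_eqI[OF S(1) ab(5) ab(1)])
    moreover have "Max ?S = b" by (rule Max_eqI[OF S(1) ab(6) ab(3)])
    ultimately show ?thesis using ab by simp
  qed
  obtain \<phi>s where hn: "hn_filtration T (std_slicing \<phi>\<^sub>0) E \<phi>s" using std_slicing_hn[OF E(1)] by blast
  show ?p unfolding phi_plus_def
  proof (rule the_equality)
    show "\<exists>\<phi>s. hn_filtration T (std_slicing \<phi>\<^sub>0) E \<phi>s \<and> \<phi>\<^sub>0 - real_of_int (Min ?S) = hd \<phi>s"
      using hn *[OF hn] by metis
    show "\<phi> = \<phi>\<^sub>0 - real_of_int (Min ?S)" if "\<exists>\<phi>s. hn_filtration T (std_slicing \<phi>\<^sub>0) E \<phi>s \<and> \<phi> = hd \<phi>s" for \<phi>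
      using that *[THEN conjunct1] by metis
  qed
  show ?m unfolding phi_minus_def
  proof (rule the_equality)
    show "\<exists>\<phi>s. hn_filtration T (std_slicing \<phi>\<^sub>0) E \<phi>s \<and> \<phi>\<^sub>0 - real_of_int (Max ?S) = last \<phi>s"
      using hn *[OF hn] by metis
    show "\<phi> = \<phi>\<^sub>0 - real_of_int (Max ?S)" if "\<exists>\<phi>s. hn_filtration T (std_slicing \<phi>\<^sub>0) E \<phi>s \<and> \<phi> = last \<phi>s" for \<phi>
      using that *[THEN conjunct2] by metis
  qed
qed

section \<open>The parametrization of stability conditions by the plane\<close>

definition sigma :: "complex \<Rightarrow> 'o stab" where
  "sigma w = (charge (exp w), std_slicing (Im w / pi))"

lemma std_slicing_nonzero:
  assumes E: "E \<in> std_slicing \<phi>\<^sub>0 \<phi>" "\<not> zero_obj T E"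
  obtains n where "\<phi> = \<phi>\<^sub>0 - real_of_int n" "h E n \<noteq> 0" "\<forall>i. i \<noteq> n \<longrightarrow> h E i = 0"
    "euler_char E = koszul_sign n * int (h E n)"
proof -
  have Eo: "E \<in> tob T" and s: "\<And>n. h E n \<noteq> 0 \<Longrightarrow> \<phi> = \<phi>\<^sub>0 - real_of_int n"
    using E(1) unfolding std_slicing_def by blast+
  obtain n where n: "h E n \<noteq> 0" using E(2) Eo by (auto simp: zero_iff)
  have c: "h E i = 0" if "i \<noteq> n" for i using s[OF n] s[of i] that by auto
  show ?thesis using that[OF s[OF n] n _ euler_char_concentrated[OF c]] c by simp
qed

text \<open>Lowering the phase by n multiplies the exponential by exp(-i pi n), which is the sign of
  degree n in the Euler characteristic. This is the compatibility of charge and phase.\<close>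

lemma exp_koszul: "exp (of_real a + \<i> * of_real (pi * b)) * of_int (koszul_sign n) =
    of_real (exp a) * exp (\<i> * of_real (pi * (b - real_of_int n)))"
proof -
  have "exp (\<i> * of_real (pi * (b - real_of_int n))) = exp (\<i> * of_real (pi * b)) / exp (\<i> * of_real (pi * real_of_int n))"
    by (simp add: exp_diff[symmetric] right_diff_distrib)
  moreover have "exp (\<i> * of_real (pi * real_of_int n)) = of_int (koszul_sign n)"
  proof -
    have "exp (\<i> * of_real (pi * real_of_int n)) = cis (pi * real_of_int n)" by (simp add: cis_conv_exp)
    also have "\<dots> = of_int (koszul_sign n)" by (simp add: complex_eq_iff koszul_sign_def cos_npi_int sin_npi_int mult.commute)
    finally show ?thesis .
  qed
  ultimately show ?thesis by (simp add: exp_add exp_of_real koszul_sign_def)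
qed

lemma sigma_stab: "sigma w \<in> Stab T"
proof -
  have "\<exists>m::real. m > 0 \<and> charge (exp w) (K0_class T E) = of_real m * exp (\<i> * of_real (pi * \<phi>))"
    if E: "E \<in> std_slicing (Im w / pi) \<phi>" "\<not> zero_obj T E" for E \<phi>
  proof -
    from E obtain n where n: "\<phi> = Im w / pi - real_of_int n" "h E n \<noteq> 0"
      "euler_char E = koszul_sign n * int (h E n)" by (rule std_slicing_nonzero)
    have Eo: "E \<in> tob T" using E by (simp add: std_slicing_def)
    have "w = of_real (Re w) + \<i> * of_real (pi * (Im w / pi))" by (simp add: complex_eq_iff)
    then have "exp w * of_int (koszul_sign n) = of_real (exp (Re w)) * exp (\<i> * of_real (pi * \<phi>))"
      using exp_koszul[of "Re w" "Im w / pi" n] n(1) by simp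
    then show ?thesis
      using n(2) by (intro exI[of _ "exp (Re w) * h E n"]) (simp add: charge_class[OF Eo] n(3) mult_ac)
  qed
  moreover have "ext_closure T (\<Union>\<phi>\<in>S. std_slicing \<phi>\<^sub>0 \<phi>) \<subseteq> tob T" for S \<phi>\<^sub>0
  proof
    fix X assume "X \<in> ext_closure T (\<Union>\<phi>\<in>S. std_slicing \<phi>\<^sub>0 \<phi>)"
    then show "X \<in> tob T" by induction (use triangle_obs in \<open>auto simp: std_slicing_def\<close>)
  qed
  \<comment> \<open>Every full subcategory has finite length, so the half-width 1 serves as well as
    any other.\<close>
  then have "locally_finite T (std_slicing \<phi>\<^sub>0)" for \<phi>\<^sub>0
    unfolding locally_finite_def by (intro exI[of _ 1]) (simp add: full_sub_length)
  ultimately show ?thesis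
    by (simp add: Stab_def stability_condition_def sigma_def charge_dual slicing_std_slicing)
qed

lemma simple_nonzero: "\<not> zero_obj T (simple n)"
  using simple[of n] by (auto simp: zero_iff intro!: exI[of _ n])

lemma simple_std_slicing: "simple n \<in> std_slicing \<phi>\<^sub>0 \<phi> \<longleftrightarrow> \<phi> = \<phi>\<^sub>0 - real_of_int n"
  using simple[of n] by (simp add: std_slicing_def)

lemma charge_simple_0 [simp]: "charge c (K0_class T (simple 0)) = c"
  by (simp add: charge_class simple euler_char_simple koszul_sign_def)

text \<open>The charge determines the real part of w, but the imaginary part only modulo 2 pi. The
  phase of the simple object in degree 0 determines it completely.\<close>

lemma sigma_inj: "sigma w = sigma w' \<longleftrightarrow> w = w'"
proof
  assume eq: "sigma w = sigma w'"
  then have "charge (exp w) (K0_class T (simple 0)) = charge (exp w') (K0_class T (simple 0))"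
    by (simp only: sigma_def prod.inject)
  then have "exp w = exp w'" by simp
  then have "Re w = Re w'" by (metis exp_inj_iff norm_exp_eq_Re)
  moreover have "std_slicing (Im w / pi) (Im w / pi) = std_slicing (Im w' / pi) (Im w / pi)"
    using eq by (simp only: sigma_def prod.inject)
  then have "simple 0 \<in> std_slicing (Im w / pi) (Im w / pi) \<longleftrightarrow> simple 0 \<in> std_slicing (Im w' / pi) (Im w / pi)"
    by (rule arg_cong)
  then have "Im w / pi = Im w' / pi" unfolding simple_std_slicing by simp
  ultimately show "w = w'" by (simp add: complex_eq_iff)
qed simp

text \<open>Objects that share a degree have a nonzero morphism in both directions, so two
  semistable ones have equal phases. After shifting, this shows that the sum of phase and degree is
  the same number for all semistable objects. The slicing is therefore contained in a standard one,
  and filtrations give the reverse inclusion. The charge then comes from its value at the simple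
  object.\<close>

lemma stab_sigma:
  assumes \<sigma>: "\<sigma> \<in> Stab T"
  shows "\<exists>w. \<sigma> = sigma w"
proof -
  obtain Z P where ZP: "\<sigma> = (Z, P)" by (cases \<sigma>)
  have st: "stability_condition T (Z, P)" proof -
    have "stability_condition T \<sigma>" using \<sigma> by (simp add: Stab_def)
    then show ?thesis unfolding ZP .
  qed
  have Z: "Z \<in> K0_dual T" and sl: "slicing T P"
    using st by (simp_all add: stability_condition_def)
  have ph: "\<exists>m::real. m > 0 \<and> Z (K0_class T E) = of_real m * exp (\<i> * of_real (pi * \<phi>))"
    if "E \<in> P \<phi>" "\<not> zero_obj T E" for E \<phi>
    using st that by (simp add: stability_condition_def)
  have add: "additive_subcat T (P \<phi>)" for \<phi> using sl by (simp add: slicing_def)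
  have sh: "P (\<phi> + 1) = {E \<in> tob T. \<exists>A\<in>P \<phi>. iso_obj T E (tsh T A)}" for \<phi>
    using sl unfolding slicing_def by (elim conjE) (erule spec)
  have hom: "zero_mor T A B f" if "\<phi> > \<psi>" "A \<in> P \<phi>" "B \<in> P \<psi>" "f \<in> thom T A B" for A B f \<phi> \<psi>
    using sl that unfolding slicing_def by (elim conjE) (drule spec, drule spec, drule (1) mp, drule (1) bspec, drule (1) bspec, erule (1) bspec)
  have hn: "\<exists>\<phi>s. hn_filtration T P E \<phi>s" if "E \<in> tob T" "\<not> zero_obj T E" for E
    using sl that unfolding slicing_def by (elim conjE) (drule (1) bspec, erule (1) mp)
  have Po: "A \<in> tob T" if "A \<in> P \<phi>" for A \<phi>
    using add[of \<phi>] that unfolding additive_subcat_def by (elim conjE) (rule subsetD)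
  have iso: "B \<in> P \<phi>" if "A \<in> P \<phi>" "B \<in> tob T" "h A = h B" for A B \<phi>
    using add[of \<phi>, unfolded additive_subcat_def, THEN conjunct2, THEN conjunct1, THEN bspec[OF _ that(1)], THEN spec,
      THEN mp, OF iso_objI[OF Po[OF that(1)] that(2,3)]] .
  \<comment> \<open>The slicing axiom moves phases by one in one direction; \<open>down\<close>
    reads it backwards, and \<open>shift_by\<close> iterates both. Objects are matched through their
    dimensions, as each P is closed under isomorphism.\<close>
  have up: "B \<in> P (\<phi> + 1)" if "A \<in> P \<phi>" "B \<in> tob T" "\<And>n. h B n = h A (n + 1)" for A B \<phi>
    unfolding sh
    using that(1) iso_objI[OF that(2) shift_ob[OF Po[OF that(1)]]] that(2,3) by (auto simp: fun_eq_iff shift[OF Po[OF that(1)]])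
  have down: "B \<in> P (\<phi> - 1)" if A: "A \<in> P \<phi>" and B: "B \<in> tob T" "\<And>n. h B n = h A (n - 1)" for A B \<phi>
  proof -
    have "A \<in> P (\<phi> - 1 + 1)" using A by simp
    then obtain C where C: "C \<in> P (\<phi> - 1)" "iso_obj T A (tsh T C)" unfolding sh by blast
    have "h C = h B"
    proof
      fix n show "h C n = h B n" using iso_objD[OF C(2)] shift[OF Po[OF C(1)], of "n - 1"] B(2) by simp
    qed
    then show ?thesis by (rule iso[OF C(1) B(1)])
  qed
  have sh_ob: "\<exists>B\<in>tob T. \<forall>n. h B n = h A (n + k)" if "A \<in> tob T" for A k
  proof -
    have "{n. h A (n + k) \<noteq> 0} = (\<lambda>n. n - k) ` {n. h A n \<noteq> 0}"
      by (auto intro!: image_eqI[of _ _ "_ + k"])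
    then have "finite {n. h A (n + k) \<noteq> 0}" using fin[OF that] by simp
    from ob[OF this] show ?thesis by (intro bexI[of _ "ob (\<lambda>n. h A (n + k))"]) simp_all
  qed
  have shift_by: "\<exists>B\<in>P (\<phi> + real_of_int k). \<forall>n. h B n = h A (n + k)" if A: "A \<in> P \<phi>" for A \<phi> k
  proof (induction k rule: int_induct[where k = 0])
    case base
    then show ?case using A by auto
  next
    case (step1 k)
    then obtain B where B: "B \<in> P (\<phi> + real_of_int k)" "\<And>n. h B n = h A (n + k)" by blast
    obtain C where C: "C \<in> tob T" "\<And>n. h C n = h A (n + (k + 1))" using sh_ob[OF Po[OF A]] by blast
    have "C \<in> P (\<phi> + real_of_int k + 1)" by (rule up[OF B(1) C(1)]) (simp add: B(2) C(2) add_ac)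
    then show ?case using C(2) by (auto simp: add_ac)
  next
    case (step2 k)
    then obtain B where B: "B \<in> P (\<phi> + real_of_int k)" "\<And>n. h B n = h A (n + k)" by blast
    obtain C where C: "C \<in> tob T" "\<And>n. h C n = h A (n + (k - 1))" using sh_ob[OF Po[OF A]] by blast
    have "C \<in> P (\<phi> + real_of_int k - 1)" by (rule down[OF B(1) C(1)]) (simp add: B(2) C(2) algebra_simps)
    then show ?case using C(2) by (auto simp: algebra_simps)
  qed
  \<comment> \<open>If the phase of A exceeded that of B, every morphism from A to B would be zero,
    but the common degree yields a nonzero one.\<close>
  have le: "\<phi> \<le> \<psi>" if "A \<in> P \<phi>" "B \<in> P \<psi>" "h A n \<noteq> 0" "h B n \<noteq> 0" for A B \<phi> \<psi> n
    using hom_nonzero[OF Po[OF that(1)] Po[OF that(2)] that(3,4)] hom[of \<psi> \<phi> A B] that(1,2) by (meson linorder_not_le)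
  \<comment> \<open>B is shifted by m - n, so that its cohomology in degree m moves to degree
    n.\<close>
  have le': "\<phi> + real_of_int n \<le> \<psi> + real_of_int m" if A: "A \<in> P \<phi>" "B \<in> P \<psi>" "h A n \<noteq> 0" "h B m \<noteq> 0"
    for A B \<phi> \<psi> n m
  proof -
    obtain C where C: "C \<in> P (\<psi> + real_of_int (m - n))" "\<And>i. h C i = h B (i + (m - n))"
      using shift_by[OF A(2)] by blast
    have "h C n \<noteq> 0" using C(2)[of n] A(4) by simp
    from le[OF A(1) C(1) A(3) this] show ?thesis by simp
  qed
  \<comment> \<open>A filtration of the nonzero object \<open>simple 0\<close> cannot be empty, and
    its factors are nonzero and semistable.\<close>
  have ex: "\<exists>\<psi> B. B \<in> P \<psi> \<and> \<not> zero_obj T B"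
  proof -
    obtain \<phi>s where "hn_filtration T P (simple 0) \<phi>s" using hn[OF simple(1) simple_nonzero] by blast
    then show ?thesis unfolding hn_filtration_def using simple_nonzero[of 0]
      by (metis gr0I list.size(3) length_0_conv)
  qed
  then obtain \<psi> B where B: "B \<in> P \<psi>" "\<not> zero_obj T B" by blast
  then obtain m where m: "h B m \<noteq> 0" using Po[OF B(1)] by (auto simp: zero_iff)
  define \<phi>\<^sub>0 where "\<phi>\<^sub>0 = \<psi> + real_of_int m"
  have sub: "P \<phi> \<subseteq> std_slicing \<phi>\<^sub>0 \<phi>" for \<phi>
  proof
    fix A assume A: "A \<in> P \<phi>"
    have "\<phi> = \<phi>\<^sub>0 - real_of_int n" if "h A n \<noteq> 0" for n
      using le'[OF A B(1) that m] le'[OF B(1) A m that] by (simp add: \<phi>\<^sub>0_def)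
    then show "A \<in> std_slicing \<phi>\<^sub>0 \<phi>" using Po[OF A] by (simp add: std_slicing_def)
  qed
  have "E \<in> P \<phi>" if E: "E \<in> std_slicing \<phi>\<^sub>0 \<phi>" for E \<phi>
  proof (cases "zero_obj T E")
    case True
    obtain Z0 where "Z0 \<in> P \<phi>" "zero_obj T Z0"
      using add[of \<phi>, unfolded additive_subcat_def, THEN conjunct2, THEN conjunct2, THEN conjunct1] by (rule bexE)
    then show ?thesis using True by - (rule iso[of Z0], simp_all add: zero_iff fun_eq_iff)
  next
    case False
    have Eo: "E \<in> tob T" using E by (simp add: std_slicing_def)
    from hn[OF Eo False] obtain \<phi>s where f: "hn_filtration T P E \<phi>s" by blast
    obtain n where n: "\<phi> = \<phi>\<^sub>0 - real_of_int n" "h E n \<noteq> 0" "\<forall>i. i \<noteq> n \<longrightarrow> h E i = 0"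
      by (rule std_slicing_nonzero[OF E False]) (rule that)
    have "h E i \<noteq> 0 \<longleftrightarrow> i = n" for i using n(2,3) by (cases "i = n") simp_all
    then have "{i. h E i \<noteq> 0} = {n}" by simp
    \<comment> \<open>Cohomology in one degree allows one phase only, and the phases of a filtration
      are distinct. So there is a single factor, with the same dimensions as E.\<close>
    then have "set \<phi>s = {\<phi>}" using hn_phases[OF sub f] n(1) by simp
    moreover have "distinct \<phi>s" using f unfolding hn_filtration_def
      by (metis distinct_rev sorted_wrt_rev strict_sorted_iff)
    ultimately have \<phi>s: "\<phi>s = [\<phi>]"
      by (cases \<phi>s rule: list.exhaust) (auto, metis distinct.simps(2) list.set_intros(1) neq_Nil_conv singletonD subsetD)
    from f obtain F A u v w where F: "zero_obj T (F 0)" "A 0 \<in> P \<phi>" "(F 0, E, A 0, u, v, w) \<in> tdt T"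
      unfolding hn_filtration_def \<phi>s by auto
    from triangle_exact[OF F(3)] obtain k where k: "\<And>n. h E n + k n + k (n - 1) = h (F 0) n + h (A 0) n"
      "\<And>n. k n \<le> h (F 0) (n + 1)" by blast
    have "h (A 0) = h E"
    proof
      fix n show "h (A 0) n = h E n" using k(1)[of n] k(2)[of n] k(2)[of "n - 1"] F(1) by (simp add: zero_iff)
    qed
    then show ?thesis by (rule iso[OF F(2) Eo])
  qed
  with sub have P: "P = std_slicing \<phi>\<^sub>0" by (intro HOL.ext) blast
  have "simple 0 \<in> P \<phi>\<^sub>0" unfolding P simple_std_slicing by simp
  from ph[OF this simple_nonzero] obtain r :: real where r: "r > 0"
    "Z (K0_class T (simple 0)) = of_real r * exp (\<i> * of_real (pi * \<phi>\<^sub>0))" by blast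
  let ?w = "of_real (ln r) + \<i> * of_real (pi * \<phi>\<^sub>0)"
  have "exp ?w = Z (K0_class T (simple 0))" using r by (simp add: exp_add exp_of_real)
  then have "sigma ?w = \<sigma>"
    using dual_eq_charge[OF Z] by (simp add: sigma_def ZP P)
  then show ?thesis by metis
qed

lemma Stab_eq: "Stab T = range sigma"
  using sigma_stab stab_sigma by blast

end

section \<open>The topology\<close>

lemma Hausdorff_space_euclidean: "Hausdorff_space (euclidean :: 'a::t2_space topology)"
  unfolding Hausdorff_space_def disjnt_def by (simp, metis hausdorff)

lemma second_countable_euclidean: "second_countable (euclidean :: 'a::second_countable_topology topology)"
proof -
  obtain B :: "'a set set" where B: "countable B" "topological_basis B" using ex_countable_basis by blast
  show ?thesis
    unfolding second_countable_def
  proof (intro exI[of _ B] conjI ballI allI impI B(1))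
    show "openin euclidean V" if "V \<in> B" for V using topological_basis_open[OF B(2) that] by simp
    fix U and x :: 'a assume "openin euclidean U \<and> x \<in> U"
    then have "open U" "x \<in> U" by simp_all
    then obtain V where "V \<in> B" "x \<in> V" "V \<subseteq> U" by (rule topological_basisE[OF B(2)])
    then show "\<exists>V\<in>B. x \<in> V \<and> V \<subseteq> U" by blast
  qed
qed

text \<open>Charts may land in \<open>cvec n\<close> for various n, but every map to be checked
  depends on a single coordinate. Its differential is the ordinary derivative in that coordinate and
  zero in the others.\<close>

lemma holo_fun_coordinate:
  assumes "i < n" and f: "\<And>x. x \<in> W \<Longrightarrow> \<exists>D. (f has_field_derivative D) (at (x i))"
  shows "holo_fun n W (\<lambda>x. f (x i))"
  unfolding holo_fun_def
proof
  fix x assume "x \<in> W"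
  then obtain D where D: "(f has_field_derivative D) (at (x i))" using f by blast
  show "\<exists>a. \<forall>e>0. \<exists>\<delta>>0. \<forall>y\<in>W. (\<forall>k<n. cmod (y k - x k) < \<delta>) \<longrightarrow>
      cmod (f (y i) - f (x i) - (\<Sum>k<n. a k * (y k - x k))) \<le> e * (\<Sum>k<n. cmod (y k - x k))"
  proof (intro exI[of _ "\<lambda>k. if k = i then D else 0"] allI impI)
    fix e :: real assume e: "e > 0"
    obtain \<delta> where \<delta>: "\<delta> > 0" "\<And>z. cmod (z - x i) < \<delta> \<Longrightarrow> cmod (f z - f (x i) - D * (z - x i)) \<le> e * cmod (z - x i)"
      using D e unfolding has_field_derivative_def has_derivative_at_alt by blast
    show "\<exists>\<delta>>0. \<forall>y\<in>W. (\<forall>k<n. cmod (y k - x k) < \<delta>) \<longrightarrow>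
        cmod (f (y i) - f (x i) - (\<Sum>k<n. (if k = i then D else 0) * (y k - x k))) \<le> e * (\<Sum>k<n. cmod (y k - x k))"
    proof (intro exI[of _ \<delta>] conjI \<delta>(1) ballI impI)
      fix y assume y: "\<forall>k<n. cmod (y k - x k) < \<delta>"
      have s: "(\<Sum>k<n. (if k = i then D else 0) * (y k - x k)) = D * (y i - x i)"
        using assms(1) by (simp add: if_distrib[of "\<lambda>c. c * _"] sum.delta cong: if_cong)
      have "cmod (y i - x i) \<le> (\<Sum>k<n. cmod (y k - x k))"
        by (rule member_le_sum) (use assms(1) in auto)
      then have "e * cmod (y i - x i) \<le> e * (\<Sum>k<n. cmod (y k - x k))" using e by simp
      then show "cmod (f (y i) - f (x i) - (\<Sum>k<n. (if k = i then D else 0) * (y k - x k))) \<le> e * (\<Sum>k<n. cmod (y k - x k))"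
        unfolding s using \<delta>(2)[of "y i"] y assms(1) by (meson order_trans)
    qed
  qed
qed

lemma holo_fun_cong:
  assumes "\<And>x. x \<in> W \<Longrightarrow> f x = g x" and "holo_fun n W g"
  shows "holo_fun n W f"
  using assms(2) unfolding holo_fun_def by (simp add: assms(1) cong: ball_cong)

section \<open>The plane as a complex manifold\<close>

definition line_coordinate :: "complex \<Rightarrow> nat \<Rightarrow> complex" where
  "line_coordinate z = (\<lambda>i. if i = 0 then z else 0)"

lemma line_coordinate_0 [simp]: "line_coordinate z 0 = z"
  by (simp add: line_coordinate_def)

lemma line_coordinate_homeomorphic:
  "homeomorphic_map euclidean (top_of_set (cvec 1)) line_coordinate"
proof (rule homeomorphic_maps_imp_map)
  show "homeomorphic_maps euclidean (top_of_set (cvec 1)) line_coordinate (\<lambda>x. x 0)"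
    unfolding homeomorphic_maps_def
  proof (intro conjI ballI)
    have "continuous_on UNIV line_coordinate"
      unfolding line_coordinate_def
    proof (rule continuous_on_coordinatewise_then_product)
      show "continuous_on UNIV (\<lambda>z::complex. if i = 0 then z else 0)" for i :: nat by (cases "i = 0") simp_all
    qed
    then show "continuous_map euclidean (top_of_set (cvec 1)) line_coordinate"
      by (simp add: continuous_map_in_subtopology) (simp add: line_coordinate_def cvec_def image_subset_iff Pi_iff)
    show "continuous_map (top_of_set (cvec 1)) euclidean (\<lambda>x::nat \<Rightarrow> complex. x 0)"
      by (simp add: continuous_on_subset[OF continuous_on_product_coordinates])
    fix x :: "nat \<Rightarrow> complex" assume "x \<in> topspace (top_of_set (cvec 1))"
    then show "line_coordinate (x 0) = x" by (auto simp: line_coordinate_def cvec_def fun_eq_iff)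
  qed simp
qed

lemma range_line_coordinate: "range line_coordinate = cvec 1"
  using homeomorphic_imp_surjective_map[OF line_coordinate_homeomorphic] by simp

lemma inj_line_coordinate: "inj line_coordinate"
  by (rule injI) (metis line_coordinate_0)

lemma complex_plane_atlas_eq: "complex_plane_atlas = {(1, UNIV, line_coordinate)}"
  by (simp add: complex_plane_atlas_def line_coordinate_def[abs_def])

lemma complex_manifold_plane: "complex_manifold (euclidean :: complex topology) complex_plane_atlas"
  unfolding complex_manifold_def complex_plane_atlas_eq
proof (intro conjI)
  show "\<forall>c\<in>{(1, UNIV, line_coordinate)}. chart_on euclidean c"
    using line_coordinate_homeomorphic by (simp add: chart_on_def range_line_coordinate)
  have "holo_fun 1 (range line_coordinate) (\<lambda>x. (line_coordinate \<circ> inv_into UNIV line_coordinate) x j)" if "j < 1" for j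
    by (rule holo_fun_cong[OF _ holo_fun_coordinate[of 0 1 _ "\<lambda>z. z"]])
      (use that in \<open>auto simp: f_inv_into_f inj_line_coordinate intro: DERIV_ident\<close>)
  then show "\<forall>(n, U, \<phi>)\<in>{(1, UNIV, line_coordinate)}. \<forall>(m, V, \<psi>)\<in>{(1, UNIV, line_coordinate)}.
      holo_map n m (\<phi> ` (U \<inter> V)) (\<psi> \<circ> inv_into U \<phi>)"
    by (simp add: holo_map_def)
qed (simp_all add: Hausdorff_space_euclidean second_countable_euclidean)

section \<open>Norm, distance and basic neighbourhoods in the parameter plane\<close>

context graded_tricat
begin

lemma euler_char_nonzero:
  assumes "E \<in> std_slicing \<phi>\<^sub>0 \<phi>" "\<not> zero_obj T E"
  shows "euler_char E \<noteq> 0"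
  by (rule std_slicing_nonzero[OF assms]) (simp add: koszul_sign_def)

text \<open>Numerator and denominator are both proportional to the Euler characteristic, which is
  nonzero on semistable objects. So all quotients in the supremum are equal.\<close>

lemma stab_norm_sigma:
  assumes U: "\<And>E. E \<in> tob T \<Longrightarrow> U (K0_class T E) = u * of_int (euler_char E)"
  shows "stab_norm T (sigma w) U = ennreal (cmod u / cmod (exp w))"
proof -
  let ?S = "{E. (\<exists>\<phi>. E \<in> std_slicing (Im w / pi) \<phi>) \<and> \<not> zero_obj T E}"
  have ne: "?S \<noteq> {}" using simple_std_slicing[of 0] simple_nonzero[of 0] by blast
  have "cmod (U (K0_class T E)) / cmod (charge (exp w) (K0_class T E)) = cmod u / cmod (exp w)" if "E \<in> ?S" for E
  proof -
    have E: "E \<in> tob T" "euler_char E \<noteq> 0"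
      using that euler_char_nonzero[of E] by (auto simp: std_slicing_def)
    then show ?thesis by (simp add: U charge_class norm_mult)
  qed
  then have "stab_norm T (sigma w) U = (SUP E\<in>?S. ennreal (cmod u / cmod (exp w)))"
    unfolding stab_norm_def sigma_def fst_conv snd_conv by (intro SUP_cong refl arg_cong[where f = ennreal]) simp
  then show ?thesis using ne by simp
qed

text \<open>Passing from one standard slicing to another moves the extreme phases of every object by
  the same amount.\<close>

lemma slicing_dist_std: "slicing_dist T (std_slicing a) (std_slicing b) = ennreal \<bar>a - b\<bar>"
proof -
  let ?S = "{E \<in> tob T. \<not> zero_obj T E}"
  have ne: "?S \<noteq> {}" using simple(1)[of 0] simple_nonzero[of 0] by blast
  have "slicing_dist T (std_slicing a) (std_slicing b) = (SUP E\<in>?S. ennreal \<bar>a - b\<bar>)"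
    unfolding slicing_dist_def
    by (intro SUP_cong refl arg_cong[where f = ennreal]) (simp add: phi_std_slicing)
  then show ?thesis using ne by simp
qed

definition disc :: "complex \<Rightarrow> real \<Rightarrow> complex set" where
  "disc w \<epsilon> = {w'. cmod (exp w' - exp w) / cmod (exp w) < sin (pi * \<epsilon>) \<and> \<bar>Im w / pi - Im w' / pi\<bar> < \<epsilon>}"

lemma stab_ball_sigma: "stab_ball T (sigma w) \<epsilon> = sigma ` disc w \<epsilon>"
proof -
  have "sigma w' \<in> stab_ball T (sigma w) \<epsilon> \<longleftrightarrow> w' \<in> disc w \<epsilon>" for w'
  proof -
    have "stab_norm T (sigma w) (\<lambda>x. fst (sigma w') x - fst (sigma w) x) = ennreal (cmod (exp w' - exp w) / cmod (exp w))"
      by (rule stab_norm_sigma) (simp add: sigma_def charge_class algebra_simps)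
    moreover have "slicing_dist T (snd (sigma w)) (snd (sigma w')) = ennreal \<bar>Im w / pi - Im w' / pi\<bar>"
      unfolding sigma_def snd_conv by (rule slicing_dist_std)
    ultimately show ?thesis
      unfolding stab_ball_def disc_def by (simp add: sigma_stab ennreal_less_iff)
  qed
  moreover have "stab_ball T (sigma w) \<epsilon> \<subseteq> range sigma" unfolding stab_ball_def Stab_eq[symmetric] by (rule Collect_restrict)
  ultimately show ?thesis by auto
qed

lemma open_disc: "open (disc w \<epsilon>)"
  unfolding disc_def by (intro open_Collect_conj open_Collect_less continuous_intros) simp_all

text \<open>The first condition of a disc puts exp(w' - w) near 1, hence its principal logarithm
  near 0. The second keeps the imaginary part of w' - w below pi, so this logarithm is w' - w
  itself.\<close>

lemma disc_small:
  assumes "open V" "w \<in> V"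
  shows "\<exists>\<epsilon>. 0 < \<epsilon> \<and> \<epsilon> < 1 / 4 \<and> disc w \<epsilon> \<subseteq> V \<and> w \<in> disc w \<epsilon>"
proof -
  obtain r where r: "r > 0" "ball w r \<subseteq> V" using assms open_contains_ball by blast
  have "isCont Ln 1" by (rule continuous_at_Ln) simp
  then obtain \<delta> where \<delta>: "\<delta> > 0" "\<And>z. dist z 1 < \<delta> \<Longrightarrow> dist (Ln z) (Ln 1) < r"
    using r(1) unfolding continuous_at_eps_delta by blast
  \<comment> \<open>The bound 1/8 stays below the required 1/4 and keeps imaginary parts within pi;
    the bound by \<open>\<delta> / pi\<close> gives sin(pi e) at most \<open>\<delta>\<close> for
    this radius e.\<close>
  define \<epsilon> where "\<epsilon> = min (1 / 8) (\<delta> / pi)"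
  have \<epsilon>: "0 < \<epsilon>" "\<epsilon> < 1 / 4" "pi * \<epsilon> \<le> \<delta>" using \<delta>(1) by (auto simp: \<epsilon>_def min_def field_simps)
  have sin: "sin (pi * \<epsilon>) \<le> \<delta>" using sin_x_le_x[of "pi * \<epsilon>"] \<epsilon> by simp
  have "0 < sin (pi * \<epsilon>)" using \<epsilon> by (intro sin_gt_zero) auto
  then have "w \<in> disc w \<epsilon>" using \<epsilon>(1) by (simp add: disc_def)
  moreover have "w' \<in> V" if w': "w' \<in> disc w \<epsilon>" for w'
  proof -
    have "cmod (exp (w' - w) - 1) = cmod (exp w' - exp w) / cmod (exp w)"
      unfolding norm_divide[symmetric] by (simp add: exp_diff diff_divide_distrib)
    then have "dist (exp (w' - w)) 1 < \<delta>" using w' sin by (simp add: disc_def dist_norm)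
    then have dl: "dist (Ln (exp (w' - w))) (Ln 1) < r" by (rule \<delta>(2))
    have "\<bar>Im w - Im w'\<bar> < pi * \<epsilon>"
      using w' by (simp add: disc_def field_simps abs_mult flip: diff_divide_distrib)
    moreover have "pi * \<epsilon> < pi" using \<epsilon>(2) by simp
    ultimately have "\<bar>Im (w' - w)\<bar> < pi" by (simp only: minus_complex.sel)
    then have "Ln (exp (w' - w)) = w' - w" by (intro Ln_exp) auto
    with dl have "w' \<in> ball w r" by (simp add: dist_norm norm_minus_commute)
    then show ?thesis using r(2) by blast
  qed
  ultimately show ?thesis using \<epsilon> by blast
qed

abbreviation "\<T> \<equiv> stab_topology T"

text \<open>The generating balls are images of open discs, and discs around a point become
  arbitrarily small. So Bridgeland's topology is the topology of the plane carried over by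
  \<open>sigma\<close>.\<close>

lemma openin_stab: "openin \<T> S \<longleftrightarrow> S \<subseteq> range sigma \<and> open (sigma -` S)"
proof
  let ?B = "{stab_ball T \<sigma> \<epsilon> | \<sigma> \<epsilon>. \<sigma> \<in> Stab T \<and> 0 < \<epsilon> \<and> \<epsilon> < 1 / 4}"
  assume "openin \<T> S"
  then have "generate_topology_on ?B S" unfolding stab_topology_def openin_topology_generated_by_iff .
  then show "S \<subseteq> range sigma \<and> open (sigma -` S)"
  proof induction
    case (Basis s)
    then obtain w \<epsilon> where s: "s = sigma ` disc w \<epsilon>" unfolding Stab_eq using stab_ball_sigma by blast
    have "sigma -` s = disc w \<epsilon>" unfolding s by (auto simp: sigma_inj)
    then show ?case using open_disc s by auto
  qed (auto simp: vimage_Union)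
next
  assume S: "S \<subseteq> range sigma \<and> open (sigma -` S)"
  show "openin \<T> S"
    unfolding openin_subopen[of \<T> S]
  proof
    fix s assume s: "s \<in> S"
    then obtain w where w: "s = sigma w" "w \<in> sigma -` S" using S by blast
    obtain \<epsilon> where \<epsilon>: "0 < \<epsilon>" "\<epsilon> < 1 / 4" "disc w \<epsilon> \<subseteq> sigma -` S" "w \<in> disc w \<epsilon>"
      using disc_small[of "sigma -` S" w] S w(2) by blast
    have "openin \<T> (stab_ball T (sigma w) \<epsilon>)"
      unfolding stab_topology_def by (rule topology_generated_by_Basis) (use \<epsilon> sigma_stab in blast)
    then show "\<exists>U. openin \<T> U \<and> s \<in> U \<and> U \<subseteq> S"
      using \<epsilon>(3,4) unfolding stab_ball_sigma w(1) by blast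
  qed
qed

lemma vimage_sigma: "sigma -` (sigma ` S) = S"
  by (auto simp: sigma_inj)

lemma topspace_stab: "topspace \<T> = range sigma"
proof (rule antisym)
  show "topspace \<T> \<subseteq> range sigma" using openin_topspace[of \<T>] unfolding openin_stab by blast
  have "openin \<T> (range sigma)" unfolding openin_stab vimage_sigma by simp
  then show "range sigma \<subseteq> topspace \<T>" by (rule openin_subset)
qed

lemma sigma_homeomorphic: "homeomorphic_map euclidean \<T> sigma"
proof (rule bijective_open_imp_homeomorphic_map)
  show "continuous_map euclidean \<T> sigma"
    unfolding continuous_map_def by (auto simp: topspace_stab openin_stab vimage_def)
  show "open_map euclidean \<T> sigma"
    unfolding open_map_def openin_stab vimage_sigma by auto
qed (auto simp: topspace_stab inj_on_def sigma_inj)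

lemma inv_sigma [simp]: "inv_into UNIV sigma (sigma w) = w"
  by (rule inv_f_f) (simp add: inj_on_def sigma_inj)

lemma sigma_homeomorphic_maps: "homeomorphic_maps euclidean \<T> sigma (inv_into UNIV sigma)"
proof -
  have "sigma -` {x \<in> range sigma. inv_into UNIV sigma x \<in> U} = U" for U by auto
  then have "continuous_map \<T> euclidean (inv_into UNIV sigma)"
    unfolding continuous_map_def by (simp add: topspace_stab openin_stab)
  then show ?thesis
    unfolding homeomorphic_maps_def
    using homeomorphic_imp_continuous_map[OF sigma_homeomorphic] by (auto simp: topspace_stab)
qed

end

section \<open>Charts\<close>

context graded_tricat
begin

lemma charge_smult: "charge c = (\<lambda>x\<in>carrier (K0 T). c * charge 1 x)"
  by (auto simp: charge_def fun_eq_iff)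

text \<open>Every functional is a multiple of the Euler characteristic and has finite norm; the
  model space is the full dual at each point.\<close>

lemma stab_tangent_sigma: "stab_tangent T (sigma w) = K0_dual T"
proof -
  have "stab_norm T (sigma w) U < \<infinity>" if "U \<in> K0_dual T" for U
  proof -
    let ?c = "U (K0_class T (simple 0))"
    have "stab_norm T (sigma w) (charge ?c) = ennreal (cmod ?c / cmod (exp w))"
      by (rule stab_norm_sigma) (simp add: charge_class)
    then show ?thesis using dual_eq_charge[OF that] by simp
  qed
  then show ?thesis by (auto simp: stab_tangent_def)
qed

text \<open>The atlas admits all linear coordinates, with n not fixed in advance. Linearity makes
  each chart exp w times the fixed vector \<open>a = L (charge 1)\<close>, and injectivity of L
  gives this vector a nonzero entry, from which exp w can be recovered.\<close>

lemma chart_form: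
  assumes c: "(n, U, \<phi>) \<in> stab_atlas T" and w\<^sub>0: "sigma w\<^sub>0 \<in> U"
  obtains a i where "i < n" "a i \<noteq> 0" "\<And>w. sigma w \<in> U \<Longrightarrow> \<phi> (sigma w) = (\<lambda>j. exp w * a j)"
proof -
  from c obtain V L where V: "\<forall>\<sigma>\<in>U. stab_tangent T \<sigma> = V \<and> fst \<sigma> \<in> V" and L: "linear_coordinates T V n L"
    and \<phi>: "\<phi> = (\<lambda>\<sigma>. L (fst \<sigma>))" unfolding stab_atlas_def by blast
  have V: "V = K0_dual T" using bspec[OF V w\<^sub>0] by (simp add: stab_tangent_sigma)
  have bij: "bij_betw L (K0_dual T) (cvec n)"
    and smult: "\<And>c u. u \<in> K0_dual T \<Longrightarrow> L (\<lambda>x\<in>carrier (K0 T). c * u x) = (\<lambda>i. c * L u i)"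
    using L unfolding linear_coordinates_def V by blast+
  define a where "a = L (charge 1)"
  have La: "L (charge c) = (\<lambda>j. c * a j)" for c
    using smult[OF charge_dual, of c 1] by (simp only: charge_smult[symmetric] a_def)
  have a: "a \<in> cvec n" using bij_betwE[OF bij] charge_dual unfolding a_def by blast
  have "\<exists>i. a i \<noteq> 0"
  proof (rule ccontr)
    assume "\<not> (\<exists>i. a i \<noteq> 0)"
    then have "L (charge 1) = L (charge 0)" by (simp add: La)
    then have "charge 1 = charge 0" by (rule inj_onD[OF bij_betw_imp_inj_on[OF bij] _ charge_dual charge_dual])
    then have "charge 1 (K0_class T (simple 0)) = charge 0 (K0_class T (simple 0))" by (rule arg_cong)
    then show False by simp
  qed
  then obtain i where i: "a i \<noteq> 0" by blast
  have n: "i < n" using a i unfolding cvec_def by (metis (mono_tags, lifting) mem_Collect_eq linorder_not_less)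
  show ?thesis by (rule that[of i a, OF n i]) (simp add: \<phi> sigma_def La)
qed

lemma chart_inj:
  assumes "chart_on \<T> (n, U, \<phi>)"
  shows "inj_on \<phi> U" and "openin \<T> U" and "U \<subseteq> range sigma"
proof -
  show o: "openin \<T> U" using assms by (simp add: chart_on_def)
  then show s: "U \<subseteq> range sigma" by (simp add: openin_stab)
  have "homeomorphic_map (subtopology \<T> U) (top_of_set (\<phi> ` U)) \<phi>" using assms by (simp add: chart_on_def)
  from homeomorphic_imp_injective_map[OF this] show "inj_on \<phi> U"
    using s by (simp add: topspace_stab inf_absorb2)
qed

lemma stab_atlas_chart: "(n, U, \<phi>) \<in> stab_atlas T \<Longrightarrow> chart_on \<T> (n, U, \<phi>)"
  unfolding stab_atlas_def by blast

lemma transition_holo: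
  assumes c: "(n, U, \<phi>) \<in> stab_atlas T" and d: "(m, V, \<psi>) \<in> stab_atlas T"
  shows "holo_map n m (\<phi> ` (U \<inter> V)) (\<psi> \<circ> inv_into U \<phi>)"
proof (cases "U \<inter> V = {}")
  case True
  then show ?thesis by (simp add: holo_map_def holo_fun_def)
next
  case False
  note ci = chart_inj[OF stab_atlas_chart[OF c]]
  obtain w\<^sub>0 where w\<^sub>0: "sigma w\<^sub>0 \<in> U" "sigma w\<^sub>0 \<in> V" using False ci(3) by blast
  obtain a i where a: "i < n" "a i \<noteq> 0" "\<And>w. sigma w \<in> U \<Longrightarrow> \<phi> (sigma w) = (\<lambda>j. exp w * a j)"
    using chart_form[OF c w\<^sub>0(1)] by metis
  obtain b k where b: "k < m" "b k \<noteq> 0" "\<And>w. sigma w \<in> V \<Longrightarrow> \<psi> (sigma w) = (\<lambda>j. exp w * b j)"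
    using chart_form[OF d w\<^sub>0(2)] by metis
  show ?thesis
    unfolding holo_map_def
  proof (intro allI impI)
    fix j
    show "holo_fun n (\<phi> ` (U \<inter> V)) (\<lambda>x. (\<psi> \<circ> inv_into U \<phi>) x j)"
    proof (rule holo_fun_cong)
      \<comment> \<open>The coordinate i recovers exp w as \<open>x i / a i\<close>, and the second
        chart multiplies it by \<open>b j\<close>.\<close>
      show "holo_fun n (\<phi> ` (U \<inter> V)) (\<lambda>x. x i / a i * b j)"
        by (rule holo_fun_coordinate[OF a(1)]) (auto intro!: exI derivative_eq_intros simp: a(2))
      fix x assume "x \<in> \<phi> ` (U \<inter> V)"
      then obtain w where w: "sigma w \<in> U" "sigma w \<in> V" "x = \<phi> (sigma w)" using ci(3) by blast
      show "(\<psi> \<circ> inv_into U \<phi>) x j = x i / a i * b j"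
        using inv_into_f_f[OF ci(1) w(1)] a(2) by (simp add: w(3) a(3)[OF w(1)] b(3)[OF w(2)])
    qed
  qed
qed

text \<open>A chart depends on w only through exp w, so injectivity of the chart makes exp injective
  on the open parameter domain. There exp has a holomorphic inverse g, a branch of the logarithm,
  and the parameter is g of \<open>x i / a i\<close>.\<close>

lemma inv_holo:
  assumes c: "(n, U, \<phi>) \<in> stab_atlas T"
  shows "holo_map n 1 (\<phi> ` U) (line_coordinate \<circ> inv_into UNIV sigma \<circ> inv_into U \<phi>)"
proof (cases "U = {}")
  case True
  then show ?thesis by (simp add: holo_map_def holo_fun_def)
next
  case False
  note ci = chart_inj[OF stab_atlas_chart[OF c]]
  obtain w\<^sub>0 where w\<^sub>0: "sigma w\<^sub>0 \<in> U" using False ci(3) by blast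
  obtain a i where a: "i < n" "a i \<noteq> 0" "\<And>w. sigma w \<in> U \<Longrightarrow> \<phi> (sigma w) = (\<lambda>j. exp w * a j)"
    using chart_form[OF c w\<^sub>0] by metis
  let ?S = "sigma -` U"
  have S: "open ?S" using ci(2) by (simp add: openin_stab)
  have inj: "inj_on exp ?S"
  proof (rule inj_onI)
    fix w w' assume w: "w \<in> ?S" "w' \<in> ?S" "exp w = exp w'"
    then have "\<phi> (sigma w) = \<phi> (sigma w')" by (simp add: a(3))
    then have "sigma w = sigma w'" using w(1,2) by (intro inj_onD[OF ci(1)]) simp_all
    then show "w = w'" by (simp add: sigma_inj)
  qed
  obtain g where g: "g holomorphic_on exp ` ?S" "\<And>z. z \<in> ?S \<Longrightarrow> g (exp z) = z"
    using holomorphic_has_inverse[OF holomorphic_on_exp S inj] by metis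
  have oS: "open (exp ` ?S)" by (rule open_mapping_thm3[OF holomorphic_on_exp S inj])
  have "holo_fun n (\<phi> ` U) (\<lambda>x. (line_coordinate \<circ> inv_into UNIV sigma \<circ> inv_into U \<phi>) x 0)"
  proof (rule holo_fun_cong)
    show "holo_fun n (\<phi> ` U) (\<lambda>x. g (x i / a i))"
    proof (rule holo_fun_coordinate[OF a(1)])
      fix x assume "x \<in> \<phi> ` U"
      then obtain w where w: "sigma w \<in> U" "x = \<phi> (sigma w)" using ci(3) by blast
      have x: "x i / a i = exp w" using a(2) by (simp add: w(2) a(3)[OF w(1)])
      have "(g has_field_derivative deriv g (x i / a i)) (at (x i / a i))"
        by (rule holomorphic_derivI[OF g(1) oS]) (use x w(1) in auto)
      moreover have "((\<lambda>z. z / a i) has_field_derivative 1 / a i) (at (x i))"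
        by (auto intro!: derivative_eq_intros simp: a(2))
      ultimately show "\<exists>D. ((\<lambda>z. g (z / a i)) has_field_derivative D) (at (x i))"
        by (intro exI) (rule DERIV_chain2)
    qed
    fix x assume "x \<in> \<phi> ` U"
    then obtain w where w: "sigma w \<in> U" "x = \<phi> (sigma w)" using ci(3) by blast
    show "(line_coordinate \<circ> inv_into UNIV sigma \<circ> inv_into U \<phi>) x 0 = g (x i / a i)"
      using inv_into_f_f[OF ci(1) w(1)] a(2) g(2)[of w] w(1) by (simp add: w(2) a(3)[OF w(1)])
  qed
  then show ?thesis by (simp add: holo_map_def)
qed

lemma sigma_holo:
  assumes c: "(m, V, \<psi>) \<in> stab_atlas T"
  shows "holo_map 1 m (line_coordinate ` (sigma -` V)) (\<psi> \<circ> sigma \<circ> inv_into UNIV line_coordinate)"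
proof (cases "V = {}")
  case True
  then show ?thesis by (simp add: holo_map_def holo_fun_def)
next
  case False
  note ci = chart_inj[OF stab_atlas_chart[OF c]]
  obtain w\<^sub>0 where w\<^sub>0: "sigma w\<^sub>0 \<in> V" using False ci(3) by blast
  obtain b k where b: "\<And>w. sigma w \<in> V \<Longrightarrow> \<psi> (sigma w) = (\<lambda>j. exp w * b j)"
    using chart_form[OF c w\<^sub>0] by metis
  show ?thesis
    unfolding holo_map_def
  proof (intro allI impI)
    fix j
    show "holo_fun 1 (line_coordinate ` (sigma -` V)) (\<lambda>x. (\<psi> \<circ> sigma \<circ> inv_into UNIV line_coordinate) x j)"
    proof (rule holo_fun_cong)
      show "holo_fun 1 (line_coordinate ` (sigma -` V)) (\<lambda>x. exp (x 0) * b j)"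
        by (rule holo_fun_coordinate[of 0]) (auto intro!: exI derivative_eq_intros)
      fix x assume "x \<in> line_coordinate ` (sigma -` V)"
      then obtain w where w: "sigma w \<in> V" "x = line_coordinate w" by blast
      show "(\<psi> \<circ> sigma \<circ> inv_into UNIV line_coordinate) x j = exp (x 0) * b j"
        using inv_into_f_f[OF inj_line_coordinate, of w] by (simp add: w(2) b[OF w(1)])
    qed
  qed
qed

text \<open>Around a given point the strip of height 2 pi serves as parameter domain, since exp is
  injective on it; the coordinate is the charge of the simple object in degree 0.\<close>

lemma covering_chart: "\<exists>U \<phi>. (1, U, \<phi>) \<in> stab_atlas T \<and> sigma w\<^sub>0 \<in> U"
proof -
  define L where "L = (\<lambda>Z :: ('o \<Rightarrow>\<^sub>0 int) set \<Rightarrow> complex. line_coordinate (Z (K0_class T (simple 0))))"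
  \<comment> \<open>Imaginary parts of two points of this strip differ by less than 2 pi, the period
    of exp.\<close>
  define S where "S = {w. \<bar>Im w - Im w\<^sub>0\<bar> < pi}"
  let ?\<phi> = "\<lambda>\<sigma>. L (fst \<sigma>)"
  let ?U = "sigma ` S"
  have S: "open S" unfolding S_def by (intro open_Collect_less continuous_intros)
  have inj: "inj_on exp S"
  proof (rule inj_onI)
    fix w w' assume "w \<in> S" "w' \<in> S" and e: "exp w = exp w'"
    then have "\<bar>Im w - Im w'\<bar> < 2 * pi" unfolding S_def by simp
    then show "w = w'" using e by (rule exp_complex_eqI)
  qed
  have \<phi>: "?\<phi> (sigma w) = line_coordinate (exp w)" for w by (simp add: L_def sigma_def)
  have \<phi>U: "?\<phi> ` ?U = line_coordinate ` exp ` S" by (auto simp: \<phi> image_image)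
  obtain g where g: "g holomorphic_on exp ` S" "\<And>z. z \<in> S \<Longrightarrow> g (exp z) = z"
    using holomorphic_has_inverse[OF holomorphic_on_exp S inj] by metis
  have oS: "open (exp ` S)" by (rule open_mapping_thm3[OF holomorphic_on_exp S inj])
  have U: "openin \<T> ?U" unfolding openin_stab vimage_sigma using S by blast
  have h1: "homeomorphic_map (subtopology \<T> ?U) (top_of_set S) (inv_into UNIV sigma)"
  proof (rule homeomorphic_map_subtopologies)
    show "homeomorphic_map \<T> euclidean (inv_into UNIV sigma)"
      by (rule homeomorphic_maps_imp_map[OF sigma_homeomorphic_maps[THEN homeomorphic_maps_sym[THEN iffD1]]])
    have "topspace \<T> \<inter> ?U = sigma ` S" unfolding topspace_stab by blast
    then show "inv_into UNIV sigma ` (topspace \<T> \<inter> ?U) = topspace euclidean \<inter> S"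
      by (simp add: image_image)
  qed
  have h2: "homeomorphic_map (top_of_set S) (top_of_set (exp ` S)) exp"
  proof (rule homeomorphic_maps_imp_map)
    show "homeomorphic_maps (top_of_set S) (top_of_set (exp ` S)) exp g"
      unfolding homeomorphic_maps_def continuous_map_subtopology_eu
      using holomorphic_on_imp_continuous_on[OF g(1)] g(2) by (auto intro: continuous_intros)
  qed
  have h3: "homeomorphic_map (top_of_set (exp ` S)) (top_of_set (line_coordinate ` exp ` S)) line_coordinate"
  proof -
    have "homeomorphic_map (subtopology euclidean (exp ` S)) (subtopology (top_of_set (cvec 1)) (line_coordinate ` exp ` S)) line_coordinate"
    proof (rule homeomorphic_map_subtopologies[OF line_coordinate_homeomorphic])
      have "line_coordinate ` exp ` S \<subseteq> cvec 1" unfolding range_line_coordinate[symmetric] by blast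
      then show "line_coordinate ` (topspace euclidean \<inter> exp ` S) = topspace (top_of_set (cvec 1)) \<inter> line_coordinate ` exp ` S"
        by auto
    qed
    moreover have "cvec 1 \<inter> line_coordinate ` exp ` S = line_coordinate ` exp ` S"
      unfolding range_line_coordinate[symmetric] by blast
    ultimately show ?thesis by (simp add: subtopology_subtopology)
  qed
  have "homeomorphic_map (subtopology \<T> ?U) (top_of_set (line_coordinate ` exp ` S)) (line_coordinate \<circ> (exp \<circ> inv_into UNIV sigma))"
    by (rule homeomorphic_map_compose[OF homeomorphic_map_compose[OF h1 h2] h3])
  then have h: "homeomorphic_map (subtopology \<T> ?U) (top_of_set (?\<phi> ` ?U)) ?\<phi>"
    unfolding \<phi>U by (rule homeomorphic_map_eq) (auto simp: \<phi>)
  have "openin (top_of_set (cvec 1)) (?\<phi> ` ?U)"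
    unfolding \<phi>U using homeomorphic_map_openness[OF line_coordinate_homeomorphic, of "exp ` S"] oS by simp
  then have chart: "chart_on \<T> (1, ?U, ?\<phi>)" using U h by (simp add: chart_on_def)
  have "linear_coordinates T (K0_dual T) 1 L"
    unfolding linear_coordinates_def
  proof (intro conjI ballI allI)
    have cl: "K0_class T (simple 0) \<in> carrier (K0 T)" by (rule K0_class_carrier[OF simple(1)])
    show "L (\<lambda>x\<in>carrier (K0 T). u x + v x) = (\<lambda>i. L u i + L v i)" for u v
      using cl by (simp add: L_def line_coordinate_def fun_eq_iff)
    show "L (\<lambda>x\<in>carrier (K0 T). c * u x) = (\<lambda>i. c * L u i)" for c u
      using cl by (simp add: L_def line_coordinate_def fun_eq_iff)
    show "bij_betw L (K0_dual T) (cvec 1)"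
    proof (rule bij_betw_imageI)
      show "inj_on L (K0_dual T)"
      proof (rule inj_onI)
        fix u v assume uv: "u \<in> K0_dual T" "v \<in> K0_dual T" "L u = L v"
        then have "u (K0_class T (simple 0)) = v (K0_class T (simple 0))"
          unfolding L_def by (metis line_coordinate_0)
        then show "u = v" using dual_eq_charge[OF uv(1)] dual_eq_charge[OF uv(2)] by simp
      qed
      have "line_coordinate c \<in> L ` K0_dual T" for c
        by (rule image_eqI[OF _ charge_dual[of c]]) (simp add: L_def)
      moreover have "L u \<in> cvec 1" for u unfolding L_def range_line_coordinate[symmetric] by (rule rangeI)
      ultimately show "L ` K0_dual T = cvec 1"
        unfolding range_line_coordinate[symmetric] by blast
    qed
  qed
  moreover have "\<forall>\<sigma>\<in>?U. stab_tangent T \<sigma> = K0_dual T \<and> fst \<sigma> \<in> K0_dual T"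
    by (simp add: stab_tangent_sigma) (simp add: sigma_def charge_dual)
  ultimately have "(1, ?U, ?\<phi>) \<in> stab_atlas T"
    unfolding stab_atlas_def using chart by blast
  moreover have "sigma w\<^sub>0 \<in> ?U" by (simp add: S_def)
  ultimately show ?thesis by blast
qed

lemma complex_manifold_stab: "complex_manifold \<T> (stab_atlas T)"
  unfolding complex_manifold_def
proof (intro conjI)
  have h: "\<T> homeomorphic_space (euclidean :: complex topology)"
    using homeomorphic_map_imp_homeomorphic_space[OF sigma_homeomorphic] by (rule homeomorphic_space_sym[THEN iffD1])
  show "Hausdorff_space \<T>" using homeomorphic_Hausdorff_space[OF h] Hausdorff_space_euclidean by blast
  show "second_countable \<T>" using homeomorphic_space_second_countability[OF h] second_countable_euclidean by blast
  show "\<forall>c\<in>stab_atlas T. chart_on \<T> c" using stab_atlas_chart by fast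
  show "(\<Union>(n, U, \<phi>)\<in>stab_atlas T. U) = topspace \<T>"
  proof (intro equalityI subsetI)
    fix s assume "s \<in> (\<Union>(n, U, \<phi>)\<in>stab_atlas T. U)"
    then obtain n U \<phi> where "(n, U, \<phi>) \<in> stab_atlas T" "s \<in> U" by auto
    then show "s \<in> topspace \<T>" using chart_inj(3)[OF stab_atlas_chart] unfolding topspace_stab by blast
  next
    fix s assume "s \<in> topspace \<T>"
    then obtain w where w: "s = sigma w" unfolding topspace_stab by blast
    obtain U \<phi> where "(1, U, \<phi>) \<in> stab_atlas T" "s \<in> U" using covering_chart[of w] w by blast
    then show "s \<in> (\<Union>(n, U, \<phi>)\<in>stab_atlas T. U)" by - (rule UN_I[of "(1, U, \<phi>)"], assumption, simp only: prod.case)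
  qed
  show "\<forall>(n, U, \<phi>)\<in>stab_atlas T. \<forall>(m, V, \<psi>)\<in>stab_atlas T.
      holo_map n m (\<phi> ` (U \<inter> V)) (\<psi> \<circ> inv_into U \<phi>)"
    using transition_holo by fast
qed

theorem stab_isomorphic_plane:
  "isomorphic_complex_manifolds \<T> (stab_atlas T) (euclidean :: complex topology) complex_plane_atlas"
  unfolding isomorphic_complex_manifolds_def
proof (intro conjI exI)
  show "complex_manifold \<T> (stab_atlas T)" by (rule complex_manifold_stab)
  show "complex_manifold (euclidean :: complex topology) complex_plane_atlas" by (rule complex_manifold_plane)
  note hm = sigma_homeomorphic_maps[unfolded homeomorphic_maps_def]
  show "holomorphic_between \<T> (stab_atlas T) euclidean complex_plane_atlas (inv_into UNIV sigma)"
    unfolding holomorphic_between_def complex_plane_atlas_eq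
  proof (intro conjI)
    show "\<forall>(n, U, \<phi>)\<in>stab_atlas T. \<forall>(m, V, \<psi>)\<in>{(1, UNIV, line_coordinate)}.
        holo_map n m (\<phi> ` (U \<inter> inv_into UNIV sigma -` V)) (\<psi> \<circ> inv_into UNIV sigma \<circ> inv_into U \<phi>)"
      using inv_holo by auto
  qed (use hm in blast)
  show "holomorphic_between euclidean complex_plane_atlas \<T> (stab_atlas T) sigma"
    unfolding holomorphic_between_def complex_plane_atlas_eq
  proof (intro conjI)
    show "\<forall>(n, U, \<phi>)\<in>{(1, UNIV, line_coordinate)}. \<forall>(m, V, \<psi>)\<in>stab_atlas T.
        holo_map n m (\<phi> ` (U \<inter> sigma -` V)) (\<psi> \<circ> sigma \<circ> inv_into U \<phi>)"
      using sigma_holo by auto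
  qed (use hm in blast)
  show "\<forall>x\<in>topspace \<T>. sigma (inv_into UNIV sigma x) = x" "\<forall>y\<in>topspace euclidean. inv_into UNIV sigma (sigma y) = y"
    using hm by blast+
qed

end

section \<open>The derived category as an instance\<close>

context derived
begin

sublocale graded_tricat "Db_mod K" "hdim K"
proof
  fix X Y Z S :: "('a, 'a list) cplx" and n :: int and u v w
  show "finite {n. hdim K X n \<noteq> 0}" if "X \<in> tob T" using hdim_finite[OF K] that by simp
  show "\<exists>X\<in>tob T. hdim K X = d" if "finite {n. d n \<noteq> 0}" for d using object_exists[OF that] by simp
  show "iso_obj T X Y \<longleftrightarrow> hdim K X = hdim K Y" if "X \<in> tob T" "Y \<in> tob T" using iso_obj_iff that by simp
  show "zero_obj T X \<longleftrightarrow> X \<in> tob T \<and> (\<forall>n. hdim K X n = 0)" using zero_obj_iff by simp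
  show "\<exists>f\<in>thom T X Y. \<not> zero_mor T X Y f" if "X \<in> tob T" "Y \<in> tob T" "hdim K X n \<noteq> 0" "hdim K Y n \<noteq> 0"
    using homs_nonzero[of X Y n] that by simp
  show "zero_mor T X Y f" if "X \<in> tob T" "Y \<in> tob T" "f \<in> thom T X Y" "\<And>n. hdim K X n = 0 \<or> hdim K Y n = 0" for f
    using homs_disjoint[of X Y f] that by simp
  show "hdim K X n \<noteq> 0 \<or> hdim K Y n \<noteq> 0"
    if "X \<in> tob T" "Y \<in> tob T" "direct_sum T X Y S" "hdim K S n \<noteq> 0"
    using direct_sum_hdim[of X Y S n] that by simp
  show "tsh T X \<in> tob T" if "X \<in> tob T"
    using that bounded_complex.shift_bounded[OF bounded_complex.intro[OF K]] by simp
  show "hdim K (tsh T X) n = hdim K X (n + 1)" if "X \<in> tob T"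
    using that bounded_complex.hdim_shift[OF bounded_complex.intro[OF K]] by simp
  show "X \<in> tob T \<and> Y \<in> tob T \<and> Z \<in> tob T" if "(X, Y, Z, u, v, w) \<in> tdt T"
    using that triangle_objects by simp
  show "\<exists>k. \<forall>n. hdim K Y n + k n + k (n - 1) = hdim K X n + hdim K Z n \<and> k n \<le> hdim K Z n \<and> k n \<le> hdim K X (n + 1)"
    if "(X, Y, Z, u, v, w) \<in> tdt T"
    using that triangle_hdim by simp
  show "\<exists>u v w. (X, Y, Z, u, v, w) \<in> tdt T"
    if "X \<in> tob T" "Y \<in> tob T" "Z \<in> tob T" "\<And>n. hdim K Y n = hdim K X n + hdim K Z n"
    using that triangle_exists by simp
  show "\<exists>X Y Z u v w. (X, Y, Z, u, v, w) \<in> tdt T \<and> hdim K X = (\<lambda>i. if i = n + 1 then 1 else 0) \<and>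
      hdim K Y = (\<lambda>_. 0) \<and> hdim K Z = (\<lambda>i. if i = n then 1 else 0)"
    using shift_triangle_exists by simp
  show "finite_length (full_sub T A)" if "A \<subseteq> tob T" for A
    using that full_sub_finite_length by simp
qed

end

theorem corollary3p8:
  fixes K :: "'a ring"
  assumes "field K"
  shows "isomorphic_complex_manifolds
           (stab_topology (Db_mod K)) (stab_atlas (Db_mod K))
           (euclidean :: complex topology) complex_plane_atlas"
proof -
  interpret derived K by (rule derived.intro[OF assms])
  show ?thesis by (rule stab_isomorphic_plane)
qed

end
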